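(* Let $G$ be a vertex transitive graph and let $A \subseteq V(G)$ be a finite non-empty set with $|A| \le \tfrac12 |V(G)|$ such that the induced subgraph $G[A\cup\partial A]$ is connected. Set $k = |\partial A|$ and assume that ${\mathit diam}(G) \ge 31(k+1)^2$. Then one of the following holds: (i) ${\mathit depth}(A) \le k$ and $|A| \le 2k^3+k^2$ (and $G$ is $d$-regular where $d \le \tfrac{3}{2}k-1$); (ii) there exist positive integers $s,t$ with $st \le \frac{k}{2}$ and a cyclic system $\vec{\sigma}$ on $G$ such that $G$ is $(s,t)$-ring-like with respect to $\vec{\sigma}$, and there exists an interval $J$ of $\vec{\sigma}$ such that the set $Q = \bigcup_{B \in J} B$ satisfies $A \subseteq Q$ and $|Q \setminus A| \le \tfrac{1}{2}k^3 + k^2$.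
   Context: Graphs are simple, undirected, possibly infinite, and locally finite. For $X \subseteq V(G)$, the boundary is $\partial X = \{ v \in V(G) \setminus X : uv \in E(G) \text{ for some } u \in X\}$. The diameter of a set $A$ is ${\mathit diam}(A)=\sup_{x,y\in A}{\mathit dist}_G(x,y)$, and ${\mathit diam}(G)={\mathit diam}(V(G))$. For a proper subset $A \subsetneq V(G)$, the depth of $v\in A$ is ${\mathit dist}_G(v, V(G)\setminus A)$ and ${\mathit depth}(A)$ is the supremum of the depths of vertices of $A$. A system of imprimitivity is a partition $\sigma$ of $V(G)$ into blocks such that every automorphism of $G$ maps each block onto a block. A cyclic order on a set $S$ is a symmetric relation $\sim$ on $S$ whose corresponding graph is either a cycle or a two-way-infinite path; distance in $S$ is distance in this graph, and an interval is a finite subset $\{s_1,\dots,s_m\}$ with $s_i\sim s_{i+1}$ for $1\le i\le m-1$. A cyclic system $\vec\sigma$ on $G$ is a system of imprimitivity $\sigma$ together with a cyclic order on its blocks that is preserved by every automorphism of $G$. For positive integers $s,t$, $G$ is $(s,t)$-ring-like with respect to $\vec\sigma$ if every block has exactly $s$ vertices and any two adjacent vertices of $G$ lie in blocks at distance at most $t$ in the cyclic order.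
   Formalization: G is additionally assumed to be connected; without this the claim fails, for example for G two disjoint copies of K_n and A one of the copies (k = 0, infinite diameter). *)

theory Defs
  imports Complex_Main "HOL-Library.Extended_Nat" "HOL-Library.Disjoint_Sets"
begin

text \<open>
  A simple graph, possibly infinite, is a vertex set \<open>V\<close> together with a symmetric, irreflexive
  adjacency relation \<open>E\<close> on \<open>V\<close>, each undirected edge being represented by both ordered pairs.
\<close>

definition simple_graph :: "'a set \<Rightarrow> 'a rel \<Rightarrow> bool" where
  "simple_graph V E \<longleftrightarrow> E \<subseteq> V \<times> V \<and> sym E \<and> irrefl E"

definition neighbours :: "'a rel \<Rightarrow> 'a \<Rightarrow> 'a set" where
  "neighbours E v = {w. (v, w) \<in> E}"

definition locally_finite :: "'a set \<Rightarrow> 'a rel \<Rightarrow> bool" where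
  "locally_finite V E \<longleftrightarrow> (\<forall>v\<in>V. finite (neighbours E v))"

definition regular :: "'a set \<Rightarrow> 'a rel \<Rightarrow> nat \<Rightarrow> bool" where
  "regular V E d \<longleftrightarrow> (\<forall>v\<in>V. finite (neighbours E v) \<and> card (neighbours E v) = d)"

definition connected_graph :: "'a set \<Rightarrow> 'a rel \<Rightarrow> bool" where
  "connected_graph V E \<longleftrightarrow> (\<forall>u\<in>V. \<forall>v\<in>V. (u, v) \<in> E\<^sup>*)"

definition induced_edges :: "'a rel \<Rightarrow> 'a set \<Rightarrow> 'a rel" where
  "induced_edges E X = E \<inter> (X \<times> X)"

definition boundary :: "'a set \<Rightarrow> 'a rel \<Rightarrow> 'a set \<Rightarrow> 'a set" where
  "boundary V E X = {v \<in> V - X. \<exists>u\<in>X. (u, v) \<in> E}"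

text \<open>
  The relation \<open>E ^^ n\<close> holds between the ends of walks of length \<open>n\<close>; since \<open>Inf {} = \<infinity>\<close> in
  \<^typ>\<open>enat\<close>, vertices not joined by a walk are at distance \<open>\<infinity>\<close>.
\<close>

definition gdist :: "'a rel \<Rightarrow> 'a \<Rightarrow> 'a \<Rightarrow> enat" where
  "gdist E u v = (INF n\<in>{n. (u, v) \<in> E ^^ n}. enat n)"

definition diam :: "'a rel \<Rightarrow> 'a set \<Rightarrow> enat" where
  "diam E X = (SUP x\<in>X. SUP y\<in>X. gdist E x y)"

definition vertex_depth :: "'a set \<Rightarrow> 'a rel \<Rightarrow> 'a set \<Rightarrow> 'a \<Rightarrow> enat" where
  "vertex_depth V E A v = (INF w\<in>V - A. gdist E v w)"

definition depth :: "'a set \<Rightarrow> 'a rel \<Rightarrow> 'a set \<Rightarrow> enat" where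
  "depth V E A = (SUP v\<in>A. vertex_depth V E A v)"

text \<open>Only the values of an automorphism on \<open>V\<close> are relevant.\<close>

definition automorphism :: "'a set \<Rightarrow> 'a rel \<Rightarrow> ('a \<Rightarrow> 'a) \<Rightarrow> bool" where
  "automorphism V E \<phi> \<longleftrightarrow>
     bij_betw \<phi> V V \<and> (\<forall>u\<in>V. \<forall>v\<in>V. (u, v) \<in> E \<longleftrightarrow> (\<phi> u, \<phi> v) \<in> E)"

definition vertex_transitive :: "'a set \<Rightarrow> 'a rel \<Rightarrow> bool" where
  "vertex_transitive V E \<longleftrightarrow> (\<forall>u\<in>V. \<forall>v\<in>V. \<exists>\<phi>. automorphism V E \<phi> \<and> \<phi> u = v)"

definition imprimitivity_system :: "'a set \<Rightarrow> 'a rel \<Rightarrow> 'a set set \<Rightarrow> bool" where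
  "imprimitivity_system V E \<sigma> \<longleftrightarrow>
     partition_on V \<sigma> \<and> (\<forall>\<phi>. automorphism V E \<phi> \<longrightarrow> (\<forall>B\<in>\<sigma>. \<phi> ` B \<in> \<sigma>))"

text \<open>Cycles in a simple graph have length at least three.\<close>

definition is_cycle :: "'b set \<Rightarrow> 'b rel \<Rightarrow> bool" where
  "is_cycle S R \<longleftrightarrow> (\<exists>n\<ge>3. \<exists>f. bij_betw f {0..<n::nat} S \<and>
     (\<forall>i<n. \<forall>j<n. (f i, f j) \<in> R \<longleftrightarrow> j = (i + 1) mod n \<or> i = (j + 1) mod n))"

definition is_two_way_infinite_path :: "'b set \<Rightarrow> 'b rel \<Rightarrow> bool" where
  "is_two_way_infinite_path S R \<longleftrightarrow> (\<exists>f. bij_betw f (UNIV :: int set) S \<and>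
     (\<forall>i j. (f i, f j) \<in> R \<longleftrightarrow> j = i + 1 \<or> i = j + 1))"

definition cyclic_order :: "'b set \<Rightarrow> 'b rel \<Rightarrow> bool" where
  "cyclic_order S R \<longleftrightarrow> simple_graph S R \<and> (is_cycle S R \<or> is_two_way_infinite_path S R)"

definition cyclic_interval :: "'b set \<Rightarrow> 'b rel \<Rightarrow> 'b set \<Rightarrow> bool" where
  "cyclic_interval S R J \<longleftrightarrow> J \<subseteq> S \<and>
     (\<exists>xs. xs \<noteq> [] \<and> distinct xs \<and> set xs = J \<and> successively (\<lambda>x y. (x, y) \<in> R) xs)"

definition cyclic_system :: "'a set \<Rightarrow> 'a rel \<Rightarrow> 'a set set \<Rightarrow> 'a set rel \<Rightarrow> bool" where
  "cyclic_system V E \<sigma> R \<longleftrightarrow> imprimitivity_system V E \<sigma> \<and> cyclic_order \<sigma> R \<and>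
     (\<forall>\<phi>. automorphism V E \<phi> \<longrightarrow> (\<forall>(B, C)\<in>R. (\<phi> ` B, \<phi> ` C) \<in> R))"

definition ring_like :: "'a rel \<Rightarrow> 'a set set \<Rightarrow> 'a set rel \<Rightarrow> nat \<Rightarrow> nat \<Rightarrow> bool" where
  "ring_like E \<sigma> R s t \<longleftrightarrow> (\<forall>B\<in>\<sigma>. finite B \<and> card B = s) \<and>
     (\<forall>B\<in>\<sigma>. \<forall>C\<in>\<sigma>. \<forall>u\<in>B. \<forall>v\<in>C. (u, v) \<in> E \<longrightarrow> gdist R B C \<le> enat t)"

end

theory Submission imports Defs begin

text \<open>
  If every vertex of \<open>A\<close> is within distance \<open>k\<close> of \<open>\<partial>A\<close>, then \<open>A\<close> has small diameter, and counting the
  translates of a long geodesic that leave \<open>A\<close> bounds \<open>|A|\<close>; the degree is bounded by means of atoms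
  in the sense of Mader and Watkins.

  Otherwise \<open>A\<close> contains a ball of radius \<open>|\<partial>A|\<close>. Let \<open>q\<close> be the least boundary size of such deep sets.
  A deep set with boundary \<open>q\<close> of least cardinality is determined by any ball of radius \<open>q\<close> inside it,
  so these sets are permuted by the automorphisms, and by uncrossing their unions along connected
  vertex sets again have boundary at most \<open>q\<close>. The boundary of a long union splits between its two
  ends, so the graph is locally two-sided, and counting signed passages through one side of a large
  union gives an integral cochain whose cohomology class is invariant up to sign. The graph (if it
  is infinite) or the infinite cyclic cover defined by the cochain (if it is finite) has two ends.
  Comparing an end with its image under an automorphism yields an equivariant height function, whose
  level sets are the blocks. The minimality of \<open>q\<close> finally implies that long runs of blocks without
  vertices of \<open>\<partial>A\<close> lie inside or outside \<open>A\<close>.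
\<close>

section \<open>Locally finite connected graphs\<close>

text \<open>A finite graph has no ends, so the two sides visible near a vertex must be glued
  together without a global cut; hence the cochain. In a finite graph it has to wind around:
  otherwise both sides would contain a ball of radius \<open>q\<close> while being cut off by fewer
  than \<open>q\<close> vertices, and one of them would be at most half of \<open>V\<close>, against
  the choice of \<open>q\<close>. In an infinite graph long geodesics exclude winding. In either
  case the remaining cut is a part of the boundary of a tube, chosen to contain at most half of its
  at most \<open>q\<close> vertices. A cut between the ends of a ring with blocks of size
  \<open>s\<close> and jumps of length \<open>t\<close> has at least \<open>s * t\<close> vertices,
  and this gives \<open>s * t \<le> k / 2\<close>. The height is defined by counting vertices moved
  across a cut, because point stabilizers may be infinite and the count vanishes on them. The
  automorphisms that preserve the ends may have two orbits, whose relative position is not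
  determined by symmetry. With \<open>a = s * t\<close>, each block meeting the boundary of
  \<open>A\<close> is charged with at most \<open>2 * a * (a + 1)\<close> vertices missing from
  \<open>A\<close>; as \<open>2 * a \<le> k\<close>, this adds up to the bound for the
  interval.\<close>

locale lf_graph =
  fixes V :: "'a set" and E :: "'a rel"
  assumes E_sub: "E \<subseteq> V \<times> V"
    and E_sym: "(x, y) \<in> E \<Longrightarrow> (y, x) \<in> E"
    and fin_nbrs: "x \<in> V \<Longrightarrow> finite {y. (x, y) \<in> E}"
    and conn: "x \<in> V \<Longrightarrow> y \<in> V \<Longrightarrow> (x, y) \<in> E\<^sup>*"
begin

text \<open>A natural-valued version of \<open>gdist\<close>; connectedness makes the two agree on
  \<open>V\<close>, see \<open>gdist_gd\<close>.\<close>

definition gd :: "'a \<Rightarrow> 'a \<Rightarrow> nat" where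
  "gd x y = (LEAST n. (x, y) \<in> E ^^ n)"

definition bl :: "'a \<Rightarrow> nat \<Rightarrow> 'a set" where
  "bl x r = {y \<in> V. gd x y \<le> r}"

definition bd :: "'a set \<Rightarrow> 'a set" where
  "bd X = {v \<in> V - X. \<exists>u\<in>X. (u, v) \<in> E}"

definition cn :: "'a set \<Rightarrow> bool" where
  "cn S \<longleftrightarrow> (\<forall>x\<in>S. \<forall>y\<in>S. (x, y) \<in> (E \<inter> S \<times> S)\<^sup>*)"

text \<open>The union of all shortest paths from \<open>x\<close> to \<open>y\<close>. It takes the
  place of one chosen path and is connected by \<open>cn_geo\<close>.\<close>

definition geo :: "'a \<Rightarrow> 'a \<Rightarrow> 'a set" where
  "geo x y = {p \<in> V. gd x p + gd p y = gd x y}"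

lemma E_V: "(x, y) \<in> E \<Longrightarrow> x \<in> V \<and> y \<in> V"
  using E_sub by auto

lemma relpow_gd: "x \<in> V \<Longrightarrow> y \<in> V \<Longrightarrow> (x, y) \<in> E ^^ gd x y"
  unfolding gd_def using conn[of x y] by (auto simp: rtrancl_power intro: LeastI)

lemma gd_le: "(x, y) \<in> E ^^ n \<Longrightarrow> gd x y \<le> n"
  unfolding gd_def by (rule Least_le)

lemma gd_self [simp]: "gd x x = 0"
  using gd_le[of x x 0] by simp

lemma gd_eq_0: "x \<in> V \<Longrightarrow> y \<in> V \<Longrightarrow> gd x y = 0 \<longleftrightarrow> x = y"
  using relpow_gd[of x y] by auto

lemma gd_edge: "(x, y) \<in> E \<Longrightarrow> gd x y \<le> 1"
  using gd_le[of x y 1] by simp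

lemma relpow_sym: "(x, y) \<in> E ^^ n \<Longrightarrow> (y, x) \<in> E ^^ n"
proof (induction n arbitrary: y)
  case (Suc n)
  then obtain z where "(x, z) \<in> E ^^ n" "(z, y) \<in> E" by auto
  with Suc.IH[of z] E_sym have "(z, x) \<in> E ^^ n" "(y, z) \<in> E" by auto
  then show ?case by (metis relpow_Suc_I2)
qed simp

lemma gd_sym: "x \<in> V \<Longrightarrow> y \<in> V \<Longrightarrow> gd x y = gd y x"
  by (meson gd_le relpow_gd relpow_sym order_antisym)

lemma gd_triangle:
  assumes "x \<in> V" "y \<in> V" "z \<in> V" shows "gd x z \<le> gd x y + gd y z"
proof -
  have "(x, z) \<in> E ^^ gd x y O E ^^ gd y z"
    using relpow_gd assms by blast
  then show ?thesis using gd_le relpow_add by metis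
qed

lemma relpow_V: "(x, y) \<in> E ^^ n \<Longrightarrow> x \<in> V \<Longrightarrow> y \<in> V"
  by (induction n arbitrary: y) (auto dest: E_V)

lemma gd_between:
  assumes "x \<in> V" "y \<in> V" "m \<le> gd x y"
  shows "\<exists>z\<in>V. gd x z = m \<and> gd z y = gd x y - m"
proof -
  have "(x, y) \<in> E ^^ (m + (gd x y - m))" using relpow_gd assms by simp
  then obtain z where z: "(x, z) \<in> E ^^ m" "(z, y) \<in> E ^^ (gd x y - m)"
    by (auto simp: relpow_add)
  have "z \<in> V" using relpow_V z assms by blast
  moreover have "gd x z \<le> m" "gd z y \<le> gd x y - m" using z gd_le by auto
  moreover have "gd x y \<le> gd x z + gd z y" using gd_triangle assms \<open>z \<in> V\<close> by blast
  ultimately show ?thesis using assms(3) by (intro bexI[of _ z]) auto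
qed

lemma gd_edge_le: "(y, z) \<in> E \<Longrightarrow> x \<in> V \<Longrightarrow> gd x z \<le> gd x y + 1"
  using gd_triangle[of x y z] gd_edge[of y z] E_V[of y z] by auto

lemma edge_iff_gd: "x \<in> V \<Longrightarrow> y \<in> V \<Longrightarrow> gd x y = 1 \<Longrightarrow> (x, y) \<in> E"
  using relpow_gd[of x y] by simp

lemma bl_V: "bl x r \<subseteq> V" by (auto simp: bl_def)

lemma bl_center [simp]: "x \<in> V \<Longrightarrow> x \<in> bl x r" by (simp add: bl_def)

lemma bl_mono: "r \<le> s \<Longrightarrow> bl x r \<subseteq> bl x s" by (auto simp: bl_def)

lemma bl_sub: "x \<in> V \<Longrightarrow> y \<in> V \<Longrightarrow> gd x y + s \<le> r \<Longrightarrow> bl y s \<subseteq> bl x r"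
  using gd_triangle[of x y] by (fastforce simp: bl_def)

lemma finite_bl: assumes "x \<in> V" shows "finite (bl x r)"
proof (induction r)
  case 0
  have "bl x 0 \<subseteq> {x}" using gd_eq_0 assms by (auto simp: bl_def)
  then show ?case using finite_subset by blast
next
  case (Suc r)
  have "bl x (Suc r) \<subseteq> bl x r \<union> (\<Union>z\<in>bl x r. {y. (z, y) \<in> E})"
  proof
    fix y assume y: "y \<in> bl x (Suc r)"
    show "y \<in> bl x r \<union> (\<Union>z\<in>bl x r. {y. (z, y) \<in> E})"
    proof (cases "gd x y \<le> r")
      case True then show ?thesis using y by (auto simp: bl_def)
    next
      case False
      then have e: "gd x y = Suc r" and "y \<in> V" using y by (auto simp: bl_def)
      obtain z where z: "z \<in> V" "gd x z = r" "gd z y = 1"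
        using gd_between[of x y r] assms \<open>y \<in> V\<close> e by auto
      then show ?thesis using edge_iff_gd \<open>y \<in> V\<close> by (auto simp: bl_def)
    qed
  qed
  then show ?case using Suc fin_nbrs bl_V
    by (meson finite_UN_I finite_Un finite_subset in_mono)
qed

lemma bd_V: "bd X \<subseteq> V - X" by (auto simp: bd_def)

lemma bd_empty [simp]: "bd {} = {}" by (simp add: bd_def)

lemma bd_boundary: "bd X = boundary V E X" by (simp add: bd_def boundary_def)

lemma finite_bd: assumes "finite X" shows "finite (bd X)"
proof (rule finite_subset)
  show "bd X \<subseteq> (\<Union>u\<in>X \<inter> V. {y. (u, y) \<in> E})" using E_V by (auto simp: bd_def)
  show "finite (\<Union>u\<in>X \<inter> V. {y. (u, y) \<in> E})" using assms fin_nbrs by auto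
qed

lemma step_bd: "u \<in> X \<Longrightarrow> (u, v) \<in> E \<Longrightarrow> v \<in> X \<union> bd X"
  using E_V by (auto simp: bd_def)

lemma exit_path:
  assumes "(x, y) \<in> (E \<inter> S \<times> S)\<^sup>*" "x \<in> X" "y \<notin> X"
  shows "bd X \<inter> S \<noteq> {}"
  using assms
proof (induction rule: rtrancl_induct)
  case (step y z)
  then show ?case using step_bd[of y X z] by (cases "y \<in> X") auto
qed simp

lemma cn_exit: "cn S \<Longrightarrow> x \<in> S \<Longrightarrow> y \<in> S \<Longrightarrow> x \<in> X \<Longrightarrow> y \<notin> X \<Longrightarrow> bd X \<inter> S \<noteq> {}"
  using exit_path unfolding cn_def by blast

lemma cn_sub: "cn S \<Longrightarrow> bd X \<inter> S = {} \<Longrightarrow> S \<inter> X \<noteq> {} \<Longrightarrow> S \<subseteq> X"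
  using cn_exit by blast

lemma rtrancl_mono_set: "(x, y) \<in> (E \<inter> S \<times> S)\<^sup>* \<Longrightarrow> S \<subseteq> T \<Longrightarrow> (x, y) \<in> (E \<inter> T \<times> T)\<^sup>*"
  using rtrancl_mono[of "E \<inter> S \<times> S" "E \<inter> T \<times> T"] by blast

lemma rtrancl_sym: "(x, y) \<in> (E \<inter> S \<times> S)\<^sup>* \<Longrightarrow> (y, x) \<in> (E \<inter> S \<times> S)\<^sup>*"
proof -
  have "sym (E \<inter> S \<times> S)" using E_sym by (auto simp: sym_def)
  then show "(x, y) \<in> (E \<inter> S \<times> S)\<^sup>* \<Longrightarrow> (y, x) \<in> (E \<inter> S \<times> S)\<^sup>*"
    using sym_rtrancl symD by metis
qed

lemma cnI: "(\<And>y. y \<in> S \<Longrightarrow> (x, y) \<in> (E \<inter> S \<times> S)\<^sup>*) \<Longrightarrow> cn S"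
  unfolding cn_def by (blast intro: rtrancl_sym rtrancl_trans)

lemma cn_Un: assumes "cn S" "cn T" "z \<in> S" "z \<in> T" shows "cn (S \<union> T)"
proof (rule cnI[of _ z])
  fix y assume "y \<in> S \<union> T"
  then have "(z, y) \<in> (E \<inter> S \<times> S)\<^sup>* \<or> (z, y) \<in> (E \<inter> T \<times> T)\<^sup>*"
    using assms by (auto simp: cn_def)
  then show "(z, y) \<in> (E \<inter> (S \<union> T) \<times> (S \<union> T))\<^sup>*"
    using rtrancl_mono_set[of z y _ "S \<union> T"] by blast
qed

lemma cn_single [simp]: "cn {x}" by (simp add: cn_def)

lemma cn_edge: "(x, y) \<in> E \<Longrightarrow> cn {x, y}"
  by (rule cnI[of _ x]) auto

lemma cn_insert: "cn S \<Longrightarrow> s \<in> S \<Longrightarrow> (s, y) \<in> E \<Longrightarrow> cn (insert y S)"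
  using cn_Un[of S "{s, y}" s] cn_edge[of s y] by (simp add: insert_absorb)

lemma cn_UN: 
  assumes "\<And>i. i \<in> I \<Longrightarrow> cn (F i)" "\<And>i. i \<in> I \<Longrightarrow> z \<in> F i" shows "cn (\<Union>i\<in>I. F i)"
proof (rule cnI[of _ z])
  fix y assume "y \<in> (\<Union>i\<in>I. F i)"
  then obtain i where i: "i \<in> I" "y \<in> F i" by blast
  then have "(z, y) \<in> (E \<inter> F i \<times> F i)\<^sup>*" using assms by (auto simp: cn_def)
  then show "(z, y) \<in> (E \<inter> (\<Union>i\<in>I. F i) \<times> (\<Union>i\<in>I. F i))\<^sup>*"
    using rtrancl_mono_set[of z y "F i"] i by blast
qed

lemma cn_V: "cn V"
proof -
  have "E \<inter> V \<times> V = E" using E_sub by auto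
  then show ?thesis using conn by (auto simp: cn_def)
qed

lemma geo_ends: "x \<in> V \<Longrightarrow> y \<in> V \<Longrightarrow> x \<in> geo x y \<and> y \<in> geo x y"
  by (auto simp: geo_def)

lemma geo_bl: "geo x y \<subseteq> bl x (gd x y)" by (auto simp: geo_def bl_def)

lemma cn_geo: assumes "x \<in> V" "y \<in> V" shows "cn (geo x y)"
proof (rule cnI[of _ x])
  fix p assume "p \<in> geo x y"
  then show "(x, p) \<in> (E \<inter> geo x y \<times> geo x y)\<^sup>*"
  proof (induction "gd x p" arbitrary: p)
    case 0
    then have "p = x" using gd_eq_0 assms by (auto simp: geo_def)
    then show ?case by simp
  next
    case (Suc n)
    then have p: "p \<in> V" "gd x p + gd p y = gd x y" by (auto simp: geo_def)
    obtain z where z: "z \<in> V" "gd x z = n" "gd z p = 1"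
      using gd_between[of x p n] assms p Suc(2)[symmetric] by auto
    have "gd z y \<le> 1 + gd p y" using gd_triangle[of z p y] z p assms by auto
    moreover have "gd x y \<le> gd x z + gd z y" using gd_triangle z assms by blast
    ultimately have zg: "z \<in> geo x y" using z p Suc(2) by (auto simp: geo_def)
    have "(z, p) \<in> E" using edge_iff_gd z p by auto
    then show ?case using Suc(1)[of z] z zg Suc(3) by (auto intro: rtrancl_into_rtrancl)
  qed
qed

text \<open>The boundary vertex lies on a shortest path, so a bound on the distance to some vertex
  outside \<open>X\<close> becomes a bound on the distance to \<open>bd X\<close>.\<close>

lemma geo_exit:
  assumes "x \<in> X" "y \<notin> X" "x \<in> V" "y \<in> V"
  obtains b where "b \<in> bd X" "gd x b + gd b y = gd x y"
  using cn_exit[OF cn_geo[of x y], of x y X] geo_ends[of x y] assms by (auto simp: geo_def)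

lemma cn_bl: assumes "x \<in> V" shows "cn (bl x r)"
proof -
  have "bl x r = (\<Union>y\<in>bl x r. geo x y)"
    using geo_bl bl_mono geo_ends assms bl_V
    by (auto simp: bl_def geo_def)
  moreover have "cn (\<Union>y\<in>bl x r. geo x y)"
    using cn_UN[of "bl x r" "geo x" x] cn_geo geo_ends assms bl_V by (meson subsetD)
  ultimately show ?thesis by simp
qed

lemma bl_out: 
  assumes "x \<in> X" "x \<in> V" "\<And>b. b \<in> bd X \<Longrightarrow> r < gd x b" shows "bl x r \<subseteq> X"
proof
  fix y assume "y \<in> bl x r"
  then have y: "y \<in> V" "gd x y \<le> r" by (auto simp: bl_def)
  show "y \<in> X"
  proof (rule ccontr)
    assume "y \<notin> X"
    then obtain b where "b \<in> bd X" "gd x b + gd b y = gd x y" using geo_exit assms y by blast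
    then show False using assms(3) y by fastforce
  qed
qed

text \<open>A largest connected subset of \<open>P\<close> through \<open>x0\<close> with the
  property \<open>Q\<close> is all of \<open>P\<close>, since otherwise connectedness offers a
  neighbour in \<open>P\<close> that could be added.\<close>

lemma cn_induct:
  assumes P: "finite P" "cn P" "x0 \<in> P" and base: "Q {x0}"
    and step: "\<And>S s y. S \<subseteq> P \<Longrightarrow> x0 \<in> S \<Longrightarrow> cn S \<Longrightarrow> s \<in> S \<Longrightarrow> y \<in> P - S \<Longrightarrow> (s, y) \<in> E \<Longrightarrow> Q S \<Longrightarrow> Q (insert y S)"
  shows "Q P"
proof -
  define F where "F = {S. S \<subseteq> P \<and> x0 \<in> S \<and> cn S \<and> Q S}"
  have F: "finite F" "F \<noteq> {}"
    using P base by (auto simp: F_def intro: exI[of _ "{x0}"])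
  obtain S where S: "S \<in> F" "\<And>T. T \<in> F \<Longrightarrow> card T \<le> card S"
  proof -
    have "Max (card ` F) \<in> card ` F" using F by (intro Max_in) auto
    then obtain S where "S \<in> F" "card S = Max (card ` F)" by auto
    then show ?thesis using that[of S] F by simp
  qed
  have "S = P"
  proof (rule ccontr)
    assume "S \<noteq> P"
    then obtain z where "z \<in> P" "z \<notin> S" using S by (auto simp: F_def)
    then have ne: "bd S \<inter> P \<noteq> {}" using cn_exit[OF P(2), of x0 z S] P S by (auto simp: F_def)
    then obtain y s where y: "y \<in> P - S" "s \<in> S" "(s, y) \<in> E" by (auto simp: bd_def)
    have "Q (insert y S)" using step[of S s y] S(1) y by (auto simp: F_def)
    then have "insert y S \<in> F" using S y cn_insert by (auto simp: F_def)
    moreover have "finite S" using S P finite_subset by (auto simp: F_def)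
    ultimately show False using S(2)[of "insert y S"] y by auto
  qed
  then show ?thesis using S by (auto simp: F_def)
qed

text \<open>Submodularity of the vertex boundary: a vertex of either new boundary lies in an old
  one, and a vertex of both new ones lies in both old ones.\<close>

lemma uncross:
  assumes "finite (bd X)" "finite (bd Y)"
  shows "card (bd (X \<inter> Y)) + card (bd (X \<union> Y)) \<le> card (bd X) + card (bd Y)"
    and "finite (bd (X \<inter> Y))" and "finite (bd (X \<union> Y))"
proof -
  have s: "bd (X \<inter> Y) \<union> bd (X \<union> Y) \<subseteq> bd X \<union> bd Y" "bd (X \<inter> Y) \<inter> bd (X \<union> Y) \<subseteq> bd X \<inter> bd Y"
    by (auto simp: bd_def)
  then show f: "finite (bd (X \<inter> Y))" "finite (bd (X \<union> Y))"
    using assms finite_subset finite_Un by metis+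
  have "card (bd (X \<inter> Y)) + card (bd (X \<union> Y)) = card (bd (X \<inter> Y) \<union> bd (X \<union> Y)) + card (bd (X \<inter> Y) \<inter> bd (X \<union> Y))"
    using card_Un_Int f by blast
  also have "\<dots> \<le> card (bd X \<union> bd Y) + card (bd X \<inter> bd Y)"
    using s assms by (intro add_mono card_mono) auto
  also have "\<dots> = card (bd X) + card (bd Y)" using card_Un_Int assms by metis
  finally show "card (bd (X \<inter> Y)) + card (bd (X \<union> Y)) \<le> card (bd X) + card (bd Y)" .
qed

text \<open>Induction on \<open>card S\<close>. Up to its last vertex within \<open>r\<close> of a
  chosen \<open>s\<close> the walk has advanced at most \<open>2 * r\<close>; after one more step it
  is governed by \<open>S - {s}\<close> alone.\<close>

lemma cluster_walk:
  assumes "finite S" "S \<subseteq> V"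
  shows "(\<And>i. i < n \<Longrightarrow> (f i, f (Suc i)) \<in> E) \<Longrightarrow>
    (\<And>i. i \<le> n \<Longrightarrow> f i \<in> V \<and> (\<exists>s\<in>S. gd (f i) s \<le> r)) \<Longrightarrow> gd (f 0) (f n) + 1 \<le> card S * (2 * r + 1)"
  using assms
proof (induction "card S" arbitrary: S f n)
  case 0
  then show ?case by fastforce
next
  case (Suc m)
  obtain s where s: "s \<in> S" "gd (f 0) s \<le> r" using Suc(4)[of 0] by auto
  define J where "J = {i. i \<le> n \<and> gd (f i) s \<le> r}"
  have J: "finite J" "0 \<in> J" using s by (auto simp: J_def)
  define j where "j = Max J"
  have j: "j \<in> J" "\<And>i. i \<in> J \<Longrightarrow> i \<le> j" using J Max_in by (auto simp: j_def)
  then have jn: "j \<le> n" "gd (f j) s \<le> r" by (auto simp: J_def)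
  have sV: "s \<in> V" using s Suc by auto
  have fV: "i \<le> n \<Longrightarrow> f i \<in> V" for i using Suc(4) by blast
  have a: "gd (f 0) (f j) \<le> 2 * r"
    using gd_triangle[of "f 0" s "f j"] gd_sym[of s "f j"] fV[of 0] fV[of j] sV s jn by simp
  show ?case
  proof (cases "j = n")
    case True
    then show ?thesis using a Suc(2)[symmetric] by simp
  next
    case False
    define g where "g i = f (Suc j + i)" for i
    define l where "l = n - Suc j"
    have n: "n = Suc j + l" using False jn by (simp add: l_def)
    have c: "card (S - {s}) = m" using Suc(2,5) s by simp
    have "gd (g 0) (g l) + 1 \<le> card (S - {s}) * (2 * r + 1)"
    proof (rule Suc(1))
      show "m = card (S - {s})" using c by simp
      show "(g i, g (Suc i)) \<in> E" if "i < l" for i using Suc(3)[of "Suc j + i"] that n by (simp add: g_def)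
      show "g i \<in> V \<and> (\<exists>s'\<in>S - {s}. gd (g i) s' \<le> r)" if "i \<le> l" for i
      proof -
        have "Suc j + i \<notin> J" using j(2)[of "Suc j + i"] by auto
        then have "\<not> gd (g i) s \<le> r" using that n by (auto simp: J_def g_def)
        then show ?thesis using Suc(4)[of "Suc j + i"] that n unfolding g_def by auto
      qed
    qed (use Suc in auto)
    then have b: "gd (f (Suc j)) (f n) + 1 \<le> m * (2 * r + 1)" using c n by (simp add: g_def)
    have "gd (f 0) (f n) \<le> gd (f 0) (f j) + gd (f j) (f n)" using gd_triangle fV jn by blast
    moreover have "gd (f j) (f n) \<le> gd (f j) (f (Suc j)) + gd (f (Suc j)) (f n)"
      using gd_triangle fV jn n by (metis False Suc_leI le_neq_implies_less order_refl)
    moreover have "gd (f j) (f (Suc j)) \<le> 1" using gd_edge Suc(3)[of j] n by simp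
    ultimately show ?thesis using a b Suc(2)[symmetric] by simp
  qed
qed

lemma cluster:
  assumes "finite S" "S \<subseteq> V" "cn H" "H \<subseteq> V" "\<And>h. h \<in> H \<Longrightarrow> \<exists>s\<in>S. gd h s \<le> r" "x \<in> H" "y \<in> H"
  shows "gd x y + 1 \<le> card S * (2 * r + 1)"
proof -
  have "(x, y) \<in> (E \<inter> H \<times> H)\<^sup>*" using assms by (auto simp: cn_def)
  then obtain n where "(x, y) \<in> (E \<inter> H \<times> H) ^^ n" by (auto simp: rtrancl_power)
  then obtain f where f: "f 0 = x" "f n = y" "\<And>i. i < n \<Longrightarrow> (f i, f (Suc i)) \<in> E \<inter> H \<times> H"
    by (auto simp: relpow_fun_conv)
  have "f i \<in> H" if "i \<le> n" for i
  proof (cases "i < n")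
    case True then show ?thesis using f(3)[of i] by auto
  next
    case False then show ?thesis using that f(2) assms by simp
  qed
  then show ?thesis using cluster_walk[OF assms(1,2), of n f r] f assms by blast
qed

section \<open>Automorphisms\<close>

abbreviation aut where "aut \<equiv> automorphism V E"

lemma aut_V: "aut \<phi> \<Longrightarrow> x \<in> V \<Longrightarrow> \<phi> x \<in> V"
  by (auto simp: automorphism_def bij_betw_def)

lemma aut_inj: "aut \<phi> \<Longrightarrow> inj_on \<phi> V"
  by (auto simp: automorphism_def bij_betw_def)

lemma aut_image_V: "aut \<phi> \<Longrightarrow> \<phi> ` V = V"
  by (auto simp: automorphism_def bij_betw_def)

lemma aut_E: "aut \<phi> \<Longrightarrow> x \<in> V \<Longrightarrow> y \<in> V \<Longrightarrow> (\<phi> x, \<phi> y) \<in> E \<longleftrightarrow> (x, y) \<in> E"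
  by (auto simp: automorphism_def)

lemma aut_id: "aut (\<lambda>x. x)"
  by (auto simp: automorphism_def bij_betw_def)

lemma autI:
  "bij_betw \<phi> V V \<Longrightarrow> (\<And>u v. u \<in> V \<Longrightarrow> v \<in> V \<Longrightarrow> (u, v) \<in> E \<longleftrightarrow> (\<phi> u, \<phi> v) \<in> E) \<Longrightarrow> aut \<phi>"
  unfolding automorphism_def by blast

lemma aut_bij: "aut \<phi> \<Longrightarrow> bij_betw \<phi> V V"
  unfolding automorphism_def by blast

lemma aut_comp: "aut \<phi> \<Longrightarrow> aut \<psi> \<Longrightarrow> aut (\<phi> \<circ> \<psi>)"
  by (rule autI, rule bij_betw_trans[OF aut_bij aut_bij], assumption+) (simp add: aut_V aut_E)

lemma aut_inv: assumes "aut \<phi>" shows "aut (inv_into V \<phi>)"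
proof -
  have b: "bij_betw \<phi> V V" using assms by (auto simp: automorphism_def)
  have i: "inv_into V \<phi> u \<in> V" "\<phi> (inv_into V \<phi> u) = u" if "u \<in> V" for u
    using that b by (auto simp: bij_betw_def inv_into_into f_inv_into_f)
  have "(u, v) \<in> E \<longleftrightarrow> (inv_into V \<phi> u, inv_into V \<phi> v) \<in> E" if "u \<in> V" "v \<in> V" for u v
    using aut_E[OF assms, of "inv_into V \<phi> u" "inv_into V \<phi> v"] that i by simp
  then show ?thesis using bij_betw_inv_into[OF b] by (intro autI)
qed

lemma aut_inv_f: "aut \<phi> \<Longrightarrow> x \<in> V \<Longrightarrow> inv_into V \<phi> (\<phi> x) = x"
  using aut_inj by (simp add: inv_into_f_f)

lemma aut_f_inv: "aut \<phi> \<Longrightarrow> x \<in> V \<Longrightarrow> \<phi> (inv_into V \<phi> x) = x"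
  using aut_image_V by (simp add: f_inv_into_f)

lemma aut_relpow: 
  assumes "aut \<phi>" shows "(x, y) \<in> E ^^ n \<Longrightarrow> x \<in> V \<Longrightarrow> (\<phi> x, \<phi> y) \<in> E ^^ n"
proof (induction n arbitrary: y)
  case (Suc n)
  then obtain z where "(x, z) \<in> E ^^ n" "(z, y) \<in> E" by auto
  then show ?case using Suc aut_E[OF assms, of z y] E_V[of z y] by auto
qed simp

lemma aut_gd: assumes "aut \<phi>" "x \<in> V" "y \<in> V" shows "gd (\<phi> x) (\<phi> y) = gd x y"
proof (rule order_antisym)
  show "gd (\<phi> x) (\<phi> y) \<le> gd x y"
    by (rule gd_le, rule aut_relpow[OF assms(1)], rule relpow_gd) (use assms in auto)
  have "gd (inv_into V \<phi> (\<phi> x)) (inv_into V \<phi> (\<phi> y)) \<le> gd (\<phi> x) (\<phi> y)"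
    by (rule gd_le, rule aut_relpow[OF aut_inv[OF assms(1)]], rule relpow_gd) (use assms aut_V in auto)
  then show "gd x y \<le> gd (\<phi> x) (\<phi> y)" using assms by (simp add: aut_inv_f)
qed

lemma aut_bl: assumes "aut \<phi>" "x \<in> V" shows "\<phi> ` bl x r = bl (\<phi> x) r"
proof -
  have "y \<in> \<phi> ` bl x r" if "y \<in> bl (\<phi> x) r" for y
  proof -
    have "y \<in> \<phi> ` V" using that aut_image_V[OF assms(1)] by (simp add: bl_def)
    then obtain z where "z \<in> V" "y = \<phi> z" by auto
    then show ?thesis using that assms aut_gd by (auto simp: bl_def)
  qed
  then show ?thesis using assms aut_gd aut_V by (auto simp: bl_def)
qed

lemma aut_bd: assumes "aut \<phi>" "X \<subseteq> V" shows "bd (\<phi> ` X) = \<phi> ` bd X"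
proof (intro equalityI subsetI)
  fix v assume "v \<in> bd (\<phi> ` X)"
  then obtain u where u: "v \<in> V" "v \<notin> \<phi> ` X" "u \<in> X" "(\<phi> u, v) \<in> E" by (auto simp: bd_def)
  then obtain w where "w \<in> V" "v = \<phi> w" using aut_image_V[OF assms(1)] by auto
  then show "v \<in> \<phi> ` bd X" using u assms aut_E[OF assms(1), of u w] by (auto simp: bd_def)
next
  fix v assume "v \<in> \<phi> ` bd X"
  then obtain w u where w: "v = \<phi> w" "w \<in> V" "w \<notin> X" "u \<in> X" "(u, w) \<in> E" by (auto simp: bd_def)
  have "\<phi> w \<notin> \<phi> ` X" using w assms aut_inj[OF assms(1)] by (auto dest: inj_onD)
  then show "v \<in> bd (\<phi> ` X)" using w assms aut_E[OF assms(1), of u w] aut_V[OF assms(1)]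
    by (auto simp: bd_def)
qed

lemma aut_card: "aut \<phi> \<Longrightarrow> X \<subseteq> V \<Longrightarrow> card (\<phi> ` X) = card X"
  using aut_inj card_image inj_on_subset by metis

lemma aut_finite: "aut \<phi> \<Longrightarrow> X \<subseteq> V \<Longrightarrow> finite (\<phi> ` X) \<longleftrightarrow> finite X"
  using aut_inj finite_image_iff inj_on_subset by metis

lemma aut_image_Diff: "aut \<phi> \<Longrightarrow> X \<subseteq> V \<Longrightarrow> Y \<subseteq> V \<Longrightarrow> \<phi> ` (X - Y) = \<phi> ` X - \<phi> ` Y"
  using aut_inj inj_on_image_set_diff by (metis Diff_subset subset_trans)

lemma aut_image_inv: "aut \<phi> \<Longrightarrow> X \<subseteq> V \<Longrightarrow> inv_into V \<phi> ` \<phi> ` X = X"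
  using aut_inv_f by (force simp: image_image)

lemma aut_mem: "aut \<phi> \<Longrightarrow> X \<subseteq> V \<Longrightarrow> x \<in> V \<Longrightarrow> \<phi> x \<in> \<phi> ` X \<longleftrightarrow> x \<in> X"
  using aut_inj by (meson inj_on_image_mem_iff)

lemma gdist_gd: assumes "x \<in> V" "y \<in> V" shows "gdist E x y = enat (gd x y)"
proof -
  have "gdist E x y \<le> enat (gd x y)"
    unfolding gdist_def by (rule INF_lower) (use relpow_gd assms in auto)
  moreover have "enat (gd x y) \<le> gdist E x y"
    unfolding gdist_def by (rule INF_greatest) (use gd_le in auto)
  ultimately show ?thesis by simp
qed

end

locale vt_graph = lf_graph +
  assumes vt: "x \<in> V \<Longrightarrow> y \<in> V \<Longrightarrow> \<exists>\<phi>. automorphism V E \<phi> \<and> \<phi> x = y"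
begin

lemma card_bl_eq: "x \<in> V \<Longrightarrow> y \<in> V \<Longrightarrow> card (bl x r) = card (bl y r)"
  by (metis vt aut_bl aut_card bl_V)

end

section \<open>Deep sets of minimal boundary\<close>

context vt_graph
begin

text \<open>In an infinite graph the condition is void, so that every finite set counts as small;
  this matches the assumption on \<open>A\<close>.\<close>

definition half :: "'a set \<Rightarrow> bool" where
  "half X \<longleftrightarrow> (finite V \<longrightarrow> 2 * card X \<le> card V)"

text \<open>The radius is the size of the set's own boundary, so a set with a smaller boundary needs
  only a smaller ball. Hence the least boundary \<open>q\<close> is a lower bound for all small sets
  that contain a ball of radius \<open>q - 1\<close>, see \<open>deep_bd\<close>.\<close>

definition deep_sets :: "'a set set" where
  "deep_sets = {X. X \<subseteq> V \<and> finite X \<and> half X \<and> (\<exists>v\<in>V. bl v (card (bd X)) \<subseteq> X)}"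

lemma half_mono: "half X \<Longrightarrow> Y \<subseteq> X \<Longrightarrow> finite X \<Longrightarrow> half Y"
  unfolding half_def using card_mono[of X Y] by auto

lemma half_aut: "aut \<phi> \<Longrightarrow> X \<subseteq> V \<Longrightarrow> half (\<phi> ` X) \<longleftrightarrow> half X"
  by (simp add: half_def aut_card)

lemma half_not_V: assumes "X \<subseteq> V" "finite X" "half X" "V \<noteq> {}" shows "X \<noteq> V"
proof
  assume "X = V"
  then have "2 * card V \<le> card V" "card V \<noteq> 0" using assms by (auto simp: half_def)
  then show False by simp
qed

lemma bd_nonempty: assumes "X \<subseteq> V" "finite X" "half X" "X \<noteq> {}" shows "bd X \<noteq> {}"
proof -
  have "V \<noteq> {}" using assms by auto
  then obtain y where "y \<in> V" "y \<notin> X" using half_not_V assms by blast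
  then show ?thesis using cn_exit[OF cn_V] assms by blast
qed

lemma deep_sets_aut: assumes "aut \<phi>" "X \<in> deep_sets" shows "\<phi> ` X \<in> deep_sets"
proof -
  obtain v where X: "X \<subseteq> V" "finite X" "half X" "v \<in> V" "bl v (card (bd X)) \<subseteq> X"
    using assms by (auto simp: deep_sets_def)
  have c: "card (bd (\<phi> ` X)) = card (bd X)"
    using aut_bd[OF assms(1) X(1)] aut_card[OF assms(1), of "bd X"] bd_V[of X] by auto
  have "bl (\<phi> v) (card (bd X)) \<subseteq> \<phi> ` X" using aut_bl[OF assms(1) X(4)] X(5) by blast
  moreover have "\<phi> ` X \<subseteq> V" using aut_V[OF assms(1)] X(1) by blast
  ultimately show ?thesis
    using X c half_aut[OF assms(1) X(1)] aut_V[OF assms(1) X(4)] unfolding deep_sets_def by auto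
qed

text \<open>Every vertex of \<open>X\<close> has a vertex outside \<open>X\<close>, hence also a
  boundary vertex, within distance \<open>r\<close>; so the balls around the boundary cover
  \<open>X\<close>.\<close>

lemma shallow_card:
  assumes "X \<subseteq> V" "finite X" "\<And>z. z \<in> X \<Longrightarrow> \<not> bl z r \<subseteq> X" "v \<in> V"
  shows "card X \<le> card (bd X) * card (bl v r)"
proof -
  have "X \<subseteq> (\<Union>b\<in>bd X. bl b r)"
  proof
    fix z assume z: "z \<in> X"
    then obtain y where y: "y \<in> V" "gd z y \<le> r" "y \<notin> X" using assms by (auto simp: bl_def)
    then obtain b where b: "b \<in> bd X" "gd z b + gd b y = gd z y"
      using geo_exit[of z X y] z assms by blast
    then have "gd b z \<le> r" using gd_sym[of b z] y bd_V z assms by (metis DiffD1 add_leD1 order_trans subsetD)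
    then show "z \<in> (\<Union>b\<in>bd X. bl b r)" using b z assms by (auto simp: bl_def)
  qed
  then have "card X \<le> card (\<Union>b\<in>bd X. bl b r)"
    using finite_bd[OF assms(2)] bd_V[of X] finite_bl by (intro card_mono finite_UN_I) auto
  also have "\<dots> \<le> (\<Sum>b\<in>bd X. card (bl b r))" using finite_bd assms by (intro card_UN_le) auto
  also have "\<dots> = (\<Sum>b\<in>bd X. card (bl v r))" 
    using bd_V[of X] assms(4) by (intro sum.cong card_bl_eq) auto
  finally show ?thesis by simp
qed

end

text \<open>\<open>A0\<close> witnesses that some deep set has at most \<open>k\<close> boundary
  vertices, which bounds the minimum \<open>q\<close> by \<open>k\<close>. The set analysed against
  the ring is a separate parameter of \<open>ring_cut\<close>.\<close>

locale deep_graph = vt_graph +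
  fixes k :: nat and A0 :: "'a set"
  assumes long: "\<exists>x\<in>V. \<exists>y\<in>V. 31 * (k + 1)\<^sup>2 \<le> gd x y"
    and A0: "A0 \<in> deep_sets" "card (bd A0) \<le> k"
begin

lemma V_ne: "V \<noteq> {}" using long by auto

text \<open>Around two vertices at distance more than \<open>2 * R\<close> there are disjoint balls
  of radius \<open>R\<close>, and by transitivity they are as large as the given one.\<close>

lemma half_bl: 
  assumes "2 * R + 1 \<le> 31 * (k + 1)\<^sup>2" "X \<subseteq> bl v R" "v \<in> V" shows "half X"
  unfolding half_def
proof
  assume fV: "finite V"
  obtain x y where xy: "x \<in> V" "y \<in> V" "2 * R + 1 \<le> gd x y" using long assms(1) by fastforce
  have "bl x R \<inter> bl y R = {}"
    using xy gd_triangle[of x _ y] gd_sym[of y] by (fastforce simp: bl_def)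
  then have "card (bl x R) + card (bl y R) \<le> card V"
    using card_mono[OF fV, of "bl x R \<union> bl y R"] bl_V fV
    by (metis (no_types, lifting) card_Un_disjoint finite_subset le_sup_iff)
  moreover have "card X \<le> card (bl v R)" using card_mono finite_bl assms by blast
  ultimately show "2 * card X \<le> card V"
    using card_bl_eq[of x v R] card_bl_eq[of y v R] xy assms by simp
qed

definition q :: nat where "q = (LEAST j. \<exists>X\<in>deep_sets. card (bd X) = j)"

definition m0 :: nat where "m0 = (LEAST m. \<exists>X\<in>deep_sets. card (bd X) = q \<and> card X = m)"

definition min_sets :: "'a set set" where
  "min_sets = {X \<in> deep_sets. card (bd X) = q \<and> card X = m0}"

lemma q_min: "X \<in> deep_sets \<Longrightarrow> q \<le> card (bd X)"
  unfolding q_def by (rule Least_le) blast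

lemma q_le_k: "q \<le> k" using q_min A0 by fastforce

lemma m0_min: "X \<in> deep_sets \<Longrightarrow> card (bd X) = q \<Longrightarrow> m0 \<le> card X"
  unfolding m0_def by (rule Least_le) blast

lemma min_sets_ne: "\<exists>X. X \<in> min_sets"
proof -
  have "\<exists>X\<in>deep_sets. card (bd X) = q" unfolding q_def by (rule LeastI_ex) (use A0 in blast)
  then have "\<exists>m. \<exists>X\<in>deep_sets. card (bd X) = q \<and> card X = m" by blast
  then have "\<exists>X\<in>deep_sets. card (bd X) = q \<and> card X = m0" unfolding m0_def by (rule LeastI_ex)
  then show ?thesis by (auto simp: min_sets_def)
qed

lemma min_setsD: 
  assumes "X \<in> min_sets" 
  shows "X \<subseteq> V" "finite X" "half X" "\<exists>v\<in>V. bl v q \<subseteq> X" "card (bd X) = q" "card X = m0" "X \<in> deep_sets" "finite (bd X)"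
proof -
  have X: "X \<in> deep_sets" "card (bd X) = q" "card X = m0" using assms by (auto simp: min_sets_def)
  then show "card (bd X) = q" "card X = m0" "X \<in> deep_sets" by auto
  show "X \<subseteq> V" "finite X" "half X" using X by (auto simp: deep_sets_def)
  then show "finite (bd X)" using finite_bd by blast
  show "\<exists>v\<in>V. bl v q \<subseteq> X" using X(1) unfolding deep_sets_def X(2)[symmetric] by blast
qed

text \<open>With fewer than \<open>q\<close> boundary vertices the ball of radius
  \<open>r \<ge> q - 1\<close> would already make \<open>X\<close> deep, against the choice of
  \<open>q\<close>.\<close>

lemma deep_bd:
  assumes "X \<subseteq> V" "finite X" "half X" "v \<in> V" "bl v r \<subseteq> X" "q \<le> r + 1"
  shows "q \<le> card (bd X)"
proof (rule ccontr)
  assume n: "\<not> q \<le> card (bd X)"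
  then have "bl v (card (bd X)) \<subseteq> X" using bl_mono[of "card (bd X)" r v] assms by auto
  then have "X \<in> deep_sets" using assms by (auto simp: deep_sets_def)
  then show False using q_min n by blast
qed

lemma min_deepI:
  assumes "X \<subseteq> V" "finite X" "half X" "v \<in> V" "bl v q \<subseteq> X" "card (bd X) \<le> q"
  shows "X \<in> deep_sets" "card (bd X) = q"
proof -
  show "card (bd X) = q" using deep_bd[of X v q] assms by auto
  then show "X \<in> deep_sets" using assms by (auto simp: deep_sets_def)
qed

lemma min_sets_aut: assumes "aut \<phi>" "X \<in> min_sets" shows "\<phi> ` X \<in> min_sets"
proof -
  note X = min_setsD[OF assms(2)]
  have "card (bd (\<phi> ` X)) = card (bd X)" 
    using aut_bd[OF assms(1) X(1)] aut_card[OF assms(1), of "bd X"] bd_V[of X] by auto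
  moreover have "card (\<phi> ` X) = card X" using aut_card assms X(1) by blast
  ultimately show ?thesis using deep_sets_aut[OF assms(1) X(7)] X(5,6) by (simp add: min_sets_def)
qed

lemma q_pos: "0 < q"
proof -
  obtain X where X: "X \<in> min_sets" using min_sets_ne by blast
  note D = min_setsD[OF X]
  have "X \<noteq> {}" using D(4) bl_center by blast
  then have "bd X \<noteq> {}" using bd_nonempty D by blast
  then show ?thesis using D(5,8) by (metis card_gt_0_iff)
qed

abbreviation \<beta> where "\<beta> \<equiv> card (bl (SOME v. v \<in> V) q)"

lemma some_V: "(SOME v. v \<in> V) \<in> V" using V_ne some_in_eq by blast

lemma card_bl_q: "v \<in> V \<Longrightarrow> card (bl v q) = \<beta>" using card_bl_eq some_V by blast

lemma \<beta>_pos: "0 < \<beta>" using some_V finite_bl by (auto simp: card_gt_0_iff intro: bl_center)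

lemma q_le_\<beta>: "q \<le> \<beta>"
proof -
  obtain x y where xy: "x \<in> V" "y \<in> V" "31 * (k + 1)\<^sup>2 \<le> gd x y" using long by blast
  have "k \<le> 31 * (k + 1)\<^sup>2" by (simp add: power2_eq_square)
  then have "q \<le> gd x y" using xy(3) q_le_k by linarith
  then have "\<forall>i\<in>{..q}. \<exists>z\<in>V. gd x z = i" using gd_between[OF xy(1,2)] order_trans by (metis atMost_iff)
  then obtain f where f: "\<And>i. i \<le> q \<Longrightarrow> f i \<in> V \<and> gd x (f i) = i" by (metis atMost_iff)
  have "inj_on f {..q}" by (rule inj_onI) (metis f atMost_iff)
  then have "card {..q} = card (f ` {..q})" by (simp add: card_image)
  also have "\<dots> \<le> card (bl x q)" using f finite_bl xy by (intro card_mono) (auto simp: bl_def)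
  finally show ?thesis using card_bl_q xy by simp
qed

text \<open>On a long geodesic the balls of radius \<open>q\<close> at positions divisible by
  \<open>2 * q + 1\<close> are disjoint. The factor 7 is the one that arises in
  \<open>min_sets_unique\<close>.\<close>

lemma vol: assumes "finite V" shows "7 * q * \<beta> < card V"
proof -
  obtain x y where xy: "x \<in> V" "y \<in> V" "31 * (k + 1)\<^sup>2 \<le> gd x y" using long by blast
  have b: "i * (2 * q + 1) \<le> gd x y" if "i \<le> 7 * q" for i
  proof -
    have "i * (2 * q + 1) \<le> 7 * q * (2 * q + 1)" using that by (rule mult_le_mono1)
    also have "\<dots> \<le> 7 * k * (2 * k + 1)" using q_le_k by (intro mult_le_mono) auto
    also have "\<dots> \<le> 31 * (k + 1)\<^sup>2" by (simp add: power2_eq_square algebra_simps)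
    finally show ?thesis using xy by simp
  qed
  then have "\<forall>i\<in>{..7 * q}. \<exists>z\<in>V. gd x z = i * (2 * q + 1)" using gd_between[OF xy(1,2)] by auto
  then obtain f where f: "\<And>i. i \<le> 7 * q \<Longrightarrow> f i \<in> V \<and> gd x (f i) = i * (2 * q + 1)" by (metis atMost_iff)
  have disj': "bl (f i) q \<inter> bl (f j) q = {}" if "i \<le> 7 * q" "j \<le> 7 * q" "i < j" for i j
  proof -
    have "(i + 1) * (2 * q + 1) \<le> j * (2 * q + 1)" using that by (intro mult_le_mono1) auto
    then have s: "gd x (f i) + 2 * q + 1 \<le> gd x (f j)" using f that by simp
    have "False" if z: "z \<in> bl (f i) q" "z \<in> bl (f j) q" for z
    proof -
      have z': "z \<in> V" "gd (f i) z \<le> q" "gd z (f j) \<le> q"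
        using z gd_sym[of "f j" z] f[OF \<open>j \<le> 7 * q\<close>] by (auto simp: bl_def)
      have "gd x (f j) \<le> gd x (f i) + gd (f i) (f j)" "gd (f i) (f j) \<le> gd (f i) z + gd z (f j)"
        using gd_triangle f that xy z' \<open>i \<le> 7 * q\<close> \<open>j \<le> 7 * q\<close> by blast+
      then show False using s z' by linarith
    qed
    then show ?thesis by blast
  qed
  have disj: "disjoint_family_on (\<lambda>i. bl (f i) q) {..7 * q}"
    unfolding disjoint_family_on_def using disj' by (metis atMost_iff inf_commute nat_neq_iff)
  have "(7 * q + 1) * \<beta> = (\<Sum>i\<le>7 * q. card (bl (f i) q))" using f card_bl_q by simp
  also have "\<dots> = card (\<Union>i\<le>7 * q. bl (f i) q)"
    using disj f finite_bl by (intro card_UN_disjoint'[symmetric]) auto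
  also have "\<dots> \<le> card V" using assms bl_V by (intro card_mono) auto
  finally show ?thesis using \<beta>_pos by simp
qed

text \<open>Submodularity leaves at most \<open>q\<close> boundary vertices for the intersection,
  which contains the ball and is therefore deep. By minimal cardinality it equals both sets.\<close>

lemma min_sets_eqI:
  assumes "X \<in> min_sets" "Y \<in> min_sets" "w \<in> V" "bl w q \<subseteq> X \<inter> Y" "q \<le> card (bd (X \<union> Y))"
  shows "X = Y"
proof -
  note X = min_setsD[OF assms(1)] note Y = min_setsD[OF assms(2)]
  have "card (bd (X \<inter> Y)) \<le> q" using uncross(1)[OF X(8) Y(8)] X(5) Y(5) assms by simp
  then have d: "X \<inter> Y \<in> deep_sets" "card (bd (X \<inter> Y)) = q"
    using min_deepI[of "X \<inter> Y" w] X Y assms half_mono[of X "X \<inter> Y"] by auto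
  have "m0 \<le> card (X \<inter> Y)" using m0_min d by blast
  then have "X \<inter> Y = X" "X \<inter> Y = Y"
    using card_subset_eq[of X "X \<inter> Y"] card_subset_eq[of Y "X \<inter> Y"] X Y 
    by (metis Int_lower1 Int_lower2 card_mono le_antisym)+
  then show ?thesis by blast
qed

lemma bd_outer: "bd (V - (X \<union> bd X)) \<subseteq> bd X"
  using E_sym by (auto simp: bd_def)

lemma outer_half: 
  assumes "finite V" "X \<subseteq> V" "\<not> half X" shows "half (V - (X \<union> bd X))"
proof -
  have "card (V - (X \<union> bd X)) \<le> card (V - X)" using assms by (intro card_mono) auto
  also have "\<dots> = card V - card X" using assms by (simp add: card_Diff_subset finite_subset)
  finally show ?thesis using assms by (auto simp: half_def)
qed

text \<open>The outer set is at most half of \<open>V\<close> and has fewer than \<open>q\<close>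
  boundary vertices, so it is not deep; it contains no ball of radius \<open>q\<close> and
  \<open>shallow_card\<close> applies.\<close>

lemma outer_shallow:
  assumes "finite V" "X \<subseteq> V" "\<not> half X" "card (bd X) < q"
  shows "card (V - (X \<union> bd X)) \<le> (q - 1) * \<beta>"
proof -
  let ?Z = "V - (X \<union> bd X)"
  have b: "card (bd ?Z) \<le> card (bd X)" using bd_outer bd_V assms finite_subset 
    by (metis card_mono finite_Diff)
  have "?Z \<notin> deep_sets" using b q_min[of ?Z] assms by auto
  then have "\<not> bl z (card (bd ?Z)) \<subseteq> ?Z" if "z \<in> ?Z" for z
    using that outer_half assms by (auto simp: deep_sets_def)
  then have "\<not> bl z q \<subseteq> ?Z" if "z \<in> ?Z" for z
    using that b assms bl_mono[of "card (bd ?Z)" q z] by (meson less_imp_le_nat order_trans)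
  then have "card ?Z \<le> card (bd ?Z) * \<beta>"
    using shallow_card[of ?Z q "SOME v. v \<in> V"] assms some_V by auto
  also have "\<dots> \<le> (q - 1) * \<beta>" using b assms by (intro mult_le_mono1) auto
  finally show ?thesis .
qed

text \<open>A union with fewer than \<open>q\<close> boundary vertices would exceed half of
  \<open>V\<close> and miss at most \<open>q * \<beta>\<close> vertices, whereas two sets of at most
  half size never share more vertices than they jointly miss. So the intersection has at most
  \<open>q\<close> boundary vertices, and being large it contains a ball of radius
  \<open>q\<close>.\<close>

lemma min_sets_inter:
  assumes "X \<in> min_sets" "Y \<in> min_sets" "q * \<beta> < card (X \<inter> Y)" shows "X = Y"
proof -
  note X = min_setsD[OF assms(1)] note Y = min_setsD[OF assms(2)]
  have q: "q \<le> card (bd (X \<union> Y))"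
  proof (rule ccontr)
    assume n: "\<not> q \<le> card (bd (X \<union> Y))"
    show False
    proof (cases "half (X \<union> Y)")
      case True
      obtain v where "v \<in> V" "bl v q \<subseteq> X" using X by blast
      then show False using deep_bd[of "X \<union> Y" v q] n True X Y by auto
    next
      case False
      then have fV: "finite V" by (auto simp: half_def)
      have "card (V - (X \<union> Y \<union> bd (X \<union> Y))) \<le> (q - 1) * \<beta>"
        using outer_shallow[of "X \<union> Y"] fV False n X Y by auto
      moreover have "card (V - (X \<union> Y)) \<le> card (V - (X \<union> Y \<union> bd (X \<union> Y))) + card (bd (X \<union> Y))"
      proof -
        have "V - (X \<union> Y) \<subseteq> (V - (X \<union> Y \<union> bd (X \<union> Y))) \<union> bd (X \<union> Y)" by blast
        then have "card (V - (X \<union> Y)) \<le> card ((V - (X \<union> Y \<union> bd (X \<union> Y))) \<union> bd (X \<union> Y))"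
          using fV X Y finite_bd by (intro card_mono) auto
        then show ?thesis using card_Un_le order_trans by blast
      qed
      moreover have "card (X \<inter> Y) \<le> card (V - (X \<union> Y))"
      proof -
        have "card (V - (X \<union> Y)) = card V - card (X \<union> Y)"
          using fV X Y by (intro card_Diff_subset) auto
        moreover have "card (X \<union> Y) + card (X \<inter> Y) = card X + card Y"
          using card_Un_Int X Y by metis
        ultimately show ?thesis using X(3) Y(3) fV by (auto simp: half_def)
      qed
      ultimately have "q * \<beta> < (q - 1) * \<beta> + (q - 1)" using n assms(3) by linarith
      moreover have "(q - 1) * \<beta> + \<beta> = q * \<beta>" using q_pos by (cases q) auto
      ultimately show False using q_le_\<beta> by linarith
    qed
  qed
  then have "card (bd (X \<inter> Y)) \<le> q" using uncross(1)[OF X(8) Y(8)] X(5) Y(5) by simp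
  then have "card (bd (X \<inter> Y)) * \<beta> < card (X \<inter> Y)" using assms(3) by (meson le_less_trans mult_le_mono1)
  then obtain z where "z \<in> X \<inter> Y" "bl z q \<subseteq> X \<inter> Y"
    using shallow_card[of "X \<inter> Y" q "SOME v. v \<in> V"] some_V X Y by (meson finite_Int inf.coboundedI1 leD)
  then show ?thesis using min_sets_eqI[OF assms(1,2), of z] q X by blast
qed

text \<open>If two distinct minimal sets shared a deep ball, then (in the finite case) they would almost
  cover \<open>V\<close>, and a third translate would have no room.\<close>

lemma min_sets_unique:
  assumes "X \<in> min_sets" "Y \<in> min_sets" "w \<in> V" "bl w q \<subseteq> X" "bl w q \<subseteq> Y" shows "X = Y"
proof (rule ccontr)
  assume ne: "X \<noteq> Y"
  note X = min_setsD[OF assms(1)] note Y = min_setsD[OF assms(2)]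
  have n: "card (bd (X \<union> Y)) < q" using min_sets_eqI[of X Y w] assms ne by (meson Int_subset_iff not_le)
  have nh: "\<not> half (X \<union> Y)" using deep_bd[of "X \<union> Y" w q] n assms X Y by auto
  then have fV: "finite V" by (auto simp: half_def)
  have "card (V - (X \<union> Y)) \<le> card ((V - (X \<union> Y \<union> bd (X \<union> Y))) \<union> bd (X \<union> Y))"
    using fV finite_bd X Y by (intro card_mono) auto
  also have "\<dots> \<le> card (V - (X \<union> Y \<union> bd (X \<union> Y))) + card (bd (X \<union> Y))" by (rule card_Un_le)
  also have "\<dots> \<le> (q - 1) * \<beta> + \<beta>" using outer_shallow[of "X \<union> Y"] fV nh n X Y q_le_\<beta> by auto
  also have "\<dots> = q * \<beta>" using q_pos by (cases q) auto
  finally have out: "card (V - (X \<union> Y)) \<le> q * \<beta>" .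
  have cV: "card V = card (X \<union> Y) + card (V - (X \<union> Y))"
    using fV X Y card_Diff_subset[of "X \<union> Y" V] card_mono[of V "X \<union> Y"] by auto
  have UI: "card (X \<union> Y) + card (X \<inter> Y) = 2 * m0"
    using card_Un_Int[of X Y] X(2,6) Y(2,6) by simp
  have "X \<union> Y \<noteq> V"
  proof
    assume "X \<union> Y = V"
    moreover have "w \<in> X \<inter> Y" using assms by auto
    then have "0 < card (X \<inter> Y)" using X by (auto simp: card_gt_0_iff)
    ultimately have "card V < 2 * m0" using UI by simp
    then show False using X(3,6) fV by (auto simp: half_def)
  qed
  then obtain y where y: "y \<in> V" "y \<notin> X \<union> Y" using X Y by blast
  obtain \<phi> where \<phi>: "aut \<phi>" "\<phi> w = y" using vt assms y by blast
  let ?Z = "\<phi> ` X"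
  have "w \<in> X" using assms by auto
  then have Z: "?Z \<in> min_sets" "y \<in> ?Z" using min_sets_aut \<phi> assms by auto
  note ZD = min_setsD[OF Z(1)]
  have "card (?Z \<inter> X) \<le> q * \<beta>" "card (?Z \<inter> Y) \<le> q * \<beta>"
    using min_sets_inter[OF Z(1) assms(1)] min_sets_inter[OF Z(1) assms(2)] Z(2) y(2)
    by (metis UnCI not_le_imp_less)+
  moreover have "card ?Z \<le> card (?Z \<inter> X) + card (?Z \<inter> Y) + card (V - (X \<union> Y))"
  proof -
    have "card ?Z \<le> card ((?Z \<inter> X) \<union> (?Z \<inter> Y) \<union> (V - (X \<union> Y)))"
      using ZD fV by (intro card_mono) auto
    also have "\<dots> \<le> card ((?Z \<inter> X) \<union> (?Z \<inter> Y)) + card (V - (X \<union> Y))" by (rule card_Un_le)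
    finally show ?thesis using card_Un_le[of "?Z \<inter> X" "?Z \<inter> Y"] by linarith
  qed
  \<comment> \<open>The third set has at most \<open>q * \<beta>\<close> vertices in each of
    \<open>X\<close>, \<open>Y\<close> and the rest. As \<open>X \<union> Y\<close> has at most
    \<open>2 * m0\<close> vertices, \<open>V\<close> has at most 6 + 1 times
    \<open>q * \<beta>\<close>.\<close>
  ultimately have "m0 \<le> 3 * (q * \<beta>)" using ZD out by linarith
  then have "card V \<le> 7 * (q * \<beta>)" using cV UI out by linarith
  then show False using vol[OF fV] by simp
qed

section \<open>Cells: the minimal deep set around each vertex\<close>

definition cell :: "'a \<Rightarrow> 'a set" where
  "cell y = (SOME X. X \<in> min_sets \<and> bl y q \<subseteq> X)"

lemma cell: assumes "y \<in> V" shows "cell y \<in> min_sets" "bl y q \<subseteq> cell y"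
proof -
  obtain X v where X: "X \<in> min_sets" "v \<in> V" "bl v q \<subseteq> X" using min_sets_ne min_setsD by metis
  obtain \<phi> where \<phi>: "aut \<phi>" "\<phi> v = y" using vt X assms by blast
  have "\<phi> ` X \<in> min_sets \<and> bl y q \<subseteq> \<phi> ` X"
    using min_sets_aut[OF \<phi>(1) X(1)] aut_bl[OF \<phi>(1) X(2), of q] X \<phi> by auto
  then have "cell y \<in> min_sets \<and> bl y q \<subseteq> cell y" unfolding cell_def by (rule someI)
  then show "cell y \<in> min_sets" "bl y q \<subseteq> cell y" by auto
qed

lemma cell_unique: "y \<in> V \<Longrightarrow> X \<in> min_sets \<Longrightarrow> bl y q \<subseteq> X \<Longrightarrow> cell y = X"
  using cell min_sets_unique by blast

lemma cell_aut: "aut \<phi> \<Longrightarrow> y \<in> V \<Longrightarrow> \<phi> ` cell y = cell (\<phi> y)"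
  using cell_unique[of "\<phi> y" "\<phi> ` cell y"] aut_V min_sets_aut cell aut_bl by (metis image_mono)

lemma cell_self: "y \<in> V \<Longrightarrow> y \<in> cell y" using cell(2) bl_center by blast

text \<open>By transitivity every cell would contain the ball of radius \<open>q + 1\<close> around
  its centre, hence the balls of radius \<open>q\<close> around the neighbours of the centre.
  Adjacent vertices would then share their cell, and a single cell would be all of
  \<open>V\<close>.\<close>

lemma cell_not_deeper: assumes "y \<in> V" "z \<in> V" shows "\<not> bl z (q + 1) \<subseteq> cell y"
proof
  assume b: "bl z (q + 1) \<subseteq> cell y"
  have z: "cell z = cell y" using cell_unique[of z "cell y"] cell assms b bl_mono[of q "q + 1" z] by auto
  have b': "bl u (q + 1) \<subseteq> cell u" if "u \<in> V" for u
  proof -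
    obtain \<phi> where "aut \<phi>" "\<phi> z = u" using vt assms \<open>u \<in> V\<close> by blast
    then show ?thesis using b z aut_bl[of \<phi> z "q + 1"] cell_aut[of \<phi> z] assms by (metis image_mono)
  qed
  have e: "cell v = cell u" if "(u, v) \<in> E" for u v
  proof -
    have uv: "u \<in> V" "v \<in> V" using E_V that by auto
    have "bl v q \<subseteq> bl u (q + 1)" using bl_sub[of u v q "q + 1"] gd_edge that uv by fastforce
    then show ?thesis using cell_unique[of v "cell u"] b'[of u] cell uv by blast
  qed
  have "cell v = cell z" if "v \<in> V" for v
    using conn[OF assms(2) that] by (induction rule: rtrancl_induct) (auto dest: e)
  then have "V \<subseteq> cell z" using cell_self by blast
  then show False using half_not_V[of "cell z"] min_setsD[OF cell(1)[OF assms(2)]] V_ne by blast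
qed

lemma cell_V: "y \<in> V \<Longrightarrow> cell y \<subseteq> V" using cell min_setsD by blast

lemma finite_cell: "y \<in> V \<Longrightarrow> finite (cell y)" using cell min_setsD by blast

text \<open>The component of \<open>y\<close> inside its cell has no boundary vertices of its own
  and still contains the ball, so minimal cardinality makes it the whole cell.\<close>

lemma cn_cell: assumes "y \<in> V" shows "cn (cell y)"
proof -
  let ?X = "cell y"
  note X = min_setsD[OF cell(1)[OF assms]]
  define Y where "Y = {u \<in> ?X. (y, u) \<in> (E \<inter> ?X \<times> ?X)\<^sup>*}"
  have yX: "y \<in> ?X" using cell_self assms by blast
  have YX: "Y \<subseteq> ?X" "y \<in> Y" using yX by (auto simp: Y_def)
  have bY: "bd Y \<subseteq> bd ?X"
  proof
    fix v assume "v \<in> bd Y"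
    then obtain u where u: "v \<in> V" "v \<notin> Y" "u \<in> Y" "(u, v) \<in> E" by (auto simp: bd_def)
    have "v \<notin> ?X"
    proof
      assume "v \<in> ?X"
      then have "(y, v) \<in> (E \<inter> ?X \<times> ?X)\<^sup>*"
        using u by (auto simp: Y_def intro: rtrancl_into_rtrancl)
      then show False using u \<open>v \<in> ?X\<close> by (auto simp: Y_def)
    qed
    then show "v \<in> bd ?X" using u YX by (auto simp: bd_def)
  qed
  have "bl y q \<subseteq> Y"
  proof
    fix u assume u: "u \<in> bl y q"
    have "(y, u) \<in> (E \<inter> bl y q \<times> bl y q)\<^sup>*" using cn_bl[OF assms, of q] u assms unfolding cn_def by auto
    then have "(y, u) \<in> (E \<inter> ?X \<times> ?X)\<^sup>*" using rtrancl_mono_set cell(2) assms by blast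
    then show "u \<in> Y" using u cell(2) assms by (auto simp: Y_def)
  qed
  moreover have "card (bd Y) \<le> q" using bY X card_mono by metis
  moreover have fY: "finite Y" using YX X finite_subset by blast
  moreover have "half Y" using half_mono YX X by blast
  ultimately have "Y \<in> deep_sets" "card (bd Y) = q" using min_deepI[of Y y] assms YX X by auto
  then have "m0 \<le> card Y" using m0_min by blast
  then have "Y = ?X" using card_subset_eq[of ?X Y] YX X card_mono[of ?X Y] by auto
  then show ?thesis by (intro cnI[of _ y]) (auto simp: Y_def)
qed

text \<open>A bound for the diameter of a cell: the value that \<open>cluster\<close> gives for the
  \<open>q\<close> boundary vertices and radius \<open>q + 1\<close>.\<close>

definition om :: nat where "om = q * (2 * q + 3) - 1"

lemma om_eq: "om + 1 = q * (2 * q + 3)" using q_pos by (auto simp: om_def)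

lemma cell_diam: assumes "y \<in> V" "u \<in> cell y" "v \<in> cell y" shows "gd u v \<le> om"
proof -
  note X = min_setsD[OF cell(1)[OF assms(1)]]
  have "\<exists>s\<in>bd (cell y). gd h s \<le> q + 1" if h: "h \<in> cell y" for h
  proof -
    have "h \<in> V" using h X by blast
    then obtain w where w: "w \<in> V" "gd h w \<le> q + 1" "w \<notin> cell y"
      using cell_not_deeper[OF assms(1), of h] by (auto simp: bl_def)
    then obtain b where "b \<in> bd (cell y)" "gd h b + gd b w = gd h w" using geo_exit h \<open>h \<in> V\<close> by blast
    then show ?thesis using w by (intro bexI[of _ b]) auto
  qed
  then have "gd u v + 1 \<le> card (bd (cell y)) * (2 * (q + 1) + 1)"
    using cluster[of "bd (cell y)" "cell y" "q + 1" u v] X cn_cell bd_V assms by blast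
  then have "gd u v + 1 \<le> om + 1" using X(5) om_eq by (simp add: algebra_simps)
  then show ?thesis by simp
qed

lemma cell_bl: "y \<in> V \<Longrightarrow> cell y \<subseteq> bl y om"
  using cell_diam cell_self cell_V by (fastforce simp: bl_def)

section \<open>Tubes: unions of cells along connected sets\<close>

definition tube :: "'a set \<Rightarrow> 'a set" where "tube P = (\<Union>y\<in>P. cell y)"

lemma tube_V: "P \<subseteq> V \<Longrightarrow> tube P \<subseteq> V" using cell_V by (auto simp: tube_def)

lemma finite_tube: "P \<subseteq> V \<Longrightarrow> finite P \<Longrightarrow> finite (tube P)" using finite_cell by (auto simp: tube_def)

lemma tube_sub: "P \<subseteq> V \<Longrightarrow> P \<subseteq> tube P" using cell_self by (auto simp: tube_def)

text \<open>Vertices are added one at a time. A neighbour of the new vertex is already present, so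
  the new cell shares a ball of radius \<open>q - 1\<close> with the tube. The intersection
  therefore has at least \<open>q\<close> boundary vertices, and submodularity leaves at most
  \<open>q\<close> for the union.\<close>

lemma tube_bd: assumes "P \<subseteq> V" "finite P" "cn P" "P \<noteq> {}" shows "card (bd (tube P)) \<le> q"
proof -
  obtain p0 where p0: "p0 \<in> P" using assms by blast
  show ?thesis
  proof (rule cn_induct[OF assms(2,3) p0])
    show "card (bd (tube {p0})) \<le> q" using min_setsD(5)[OF cell(1)] p0 assms by (auto simp: tube_def)
    fix S s y assume S: "S \<subseteq> P" "s \<in> S" "y \<in> P - S" "(s, y) \<in> E" "card (bd (tube S)) \<le> q"
    have sy: "s \<in> V" "y \<in> V" using E_V S by auto
    note X = min_setsD[OF cell(1)[OF sy(2)]]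
    have fS: "finite (tube S)" using finite_tube S assms finite_subset by (meson subset_trans)
    have "gd s y \<le> 1" using gd_edge S by blast
    then have b: "bl y (q - 1) \<subseteq> bl s q" using bl_sub[of s y "q - 1" q] q_pos sy by auto
    have "bl y (q - 1) \<subseteq> tube S \<inter> cell y"
      using b cell(2)[OF sy(1)] cell(2)[OF sy(2)] bl_mono[of "q - 1" q y] S(2) by (fastforce simp: tube_def)
    then have "q \<le> card (bd (tube S \<inter> cell y))"
      using q_pos deep_bd[of "tube S \<inter> cell y" y "q - 1"] X(1-3) sy half_mono[of "cell y" "tube S \<inter> cell y"] by auto
    moreover have "card (bd (tube S \<inter> cell y)) + card (bd (tube S \<union> cell y)) \<le> q + q"
      using uncross(1)[of "tube S" "cell y"] finite_bd[OF fS] X S(5) by linarith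
    moreover have "tube (insert y S) = tube S \<union> cell y" by (auto simp: tube_def)
    ultimately show "card (bd (tube (insert y S))) \<le> q" by simp
  qed
qed

lemma cn_tube: assumes "P \<subseteq> V" "cn P" shows "cn (tube P)"
proof (cases "P = {}")
  case False
  then obtain p0 where p0: "p0 \<in> P" by blast
  have "tube P = (\<Union>y\<in>P. P \<union> cell y)" using tube_sub[OF assms(1)] p0 by (auto simp: tube_def)
  moreover have "cn (P \<union> cell y)" if "y \<in> P" for y
    using cn_Un[of P "cell y" y] assms that cn_cell cell_self by blast
  ultimately show ?thesis using cn_UN[of P "\<lambda>y. P \<union> cell y" p0] p0 by auto
qed (simp add: tube_def cn_def)

lemma tube_mono: "P \<subseteq> Q \<Longrightarrow> tube P \<subseteq> tube Q" by (auto simp: tube_def)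

end

section \<open>Local two-sidedness\<close>

context lf_graph
begin

text \<open>Only the arguments between \<open>-b\<close> and \<open>b\<close> are relevant.\<close>

definition chart :: "nat \<Rightarrow> (int \<Rightarrow> 'a) \<Rightarrow> bool" where
  "chart b \<gamma> \<longleftrightarrow> (\<forall>i. \<bar>i\<bar> \<le> int b \<longrightarrow> \<gamma> i \<in> V) \<and>
     (\<forall>i j. \<bar>i\<bar> \<le> int b \<longrightarrow> \<bar>j\<bar> \<le> int b \<longrightarrow> int (gd (\<gamma> i) (\<gamma> j)) = \<bar>i - j\<bar>)"

lemma chartD:
  assumes "chart b \<gamma>" "\<bar>i\<bar> \<le> int b" "\<bar>j\<bar> \<le> int b"
  shows "\<gamma> i \<in> V" "int (gd (\<gamma> i) (\<gamma> j)) = \<bar>i - j\<bar>"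
  using assms by (auto simp: chart_def)

lemma chart_rev: "chart b \<gamma> \<Longrightarrow> chart b (\<lambda>i. \<gamma> (- i))"
  by (auto simp: chart_def)

lemma chart_aut: "aut \<phi> \<Longrightarrow> chart b \<gamma> \<Longrightarrow> chart b (\<phi> \<circ> \<gamma>)"
  using aut_V by (auto simp: chart_def aut_gd)

lemma chart_conn:
  assumes "chart b \<gamma>" "\<And>l. min i j \<le> l \<Longrightarrow> l \<le> max i j \<Longrightarrow> \<bar>l\<bar> \<le> int b \<and> \<gamma> l \<in> S"
  shows "(\<gamma> i, \<gamma> j) \<in> (E \<inter> S \<times> S)\<^sup>*"
proof -
  have *: "(\<gamma> i, \<gamma> (i + int n)) \<in> (E \<inter> S \<times> S)\<^sup>*"
    if "\<And>l. i \<le> l \<Longrightarrow> l \<le> i + int n \<Longrightarrow> \<bar>l\<bar> \<le> int b \<and> \<gamma> l \<in> S" for i n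
    using that
  proof (induction n)
    case (Suc n)
    let ?j = "i + int n"
    have b: "\<bar>?j\<bar> \<le> int b" "\<gamma> ?j \<in> S" "\<bar>?j + 1\<bar> \<le> int b" "\<gamma> (?j + 1) \<in> S"
      using Suc(2)[of ?j] Suc(2)[of "?j + 1"] by auto
    have "gd (\<gamma> ?j) (\<gamma> (?j + 1)) = 1" using chartD(2)[OF assms(1) b(1,3)] by simp
    then have "(\<gamma> ?j, \<gamma> (?j + 1)) \<in> E" using edge_iff_gd chartD(1)[OF assms(1)] b by blast
    moreover have "(\<gamma> i, \<gamma> ?j) \<in> (E \<inter> S \<times> S)\<^sup>*" using Suc by auto
    ultimately have "(\<gamma> i, \<gamma> (?j + 1)) \<in> (E \<inter> S \<times> S)\<^sup>*"
      using b by (auto intro: rtrancl_into_rtrancl)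
    then show ?case by (simp add: algebra_simps)
  qed simp
  show ?thesis
  proof (cases "i \<le> j")
    case True
    then show ?thesis using *[of i "nat (j - i)"] assms(2) by auto
  next
    case False
    then have "(\<gamma> j, \<gamma> i) \<in> (E \<inter> S \<times> S)\<^sup>*" using *[of j "nat (i - j)"] assms(2) by auto
    then show ?thesis by (rule rtrancl_sym)
  qed
qed

lemma cn_chart: "chart b \<gamma> \<Longrightarrow> - int b \<le> i \<Longrightarrow> j \<le> int b \<Longrightarrow> cn (\<gamma> ` {i..j})"
  unfolding cn_def by (auto intro!: chart_conn imageI)

end

context vt_graph
begin

text \<open>The first \<open>2 * b\<close> steps of a geodesic, indexed from their middle, are moved
  to the prescribed centre by an automorphism.\<close>

lemma chart_ex:
  assumes "o' \<in> V" "x \<in> V" "y \<in> V" "2 * b \<le> gd x y"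
  shows "\<exists>\<gamma>. chart b \<gamma> \<and> \<gamma> 0 = o'"
proof -
  define n where "n = gd x y"
  have "(x, y) \<in> E ^^ n" using relpow_gd assms by (simp add: n_def)
  then obtain f where f: "f 0 = x" "f n = y" "\<And>i. i < n \<Longrightarrow> (f i, f (Suc i)) \<in> E"
    by (auto simp: relpow_fun_conv)
  have fV: "f i \<in> V" if "i \<le> n" for i using that f E_V assms by (cases "i < n") auto
  have up: "gd (f i) (f (i + m)) \<le> m" if "i + m \<le> n" for i m
    using that
  proof (induction m)
    case (Suc m)
    then have "gd (f i) (f (i + Suc m)) \<le> gd (f i) (f (i + m)) + 1"
      using gd_edge_le[of "f (i + m)" "f (i + Suc m)" "f i"] f(3)[of "i + m"] fV[of i] by simp
    then show ?case using Suc by simp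
  qed simp
  have eq: "gd (f i) (f j) = j - i" if "i \<le> j" "j \<le> n" for i j
  proof -
    have "gd (f 0) (f n) \<le> gd (f 0) (f i) + gd (f i) (f j) + gd (f j) (f n)"
      using gd_triangle[of "f 0" "f i" "f n"] gd_triangle[of "f i" "f j" "f n"] fV that by force
    moreover have "gd (f 0) (f i) \<le> i" "gd (f i) (f j) \<le> j - i" "gd (f j) (f n) \<le> n - j"
      using up[of 0 i] up[of i "j - i"] up[of j "n - j"] that by auto
    ultimately show ?thesis using f n_def that by simp
  qed
  have eq': "int (gd (f i) (f j)) = \<bar>int i - int j\<bar>" if "i \<le> n" "j \<le> n" for i j
    using eq[of i j] eq[of j i] gd_sym[of "f i" "f j"] fV that by (cases "i \<le> j") auto
  define \<gamma> where "\<gamma> i = f (nat (i + int b))" for i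
  have bn: "2 * b \<le> n" using assms n_def by simp
  have c: "chart b \<gamma>" unfolding chart_def
  proof (intro conjI allI impI)
    fix i :: int assume i: "\<bar>i\<bar> \<le> int b"
    then show "\<gamma> i \<in> V" using fV bn by (simp add: \<gamma>_def nat_le_iff)
    fix j :: int assume j: "\<bar>j\<bar> \<le> int b"
    show "int (gd (\<gamma> i) (\<gamma> j)) = \<bar>i - j\<bar>"
      using eq'[of "nat (i + int b)" "nat (j + int b)"] i j bn by (simp add: \<gamma>_def nat_le_iff abs_le_iff)
  qed
  then have "\<gamma> 0 \<in> V" by (simp add: chart_def)
  then obtain \<phi> where \<phi>: "aut \<phi>" "\<phi> (\<gamma> 0) = o'" using vt assms by blast
  then show ?thesis using chart_aut[OF \<phi>(1) c] by (intro exI[of _ "\<phi> \<circ> \<gamma>"]) simp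
qed

end

context deep_graph
begin

lemma om_le: "om + q + 3 \<le> 2 * (k + 1)\<^sup>2"
proof -
  have "om + 1 = 2 * q * q + 3 * q" using om_eq by (simp add: algebra_simps)
  moreover have "q * q \<le> k * k" using q_le_k mult_le_mono by blast
  ultimately show ?thesis using q_le_k by (simp add: power2_eq_square algebra_simps)
qed

lemma om_q: "4 * q \<le> om + 1"
proof -
  obtain m where m: "q = Suc m" using q_pos gr0_implies_Suc by blast
  have "om + 1 = 5 + (7 * m + 2 * (m * m))" using om_eq unfolding m by (simp add: algebra_simps)
  then show ?thesis using m by simp
qed

section \<open>The two sides of a geodesic within an annulus\<close>

definition annulus :: "'a \<Rightarrow> nat \<Rightarrow> nat \<Rightarrow> 'a set" where
  "annulus o' s n = {z \<in> V. s < gd o' z \<and> gd o' z \<le> n}"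

text \<open>The two differences \<open>Dp\<close>, \<open>Dm\<close> at the ends of the longer tube are both deep, so their disjoint
  boundaries use up all of the (at most \<open>2 * q\<close>) boundary vertices of both tubes.\<close>

lemma bd_far:
  assumes ch: "chart b \<gamma>" "\<gamma> 0 = o'" and P: "P \<subseteq> bl o' a" "cn P" "\<gamma> (int a) \<in> P" "\<gamma> (- int a) \<in> P"
    and ab: "om + 1 \<le> a" "b = a + om + q + 2" and z: "z \<in> bd (tube P)"
  shows "a \<le> gd o' z + om"
proof -
  have oV: "o' \<in> V" using ch by (auto simp: chart_def)
  have PV: "P \<subseteq> V" using P(1) bl_V by blast
  have fP: "finite P" using P(1) finite_bl[OF oV] finite_subset by blast
  \<comment> \<open>The prolongation by \<open>om + q + 2\<close> on either side makes room for a
    ball of radius \<open>q\<close> around each new end, outside the old tube and its boundary,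
    which reach no farther than \<open>a + om + 1\<close>.\<close>
  define P2 where "P2 = P \<union> \<gamma> ` {int a..int b} \<union> \<gamma> ` {- int b..- int a}"
  have \<gamma>V: "\<gamma> i \<in> V" if "\<bar>i\<bar> \<le> int b" for i using chartD(1)[OF ch(1) that that] .
  have \<gamma>d: "int (gd (\<gamma> i) (\<gamma> j)) = \<bar>i - j\<bar>" if "\<bar>i\<bar> \<le> int b" "\<bar>j\<bar> \<le> int b" for i j
    using chartD(2)[OF ch(1)] that by blast
  have \<gamma>o: "int (gd o' (\<gamma> i)) = \<bar>i\<bar>" if "\<bar>i\<bar> \<le> int b" for i using \<gamma>d[of 0 i] that ch by auto
  have P2V: "P2 \<subseteq> V" using PV \<gamma>V ab by (auto simp: P2_def)
  have fP2: "finite P2" using fP by (simp add: P2_def)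
  have cP2: "cn P2" unfolding P2_def
    using ab cn_chart[OF ch(1)] P
    by (intro cn_Un[of _ _ "\<gamma> (- int a)"] cn_Un[of _ _ "\<gamma> (int a)"]) auto
  let ?W1 = "tube P" and ?W2 = "tube P2"
  have Pne: "P \<noteq> {}" using P by auto
  have b1: "card (bd ?W1) \<le> q" using tube_bd PV fP P(2) Pne by blast
  have b2: "card (bd ?W2) \<le> q" using tube_bd P2V fP2 cP2 Pne by (auto simp: P2_def)
  have W12: "?W1 \<subseteq> ?W2" by (rule tube_mono) (auto simp: P2_def)
  define D where "D = ?W2 - (?W1 \<union> bd ?W1)"
  define Dp where "Dp = {z \<in> D. \<exists>i. int a < i \<and> i \<le> int b \<and> z \<in> cell (\<gamma> i)}"
  define Dm where "Dm = {z \<in> D. \<exists>i. - int b \<le> i \<and> i < - int a \<and> z \<in> cell (\<gamma> i)}"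
  have D: "D = Dp \<union> Dm"
  proof
    show "D \<subseteq> Dp \<union> Dm"
    proof
      fix z assume z: "z \<in> D"
      then obtain p where p: "p \<in> P2" "z \<in> cell p" "p \<notin> P" by (auto simp: D_def tube_def)
      then obtain i where i: "p = \<gamma> i" "i \<in> {int a..int b} \<union> {- int b..- int a}" by (auto simp: P2_def)
      moreover have "i \<noteq> int a" "i \<noteq> - int a" using p i P by auto
      ultimately show "z \<in> Dp \<union> Dm" using z p by (auto simp: Dp_def Dm_def)
    qed
  qed (auto simp: Dp_def Dm_def)
  have DV: "D \<subseteq> V" using tube_V[OF P2V] by (auto simp: D_def)
  have sep: "2 < gd u v" if u: "u \<in> Dp" and v: "v \<in> Dm" for u v
  proof -
    obtain i where i: "int a < i" "i \<le> int b" "u \<in> cell (\<gamma> i)" using u by (auto simp: Dp_def)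
    obtain j where j: "- int b \<le> j" "j < - int a" "v \<in> cell (\<gamma> j)" using v by (auto simp: Dm_def)
    have V: "\<gamma> i \<in> V" "\<gamma> j \<in> V" "u \<in> V" "v \<in> V" using \<gamma>V i j ab u v DV D by auto
    have "gd (\<gamma> i) (\<gamma> j) \<le> gd (\<gamma> i) u + gd u v + gd v (\<gamma> j)"
      using gd_triangle[of "\<gamma> i" u "\<gamma> j"] gd_triangle[of u v "\<gamma> j"] V by linarith
    moreover have "gd (\<gamma> i) u \<le> om" "gd v (\<gamma> j) \<le> om"
      using cell_diam[OF V(1)] cell_diam[OF V(2)] cell_self V i j by auto
    moreover have "int (gd (\<gamma> i) (\<gamma> j)) = \<bar>i - j\<bar>" using \<gamma>d i j ab by auto
    ultimately show ?thesis using i j ab by linarith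
  qed
  have bD: "bd Dp \<subseteq> bd ?W1 \<union> bd ?W2" "bd Dm \<subseteq> bd ?W1 \<union> bd ?W2"
  proof -
    have *: "v \<in> bd ?W1 \<union> bd ?W2" if "u \<in> D" "(u, v) \<in> E" "v \<notin> D" for u v
    proof -
      have "v \<in> V" using E_V that by auto
      have "v \<notin> ?W1" using that step_bd[of v ?W1 u] E_sym by (auto simp: D_def)
      then show ?thesis using that step_bd[of u ?W2 v] by (auto simp: D_def)
    qed
    have ed: "gd u v \<le> 1" "gd v u \<le> 1" if "(u, v) \<in> E" for u v using gd_edge E_sym that by auto
    show "bd Dp \<subseteq> bd ?W1 \<union> bd ?W2"
    proof
      fix v assume "v \<in> bd Dp"
      then obtain u where u: "u \<in> Dp" "(u, v) \<in> E" "v \<notin> Dp" by (auto simp: bd_def)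
      have "v \<notin> Dm" using sep[of u v] u ed by fastforce
      then show "v \<in> bd ?W1 \<union> bd ?W2" using * u D by blast
    qed
    show "bd Dm \<subseteq> bd ?W1 \<union> bd ?W2"
    proof
      fix v assume "v \<in> bd Dm"
      then obtain u where u: "u \<in> Dm" "(u, v) \<in> E" "v \<notin> Dm" by (auto simp: bd_def)
      have "v \<notin> Dp" using sep[of v u] u ed by fastforce
      then show "v \<in> bd ?W1 \<union> bd ?W2" using * u D by blast
    qed
  qed
  have disj: "bd Dp \<inter> bd Dm = {}"
  proof (rule ccontr)
    assume "bd Dp \<inter> bd Dm \<noteq> {}"
    then obtain v x y where v: "x \<in> Dp" "(x, v) \<in> E" "y \<in> Dm" "(y, v) \<in> E" by (auto simp: bd_def)
    have "gd x y \<le> gd x v + 1" using gd_edge_le[of v y x] E_sym v E_V by auto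
    then have "gd x y \<le> 2" using gd_edge[OF v(2)] by simp
    then show False using sep v by fastforce
  qed
  have fW: "finite (bd ?W1)" "finite (bd ?W2)" using finite_bd finite_tube PV fP P2V fP2 by auto
  have deep: "q \<le> card (bd Q)" 
    if Q: "Q = Dp \<and> j = int b \<or> Q = Dm \<and> j = - int b" for Q j
  proof (rule deep_bd)
    have jV: "\<gamma> j \<in> V" using \<gamma>V Q by auto
    show "\<gamma> j \<in> V" "q \<le> q + 1" using jV by auto
    show "Q \<subseteq> V" "finite Q" using Q D DV finite_tube[OF P2V fP2] by (auto simp: D_def intro: finite_subset)
    have "Q \<subseteq> bl (\<gamma> j) (2 * om + q + 2)"
    proof
      fix u assume u: "u \<in> Q"
      obtain i where i: "\<bar>i\<bar> \<le> int b" "\<bar>i - j\<bar> \<le> int b - int a" "u \<in> cell (\<gamma> i)"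
      proof (cases "j = int b")
        case True
        then have "u \<in> Dp" using Q u ab by auto
        then show ?thesis using that True ab by (auto simp: Dp_def)
      next
        case False
        then have "u \<in> Dm" "j = - int b" using Q u by auto
        then obtain i where "- int b \<le> i" "i < - int a" "u \<in> cell (\<gamma> i)" by (auto simp: Dm_def)
        then show ?thesis using that[of i] \<open>j = - int b\<close> ab by linarith
      qed
      have V: "\<gamma> i \<in> V" "u \<in> V" using \<gamma>V i \<open>Q \<subseteq> V\<close> u by auto
      have "int (gd (\<gamma> j) (\<gamma> i)) = \<bar>j - i\<bar>" using \<gamma>d i Q by auto
      then have "gd (\<gamma> j) (\<gamma> i) \<le> om + q + 2" using i ab by linarith
      moreover have "gd (\<gamma> i) u \<le> om" using cell_diam[OF V(1)] cell_self V i by auto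
      moreover have "gd (\<gamma> j) u \<le> gd (\<gamma> j) (\<gamma> i) + gd (\<gamma> i) u" using gd_triangle V jV by blast
      ultimately show "u \<in> bl (\<gamma> j) (2 * om + q + 2)" using V by (simp add: bl_def)
    qed
    then show "half Q" by (rule half_bl[rotated]) (use om_le jV in auto)
    show "bl (\<gamma> j) q \<subseteq> Q"
    proof
      fix u assume u: "u \<in> bl (\<gamma> j) q"
      have uV: "u \<in> V" "gd (\<gamma> j) u \<le> q" using u by (auto simp: bl_def)
      have uX: "u \<in> cell (\<gamma> j)" using cell(2)[OF jV] u by blast
      then have u2: "u \<in> ?W2" using Q ab by (auto simp: tube_def P2_def)
      have "u \<notin> ?W1 \<union> bd ?W1"
      proof
        assume "u \<in> ?W1 \<union> bd ?W1"
        then obtain p where p: "p \<in> P" "gd p u \<le> om + 1"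
        proof
          assume "u \<in> ?W1"
          then obtain p where "p \<in> P" "u \<in> cell p" by (auto simp: tube_def)
          then have "u \<in> bl p om" using cell_bl[of p] PV by blast
          then show ?thesis using that[of p] \<open>p \<in> P\<close> by (simp add: bl_def)
        next
          assume "u \<in> bd ?W1"
          then obtain p w where "p \<in> P" "w \<in> cell p" "(w, u) \<in> E" by (auto simp: tube_def bd_def)
          moreover then have "w \<in> bl p om" "p \<in> V" using cell_bl[of p] PV by blast+
          ultimately show ?thesis using that[of p] gd_edge_le[of w u p] by (simp add: bl_def)
        qed
        have pV: "p \<in> V" "gd o' p \<le> a" using p P(1) by (auto simp: bl_def)
        have "gd o' (\<gamma> j) \<le> gd o' p + gd p u + gd u (\<gamma> j)"
          using gd_triangle[of o' p "\<gamma> j"] gd_triangle[of p u "\<gamma> j"] pV uV jV oV by linarith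
        moreover have "int (gd o' (\<gamma> j)) = int b" using \<gamma>o[of j] Q by auto
        ultimately show False using p pV uV ab gd_sym[of u "\<gamma> j"] jV by linarith
      qed
      then show "u \<in> Q" using u2 uX Q ab by (auto simp: D_def Dp_def Dm_def)
    qed
  qed
  have "card (bd Dp) + card (bd Dm) = card (bd Dp \<union> bd Dm)"
    using disj bD fW by (intro card_Un_disjoint[symmetric]) (auto intro: finite_subset)
  moreover have "card (bd ?W1 \<union> bd ?W2) \<le> 2 * q" using card_Un_le[of "bd ?W1" "bd ?W2"] b1 b2 by linarith
  ultimately have "card (bd ?W1 \<union> bd ?W2) \<le> card (bd Dp \<union> bd Dm)"
    using deep[of Dp "int b"] deep[of Dm "- int b"] by simp
  then have "bd Dp \<union> bd Dm = bd ?W1 \<union> bd ?W2"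
    using fW bD by (intro card_seteq) auto
  then have "z \<in> bd Dp \<union> bd Dm" using z by blast
  then obtain u where u: "u \<in> Dp \<union> Dm" "(u, z) \<in> E" by (auto simp: bd_def)
  then obtain i where i: "int a < \<bar>i\<bar>" "\<bar>i\<bar> \<le> int b" "u \<in> cell (\<gamma> i)"
  proof -
    from u(1) obtain i where "int a < i \<and> i \<le> int b \<or> - int b \<le> i \<and> i < - int a" "u \<in> cell (\<gamma> i)"
      unfolding Dp_def Dm_def by blast
    then show ?thesis using that[of i] by linarith
  qed
  have V: "\<gamma> i \<in> V" "u \<in> V" "z \<in> V" using \<gamma>V i E_V u by auto
  have "gd o' (\<gamma> i) \<le> gd o' z + gd z u + gd u (\<gamma> i)"
    using gd_triangle[of o' z "\<gamma> i"] gd_triangle[of z u "\<gamma> i"] V oV by linarith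
  moreover have "gd z u \<le> 1" using gd_edge E_sym u by blast
  moreover have "gd u (\<gamma> i) \<le> om" using cell_diam[OF V(1)] cell_self V i by auto
  ultimately show ?thesis using \<gamma>o[of i] i by linarith
qed

text \<open>By \<open>bd_far\<close> the boundary of the tube lies farther out than this ball; the
  ball is connected, so it lies on one side, and \<open>p\<close> decides which.\<close>

lemma cross:
  assumes ch: "chart b \<gamma>" "\<gamma> 0 = o'" and P: "P \<subseteq> bl o' a" "cn P" "\<gamma> (int a) \<in> P" "\<gamma> (- int a) \<in> P"
    and ab: "om + 1 \<le> a" "b = a + om + q + 2" and p: "p \<in> P" "gd o' p \<le> a - om - 1"
  shows "bl o' (a - om - 1) \<subseteq> tube P"
proof (rule cn_sub)
  have oV: "o' \<in> V" using ch by (auto simp: chart_def)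
  show "cn (bl o' (a - om - 1))" using cn_bl oV by blast
  show "bd (tube P) \<inter> bl o' (a - om - 1) = {}"
    using bd_far[OF ch P ab] ab by (fastforce simp: bl_def)
  have "p \<in> V" using p P bl_V by blast
  then have "p \<in> bl o' (a - om - 1) \<inter> tube P" using p cell_self by (auto simp: bl_def tube_def)
  then show "bl o' (a - om - 1) \<inter> tube P \<noteq> {}" by blast
qed

text \<open>The component of the annulus that contains the positive half of the chart.\<close>

definition right_part :: "'a \<Rightarrow> (int \<Rightarrow> 'a) \<Rightarrow> nat \<Rightarrow> 'a set" where
  "right_part o' \<gamma> n = {z. (\<gamma> (int om + 1), z) \<in> (E \<inter> annulus o' om n \<times> annulus o' om n)\<^sup>*}"

text \<open>The surplus \<open>om + q + 3\<close> is the prolongation that \<open>cross\<close>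
  consumes at radius \<open>n + 1\<close>.\<close>

definition nchart :: "'a \<Rightarrow> (int \<Rightarrow> 'a) \<Rightarrow> nat \<Rightarrow> bool" where
  "nchart o' \<gamma> n \<longleftrightarrow> chart (n + om + q + 3) \<gamma> \<and> \<gamma> 0 = o' \<and> 4 * om + 6 \<le> n"

lemma nchartD:
  assumes "nchart o' \<gamma> n"
  shows "chart (n + om + q + 3) \<gamma>" "\<gamma> 0 = o'" "4 * om + 6 \<le> n" "o' \<in> V"
    "\<And>i. \<bar>i\<bar> \<le> int n + 1 \<Longrightarrow> \<gamma> i \<in> V \<and> int (gd o' (\<gamma> i)) = \<bar>i\<bar>"
proof -
  show c: "chart (n + om + q + 3) \<gamma>" "\<gamma> 0 = o'" "4 * om + 6 \<le> n" using assms by (auto simp: nchart_def)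
  show "o' \<in> V" using c by (auto simp: chart_def)
  show "\<gamma> i \<in> V \<and> int (gd o' (\<gamma> i)) = \<bar>i\<bar>" if "\<bar>i\<bar> \<le> int n + 1" for i
    using chartD[OF c(1), of 0 i] chartD[OF c(1), of i i] c(2) that by auto
qed

lemma nchart_annulus:
  "nchart o' \<gamma> n \<Longrightarrow> \<gamma> i \<in> annulus o' s m \<longleftrightarrow> int s < \<bar>i\<bar> \<and> \<bar>i\<bar> \<le> int m" if "\<bar>i\<bar> \<le> int n + 1"
  using nchartD(5)[of o' \<gamma> n i] that by (auto simp: annulus_def)

lemma nchart_conn:
  assumes "nchart o' \<gamma> n" "m \<le> n" "int s < i" "i \<le> int m" "int s < j" "j \<le> int m"
  shows "(\<gamma> i, \<gamma> j) \<in> (E \<inter> annulus o' s m \<times> annulus o' s m)\<^sup>*" 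
    "(\<gamma> (- i), \<gamma> (- j)) \<in> (E \<inter> annulus o' s m \<times> annulus o' s m)\<^sup>*"
proof -
  have A: "\<gamma> l \<in> annulus o' s m" if "int s < \<bar>l\<bar>" "\<bar>l\<bar> \<le> int m" for l
    using that nchart_annulus[OF _ assms(1), of l] assms(2) by simp
  show "(\<gamma> i, \<gamma> j) \<in> (E \<inter> annulus o' s m \<times> annulus o' s m)\<^sup>*"
    using assms by (intro chart_conn[OF nchartD(1)[OF assms(1)]] conjI A) auto
  show "(\<gamma> (- i), \<gamma> (- j)) \<in> (E \<inter> annulus o' s m \<times> annulus o' s m)\<^sup>*"
    using assms by (intro chart_conn[OF nchartD(1)[OF assms(1)]] conjI A) auto
qed

text \<open>Otherwise the component, together with the two rays of the chart, would be a connected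
  set outside the ball of radius \<open>om\<close> around \<open>o'\<close> whose tube covers
  \<open>o'\<close>. But a cell reaches at most \<open>om\<close> from its centre.\<close>

lemma opposite:
  assumes c: "nchart o' \<gamma> n" and i: "om < i" "i \<le> n" and j: "om < j" "j \<le> n"
  shows "(\<gamma> (int i), \<gamma> (- int j)) \<notin> (E \<inter> annulus o' om n \<times> annulus o' om n)\<^sup>*"
proof
  assume con: "(\<gamma> (int i), \<gamma> (- int j)) \<in> (E \<inter> annulus o' om n \<times> annulus o' om n)\<^sup>*"
  note C = nchartD[OF c]
  define T where "T = {z. (\<gamma> (int i), z) \<in> (E \<inter> annulus o' om n \<times> annulus o' om n)\<^sup>*}"
  have iA: "\<gamma> (int i) \<in> annulus o' om n" using nchart_annulus[OF _ c] i by simp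
  have TA: "T \<subseteq> annulus o' om n"
  proof
    fix z assume "z \<in> T"
    then have "(\<gamma> (int i), z) \<in> (E \<inter> annulus o' om n \<times> annulus o' om n)\<^sup>*" by (simp add: T_def)
    then show "z \<in> annulus o' om n" using iA by (induction rule: rtrancl_induct) auto
  qed
  have cT: "cn T"
  proof (rule cnI[of _ "\<gamma> (int i)"])
    fix y assume "y \<in> T"
    then have "(\<gamma> (int i), y) \<in> (E \<inter> annulus o' om n \<times> annulus o' om n)\<^sup>*" by (simp add: T_def)
    then show "(\<gamma> (int i), y) \<in> (E \<inter> T \<times> T)\<^sup>*"
    proof (induction rule: rtrancl_induct)
      case (step u v)
      then have "u \<in> T" "v \<in> T" by (auto simp: T_def intro: rtrancl_into_rtrancl)
      then show ?case using step by (auto intro: rtrancl_into_rtrancl)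
    qed simp
  qed
  define a where "a = n + 1"
  define P where "P = T \<union> \<gamma> ` {int om + 1..int a} \<union> \<gamma> ` {- int a..- int om - 1}"
  have a: "om + 1 \<le> a" "n + om + q + 3 = a + om + q + 2" using C(3) by (auto simp: a_def)
  have avoid: "p \<in> V \<and> om < gd o' p \<and> gd o' p \<le> a" if "p \<in> P" for p
  proof -
    have *: "\<gamma> i \<in> V \<and> om < gd o' (\<gamma> i) \<and> gd o' (\<gamma> i) \<le> a" if "int om < \<bar>i\<bar>" "\<bar>i\<bar> \<le> int a" for i
      using C(5)[of i] that by (auto simp: a_def)
    show ?thesis using that * TA unfolding P_def by (auto simp: annulus_def a_def)
  qed
  have "\<gamma> (int i) \<in> T" "\<gamma> (- int j) \<in> T" using con by (auto simp: T_def)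
  then have cP: "cn P" unfolding P_def
    using cn_chart[OF C(1)] cT i j C(3)
    by (intro cn_Un[of _ _ "\<gamma> (- int j)"] cn_Un[of _ _ "\<gamma> (int i)"]) (auto simp: a_def)
  have "bl o' (a - om - 1) \<subseteq> tube P"
  proof (rule cross[OF C(1,2) _ cP _ _ a])
    show "P \<subseteq> bl o' a" using avoid by (auto simp: bl_def)
    show "\<gamma> (int a) \<in> P" "\<gamma> (- int a) \<in> P" "\<gamma> (int om + 1) \<in> P" using C(3) by (auto simp: P_def a_def)
    have "int (gd o' (\<gamma> (int om + 1))) = int om + 1" using C(5)[of "int om + 1"] C(3) by auto
    then show "gd o' (\<gamma> (int om + 1)) \<le> a - om - 1" using C(3) by (simp add: a_def)
  qed
  then have "o' \<in> tube P" using C(4) bl_center by blast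
  then obtain p where p: "p \<in> P" "o' \<in> cell p" by (auto simp: tube_def)
  then have "gd p o' \<le> om" using cell_bl[of p] avoid[of p] by (auto simp: bl_def)
  then show False using avoid[OF p(1)] gd_sym[of p o'] C(4) by auto
qed

text \<open>\<open>cross\<close>, applied to the chart segment itself, puts \<open>z\<close> into a
  cell centred on the chart. The cell is connected with diameter at most \<open>om\<close>, so it
  stays inside the annulus.\<close>

lemma to_chart:
  assumes c: "nchart o' \<gamma> n" and z: "z \<in> V" "s + om < gd o' z" "gd o' z + om \<le> m" "m \<le> n"
    and j: "s < j" "j \<le> m"
  shows "(z, \<gamma> (int j)) \<in> (E \<inter> annulus o' s m \<times> annulus o' s m)\<^sup>* \<or> (z, \<gamma> (- int j)) \<in> (E \<inter> annulus o' s m \<times> annulus o' s m)\<^sup>*"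
proof -
  note C = nchartD[OF c]
  define a where "a = n + 1"
  have "bl o' (a - om - 1) \<subseteq> tube (\<gamma> ` {- int a..int a})"
  proof (rule cross[OF C(1,2), where p = "\<gamma> 0"])
    have *: "\<gamma> i \<in> V \<and> gd o' (\<gamma> i) \<le> a" if "\<bar>i\<bar> \<le> int a" for i
      using C(5)[of i] that by (auto simp: a_def)
    then show "\<gamma> ` {- int a..int a} \<subseteq> bl o' a" by (auto simp: bl_def)
    show "cn (\<gamma> ` {- int a..int a})" using cn_chart[OF C(1)] by (simp add: a_def)
  qed (use C in \<open>auto simp: a_def\<close>)
  moreover have "z \<in> bl o' (a - om - 1)" using z by (simp add: bl_def a_def)
  ultimately have "z \<in> tube (\<gamma> ` {- int a..int a})" by blast
  then obtain i where i: "- int a \<le> i" "i \<le> int a" "z \<in> cell (\<gamma> i)" by (auto simp: tube_def)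
  have iV: "\<gamma> i \<in> V" "int (gd o' (\<gamma> i)) = \<bar>i\<bar>" using C(5)[of i] i by (auto simp: a_def)
  have X: "cell (\<gamma> i) \<subseteq> annulus o' s m"
  proof
    fix u assume u: "u \<in> cell (\<gamma> i)"
    then have uV: "u \<in> V" using cell_V iV by blast
    have "gd u z \<le> om" using cell_diam iV u i by blast
    moreover have "gd o' z \<le> gd o' u + gd u z" "gd o' u \<le> gd o' z + gd z u" "gd z u = gd u z"
      using gd_triangle[of o' u z] gd_triangle[of o' z u] gd_sym[of z u] uV z C(4) by simp_all
    ultimately have "s < gd o' u \<and> gd o' u \<le> m" using z by linarith
    then show "u \<in> annulus o' s m" using uV by (simp add: annulus_def)
  qed
  then have "\<gamma> i \<in> annulus o' s m" using cell_self iV by blast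
  then have ib: "int s < \<bar>i\<bar>" "\<bar>i\<bar> \<le> int m" using iV by (auto simp: annulus_def)
  have zi: "(z, \<gamma> i) \<in> (E \<inter> annulus o' s m \<times> annulus o' s m)\<^sup>*"
    using rtrancl_mono_set[OF _ X] cn_cell[OF iV(1)] i cell_self iV unfolding cn_def by blast
  show ?thesis
  proof (cases "0 \<le> i")
    case True
    then have "(\<gamma> i, \<gamma> (int j)) \<in> (E \<inter> annulus o' s m \<times> annulus o' s m)\<^sup>*"
      using nchart_conn(1)[OF c z(4), of s i "int j"] ib j by auto
    then show ?thesis using zi by (meson rtrancl_trans)
  next
    case False
    then have "(\<gamma> i, \<gamma> (- int j)) \<in> (E \<inter> annulus o' s m \<times> annulus o' s m)\<^sup>*"
      using nchart_conn(2)[OF c z(4), of s "- i" "int j"] ib j by auto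
    then show ?thesis using zi by (meson rtrancl_trans)
  qed
qed

lemma right_part_annulus: "nchart o' \<gamma> n \<Longrightarrow> right_part o' \<gamma> n \<subseteq> annulus o' om n"
proof
  fix z assume c: "nchart o' \<gamma> n" and "z \<in> right_part o' \<gamma> n"
  then have "(\<gamma> (int om + 1), z) \<in> (E \<inter> annulus o' om n \<times> annulus o' om n)\<^sup>*" by (simp add: right_part_def)
  then show "z \<in> annulus o' om n" 
    using nchart_annulus[OF _ c, of "int om + 1" om n] nchartD(3)[OF c]
    by (induction rule: rtrancl_induct) auto
qed

lemma right_part_conn:
  assumes "(x, y) \<in> (E \<inter> annulus o' om n \<times> annulus o' om n)\<^sup>*" 
  shows "x \<in> right_part o' \<gamma> n \<longleftrightarrow> y \<in> right_part o' \<gamma> n"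
  using assms rtrancl_sym[OF assms] unfolding right_part_def by (auto intro: rtrancl_trans)

lemma right_part_edge: "(x, y) \<in> E \<Longrightarrow> x \<in> annulus o' om n \<Longrightarrow> y \<in> annulus o' om n \<Longrightarrow> x \<in> right_part o' \<gamma> n \<longleftrightarrow> y \<in> right_part o' \<gamma> n"
  by (rule right_part_conn) auto

lemma right_part_pos: assumes "nchart o' \<gamma> n" "om < j" "j \<le> n" shows "\<gamma> (int j) \<in> right_part o' \<gamma> n"
  using nchart_conn(1)[OF assms(1), of n om "int om + 1" "int j"] assms by (auto simp: right_part_def)

lemma right_part_neg: assumes "nchart o' \<gamma> n" "om < j" "j \<le> n" shows "\<gamma> (- int j) \<notin> right_part o' \<gamma> n"
  using opposite[OF assms(1), of "om + 1" j] assms by (auto simp: right_part_def add.commute)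

text \<open>The vertices to which \<open>to_chart\<close> applies in the annulus between
  \<open>om + 1\<close> and \<open>n - 1\<close>; the slack of one on both rims allows the centre to
  move to a neighbour.\<close>

definition mid :: "'a \<Rightarrow> nat \<Rightarrow> 'a set" where
  "mid o' n = {z \<in> V. 2 * om + 1 < gd o' z \<and> gd o' z + om + 1 \<le> n}"

text \<open>Every vertex of \<open>mid\<close> is joined to one of two chart vertices inside an
  annulus contained in both annuli, so its side in the second annulus depends only on its side in
  the first. The points of the second chart at distance \<open>2 * om + 4\<close> show that both
  sides occur.\<close>

lemma right_part_compare:
  assumes c: "nchart o' \<gamma> n" and c': "nchart p \<gamma>' n'" and op: "gd o' p \<le> 1" "n \<le> n'"
  shows "(\<forall>z\<in>mid o' n. z \<in> right_part o' \<gamma> n \<longleftrightarrow> z \<in> right_part p \<gamma>' n') \<or> (\<forall>z\<in>mid o' n. z \<in> right_part o' \<gamma> n \<longleftrightarrow> z \<notin> right_part p \<gamma>' n')"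
proof -
  note C = nchartD[OF c] note C' = nchartD[OF c']
  let ?Ap = "\<gamma> (int (om + 2))" and ?Am = "\<gamma> (- int (om + 2))"
  let ?R = "\<lambda>o' s n. (E \<inter> annulus o' s n \<times> annulus o' s n)\<^sup>*"
  have near: "gd o' z \<le> gd p z + 1" "gd p z \<le> gd o' z + 1" if "z \<in> V" for z
    using gd_triangle[of o' p z] gd_triangle[of p o' z] gd_sym[of p o'] op C(4) C'(4) that by auto
  have An1: "annulus o' (om + 1) (n - 1) \<subseteq> annulus o' om n" by (auto simp: annulus_def)
  have An2: "annulus o' (om + 1) (n - 1) \<subseteq> annulus p om n'"
  proof
    fix z assume z: "z \<in> annulus o' (om + 1) (n - 1)"
    then have "z \<in> V" by (simp add: annulus_def)
    then show "z \<in> annulus p om n'" using z near[of z] op by (auto simp: annulus_def)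
  qed
  have alt: "(z, ?Ap) \<in> ?R o' (om + 1) (n - 1) \<or> (z, ?Am) \<in> ?R o' (om + 1) (n - 1)" if "z \<in> mid o' n" for z
    using to_chart[OF c, of z "om + 1" "n - 1" "om + 2"] that C(3) by (auto simp: mid_def)
  have ApR: "?Ap \<in> right_part o' \<gamma> n" "?Am \<notin> right_part o' \<gamma> n"
    using right_part_pos[OF c, of "om + 2"] right_part_neg[OF c, of "om + 2"] C(3) by auto
  have one: "z \<in> right_part o' \<gamma> n \<and> (z \<in> right_part p \<gamma>' n' \<longleftrightarrow> ?Ap \<in> right_part p \<gamma>' n') 
      \<or> z \<notin> right_part o' \<gamma> n \<and> (z \<in> right_part p \<gamma>' n' \<longleftrightarrow> ?Am \<in> right_part p \<gamma>' n')" if z: "z \<in> mid o' n" for z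
  proof -
    from alt[OF z] show ?thesis
    proof
      assume a: "(z, ?Ap) \<in> ?R o' (om + 1) (n - 1)"
      show ?thesis using right_part_conn[OF rtrancl_mono_set[OF a An1]] right_part_conn[OF rtrancl_mono_set[OF a An2]] ApR by blast
    next
      assume a: "(z, ?Am) \<in> ?R o' (om + 1) (n - 1)"
      show ?thesis using right_part_conn[OF rtrancl_mono_set[OF a An1]] right_part_conn[OF rtrancl_mono_set[OF a An2]] ApR by blast
    qed
  qed
  let ?m = "2 * om + 4"
  have g: "\<gamma>' (int ?m) \<in> mid o' n" "\<gamma>' (- int ?m) \<in> mid o' n"
  proof -
    have "\<gamma>' (int ?m) \<in> V \<and> int (gd p (\<gamma>' (int ?m))) = int ?m" "\<gamma>' (- int ?m) \<in> V \<and> int (gd p (\<gamma>' (- int ?m))) = int ?m"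
      using C'(5)[of "int ?m"] C'(5)[of "- int ?m"] C'(3) by auto
    then show "\<gamma>' (int ?m) \<in> mid o' n" "\<gamma>' (- int ?m) \<in> mid o' n"
      using near[of "\<gamma>' (int ?m)"] near[of "\<gamma>' (- int ?m)"] C(3) by (auto simp: mid_def)
  qed
  have "\<gamma>' (int ?m) \<in> right_part p \<gamma>' n'" "\<gamma>' (- int ?m) \<notin> right_part p \<gamma>' n'"
    using right_part_pos[OF c', of ?m] right_part_neg[OF c', of ?m] C'(3) by auto
  then have "(?Ap \<in> right_part p \<gamma>' n') \<noteq> (?Am \<in> right_part p \<gamma>' n')" using one[OF g(1)] one[OF g(2)] by blast
  then show ?thesis using one by blast
qed

lemma right_part_rev:
  assumes c: "nchart o' \<gamma> n"
  shows "right_part o' \<gamma> n \<inter> right_part o' (\<lambda>i. \<gamma> (- i)) n = {}"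
proof (rule ccontr)
  assume "right_part o' \<gamma> n \<inter> right_part o' (\<lambda>i. \<gamma> (- i)) n \<noteq> {}"
  then obtain z where z: "z \<in> right_part o' \<gamma> n" "(\<gamma> (- (int om + 1)), z) \<in> (E \<inter> annulus o' om n \<times> annulus o' om n)\<^sup>*"
    by (auto simp: right_part_def)
  then have "\<gamma> (- int (om + 1)) \<in> right_part o' \<gamma> n" using right_part_conn[OF z(2), of \<gamma>] by (simp add: add.commute)
  then show False using right_part_neg[OF c, of "om + 1"] nchartD(3)[OF c] by auto
qed

lemma nchart_rev: "nchart o' \<gamma> n \<Longrightarrow> nchart o' (\<lambda>i. \<gamma> (- i)) n"
  using chart_rev by (auto simp: nchart_def)

text \<open>A length for which \<open>mid\<close> contains the boundary of \<open>core\<close>,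
  whose vertices have distance at most \<open>3 * om + 4\<close> from the centre.\<close>

abbreviation n2 where "n2 \<equiv> 4 * om + 6"

lemma nchart_ex: assumes "o' \<in> V" shows "\<exists>\<gamma>. nchart o' \<gamma> n2"
proof -
  have "om + 1 = 2 * q * q + 3 * q" using om_eq by (simp add: algebra_simps)
  moreover have "q * q \<le> k * k" using q_le_k mult_le_mono by blast
  ultimately have "2 * (n2 + om + q + 3) \<le> 31 * (k + 1)\<^sup>2" 
    using q_le_k by (simp add: power2_eq_square algebra_simps)
  then obtain x y where "x \<in> V" "y \<in> V" "2 * (n2 + om + q + 3) \<le> gd x y" using long by fastforce
  then show ?thesis using chart_ex[OF assms, of x y] by (auto simp: nchart_def)
qed

lemma nchart_ex_inf: assumes "o' \<in> V" "infinite V" "n2 \<le> n" shows "\<exists>\<gamma>. nchart o' \<gamma> n"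
proof -
  obtain y where y: "y \<in> V" "2 * (n + om + q + 3) \<le> gd o' y"
  proof -
    have "\<not> V \<subseteq> bl o' (2 * (n + om + q + 3))" using finite_bl assms finite_subset by blast
    then obtain y where "y \<in> V" "y \<notin> bl o' (2 * (n + om + q + 3))" by blast
    then show ?thesis using that[of y] by (simp add: bl_def)
  qed
  then show ?thesis using chart_ex[OF assms(1,1) y] assms(3) by (auto simp: nchart_def)
qed

end

section \<open>The cut cochain\<close>

definition ind :: "'b set \<Rightarrow> 'b \<Rightarrow> int" where
  "ind S x = (if x \<in> S then 1 else 0)"

text \<open>The coboundary of \<open>W\<close>, restricted to the edges that leave \<open>W\<close> into \<open>R\<close>.\<close>

definition cut :: "'b set \<Rightarrow> 'b set \<Rightarrow> 'b \<Rightarrow> 'b \<Rightarrow> int" where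
  "cut W R x y = (if x \<in> W \<and> y \<in> R - W then 1 else 0) - (if y \<in> W \<and> x \<in> R - W then 1 else 0)"

lemma ind_simps [simp]: "ind S x = 1 \<longleftrightarrow> x \<in> S" "ind S x = 0 \<longleftrightarrow> x \<notin> S"
  by (auto simp: ind_def)

lemma cut_antisym: "cut W R y x = - cut W R x y"
  by (simp add: cut_def)

context lf_graph
begin

text \<open>The finite support of the potential is what later makes ends agree up to finitely many
  vertices. The sign is included because the two sides cannot be told apart consistently.\<close>

definition cohom :: "('a \<Rightarrow> 'a \<Rightarrow> int) \<Rightarrow> ('a \<Rightarrow> 'a \<Rightarrow> int) \<Rightarrow> bool" where
  "cohom c c' \<longleftrightarrow> (\<exists>\<epsilon>\<in>{1, -1}. \<exists>g. finite {x \<in> V. g x \<noteq> 0} \<and> (\<forall>(x, y)\<in>E. c x y = \<epsilon> * c' x y + g y - g x))"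

lemma cohI:
  "\<epsilon> = 1 \<or> \<epsilon> = -1 \<Longrightarrow> finite {x \<in> V. g x \<noteq> 0} \<Longrightarrow> (\<And>x y. (x, y) \<in> E \<Longrightarrow> c x y = \<epsilon> * c' x y + g y - g x) \<Longrightarrow> cohom c c'"
  unfolding cohom_def by blast

lemma cohom_trans: assumes "cohom c c'" "cohom c' c''" shows "cohom c c''"
proof -
  obtain \<epsilon> g where 1: "\<epsilon> = 1 \<or> \<epsilon> = -1" "finite {x \<in> V. g x \<noteq> 0}" 
    "\<And>x y. (x, y) \<in> E \<Longrightarrow> c x y = \<epsilon> * c' x y + g y - g x"
    using assms(1) unfolding cohom_def by blast
  obtain \<epsilon>' g' where 2: "\<epsilon>' = 1 \<or> \<epsilon>' = -1" "finite {x \<in> V. g' x \<noteq> 0}" 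
    "\<And>x y. (x, y) \<in> E \<Longrightarrow> c' x y = \<epsilon>' * c'' x y + g' y - g' x"
    using assms(2) unfolding cohom_def by blast
  show ?thesis
  proof (rule cohI[of "\<epsilon> * \<epsilon>'" "\<lambda>x. g x + \<epsilon> * g' x"])
    show "\<epsilon> * \<epsilon>' = 1 \<or> \<epsilon> * \<epsilon>' = -1" using 1 2 by auto
    show "finite {x \<in> V. g x + \<epsilon> * g' x \<noteq> 0}"
      by (rule finite_subset[OF _ finite_UnI[OF 1(2) 2(2)]]) auto
    show "c x y = \<epsilon> * \<epsilon>' * c'' x y + (g y + \<epsilon> * g' y) - (g x + \<epsilon> * g' x)" if "(x, y) \<in> E" for x y
      using 1(3)[OF that] 2(3)[OF that] by (simp add: algebra_simps)
  qed
qed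

text \<open>On edges the two restricted coboundaries add up to the full coboundary of
  \<open>W\<close>, which is trivial because \<open>W\<close> is finite.\<close>

lemma cut_flip:
  assumes "finite W" "\<And>z. z \<in> bd W \<Longrightarrow> z \<in> R \<longleftrightarrow> z \<notin> R'" shows "cohom (cut W R) (cut W R')"
proof (rule cohI[of "-1" "\<lambda>x. - ind W x"])
  show "finite {x \<in> V. - ind W x \<noteq> 0}"
    using assms(1) by (rule finite_subset[rotated]) (auto simp: ind_def)
  show "cut W R x y = - 1 * cut W R' x y + - ind W y - - ind W x" if "(x, y) \<in> E" for x y
    using assms(2)[of x] assms(2)[of y] step_bd[OF _ that, of W] step_bd[OF _ E_sym[OF that], of W]
    by (auto simp: cut_def ind_def)
qed simp

lemma cut_agree:
  assumes "\<And>z. z \<in> bd W \<Longrightarrow> z \<in> R \<longleftrightarrow> z \<in> R'" shows "cohom (cut W R) (cut W R')"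
proof (rule cohI[of 1 "\<lambda>x. 0"])
  show "cut W R x y = 1 * cut W R' x y + 0 - 0" if "(x, y) \<in> E" for x y
    using assms[of x] assms[of y] step_bd[OF _ that, of W] step_bd[OF _ E_sym[OF that], of W]
    by (auto simp: cut_def)
qed auto

end

context deep_graph
begin

text \<open>The potential is the difference of the indicators of the two sets, restricted to the
  right part. An edge leaves the right part only at the inner rim, where both sets contain both of
  its ends, or at the outer rim, which neither set reaches.\<close>

lemma cohom_cut_W:
  assumes c: "nchart o' \<gamma> n" and W: "W \<subseteq> bl o' (n - 1)" "bl o' (om + 1) \<subseteq> W"
    and W': "W' \<subseteq> bl o' (n - 1)" "bl o' (om + 1) \<subseteq> W'"
  shows "cohom (cut W (right_part o' \<gamma> n)) (cut W' (right_part o' \<gamma> n))"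
proof (rule cohI[of 1 "\<lambda>x. ind (right_part o' \<gamma> n \<inter> W') x - ind (right_part o' \<gamma> n \<inter> W) x"])
  let ?R = "right_part o' \<gamma> n"
  note C = nchartD[OF c]
  show "finite {x \<in> V. ind (?R \<inter> W') x - ind (?R \<inter> W) x \<noteq> 0}"
    by (rule finite_subset[OF _ finite_bl[OF C(4), of "n - 1"]]) (use W W' in \<open>auto simp: ind_def split: if_splits\<close>)
  have *: "cut W ?R x y = 1 * cut W' ?R x y + (ind (?R \<inter> W') y - ind (?R \<inter> W) y) - (ind (?R \<inter> W') x - ind (?R \<inter> W) x)"
    if xy: "(x, y) \<in> E" and y: "y \<in> ?R" for x y
  proof (cases "x \<in> ?R")
    case True
    then show ?thesis using y by (auto simp: cut_def ind_def)
  next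
    case False
    have yA: "y \<in> annulus o' om n" using right_part_annulus[OF c] y by blast
    have V: "x \<in> V" "y \<in> V" using E_V xy by auto
    have d: "gd o' x \<le> gd o' y + 1" "gd o' y \<le> gd o' x + 1"
      using gd_edge_le[OF xy C(4)] gd_edge_le[OF E_sym[OF xy] C(4)] by auto
    have "x \<notin> annulus o' om n" using right_part_edge[OF xy _ yA] False y by blast
    then have "gd o' x \<le> om \<or> n < gd o' x" using V by (auto simp: annulus_def)
    then show ?thesis
    proof
      assume "gd o' x \<le> om"
      then have "x \<in> W \<and> x \<in> W' \<and> y \<in> W \<and> y \<in> W'" using W W' V d by (auto simp: bl_def)
      then show ?thesis by (simp add: cut_def ind_def)
    next
      assume "n < gd o' x"
      then have "x \<notin> bl o' (n - 1)" "y \<notin> bl o' (n - 1)" using d C(3) by (auto simp: bl_def)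
      then have "x \<notin> W \<and> x \<notin> W' \<and> y \<notin> W \<and> y \<notin> W'" using W W' by blast
      then show ?thesis by (simp add: cut_def ind_def)
    qed
  qed
  show "cut W ?R x y = 1 * cut W' ?R x y + (ind (?R \<inter> W') y - ind (?R \<inter> W) y) - (ind (?R \<inter> W') x - ind (?R \<inter> W) x)"
    if xy: "(x, y) \<in> E" for x y
  proof (cases "y \<in> ?R")
    case True then show ?thesis using * xy by blast
  next
    case False
    show ?thesis
    proof (cases "x \<in> ?R")
      case True
      have "cut W ?R y x = 1 * cut W' ?R y x + (ind (?R \<inter> W') x - ind (?R \<inter> W) x) - (ind (?R \<inter> W') y - ind (?R \<inter> W) y)"
        using * E_sym xy True by blast
      then show ?thesis by (simp add: cut_antisym[of W ?R y x] cut_antisym[of W' ?R y x])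
    qed (use False in \<open>simp add: cut_def ind_def\<close>)
  qed
qed simp

text \<open>A ball thickened to a tube: the boundary has at most \<open>q\<close> vertices, while
  its distance from the centre stays under control.\<close>

definition core :: "'a \<Rightarrow> 'a set" where "core o' = tube (bl o' (2 * om + 3))"

lemma core:
  assumes "o' \<in> V"
  shows "bl o' (2 * om + 3) \<subseteq> core o'" "core o' \<subseteq> bl o' (3 * om + 3)" "finite (core o')" "cn (core o')"
    "card (bd (core o')) \<le> q" "core o' \<subseteq> V"
    "\<And>z. z \<in> bd (core o') \<Longrightarrow> 2 * om + 3 < gd o' z \<and> gd o' z \<le> 3 * om + 4"
proof -
  let ?B = "bl o' (2 * om + 3)"
  have B: "finite ?B" "cn ?B" "?B \<subseteq> V" "?B \<noteq> {}" using finite_bl cn_bl bl_V bl_center assms by blast+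
  show 1: "?B \<subseteq> core o'" unfolding core_def using tube_sub B by blast
  show "finite (core o')" unfolding core_def using finite_tube B by blast
  show "cn (core o')" unfolding core_def using cn_tube B by blast
  show "card (bd (core o')) \<le> q" unfolding core_def using tube_bd B by blast
  show "core o' \<subseteq> V" unfolding core_def using tube_V B by blast
  show 2: "core o' \<subseteq> bl o' (3 * om + 3)"
  proof
    fix z assume "z \<in> core o'"
    then obtain p where p: "p \<in> ?B" "z \<in> cell p" by (auto simp: core_def tube_def)
    then have "p \<in> V" using B by blast
    then have "z \<in> bl p om" using cell_bl p by blast
    then show "z \<in> bl o' (3 * om + 3)" using bl_sub[OF assms \<open>p \<in> V\<close>, of om "3 * om + 3"] p(1) by (auto simp: bl_def)
  qed
  fix z assume z: "z \<in> bd (core o')"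
  then obtain w where w: "w \<in> core o'" "(w, z) \<in> E" "z \<in> V" "z \<notin> core o'" by (auto simp: bd_def)
  have "w \<in> bl o' (3 * om + 3)" using 2 w by blast
  then have "gd o' z \<le> 3 * om + 4" using gd_edge_le[OF w(2) assms] by (auto simp: bl_def)
  moreover have "z \<notin> ?B" using 1 w by blast
  ultimately show "2 * om + 3 < gd o' z \<and> gd o' z \<le> 3 * om + 4" using w by (simp add: bl_def)
qed

definition cochain :: "'a \<Rightarrow> (int \<Rightarrow> 'a) \<Rightarrow> 'a \<Rightarrow> 'a \<Rightarrow> int" where
  "cochain o' \<gamma> = cut (core o') (right_part o' \<gamma> n2)"

text \<open>The side is exchanged while the core is kept, then the core while the side is
  kept.\<close>

lemma cohom_near:
  assumes c: "nchart o' \<gamma> n2" "nchart p \<gamma>' n2" "gd o' p \<le> 1"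
  shows "cohom (cochain o' \<gamma>) (cochain p \<gamma>')"
proof -
  have oV: "o' \<in> V" "p \<in> V" using nchartD(4) c by auto
  note W = core[OF oV(1)] note W' = core[OF oV(2)]
  have m: "bd (core o') \<subseteq> mid o' n2" using W(7) bd_V by (fastforce simp: mid_def)
  have near: "gd p z \<le> gd o' z + 1" "gd o' z \<le> gd p z + 1" if "z \<in> V" for z
    using gd_triangle[of o' p z] gd_triangle[of p o' z] gd_sym[of p o'] c(3) oV that by auto
  have "cohom (cut (core o') (right_part o' \<gamma> n2)) (cut (core o') (right_part p \<gamma>' n2))"
  proof (cases "\<forall>z\<in>mid o' n2. z \<in> right_part o' \<gamma> n2 \<longleftrightarrow> z \<in> right_part p \<gamma>' n2")
    case True
    then show ?thesis by (intro cut_agree) (use m in blast)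
  next
    case False
    then have "\<forall>z\<in>mid o' n2. z \<in> right_part o' \<gamma> n2 \<longleftrightarrow> z \<notin> right_part p \<gamma>' n2"
      using right_part_compare[OF c(1,2,3) order_refl] by blast
    then show ?thesis by (intro cut_flip[OF W(3)]) (use m in blast)
  qed
  moreover have "cohom (cut (core o') (right_part p \<gamma>' n2)) (cut (core p) (right_part p \<gamma>' n2))"
  proof (rule cohom_cut_W[OF c(2)])
    have "bl o' (3 * om + 3) \<subseteq> bl p (n2 - 1)" using near by (fastforce simp: bl_def)
    then show "core o' \<subseteq> bl p (n2 - 1)" using W(2) by blast
    have "bl p (om + 1) \<subseteq> bl o' (2 * om + 3)" using near by (fastforce simp: bl_def)
    then show "bl p (om + 1) \<subseteq> core o'" using W(1) by blast
    show "core p \<subseteq> bl p (n2 - 1)" using W'(2) bl_mono[of "3 * om + 3" "n2 - 1" p] by auto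
    show "bl p (om + 1) \<subseteq> core p" using W'(1) bl_mono[of "om + 1" "2 * om + 3" p] by auto
  qed
  ultimately show ?thesis unfolding cochain_def by (rule cohom_trans)
qed

lemma cohom_all:
  assumes c: "nchart o' \<gamma> n2" "nchart p \<gamma>' n2" shows "cohom (cochain o' \<gamma>) (cochain p \<gamma>')"
proof -
  have oV: "o' \<in> V" "p \<in> V" using nchartD(4) c by auto
  have "\<forall>\<gamma>'. nchart p \<gamma>' n2 \<longrightarrow> cohom (cochain o' \<gamma>) (cochain p \<gamma>')"
    using conn[OF oV]
  proof (induction rule: rtrancl_induct)
    case base
    then show ?case using cohom_near[OF c(1)] by simp
  next
    case (step p r)
    then have pV: "p \<in> V" "r \<in> V" using E_V by auto
    obtain \<delta> where d: "nchart p \<delta> n2" using nchart_ex pV by blast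
    show ?case using step(3) d cohom_near[OF d _ gd_edge[OF step(2)]] cohom_trans by blast
  qed
  then show ?thesis using c by blast
qed

lemma annulus_aut: "aut \<phi> \<Longrightarrow> o' \<in> V \<Longrightarrow> z \<in> V \<Longrightarrow> \<phi> z \<in> annulus (\<phi> o') s n \<longleftrightarrow> z \<in> annulus o' s n"
  using aut_V by (auto simp: annulus_def aut_gd)

lemma right_part_aut:
  assumes "aut \<phi>" "o' \<in> V" "z \<in> right_part o' \<gamma> n" "\<gamma> (int om + 1) \<in> V"
  shows "\<phi> z \<in> right_part (\<phi> o') (\<phi> \<circ> \<gamma>) n"
proof -
  have "(\<gamma> (int om + 1), z) \<in> (E \<inter> annulus o' om n \<times> annulus o' om n)\<^sup>*" using assms by (simp add: right_part_def)
  then have "(\<phi> (\<gamma> (int om + 1)), \<phi> z) \<in> (E \<inter> annulus (\<phi> o') om n \<times> annulus (\<phi> o') om n)\<^sup>*"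
  proof (induction rule: rtrancl_induct)
    case (step y z)
    have V: "y \<in> V" "z \<in> V" using step E_V by auto
    have "(\<phi> y, \<phi> z) \<in> E \<inter> annulus (\<phi> o') om n \<times> annulus (\<phi> o') om n"
      using step V aut_E[OF assms(1) V] annulus_aut[OF assms(1,2)] by auto
    then show ?case using step by (meson rtrancl_into_rtrancl)
  qed simp
  then show ?thesis by (simp add: right_part_def)
qed

lemma nchart_aut: "aut \<phi> \<Longrightarrow> nchart o' \<gamma> n \<Longrightarrow> nchart (\<phi> o') (\<phi> \<circ> \<gamma>) n"
  using chart_aut by (auto simp: nchart_def)

lemma cochain_aut:
  assumes a: "aut \<phi>" and c: "nchart o' \<gamma> n2" and V: "x \<in> V" "y \<in> V"
  shows "cochain (\<phi> o') (\<phi> \<circ> \<gamma>) (\<phi> x) (\<phi> y) = cochain o' \<gamma> x y"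
proof -
  note C = nchartD[OF c]
  have g1: "\<gamma> (int om + 1) \<in> V" using C(5)[of "int om + 1"] by auto
  have W: "\<phi> z \<in> core (\<phi> o') \<longleftrightarrow> z \<in> core o'" if "z \<in> V" for z
  proof -
    have "core (\<phi> o') = (\<Union>y\<in>bl o' (2 * om + 3). cell (\<phi> y))"
      using aut_bl[OF a C(4), symmetric] by (simp add: core_def tube_def)
    also have "\<dots> = (\<Union>y\<in>bl o' (2 * om + 3). \<phi> ` cell y)"
    proof (rule SUP_cong)
      fix y assume "y \<in> bl o' (2 * om + 3)"
      then have "y \<in> V" using bl_V by blast
      then show "cell (\<phi> y) = \<phi> ` cell y" using cell_aut[OF a] by simp
    qed simp
    also have "\<dots> = \<phi> ` core o'" by (auto simp: core_def tube_def)
    finally show ?thesis using aut_mem[OF a core(6)[OF C(4)] that] by simp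
  qed
  have R: "\<phi> z \<in> right_part (\<phi> o') (\<phi> \<circ> \<gamma>) n2 \<longleftrightarrow> z \<in> right_part o' \<gamma> n2" if "z \<in> V" for z
  proof
    assume "\<phi> z \<in> right_part (\<phi> o') (\<phi> \<circ> \<gamma>) n2"
    then have "inv_into V \<phi> (\<phi> z) \<in> right_part (inv_into V \<phi> (\<phi> o')) (inv_into V \<phi> \<circ> (\<phi> \<circ> \<gamma>)) n2"
      using right_part_aut[OF aut_inv[OF a], of "\<phi> o'" "\<phi> z" "\<phi> \<circ> \<gamma>"] aut_V[OF a] C(4) g1 by simp
    then show "z \<in> right_part o' \<gamma> n2" using aut_inv_f[OF a] that C(4) g1 by (simp add: right_part_def)
  next
    assume "z \<in> right_part o' \<gamma> n2"
    then show "\<phi> z \<in> right_part (\<phi> o') (\<phi> \<circ> \<gamma>) n2" by (intro right_part_aut a C(4) g1)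
  qed
  show ?thesis unfolding cochain_def cut_def using W R V by simp
qed

text \<open>The pull-back of the cochain is the cochain of the chart moved by the inverse
  automorphism, and all charts define the same class by \<open>cohom_all\<close>.\<close>

lemma cochain_class:
  assumes a: "aut \<phi>" and c: "nchart o' \<gamma> n2"
  shows "\<exists>\<epsilon>\<in>{1, -1}. \<exists>g. finite {x \<in> V. g x \<noteq> 0} \<and> (\<forall>(x, y)\<in>E. cochain o' \<gamma> (\<phi> x) (\<phi> y) = \<epsilon> * cochain o' \<gamma> x y + g y - g x)"
proof -
  let ?\<psi> = "inv_into V \<phi>"
  have i: "aut ?\<psi>" using aut_inv a by blast
  have "cohom (cochain (?\<psi> o') (?\<psi> \<circ> \<gamma>)) (cochain o' \<gamma>)" using cohom_all nchart_aut[OF i c] c by blast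
  moreover have "cochain (?\<psi> o') (?\<psi> \<circ> \<gamma>) x y = cochain o' \<gamma> (\<phi> x) (\<phi> y)" if "(x, y) \<in> E" for x y
    using cochain_aut[OF i c, of "\<phi> x" "\<phi> y"] aut_V[OF a] aut_inv_f[OF a] E_V[OF that] by simp
  moreover obtain \<epsilon> g where g: "\<epsilon> \<in> {1, -1}" "finite {x \<in> V. g x \<noteq> 0}"
    "\<forall>(x, y)\<in>E. cochain (?\<psi> o') (?\<psi> \<circ> \<gamma>) x y = \<epsilon> * cochain o' \<gamma> x y + g y - g x"
    using calculation(1) unfolding cohom_def by blast
  ultimately show ?thesis by (intro bexI[OF _ g(1)] exI[of _ g] conjI g(2)) auto
qed

end

text \<open>Of the two sides of a chart the one with at most half of the boundary of the core is
  kept; this is the source of the factor 2 in \<open>s * t \<le> k / 2\<close>.\<close>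

locale cut_graph = deep_graph +
  fixes o' :: 'a and \<gamma> :: "int \<Rightarrow> 'a"
  assumes nch: "nchart o' \<gamma> n2"
    and small: "2 * card (bd (core o') \<inter> right_part o' \<gamma> n2) \<le> q"
begin

abbreviation W where "W \<equiv> core o'"
abbreviation R where "R \<equiv> right_part o' \<gamma> n2"

definition wall :: "'a set" where "wall = bd W \<inter> R"

definition c :: "'a \<Rightarrow> 'a \<Rightarrow> int" where "c = cochain o' \<gamma>"

definition E0 :: "'a rel" where "E0 = {(x, y) \<in> E. c x y = 0}"

text \<open>If \<open>Y\<close> misses the core, the cochain is the coboundary of an indicator and
  \<open>Y\<close> is one side of the graph. If it meets the core, there is a closed walk of winding
  number one.\<close>

definition Y :: "'a set" where "Y = {y. \<exists>e\<in>wall. (e, y) \<in> E0\<^sup>*}"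

lemmas NC = nchartD[OF nch]
lemmas W = core[OF NC(4)]

lemma c_cases: 
  assumes "(x, y) \<in> E"
  shows "x \<in> W \<and> y \<in> wall \<and> c x y = 1 \<and> y \<notin> W \<or> y \<in> W \<and> x \<in> wall \<and> c x y = -1 \<and> x \<notin> W \<or>
    \<not> (x \<in> W \<and> y \<in> R - W) \<and> \<not> (y \<in> W \<and> x \<in> R - W) \<and> c x y = 0"
  using step_bd[OF _ assms, of W] step_bd[OF _ E_sym[OF assms], of W]
  by (auto simp: c_def cochain_def cut_def wall_def)

lemma finite_wall: "finite wall" using finite_bd[OF W(3)] by (simp add: wall_def)

lemma card_wall: "2 * card wall \<le> q" using small by (simp add: wall_def)

lemma wall_V: "wall \<subseteq> V" using bd_V by (auto simp: wall_def)

lemma Y_step: "x \<in> Y \<Longrightarrow> (x, y) \<in> E0 \<Longrightarrow> y \<in> Y"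
  by (auto simp: Y_def intro: rtrancl_into_rtrancl)

lemma wall_Y: "wall \<subseteq> Y" by (auto simp: Y_def)

lemma Y_V: "Y \<subseteq> V"
proof
  fix y assume "y \<in> Y"
  then obtain e where e: "e \<in> wall" "(e, y) \<in> E0\<^sup>*" by (auto simp: Y_def)
  from e(2) show "y \<in> V" 
    by (induction rule: rtrancl_induct) (use e(1) wall_V E_V in \<open>auto simp: E0_def\<close>)
qed

lemma conn_E0:
  assumes "(x, y) \<in> (E \<inter> S \<times> S)\<^sup>*" "S \<subseteq> W \<or> S \<inter> W = {}" shows "(x, y) \<in> E0\<^sup>*"
  using assms(1)
proof (induction rule: rtrancl_induct)
  case (step y z)
  then have "(y, z) \<in> E0" using assms(2) c_cases[of y z] by (auto simp: E0_def)
  then show ?case using step by (meson rtrancl_into_rtrancl)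
qed simp

text \<open>The cochain vanishes inside the core, which is connected; so the core vertex that was
  reached can be joined to a core neighbour of \<open>e\<close>, and the closing edge through the
  wall contributes one.\<close>

lemma winding: 
  assumes "Y \<inter> W \<noteq> {}"
  obtains x e where "(e, x) \<in> E0\<^sup>*" "(x, e) \<in> E" "c x e = 1"
proof -
  obtain e w where e: "e \<in> wall" "(e, w) \<in> E0\<^sup>*" "w \<in> W" using assms by (auto simp: Y_def)
  then obtain x where x: "x \<in> W" "(x, e) \<in> E" "e \<in> R" "e \<notin> W" by (auto simp: wall_def bd_def)
  have "(w, x) \<in> (E \<inter> W \<times> W)\<^sup>*" using W(4) e x by (auto simp: cn_def)
  then have "(e, x) \<in> E0\<^sup>*" using conn_E0[of w x W] e by (auto intro: rtrancl_trans)
  then show ?thesis using that x by (auto simp: c_def cochain_def cut_def)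
qed

text \<open>An edge leaving \<open>Y\<close> has non-zero cochain, and since \<open>Y\<close> misses
  the core it can only lead from the wall into the core.\<close>

lemma Y_bd: 
  assumes "Y \<inter> W = {}" 
  shows "bd (V - Y) \<subseteq> wall" "bd (Y - wall) \<subseteq> wall" 
    "\<And>x y. (x, y) \<in> E \<Longrightarrow> c x y = ind (V - Y) x - ind (V - Y) y"
proof -
  have *: "x \<in> wall \<and> y \<in> W \<and> c x y = -1" if "(x, y) \<in> E" "x \<in> Y" "y \<notin> Y" for x y
    using Y_step[of x y] c_cases[OF that(1)] that assms by (auto simp: E0_def)
  show "bd (V - Y) \<subseteq> wall" using * E_sym by (auto simp: bd_def)
  show "bd (Y - wall) \<subseteq> wall" using * by (auto simp: bd_def)
  show "c x y = ind (V - Y) x - ind (V - Y) y" if xy: "(x, y) \<in> E" for x y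
  proof -
    have V: "x \<in> V" "y \<in> V" using E_V xy by auto
    have anti: "c x y = - c y x" unfolding c_def cochain_def by (rule cut_antisym)
    have i: "ind (V - Y) z = (if z \<in> Y then 0 else 1)" if "z \<in> V" for z using that by (simp add: ind_def)
    consider "x \<in> Y \<longleftrightarrow> y \<in> Y" | "x \<in> Y" "y \<notin> Y" | "y \<in> Y" "x \<notin> Y" by blast
    then show ?thesis
    proof cases
      case 1
      then have "c x y = 0" using c_cases[OF xy] wall_Y assms by blast
      then show ?thesis using 1 i V by simp
    next
      case 2
      then show ?thesis using *[OF xy] i V by simp
    next
      case 3
      then have "c y x = -1" using *[OF E_sym[OF xy]] by blast
      then have "c x y = 1" using anti by linarith
      then show ?thesis using i V 3 by simp
    qed
  qed
qed

lemma big_Y: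
  assumes "Y \<inter> W = {}"
  shows "\<exists>z\<in>V. bl z q \<subseteq> Y - wall" "\<exists>z\<in>V. bl z q \<subseteq> V - Y"
proof -
  have "bl o' q \<subseteq> W" using W(1) bl_mono[of q "2 * om + 3" o'] om_q by auto
  moreover have "bl o' q \<subseteq> V" by (rule bl_V)
  ultimately show "\<exists>z\<in>V. bl z q \<subseteq> V - Y" using assms NC(4) by blast
  \<comment> \<open>A ball of radius \<open>q\<close> at this place lies beyond the boundary of
    \<open>W\<close>, which ends at distance \<open>3 * om + 4\<close>, and still inside the annulus
    because \<open>2 * q \<le> om + 1\<close>.\<close>
  let ?m = "3 * om + 5 + q"
  let ?z = "\<gamma> (int ?m)"
  have m: "?m \<le> n2" using om_q q_pos by linarith
  have z: "?z \<in> V" "gd o' ?z = ?m" using NC(5)[of "int ?m"] m by auto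
  have av: "u \<notin> W \<union> bd W \<and> u \<in> annulus o' om n2" if u: "u \<in> bl ?z q" for u
  proof -
    have uV: "u \<in> V" "gd ?z u \<le> q" using u by (auto simp: bl_def)
    have "gd o' ?z \<le> gd o' u + gd u ?z" "gd u ?z = gd ?z u" "gd o' u \<le> gd o' ?z + gd ?z u"
      using gd_triangle[of o' u ?z] gd_triangle[of o' ?z u] gd_sym[of u ?z] uV z NC(4) by simp_all
    then have d: "3 * om + 5 \<le> gd o' u" "gd o' u \<le> 3 * om + 5 + 2 * q" using uV z by linarith+
    then have "u \<notin> W" using W(2) by (auto simp: bl_def)
    moreover have "u \<notin> bd W" using W(7)[of u] d by auto
    ultimately show ?thesis using d om_q q_pos uV by (auto simp: annulus_def)
  qed
  obtain e where e: "e \<in> bd W" "e \<in> R" "(e, ?z) \<in> (E \<inter> (-W) \<times> (-W))\<^sup>*"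
  proof -
    have out: "\<gamma> l \<notin> W" if "3 * om + 3 < l" "l \<le> ?m" for l :: nat
    proof
      assume "\<gamma> (int l) \<in> W"
      then show False using W(2) NC(5)[of "int l"] that m by (auto simp: bl_def)
    qed
    \<comment> \<open>After the last chart vertex in \<open>W\<close> comes a boundary vertex on the
      right side, and from there to \<open>?z\<close> the chart avoids \<open>W\<close>.\<close>
    define L where "L = {l::nat. l \<le> ?m \<and> \<gamma> (int l) \<in> W}"
    have "\<gamma> 0 \<in> W" using W(1) NC(2,4) bl_center by blast
    then have L: "finite L" "0 \<in> L" by (auto simp: L_def)
    define l where "l = Max L"
    have l: "l \<in> L" "\<And>j. j \<in> L \<Longrightarrow> j \<le> l" using L Max_in by (auto simp: l_def)
    have lm: "l < ?m" using l(1) out[of l] by (cases "l \<le> 3 * om + 3") (auto simp: L_def)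
    have up: "\<gamma> (int j) \<notin> W" if "l < j" "j \<le> ?m" for j using l(2)[of j] that by (auto simp: L_def)
    have ed: "(\<gamma> (int l), \<gamma> (int (Suc l))) \<in> E"
    proof -
      have "int (gd (\<gamma> (int l)) (\<gamma> (int (Suc l)))) = 1"
        using chartD(2)[OF NC(1), of "int l" "int (Suc l)"] lm m by auto
      then show ?thesis using edge_iff_gd NC(5)[of "int l"] NC(5)[of "int (Suc l)"] lm m by auto
    qed
    have e: "\<gamma> (int (Suc l)) \<in> bd W"
      using ed l(1) up[of "Suc l"] lm NC(5)[of "int (Suc l)"] m by (auto simp: bd_def L_def)
    have "om < Suc l" using W(7)[OF e] NC(5)[of "int (Suc l)"] lm m by auto
    then have "\<gamma> (int (Suc l)) \<in> R" using right_part_pos[OF nch, of "Suc l"] lm m by auto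
    moreover have "(\<gamma> (int (Suc l)), ?z) \<in> (E \<inter> (-W) \<times> (-W))\<^sup>*"
    proof (rule chart_conn[OF NC(1)])
      fix j assume j: "min (int (Suc l)) (int ?m) \<le> j" "j \<le> max (int (Suc l)) (int ?m)"
      then have j': "int (Suc l) \<le> j" "j \<le> int ?m" using lm by auto
      then have "\<gamma> (int (nat j)) \<notin> W" using up[of "nat j"] by auto
      then show "\<bar>j\<bar> \<le> int (n2 + om + q + 3) \<and> \<gamma> j \<in> - W" using j' m by auto
    qed
    ultimately show ?thesis using that e by blast
  qed
  have zY: "?z \<in> Y" using conn_E0[OF e(3)] e by (auto simp: Y_def wall_def)
  have "bl ?z q \<subseteq> Y - wall"
  proof
    fix u assume u: "u \<in> bl ?z q"
    have "(?z, u) \<in> (E \<inter> bl ?z q \<times> bl ?z q)\<^sup>*" using cn_bl[OF z(1), of q] u z unfolding cn_def by auto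
    then have "(?z, u) \<in> E0\<^sup>*" by (rule conn_E0) (use av in blast)
    then have "u \<in> Y" using zY by (auto simp: Y_def intro: rtrancl_trans)
    then show "u \<in> Y - wall" using av[OF u] by (auto simp: wall_def)
  qed
  then show "\<exists>z\<in>V. bl z q \<subseteq> Y - wall" using z by blast
qed

text \<open>Both sides contain a ball of radius \<open>q\<close> but are cut off by at most half of
  \<open>q\<close> vertices, so by \<open>deep_bd\<close> neither is finite and at most half of
  \<open>V\<close>. In a finite graph one of them would be.\<close>

lemma Y_split:
  assumes "Y \<inter> W = {}" shows "infinite V" "infinite Y" "infinite (V - Y)"
proof -
  have lt: "card wall < q" using card_wall q_pos by linarith
  have 1: "\<not> (finite (Y - wall) \<and> half (Y - wall))"
  proof
    assume h: "finite (Y - wall) \<and> half (Y - wall)"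
    obtain z where "z \<in> V" "bl z q \<subseteq> Y - wall" using big_Y assms by blast
    then have "q \<le> card (bd (Y - wall))" using deep_bd[of "Y - wall" z q] h Y_V by auto
    moreover have "card (bd (Y - wall)) \<le> card wall" using Y_bd(2) assms finite_wall card_mono by blast
    ultimately show False using lt by linarith
  qed
  have 2: "\<not> (finite (V - Y) \<and> half (V - Y))"
  proof
    assume h: "finite (V - Y) \<and> half (V - Y)"
    obtain z where "z \<in> V" "bl z q \<subseteq> V - Y" using big_Y assms by blast
    then have "q \<le> card (bd (V - Y))" using deep_bd[of "V - Y" z q] h by auto
    moreover have "card (bd (V - Y)) \<le> card wall" using Y_bd(1) assms finite_wall card_mono by blast
    ultimately show False using lt by linarith
  qed
  show inf: "infinite V"
  proof
    assume f: "finite V"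
    then have fY: "finite Y" using Y_V finite_subset by blast
    have "card (V - Y) = card V - card Y" "card Y \<le> card V" using card_Diff_subset[OF fY Y_V] card_mono[OF f Y_V] by auto
    then have "half Y \<or> half (V - Y)" by (auto simp: half_def)
    moreover have "half Y \<Longrightarrow> half (Y - wall)" using half_mono fY by blast
    ultimately show False using 1 2 f fY by auto
  qed
  have h: "half X" for X using inf by (simp add: half_def)
  show "infinite Y" "infinite (V - Y)" using 1 2 h by auto
qed

text \<open>A walk of zero cochain from the wall into the core would first travel outside the core
  to a boundary vertex on the other side. An infinite graph has a chart whose annulus contains this
  piece of the walk, and \<open>right_part_compare\<close> would put both of its ends on the same
  side.\<close>

lemma no_winding_infinite:
  assumes "infinite V" shows "Y \<inter> W = {}"
proof (rule ccontr)
  assume "Y \<inter> W \<noteq> {}"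
  then obtain e w where e: "e \<in> wall" "(e, w) \<in> E0\<^sup>*" "w \<in> W" by (auto simp: Y_def)
  have eW: "e \<notin> W" using e bd_V by (auto simp: wall_def)
  have "\<exists>u. u \<in> bd W - R \<and> (e, u) \<in> (E \<inter> (-W) \<times> (-W))\<^sup>*" if "(e, w) \<in> E0\<^sup>*" "w \<in> W" for w
  proof -
    have "w \<notin> W \<and> (e, w) \<in> (E \<inter> (-W) \<times> (-W))\<^sup>* \<or> (\<exists>u. u \<in> bd W - R \<and> (e, u) \<in> (E \<inter> (-W) \<times> (-W))\<^sup>*)"
      using that(1)
    proof (induction rule: rtrancl_induct)
      case (step u v)
      have uv: "(u, v) \<in> E" "c u v = 0" using step by (auto simp: E0_def)
      show ?case
      proof (cases "\<exists>u. u \<in> bd W - R \<and> (e, u) \<in> (E \<inter> (-W) \<times> (-W))\<^sup>*")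
        case False
        then have u: "u \<notin> W" "(e, u) \<in> (E \<inter> (-W) \<times> (-W))\<^sup>*" using step by auto
        have "v \<notin> W"
        proof
          assume "v \<in> W"
          then have "u \<in> bd W" "u \<notin> R" 
            using uv u E_sym E_V c_cases[OF uv(1)] step_bd[OF \<open>v \<in> W\<close> E_sym[OF uv(1)]] by auto
          then show False using u False by blast
        qed
        then show ?thesis using u uv by (auto intro: rtrancl_into_rtrancl)
      qed blast
    qed (use eW in simp)
    then show ?thesis using that(2) by blast
  qed
  then obtain u where u: "u \<in> bd W" "u \<notin> R" "(e, u) \<in> (E \<inter> (-W) \<times> (-W))\<^sup>*" using e by blast
  have "\<exists>n\<ge>n2. (e, u) \<in> (E \<inter> annulus o' om n \<times> annulus o' om n)\<^sup>*"
    using u(3)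
  proof (induction rule: rtrancl_induct)
    case (step v x)
    then obtain n where n: "n2 \<le> n" "(e, v) \<in> (E \<inter> annulus o' om n \<times> annulus o' om n)\<^sup>*" by blast
    define m where "m = n + gd o' v + gd o' x"
    have V: "v \<in> V" "x \<in> V" using step E_V by auto
    have far: "om < gd o' z" if "z \<in> V" "z \<notin> W" for z
    proof (rule ccontr)
      assume "\<not> om < gd o' z"
      then have "z \<in> bl o' (2 * om + 3)" using that by (simp add: bl_def)
      then show False using W(1) that by blast
    qed
    have vx: "v \<in> annulus o' om m" "x \<in> annulus o' om m" using step V far by (auto simp: annulus_def m_def)
    have "annulus o' om n \<subseteq> annulus o' om m" by (auto simp: annulus_def m_def)
    then have "(e, v) \<in> (E \<inter> annulus o' om m \<times> annulus o' om m)\<^sup>*" using n rtrancl_mono_set by blast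
    then have "(e, x) \<in> (E \<inter> annulus o' om m \<times> annulus o' om m)\<^sup>*" using vx step by (auto intro: rtrancl_into_rtrancl)
    then show ?case using n by (intro exI[of _ m]) (auto simp: m_def)
  qed auto
  then obtain n where n: "n2 \<le> n" "(e, u) \<in> (E \<inter> annulus o' om n \<times> annulus o' om n)\<^sup>*" by blast
  obtain \<delta> where d: "nchart o' \<delta> n" using nchart_ex_inf NC(4) assms n by blast
  have m: "bd W \<subseteq> mid o' n2" using W(7) bd_V by (fastforce simp: mid_def)
  have eb: "e \<in> bd W" "e \<in> R" using e by (auto simp: wall_def)
  have "e \<in> right_part o' \<delta> n \<longleftrightarrow> u \<in> right_part o' \<delta> n" using right_part_conn n by blast
  then show False using right_part_compare[OF nch d _ n(1)] eb u m by auto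
qed

text \<open>Invariance of the class makes \<open>F\<close> constant along edges. So off a finite set
  the indicator of the end is transformed by an affine map with slope 1 or -1 that maps 0 and 1 into
  {0, 1}: the identity or the exchange.\<close>

lemma two_ended_infinite:
  assumes "infinite V"
  shows "card (bd (V - Y)) \<le> card wall" "infinite (V - Y)" "infinite (V - (V - Y))"
    "\<And>\<phi>. aut \<phi> \<Longrightarrow> finite {x \<in> V. (\<phi> x \<in> V - Y) \<noteq> (x \<in> V - Y)} \<or> finite {x \<in> V. (\<phi> x \<in> V - Y) = (x \<in> V - Y)}"
proof -
  have YW: "Y \<inter> W = {}" using no_winding_infinite assms by blast
  show "card (bd (V - Y)) \<le> card wall" using Y_bd(1) YW finite_wall card_mono by blast
  have "V - (V - Y) = Y" using Y_V by blast
  then show inf: "infinite (V - Y)" "infinite (V - (V - Y))" using Y_split YW by auto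
  fix \<phi> assume a: "aut \<phi>"
  let ?C = "V - Y"
  obtain \<epsilon> g where g: "\<epsilon> = 1 \<or> \<epsilon> = -1" "finite {x \<in> V. g x \<noteq> 0}"
      "\<And>x y. (x, y) \<in> E \<Longrightarrow> c (\<phi> x) (\<phi> y) = \<epsilon> * c x y + g y - g x"
    using cochain_class[OF a nch] unfolding c_def by blast
  define F where "F x = ind ?C (\<phi> x) - \<epsilon> * ind ?C x + g x" for x
  have step: "F y = F x" if xy: "(x, y) \<in> E" for x y
  proof -
    have "(\<phi> x, \<phi> y) \<in> E" using aut_E[OF a] E_V xy by blast
    then have "ind ?C (\<phi> x) - ind ?C (\<phi> y) = \<epsilon> * (ind ?C x - ind ?C y) + g y - g x"
      using Y_bd(3)[OF YW] xy g(3)[OF xy] by simp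
    then show ?thesis by (simp add: F_def algebra_simps)
  qed
  have F: "F x = F o'" if "x \<in> V" for x
    using conn[OF NC(4) that] by (induction rule: rtrancl_induct) (use step in auto)
  let ?K = "F o'"
  have off: "ind ?C (\<phi> x) = \<epsilon> * ind ?C x + ?K" if "x \<in> V" "g x = 0" for x
    using F[OF that(1)] that(2) by (simp add: F_def)
  have "\<not> ?C \<subseteq> {x \<in> V. g x \<noteq> 0}" "\<not> V - ?C \<subseteq> {x \<in> V. g x \<noteq> 0}"
    using inf g(2) finite_subset by blast+
  then obtain x y where xy: "x \<in> ?C" "g x = 0" "y \<in> V" "y \<notin> ?C" "g y = 0" by blast
  have i: "ind ?C z = 0 \<or> ind ?C z = 1" for z by (simp add: ind_def)
  have "ind ?C (\<phi> x) = \<epsilon> + ?K" "ind ?C (\<phi> y) = ?K"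
    using off[of x] off[of y] xy by (auto simp: ind_def[of ?C x] ind_def[of ?C y])
  then have K: "\<epsilon> = 1 \<and> ?K = 0 \<or> \<epsilon> = -1 \<and> ?K = 1" using i[of "\<phi> x"] i[of "\<phi> y"] g(1) by auto
  then show "finite {x \<in> V. (\<phi> x \<in> ?C) \<noteq> (x \<in> ?C)} \<or> finite {x \<in> V. (\<phi> x \<in> ?C) = (x \<in> ?C)}"
  proof
    assume K: "\<epsilon> = 1 \<and> ?K = 0"
    have "\<phi> x \<in> ?C \<longleftrightarrow> x \<in> ?C" if "x \<in> V" "g x = 0" for x
    proof -
      have "ind ?C (\<phi> x) = ind ?C x" using off[OF that] K by simp
      then show ?thesis by (metis ind_simps(1))
    qed
    then have "{x \<in> V. (\<phi> x \<in> ?C) \<noteq> (x \<in> ?C)} \<subseteq> {x \<in> V. g x \<noteq> 0}" by blast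
    then show ?thesis using g(2) finite_subset by blast
  next
    assume K: "\<epsilon> = -1 \<and> ?K = 1"
    have "\<phi> x \<in> ?C \<longleftrightarrow> x \<notin> ?C" if "x \<in> V" "g x = 0" for x
    proof -
      have "ind ?C (\<phi> x) = 1 - ind ?C x" using off[OF that] K by simp
      moreover have "1 - ind ?C x = 1 \<longleftrightarrow> x \<notin> ?C" using ind_simps(2)[of ?C x] by linarith
      ultimately show ?thesis by (metis ind_simps(1))
    qed
    then have "{x \<in> V. (\<phi> x \<in> ?C) = (x \<in> ?C)} \<subseteq> {x \<in> V. g x \<noteq> 0}" by blast
    then show ?thesis using g(2) finite_subset by blast
  qed
qed

end

context deep_graph
begin

text \<open>The right parts of a chart and of its reversal are disjoint, so one of them has at most
  half of the boundary of the core.\<close>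

lemma cut_graph_ex: "\<exists>o' \<gamma>. cut_graph V E k A0 o' \<gamma>"
proof -
  obtain o' where o': "o' \<in> V" using V_ne by blast
  obtain \<gamma> where c: "nchart o' \<gamma> n2" using nchart_ex o' by blast
  let ?g = "\<lambda>i. \<gamma> (- i)" and ?B = "bd (core o')"
  have f: "finite ?B" using finite_bd core(3)[OF o'] by blast
  have "card (?B \<inter> right_part o' \<gamma> n2) + card (?B \<inter> right_part o' ?g n2) = card (?B \<inter> right_part o' \<gamma> n2 \<union> ?B \<inter> right_part o' ?g n2)"
    using f right_part_rev[OF c] by (intro card_Un_disjoint[symmetric]) auto
  also have "\<dots> \<le> card ?B" using f by (intro card_mono) auto
  finally have "card (?B \<inter> right_part o' \<gamma> n2) + card (?B \<inter> right_part o' ?g n2) \<le> q" using core(5)[OF o'] by linarith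
  then have "2 * card (?B \<inter> right_part o' \<gamma> n2) \<le> q \<or> 2 * card (?B \<inter> right_part o' ?g n2) \<le> q" by linarith
  then show ?thesis using c nchart_rev[OF c] deep_graph_axioms
    by (auto simp: cut_graph_def cut_graph_axioms_def)
qed

end

section \<open>Two-ended graphs\<close>

locale two_ended = lf_graph +
  fixes Gam :: "('a \<Rightarrow> 'a) set" and C :: "'a set" and b0 :: 'a
  assumes Gam_aut: "\<phi> \<in> Gam \<Longrightarrow> automorphism V E \<phi>"
    and Gam_comp: "\<phi> \<in> Gam \<Longrightarrow> \<psi> \<in> Gam \<Longrightarrow> \<phi> \<circ> \<psi> \<in> Gam"
    and Gam_inv: "\<phi> \<in> Gam \<Longrightarrow> inv_into V \<phi> \<in> Gam"
    and Gam_trans: "x \<in> V \<Longrightarrow> y \<in> V \<Longrightarrow> \<exists>\<phi>\<in>Gam. \<phi> x = y"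
    and C_V: "C \<subseteq> V" and C_bd: "finite {v \<in> V - C. \<exists>u\<in>C. (u, v) \<in> E}"
    and C_inf: "infinite C" "infinite (V - C)"
    and C_Gam: "\<phi> \<in> Gam \<Longrightarrow> finite {x \<in> V. (\<phi> x \<in> C) \<noteq> (x \<in> C)} \<or> finite {x \<in> V. (\<phi> x \<in> C) = (x \<in> C)}"
    and b0_V: "b0 \<in> V"
begin

definition fin :: "('a \<Rightarrow> int) \<Rightarrow> bool" where "fin f \<longleftrightarrow> finite {x \<in> V. f x \<noteq> 0}"

definition fsum :: "('a \<Rightarrow> int) \<Rightarrow> int" where "fsum f = (\<Sum>x\<in>{x \<in> V. f x \<noteq> 0}. f x)"

lemma fin_add: "fin f \<Longrightarrow> fin g \<Longrightarrow> fin (\<lambda>x. f x + g x)"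
  unfolding fin_def by (rule finite_subset[of _ "{x \<in> V. f x \<noteq> 0} \<union> {x \<in> V. g x \<noteq> 0}"]) auto

lemma fin_diff: "fin f \<Longrightarrow> fin g \<Longrightarrow> fin (\<lambda>x. f x - g x)"
  unfolding fin_def by (rule finite_subset[of _ "{x \<in> V. f x \<noteq> 0} \<union> {x \<in> V. g x \<noteq> 0}"]) auto

lemma fin_cong: "fin f \<Longrightarrow> (\<And>x. x \<in> V \<Longrightarrow> g x = f x) \<Longrightarrow> fin g"
  unfolding fin_def by (rule finite_subset[rotated]) auto

lemma fin_aut: assumes "fin f" "aut \<phi>" shows "fin (\<lambda>x. f (\<phi> x))"
  unfolding fin_def
proof (rule finite_imageD)
  show "finite (\<phi> ` {x \<in> V. f (\<phi> x) \<noteq> 0})"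
    using assms(1) unfolding fin_def by (rule finite_subset[rotated]) (use aut_V[OF assms(2)] in auto)
  show "inj_on \<phi> {x \<in> V. f (\<phi> x) \<noteq> 0}" using aut_inj[OF assms(2)] by (rule inj_on_subset) auto
qed

lemma fsum_eq: "finite S \<Longrightarrow> S \<subseteq> V \<Longrightarrow> (\<And>x. x \<in> V - S \<Longrightarrow> f x = 0) \<Longrightarrow> fsum f = sum f S"
  unfolding fsum_def by (rule sum.mono_neutral_left) auto

lemma fsum_cong: "(\<And>x. x \<in> V \<Longrightarrow> f x = g x) \<Longrightarrow> fsum f = fsum g"
  unfolding fsum_def by (intro sum.cong) auto

lemma fsum_add: assumes "fin f" "fin g" shows "fsum (\<lambda>x. f x + g x) = fsum f + fsum g"
proof -
  let ?S = "{x \<in> V. f x \<noteq> 0} \<union> {x \<in> V. g x \<noteq> 0}"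
  have S: "finite ?S" "?S \<subseteq> V" using assms by (auto simp: fin_def)
  have "fsum (\<lambda>x. f x + g x) = (\<Sum>x\<in>?S. f x + g x)" by (rule fsum_eq[OF S]) auto
  moreover have "fsum f = sum f ?S" "fsum g = sum g ?S" by (rule fsum_eq[OF S]; auto)+
  ultimately show ?thesis by (simp add: sum.distrib)
qed

lemma fsum_minus: "fsum (\<lambda>x. - f x) = - fsum f"
  by (simp add: fsum_def sum_negf)

lemma fsum_diff: assumes "fin f" "fin g" shows "fsum (\<lambda>x. f x - g x) = fsum f - fsum g"
proof -
  have "fin (\<lambda>x. - g x)" using assms by (simp add: fin_def)
  then show ?thesis using fsum_add[OF assms(1), of "\<lambda>x. - g x"] fsum_minus[of g] by simp
qed

lemma fsum_aut: assumes "aut \<phi>" shows "fsum (\<lambda>x. f (\<phi> x)) = fsum f"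
proof -
  have "bij_betw \<phi> {x \<in> V. f (\<phi> x) \<noteq> 0} {x \<in> V. f x \<noteq> 0}"
  proof (rule bij_betw_imageI)
    show "inj_on \<phi> {x \<in> V. f (\<phi> x) \<noteq> 0}" using aut_inj[OF assms] by (rule inj_on_subset) auto
    show "\<phi> ` {x \<in> V. f (\<phi> x) \<noteq> 0} = {x \<in> V. f x \<noteq> 0}"
      using aut_image_V[OF assms] by auto
  qed
  then show ?thesis unfolding fsum_def by (rule sum.reindex_bij_betw)
qed

text \<open>The defects of \<open>\<phi>\<close> from preserving \<open>C\<close> and from
  exchanging \<open>C\<close> with its complement. Finite support means that \<open>\<phi>\<close>
  fixes both ends, or swaps them.\<close>

definition dC where "dC \<phi> x = ind C x - ind C (\<phi> x)"
definition eC where "eC \<phi> x = ind C x + ind C (\<phi> x) - 1"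
definition Gpos where "Gpos = {\<phi> \<in> Gam. fin (dC \<phi>)}"
definition Gneg where "Gneg = {\<phi> \<in> Gam. fin (eC \<phi>)}"
text \<open>The net number of vertices that \<open>\<phi>\<close> moves out of the end \<open>C\<close>; on \<open>Gpos\<close> it is a homomorphism.\<close>

definition \<tau> where "\<tau> \<phi> = fsum (dC \<phi>)"

lemma Gam_cases: "\<phi> \<in> Gam \<Longrightarrow> \<phi> \<in> Gpos \<or> \<phi> \<in> Gneg"
proof -
  assume a: "\<phi> \<in> Gam"
  have "{x \<in> V. dC \<phi> x \<noteq> 0} = {x \<in> V. (\<phi> x \<in> C) \<noteq> (x \<in> C)}" "{x \<in> V. eC \<phi> x \<noteq> 0} = {x \<in> V. (\<phi> x \<in> C) = (x \<in> C)}"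
    by (auto simp: dC_def eC_def ind_def)
  then show ?thesis using C_Gam[OF a] a by (simp add: Gpos_def Gneg_def fin_def)
qed

lemma Gpos_aut: "\<phi> \<in> Gpos \<Longrightarrow> aut \<phi>" and Gneg_aut: "\<phi> \<in> Gneg \<Longrightarrow> aut \<phi>"
  using Gam_aut by (auto simp: Gpos_def Gneg_def)

lemma V_inf: "infinite V" using C_inf by auto

lemma Gpos_comp: "\<phi> \<in> Gpos \<Longrightarrow> \<psi> \<in> Gpos \<Longrightarrow> \<phi> \<circ> \<psi> \<in> Gpos"
  using fin_add[of "dC \<psi>" "\<lambda>x. dC \<phi> (\<psi> x)"] fin_aut[of "dC \<phi>" \<psi>] Gam_aut[of \<psi>] Gam_comp[of \<phi> \<psi>]
  unfolding Gpos_def by (auto simp: dC_def elim!: fin_cong)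

lemma Gneg_comp: "\<phi> \<in> Gneg \<Longrightarrow> \<psi> \<in> Gneg \<Longrightarrow> \<phi> \<circ> \<psi> \<in> Gpos"
  using fin_diff[of "eC \<psi>" "\<lambda>x. eC \<phi> (\<psi> x)"] fin_aut[of "eC \<phi>" \<psi>] Gam_aut[of \<psi>] Gam_comp[of \<phi> \<psi>]
  unfolding Gpos_def Gneg_def by (auto simp: dC_def eC_def elim!: fin_cong)

lemma Gneg_Gpos_comp: "\<phi> \<in> Gneg \<Longrightarrow> \<psi> \<in> Gpos \<Longrightarrow> \<phi> \<circ> \<psi> \<in> Gneg"
  using fin_add[of "dC \<psi>" "\<lambda>x. eC \<phi> (\<psi> x)"] fin_aut[of "eC \<phi>" \<psi>] Gam_aut[of \<psi>] Gam_comp[of \<phi> \<psi>]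
  unfolding Gpos_def Gneg_def by (auto simp: dC_def eC_def elim!: fin_cong)

lemma Gpos_inv: assumes "\<phi> \<in> Gpos" shows "inv_into V \<phi> \<in> Gpos"
proof -
  have a: "aut \<phi>" "aut (inv_into V \<phi>)" using Gpos_aut assms aut_inv by auto
  have "fin (\<lambda>x. - dC \<phi> (inv_into V \<phi> x))" using fin_aut[OF _ a(2), of "dC \<phi>"] assms by (simp add: Gpos_def fin_def)
  then have "fin (dC (inv_into V \<phi>))" by (rule fin_cong) (simp add: dC_def aut_f_inv[OF a(1)])
  then show ?thesis using assms Gam_inv by (simp add: Gpos_def)
qed

lemma Gneg_inv: assumes "\<phi> \<in> Gneg" shows "inv_into V \<phi> \<in> Gneg"
proof -
  have a: "aut \<phi>" "aut (inv_into V \<phi>)" using Gneg_aut assms aut_inv by auto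
  have "fin (\<lambda>x. eC \<phi> (inv_into V \<phi> x))" using fin_aut[OF _ a(2), of "eC \<phi>"] assms by (simp add: Gneg_def)
  then have "fin (eC (inv_into V \<phi>))" by (rule fin_cong) (simp add: eC_def aut_f_inv[OF a(1)])
  then show ?thesis using assms Gam_inv by (simp add: Gneg_def)
qed

lemma tau_comp: "\<phi> \<in> Gpos \<Longrightarrow> \<psi> \<in> Gpos \<Longrightarrow> \<tau> (\<phi> \<circ> \<psi>) = \<tau> \<phi> + \<tau> \<psi>"
proof -
  assume a: "\<phi> \<in> Gpos" "\<psi> \<in> Gpos"
  have f: "fin (dC \<phi>)" "fin (dC \<psi>)" using a by (auto simp: Gpos_def)
  have "\<tau> (\<phi> \<circ> \<psi>) = fsum (\<lambda>x. dC \<psi> x + dC \<phi> (\<psi> x))" unfolding \<tau>_def by (rule fsum_cong) (simp add: dC_def)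
  also have "\<dots> = fsum (dC \<psi>) + fsum (\<lambda>x. dC \<phi> (\<psi> x))" using fsum_add f fin_aut Gpos_aut a by blast
  also have "fsum (\<lambda>x. dC \<phi> (\<psi> x)) = fsum (dC \<phi>)" using fsum_aut Gpos_aut a by blast
  finally show ?thesis by (simp add: \<tau>_def comp_def)
qed

text \<open>A swap turns flow out of \<open>C\<close> into flow into \<open>C\<close>. The two flows
  differ by the values of \<open>eC \<rho>\<close> at \<open>x\<close> and at
  \<open>\<phi> x\<close>, whose sums over all vertices agree.\<close>

lemma tau_conj:
  assumes "\<rho> \<in> Gneg" "\<phi> \<in> Gpos" "\<psi> \<in> Gpos" "\<And>x. x \<in> V \<Longrightarrow> \<psi> (\<rho> x) = \<rho> (\<phi> x)"
  shows "\<tau> \<psi> = - \<tau> \<phi>"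
proof -
  have a: "aut \<rho>" "aut \<phi>" using assms Gpos_aut Gneg_aut by auto
  have f: "fin (eC \<rho>)" "fin (dC \<phi>)" using assms by (auto simp: Gpos_def Gneg_def)
  have f': "fin (\<lambda>x. eC \<rho> (\<phi> x))" using fin_aut f a by blast
  have "\<tau> \<psi> = fsum (\<lambda>x. dC \<psi> (\<rho> x))" unfolding \<tau>_def using fsum_aut[OF a(1), of "dC \<psi>"] by simp
  also have "\<dots> = fsum (\<lambda>x. (eC \<rho> x - eC \<rho> (\<phi> x)) - dC \<phi> x)"
    by (rule fsum_cong) (simp add: dC_def eC_def assms)
  also have "\<dots> = fsum (eC \<rho>) - fsum (\<lambda>x. eC \<rho> (\<phi> x)) - fsum (dC \<phi>)"
    using fsum_diff[OF fin_diff[OF f(1) f'] f(2)] fsum_diff[OF f(1) f'] by simp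
  also have "fsum (\<lambda>x. eC \<rho> (\<phi> x)) = fsum (eC \<rho>)" using fsum_aut a by blast
  finally show ?thesis by (simp add: \<tau>_def)
qed

lemma fin_ball: assumes "fin f" obtains r where "\<And>x. x \<in> V \<Longrightarrow> f x \<noteq> 0 \<Longrightarrow> gd b0 x \<le> r"
proof -
  have "finite (gd b0 ` {x \<in> V. f x \<noteq> 0})" using assms by (simp add: fin_def)
  then obtain r where "\<forall>n\<in>gd b0 ` {x \<in> V. f x \<noteq> 0}. n \<le> r" using finite_nat_set_iff_bounded_le by metis
  then show ?thesis using that[of r] by auto
qed

text \<open>A map fixing \<open>b0\<close> permutes each ball around \<open>b0\<close>; in a ball
  containing the support, the vertices of \<open>C\<close> are counted once with either
  sign.\<close>

lemma tau_stab: assumes "\<phi> \<in> Gpos" "\<phi> b0 = b0" shows "\<tau> \<phi> = 0"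
proof -
  have a: "aut \<phi>" "fin (dC \<phi>)" using assms Gpos_aut by (auto simp: Gpos_def)
  obtain r where r: "\<And>x. x \<in> V \<Longrightarrow> dC \<phi> x \<noteq> 0 \<Longrightarrow> gd b0 x \<le> r" using fin_ball a by blast
  have "\<tau> \<phi> = sum (dC \<phi>) (bl b0 r)" unfolding \<tau>_def
    using finite_bl[OF b0_V] bl_V r by (intro fsum_eq) (auto simp: bl_def)
  also have "\<dots> = sum (ind C) (bl b0 r) - (\<Sum>x\<in>bl b0 r. ind C (\<phi> x))" by (simp add: dC_def sum_subtractf)
  also have "(\<Sum>x\<in>bl b0 r. ind C (\<phi> x)) = sum (ind C) (bl b0 r)"
  proof (rule sum.reindex_bij_betw)
    show "bij_betw \<phi> (bl b0 r) (bl b0 r)"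
      using aut_bl[OF a(1) b0_V, of r] assms inj_on_subset[OF aut_inj[OF a(1)] bl_V] by (intro bij_betw_imageI) auto
  qed
  finally show ?thesis by simp
qed

lemma tau_inv: assumes "\<phi> \<in> Gpos" shows "\<tau> (inv_into V \<phi>) = - \<tau> \<phi>"
proof -
  have "\<tau> (inv_into V \<phi> \<circ> \<phi>) = 0" 
    using tau_stab[OF Gpos_comp[OF Gpos_inv[OF assms] assms]] aut_inv_f[OF Gpos_aut[OF assms] b0_V] by simp
  then show ?thesis using tau_comp[OF Gpos_inv[OF assms] assms] by simp
qed

text \<open>This makes \<open>\<tau>\<close> a function of the image of \<open>b0\<close>, that is,
  a height on the orbit, even if stabilizers are infinite.\<close>

lemma tau_unique: assumes "\<phi> \<in> Gpos" "\<psi> \<in> Gpos" "\<phi> b0 = \<psi> b0" shows "\<tau> \<phi> = \<tau> \<psi>"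
proof -
  have "\<tau> (inv_into V \<phi> \<circ> \<psi>) = 0"
    using tau_stab[OF Gpos_comp[OF Gpos_inv[OF assms(1)] assms(2)]] aut_inv_f[OF Gpos_aut[OF assms(1)] b0_V] assms(3) by simp
  then show ?thesis using tau_comp[OF Gpos_inv[OF assms(1)] assms(2)] tau_inv[OF assms(1)] by simp
qed

lemma finite_bd_C: "finite (bd C)" using C_bd by (simp add: bd_def)

lemma finite_bd_outer: "finite (bd (V - C))"
proof (rule finite_subset)
  show "bd (V - C) \<subseteq> (\<Union>b\<in>bd C. {y. (b, y) \<in> E})" using E_sym by (auto simp: bd_def)
  show "finite (\<Union>b\<in>bd C. {y. (b, y) \<in> E})" using finite_bd_C bd_V fin_nbrs by fastforce
qed

text \<open>The boundary of the image of \<open>D\<close> lies in the ball of radius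
  \<open>r\<close> around \<open>\<phi> b0\<close>, away from the connected union of
  \<open>D\<close> with the ball around \<open>b0\<close>. So this union lies on one side, and since
  only finitely many vertices change sides it is the side of the image. Strictness comes from a
  boundary vertex of \<open>D\<close> in the ball.\<close>

lemma far_nested:
  assumes D: "D \<subseteq> V" "infinite D" "bd D \<subseteq> bl b0 r" "bd D \<noteq> {}" and a: "aut \<phi>"
    and f: "finite {x \<in> V. (\<phi> x \<in> D) \<noteq> (x \<in> D)}" and x: "\<phi> b0 \<notin> D" "2 * r + 1 < gd b0 (\<phi> b0)"
  shows "D \<subset> \<phi> ` D"
proof -
  let ?x = "\<phi> b0" and ?B = "bl b0 r"
  have xV: "?x \<in> V" using aut_V a b0_V by blast
  have c1: "cn (D \<union> ?B)"
  proof (rule cnI[of _ b0])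
    fix y assume y: "y \<in> D \<union> ?B"
    have B: "(b0, z) \<in> (E \<inter> (D \<union> ?B) \<times> (D \<union> ?B))\<^sup>*" if "z \<in> ?B" for z
      using rtrancl_mono_set[of b0 z ?B "D \<union> ?B"] cn_bl[OF b0_V, of r] that b0_V unfolding cn_def by auto
    show "(b0, y) \<in> (E \<inter> (D \<union> ?B) \<times> (D \<union> ?B))\<^sup>*"
    proof (cases "y \<in> ?B")
      case False
      then have yD: "y \<in> D" "y \<in> V" using y D by auto
      have "(y, z) \<in> (E \<inter> (D \<union> ?B) \<times> (D \<union> ?B))\<^sup>* \<and> z \<in> D \<or> (\<exists>z. (y, z) \<in> (E \<inter> (D \<union> ?B) \<times> (D \<union> ?B))\<^sup>* \<and> z \<in> ?B)" 
        if "(y, z) \<in> E\<^sup>*" for z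
        using that
      proof (induction rule: rtrancl_induct)
        case (step u v)
        then show ?case using step_bd[of u D v] D(3) by (auto intro: rtrancl_into_rtrancl)
      qed (use yD in auto)
      from this[OF conn[OF yD(2) b0_V]] obtain z where "(y, z) \<in> (E \<inter> (D \<union> ?B) \<times> (D \<union> ?B))\<^sup>*" "z \<in> ?B"
        using b0_V bl_center by blast
      then show ?thesis using B rtrancl_sym rtrancl_trans by meson
    qed (use B in blast)
  qed
  have disj: "bl ?x r \<inter> (D \<union> ?B) = {}"
  proof (rule ccontr)
    assume "bl ?x r \<inter> (D \<union> ?B) \<noteq> {}"
    then obtain z where z: "z \<in> V" "gd ?x z \<le> r" "z \<in> D \<or> gd b0 z \<le> r" by (auto simp: bl_def)
    have "\<exists>w\<in>V. gd ?x w \<le> r \<and> gd b0 w \<le> r"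
    proof (cases "z \<in> D")
      case True
      obtain b where b: "b \<in> bd D" "gd z b + gd b ?x = gd z ?x" using geo_exit True x z xV by blast
      have bV: "b \<in> V" using b bd_V by blast
      then have "gd ?x b \<le> r" using b z gd_sym[of b ?x] gd_sym[of z ?x] xV by simp
      then show ?thesis using b D(3) bV by (auto simp: bl_def)
    qed (use z in blast)
    then obtain w where w: "w \<in> V" "gd ?x w \<le> r" "gd b0 w \<le> r" by blast
    then show False using gd_triangle[of b0 w ?x] gd_sym[of w ?x] x(2) xV b0_V by simp
  qed
  have "bd (\<phi> ` D) = \<phi> ` bd D" using aut_bd a D by blast
  also have "\<dots> \<subseteq> bl ?x r" using D(3) aut_bl[OF a b0_V] by blast
  finally have bD: "bd (\<phi> ` D) \<inter> (D \<union> ?B) = {}" using disj by blast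
  have "\<not> D \<subseteq> \<phi> ` {x \<in> V. (\<phi> x \<in> D) \<noteq> (x \<in> D)}" using f D(2) finite_subset by blast
  then obtain z where z: "z \<in> D" "z \<notin> \<phi> ` {x \<in> V. (\<phi> x \<in> D) \<noteq> (x \<in> D)}" by blast
  then obtain w where "w \<in> V" "z = \<phi> w" using aut_image_V[OF a] D by blast
  then have "z \<in> \<phi> ` D" using z by auto
  then have "D \<union> ?B \<subseteq> \<phi> ` D" using cn_sub[OF c1 bD] z by blast
  moreover have "\<exists>b. b \<in> ?B \<and> b \<notin> D" using D(3,4) bd_V by blast
  ultimately show ?thesis by blast
qed

lemma tau_pos: 
  assumes p: "\<phi> \<in> Gpos" and "C \<subset> \<phi> ` C" shows "0 < \<tau> \<phi>"
proof -
  have a: "aut \<phi>" "fin (dC \<phi>)" using assms Gpos_aut by (auto simp: Gpos_def)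
  have le: "0 \<le> dC \<phi> x" if "x \<in> V" for x
  proof -
    have "\<phi> x \<in> C \<Longrightarrow> x \<in> C" using assms(2) aut_mem[OF a(1) C_V that] by blast
    then show ?thesis by (auto simp: dC_def ind_def)
  qed
  obtain y where y: "y \<in> \<phi> ` C" "y \<notin> C" using assms(2) by blast
  then obtain x where x: "x \<in> C" "\<phi> x \<notin> C" by blast
  then have "dC \<phi> x = 1" by (simp add: dC_def ind_def)
  then have "0 < (\<Sum>x\<in>{x \<in> V. dC \<phi> x \<noteq> 0}. dC \<phi> x)"
    using a(2) x C_V le unfolding fin_def by (intro sum_pos2[of _ x]) auto
  then show ?thesis by (simp add: \<tau>_def fsum_def)
qed

text \<open>Moving \<open>b0\<close> far beyond the finite boundary of \<open>C\<close> makes an end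
  and its image nested, so the end towards which \<open>b0\<close> moves decides the sign of
  \<open>\<tau>\<close>.\<close>

lemma far: "\<exists>r. \<forall>\<phi>\<in>Gpos. r < gd b0 (\<phi> b0) \<longrightarrow> (\<phi> b0 \<notin> C \<longrightarrow> 0 < \<tau> \<phi>) \<and> (\<phi> b0 \<in> C \<longrightarrow> \<tau> \<phi> < 0)"
proof -
  have "finite (gd b0 ` (bd C \<union> bd (V - C)))" using finite_bd_C finite_bd_outer by simp
  then obtain r where "\<forall>n\<in>gd b0 ` (bd C \<union> bd (V - C)). n \<le> r" using finite_nat_set_iff_bounded_le by metis
  then have r: "bd C \<subseteq> bl b0 r" "bd (V - C) \<subseteq> bl b0 r" using bd_V by (auto simp: bl_def)
  have ne: "bd C \<noteq> {}" "bd (V - C) \<noteq> {}"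
  proof -
    obtain x y where "x \<in> C" "y \<in> V - C" using C_inf by (metis finite.emptyI ex_in_conv)
    then show "bd C \<noteq> {}" "bd (V - C) \<noteq> {}"
      using cn_exit[OF cn_V, of x y C] cn_exit[OF cn_V, of y x "V - C"] C_V by auto
  qed
  have "(\<phi> b0 \<notin> C \<longrightarrow> 0 < \<tau> \<phi>) \<and> (\<phi> b0 \<in> C \<longrightarrow> \<tau> \<phi> < 0)" 
    if p: "\<phi> \<in> Gpos" and d: "2 * r + 1 < gd b0 (\<phi> b0)" for \<phi>
  proof (intro conjI impI)
    have a: "aut \<phi>" "fin (dC \<phi>)" using p Gpos_aut by (auto simp: Gpos_def)
    have f: "finite {x \<in> V. (\<phi> x \<in> C) \<noteq> (x \<in> C)}"
      using a(2) unfolding fin_def by (rule finite_subset[rotated]) (auto simp: dC_def ind_def)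
    show "0 < \<tau> \<phi>" if "\<phi> b0 \<notin> C"
      using tau_pos[OF p] far_nested[OF C_V C_inf(1) r(1) ne(1) a(1) f that d] by blast
    assume x: "\<phi> b0 \<in> C"
    have "{x \<in> V. (\<phi> x \<in> V - C) \<noteq> (x \<in> V - C)} = {x \<in> V. (\<phi> x \<in> C) \<noteq> (x \<in> C)}"
      using aut_V[OF a(1)] by auto
    then have s: "V - C \<subset> \<phi> ` (V - C)"
      using far_nested[of "V - C" r \<phi>] C_inf(2) r(2) ne(2) a(1) f x d by auto
    have "\<phi> ` (V - C) = V - \<phi> ` C" using aut_image_Diff[OF a(1) order_refl C_V] aut_image_V[OF a(1)] by simp
    then have sub: "\<phi> ` C \<subset> C" using s aut_V[OF a(1)] C_V by blast
    then have "inv_into V \<phi> ` \<phi> ` C \<subset> inv_into V \<phi> ` C"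
      using aut_inj[OF aut_inv[OF a(1)]] C_V by (metis image_strict_mono inj_on_subset)
    then have "C \<subset> inv_into V \<phi> ` C" using aut_image_inv[OF a(1) C_V] by simp
    then have "0 < \<tau> (inv_into V \<phi>)" using tau_pos Gpos_inv p by blast
    then show "\<tau> \<phi> < 0" using tau_inv p by simp
  qed
  then show ?thesis by blast
qed

section \<open>Orbits of the end-preserving automorphisms and the height\<close>

definition orbit where "orbit = {\<phi> b0 |\<phi>. \<phi> \<in> Gpos}"

lemma orbit_V: "orbit \<subseteq> V" using Gpos_aut aut_V b0_V by (auto simp: orbit_def)

lemma orbit_Gpos: "\<phi> \<in> Gpos \<Longrightarrow> x \<in> V \<Longrightarrow> \<phi> x \<in> orbit \<longleftrightarrow> x \<in> orbit"
proof
  assume a: "\<phi> \<in> Gpos" "x \<in> V"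
  { assume "x \<in> orbit"
    then obtain \<psi> where "\<psi> \<in> Gpos" "x = \<psi> b0" by (auto simp: orbit_def)
    then have "\<phi> x = (\<phi> \<circ> \<psi>) b0" "\<phi> \<circ> \<psi> \<in> Gpos" using Gpos_comp[OF a(1)] by auto
    then show "\<phi> x \<in> orbit" unfolding orbit_def by blast }
  assume "\<phi> x \<in> orbit"
  then obtain \<psi> where "\<psi> \<in> Gpos" "\<phi> x = \<psi> b0" by (auto simp: orbit_def)
  then have "x = (inv_into V \<phi> \<circ> \<psi>) b0" "inv_into V \<phi> \<circ> \<psi> \<in> Gpos"
    using aut_inv_f[OF Gpos_aut[OF a(1)] a(2)] Gpos_comp[OF Gpos_inv[OF a(1)]] by auto
  then show "x \<in> orbit" unfolding orbit_def by blast
qed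

lemma Gneg_ex: "orbit \<noteq> V \<Longrightarrow> \<exists>\<rho>. \<rho> \<in> Gneg"
  using Gam_trans[OF b0_V] Gam_cases orbit_V unfolding orbit_def by blast

text \<open>If a swap kept one vertex inside the orbit, some swap would fix \<open>b0\<close>.
  Composing with it would turn every swap into an end-preserving map, and the orbit would be all of
  \<open>V\<close>.\<close>

lemma orbit_Gneg: assumes "\<rho> \<in> Gneg" "x \<in> V" "orbit \<noteq> V" shows "\<rho> x \<in> orbit \<longleftrightarrow> x \<notin> orbit"
proof -
  have key: "\<rho> x \<notin> orbit" if r: "\<rho> \<in> Gneg" and x: "x \<in> orbit" for \<rho> x
  proof
    assume "\<rho> x \<in> orbit"
    then obtain \<phi> \<psi> where p: "\<phi> \<in> Gpos" "x = \<phi> b0" "\<psi> \<in> Gpos" "\<rho> (\<phi> b0) = \<psi> b0" using x by (auto simp: orbit_def)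
    have "y \<in> orbit" if y: "y \<in> V" for y
    proof -
      obtain \<chi> where c: "\<chi> \<in> Gam" "\<chi> b0 = y" using Gam_trans b0_V y by blast
      show ?thesis
      proof (cases "\<chi> \<in> Gpos")
        case False
        then have cm: "\<chi> \<in> Gneg" using Gam_cases c by blast
        have rm: "\<rho> \<circ> \<phi> \<in> Gneg" using Gneg_Gpos_comp r p by blast
        have "inv_into V \<psi> \<circ> (\<rho> \<circ> \<phi>) \<in> Gneg" 
        proof -
          have "inv_into V \<psi> \<circ> (\<rho> \<circ> \<phi>) \<in> Gam" using Gam_comp Gpos_inv[OF p(3)] rm by (auto simp: Gpos_def Gneg_def)
          moreover have "inv_into V \<psi> \<circ> (\<rho> \<circ> \<phi>) \<notin> Gpos"
          proof
            assume "inv_into V \<psi> \<circ> (\<rho> \<circ> \<phi>) \<in> Gpos"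
            then have g: "\<psi> \<circ> (inv_into V \<psi> \<circ> (\<rho> \<circ> \<phi>)) \<in> Gpos" using Gpos_comp p by blast
            have f: "fin (\<lambda>x. dC (\<psi> \<circ> (inv_into V \<psi> \<circ> (\<rho> \<circ> \<phi>))) x + eC (\<rho> \<circ> \<phi>) x)"
              using fin_add g rm by (auto simp: Gpos_def Gneg_def)
            \<comment> \<open>No map can both fix and swap the ends: for maps that agree on
              \<open>V\<close> the two defects add up to \<open>2 * ind C x - 1\<close>, which never
              vanishes, while \<open>V\<close> is infinite.\<close>
            have "dC (\<psi> \<circ> (inv_into V \<psi> \<circ> (\<rho> \<circ> \<phi>))) x + eC (\<rho> \<circ> \<phi>) x \<noteq> 0" if "x \<in> V" for x
              using aut_f_inv[OF Gpos_aut[OF p(3)]] aut_V[OF Gneg_aut[OF rm] that] 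
              by (simp add: dC_def eC_def ind_def)
            then have "{x \<in> V. dC (\<psi> \<circ> (inv_into V \<psi> \<circ> (\<rho> \<circ> \<phi>))) x + eC (\<rho> \<circ> \<phi>) x \<noteq> 0} = V" by blast
            then show False using f V_inf unfolding fin_def by simp
          qed
          ultimately show ?thesis using Gam_cases by blast
        qed
        moreover have "(inv_into V \<psi> \<circ> (\<rho> \<circ> \<phi>)) b0 = b0" using p aut_inv_f[OF Gpos_aut[OF p(3)] b0_V] by simp
        ultimately have "\<chi> \<circ> (inv_into V \<psi> \<circ> (\<rho> \<circ> \<phi>)) \<in> Gpos" "(\<chi> \<circ> (inv_into V \<psi> \<circ> (\<rho> \<circ> \<phi>))) b0 = y"
          using Gneg_comp cm c by auto
        then show ?thesis unfolding orbit_def by blast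
      qed (use c in \<open>auto simp: orbit_def\<close>)
    qed
    then show False using assms(3) orbit_V by blast
  qed
  have "\<rho> x \<in> orbit" if "x \<notin> orbit"
  proof -
    obtain \<chi> where c: "\<chi> \<in> Gam" "\<chi> b0 = x" using Gam_trans b0_V assms by blast
    then have "\<chi> \<in> Gneg" using Gam_cases that by (auto simp: orbit_def)
    then have "\<rho> \<circ> \<chi> \<in> Gpos" using Gneg_comp assms by blast
    moreover have "\<rho> x = (\<rho> \<circ> \<chi>) b0" using c by simp
    ultimately show ?thesis unfolding orbit_def by blast
  qed
  then show ?thesis using key assms by blast
qed

lemma orbit_inf: "infinite orbit"
proof (cases "orbit = V")
  case False
  obtain \<rho> where r: "\<rho> \<in> Gneg" using Gneg_ex False by blast
  have "\<rho> ` (V - orbit) \<subseteq> orbit" using orbit_Gneg[OF r _ False] by auto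
  then have "finite orbit \<Longrightarrow> finite (V - orbit)" 
    using aut_finite[OF Gneg_aut[OF r], of "V - orbit"] finite_subset by auto
  then show ?thesis using V_inf by (metis finite_Diff2)
qed (use V_inf in simp)

text \<open>The positive generator of the image of \<open>\<tau>\<close>; dividing by it makes every
  integer a height.\<close>

definition n0 :: int where "n0 = int (LEAST n. 0 < n \<and> (\<exists>\<phi>\<in>Gpos. \<tau> \<phi> = int n))"

lemma n0: "0 < n0" "\<exists>\<phi>\<in>Gpos. \<tau> \<phi> = n0"
proof -
  obtain r where r: "\<forall>\<phi>\<in>Gpos. r < gd b0 (\<phi> b0) \<longrightarrow> (\<phi> b0 \<notin> C \<longrightarrow> 0 < \<tau> \<phi>) \<and> (\<phi> b0 \<in> C \<longrightarrow> \<tau> \<phi> < 0)"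
    using far by blast
  have "\<not> orbit \<subseteq> bl b0 r" using orbit_inf finite_bl b0_V finite_subset by blast
  then obtain \<phi> where p: "\<phi> \<in> Gpos" "r < gd b0 (\<phi> b0)" 
    using orbit_V by (auto simp: orbit_def bl_def not_le) (metis not_le Gpos_aut aut_V b0_V)
  then have "\<tau> \<phi> \<noteq> 0" using r by force
  then have "\<exists>\<phi>\<in>Gpos. 0 < \<tau> \<phi>" using p tau_inv[OF p(1)] Gpos_inv[OF p(1)] 
    by (metis neg_0_less_iff_less not_less_iff_gr_or_eq)
  then obtain \<psi> where q: "\<psi> \<in> Gpos" "0 < \<tau> \<psi>" by blast
  then have "\<exists>n. 0 < n \<and> (\<exists>\<phi>\<in>Gpos. \<tau> \<phi> = int n)" by (intro exI[of _ "nat (\<tau> \<psi>)"]) auto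
  then have "0 < (LEAST n. 0 < n \<and> (\<exists>\<phi>\<in>Gpos. \<tau> \<phi> = int n)) \<and> (\<exists>\<phi>\<in>Gpos. \<tau> \<phi> = int (LEAST n. 0 < n \<and> (\<exists>\<phi>\<in>Gpos. \<tau> \<phi> = int n)))"
    by (rule LeastI_ex)
  then show "0 < n0" "\<exists>\<phi>\<in>Gpos. \<tau> \<phi> = n0" by (auto simp: n0_def)
qed

lemma n0_dvd: assumes "\<phi> \<in> Gpos" shows "n0 dvd \<tau> \<phi>"
proof (rule ccontr)
  assume n: "\<not> n0 dvd \<tau> \<phi>"
  obtain g where g: "g \<in> Gpos" "\<tau> g = n0" using n0 by blast
  have dec: "\<exists>\<psi>\<in>Gpos. \<tau> \<psi> = \<tau> \<phi> + m * n0" for m :: int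
  proof (induction m rule: int_induct[where k = 0])
    case base then show ?case using assms by auto
  next
    case (step1 i)
    then obtain \<psi> where "\<psi> \<in> Gpos" "\<tau> \<psi> = \<tau> \<phi> + i * n0" by blast
    then show ?case using Gpos_comp[OF g(1), of \<psi>] tau_comp[OF g(1), of \<psi>] g(2)
      by (intro bexI[of _ "g \<circ> \<psi>"]) (auto simp: algebra_simps comp_def)
  next
    case (step2 i)
    then obtain \<psi> where "\<psi> \<in> Gpos" "\<tau> \<psi> = \<tau> \<phi> + i * n0" by blast
    then show ?case using Gpos_comp[OF Gpos_inv[OF g(1)], of \<psi>] tau_comp[OF Gpos_inv[OF g(1)], of \<psi>] tau_inv[OF g(1)] g(2)
      by (intro bexI[of _ "inv_into V g \<circ> \<psi>"]) (auto simp: algebra_simps comp_def)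
  qed
  obtain \<psi> where p: "\<psi> \<in> Gpos" "\<tau> \<psi> = \<tau> \<phi> + (- (\<tau> \<phi> div n0)) * n0" using dec by blast
  have "\<tau> \<phi> + (- (\<tau> \<phi> div n0)) * n0 = \<tau> \<phi> mod n0" by (simp add: minus_div_mult_eq_mod[symmetric])
  then have m: "\<tau> \<psi> = \<tau> \<phi> mod n0" using p by simp
  have "0 < \<tau> \<psi>" "\<tau> \<psi> < n0" 
  proof -
    have "\<tau> \<phi> mod n0 \<noteq> 0" using n by (simp add: dvd_eq_mod_eq_0)
    then show "0 < \<tau> \<psi>" "\<tau> \<psi> < n0" 
      using m n0(1) pos_mod_sign[of n0 "\<tau> \<phi>"] pos_mod_bound[of n0 "\<tau> \<phi>"] by linarith+
  qed
  then have "(LEAST n. 0 < n \<and> (\<exists>\<phi>\<in>Gpos. \<tau> \<phi> = int n)) \<le> nat (\<tau> \<psi>)" using p by (intro Least_le) auto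
  then show False using \<open>\<tau> \<psi> < n0\<close> \<open>0 < \<tau> \<psi>\<close> by (simp add: n0_def)
qed

definition orbit_ht where "orbit_ht x = \<tau> (SOME \<phi>. \<phi> \<in> Gpos \<and> \<phi> b0 = x) div n0"

lemma orbit_ht: assumes "\<phi> \<in> Gpos" shows "orbit_ht (\<phi> b0) * n0 = \<tau> \<phi>"
proof -
  let ?\<psi> = "SOME \<psi>. \<psi> \<in> Gpos \<and> \<psi> b0 = \<phi> b0"
  have "?\<psi> \<in> Gpos \<and> ?\<psi> b0 = \<phi> b0" by (rule someI[of _ \<phi>]) (use assms in simp)
  then have "\<tau> ?\<psi> = \<tau> \<phi>" using tau_unique assms by blast
  then show ?thesis using n0_dvd[OF assms] by (simp add: orbit_ht_def)
qed

definition swapper where "swapper = (SOME \<rho>. \<rho> \<in> Gneg)"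

text \<open>The second orbit, if there is one, receives its height through a fixed swap, with the
  opposite sign because swaps reverse the direction.\<close>

definition ht where "ht x = (if x \<in> orbit then orbit_ht x else - orbit_ht (inv_into V swapper x))"

lemma swapper: "orbit \<noteq> V \<Longrightarrow> swapper \<in> Gneg" unfolding swapper_def using Gneg_ex by (metis someI_ex)

lemma outer_orbit: assumes "x \<in> V" "x \<notin> orbit" obtains \<psi> where "\<psi> \<in> Gpos" "x = swapper (\<psi> b0)" "ht x * n0 = - \<tau> \<psi>"
proof -
  have O: "orbit \<noteq> V" using assms by blast
  have r: "swapper \<in> Gneg" "aut swapper" using swapper O Gneg_aut by auto
  let ?y = "inv_into V swapper x"
  have y: "?y \<in> V" "swapper ?y = x" using aut_V[OF aut_inv[OF r(2)]] aut_f_inv[OF r(2)] assms by auto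
  then have "?y \<in> orbit" using orbit_Gneg[OF r(1) y(1) O] assms by simp
  then obtain \<psi> where "\<psi> \<in> Gpos" "?y = \<psi> b0" by (auto simp: orbit_def)
  then show ?thesis using that[of \<psi>] y orbit_ht[of \<psi>] assms by (simp add: ht_def)
qed

lemma ht_Gpos: assumes p: "\<phi> \<in> Gpos" and x: "x \<in> V" shows "ht (\<phi> x) * n0 = ht x * n0 + \<tau> \<phi>"
proof (cases "x \<in> orbit")
  case True
  then obtain \<psi> where s: "\<psi> \<in> Gpos" "x = \<psi> b0" by (auto simp: orbit_def)
  have "\<phi> x \<in> orbit" using orbit_Gpos p x True by blast
  then show ?thesis using orbit_ht[OF s(1)] orbit_ht[OF Gpos_comp[OF p s(1)]] tau_comp[OF p s(1)] s True by (simp add: ht_def)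
next
  case False
  then have O: "orbit \<noteq> V" using x by blast
  have r: "swapper \<in> Gneg" "aut swapper" using swapper O Gneg_aut by auto
  obtain \<psi> where s: "\<psi> \<in> Gpos" "x = swapper (\<psi> b0)" "ht x * n0 = - \<tau> \<psi>" using outer_orbit x False by blast
  have F: "\<phi> x \<notin> orbit" using orbit_Gpos p x False by blast
  have pxV: "\<phi> x \<in> V" using aut_V Gpos_aut p x by blast
  obtain \<chi> where t: "\<chi> \<in> Gpos" "\<phi> x = swapper (\<chi> b0)" "ht (\<phi> x) * n0 = - \<tau> \<chi>" using outer_orbit pxV F by blast
  \<comment> \<open>Conjugation by the swap moves the computation into the orbit. It reverses the
    sign of \<open>\<tau>\<close> by \<open>tau_conj\<close>, and the sign in \<open>ht\<close>
    undoes this.\<close>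
  define \<theta> where "\<theta> = inv_into V swapper \<circ> (\<phi> \<circ> swapper)"
  have th: "\<theta> \<in> Gpos"
  proof -
    have "fin (\<lambda>x. eC swapper x - dC \<phi> (swapper x))" using fin_diff fin_aut r p by (auto simp: Gpos_def Gneg_def)
    then have "fin (eC (\<phi> \<circ> swapper))" by (rule fin_cong) (simp add: eC_def dC_def)
    then have "\<phi> \<circ> swapper \<in> Gneg" using Gam_comp p r by (simp add: Gpos_def Gneg_def)
    then show ?thesis unfolding \<theta>_def using Gneg_comp Gneg_inv r by blast
  qed
  have rel: "swapper (\<theta> y) = \<phi> (swapper y)" if "y \<in> V" for y
    using aut_f_inv[OF r(2)] aut_V[OF Gpos_aut[OF p]] aut_V[OF r(2)] that by (simp add: \<theta>_def)
  have "\<tau> \<phi> = - \<tau> \<theta>" by (rule tau_conj[OF r(1) th p]) (simp add: rel)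
  moreover have "\<tau> \<chi> = \<tau> (\<theta> \<circ> \<psi>)"
  proof (rule tau_unique[OF t(1) Gpos_comp[OF th s(1)]])
    have "\<psi> b0 \<in> V" using aut_V Gpos_aut s b0_V by blast
    then have "swapper (\<chi> b0) = swapper (\<theta> (\<psi> b0))" using rel t s by simp
    moreover have "\<chi> b0 \<in> V" "\<theta> (\<psi> b0) \<in> V" using aut_V Gpos_aut t th \<open>\<psi> b0 \<in> V\<close> b0_V by blast+
    ultimately show "\<chi> b0 = (\<theta> \<circ> \<psi>) b0" using aut_inj[OF r(2)] by (auto dest: inj_onD)
  qed
  ultimately show ?thesis using t s tau_comp[OF th s(1)] by simp
qed

lemma ht_Gp': assumes "\<phi> \<in> Gpos" shows "\<exists>k. \<forall>x\<in>V. ht (\<phi> x) = ht x + k"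
proof -
  obtain k where k: "\<tau> \<phi> = n0 * k" using n0_dvd[OF assms] by blast
  have "ht (\<phi> x) = ht x + k" if "x \<in> V" for x
  proof -
    have "ht (\<phi> x) * n0 = (ht x + k) * n0" using ht_Gpos[OF assms that] k by (simp add: algebra_simps)
    then show ?thesis using n0(1) by simp
  qed
  then show ?thesis by blast
qed

lemma shift_ex: "\<exists>g\<in>Gpos. \<forall>x\<in>V. ht (g x) = ht x + 1"
proof -
  obtain g where g: "g \<in> Gpos" "\<tau> g = n0" using n0 by blast
  have "ht (g x) = ht x + 1" if "x \<in> V" for x
  proof -
    have "ht (g x) * n0 = (ht x + 1) * n0" using ht_Gpos[OF g(1) that] g(2) by (simp add: algebra_simps)
    then show ?thesis using n0(1) by simp
  qed
  then show ?thesis using g by blast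
qed

text \<open>The sum of the heights of a vertex and of its image does not change under end-preserving
  maps, so it is constant on each orbit. The longer case shows that the two orbits have the same
  constant.\<close>

lemma ht_Gneg: assumes f: "\<phi> \<in> Gneg" shows "\<exists>k. \<forall>x\<in>V. ht (\<phi> x) = - ht x + k"
proof -
  have a: "aut \<phi>" using Gneg_aut f by blast
  have conj: "ht (\<phi> (\<psi> x)) + ht (\<psi> x) = ht (\<phi> x) + ht x" if p: "\<psi> \<in> Gpos" and x: "x \<in> V" for \<psi> x
  proof -
    define \<theta> where "\<theta> = \<phi> \<circ> (\<psi> \<circ> inv_into V \<phi>)"
    have ai: "aut (inv_into V \<phi>)" using aut_inv a by blast
    have th: "\<theta> \<in> Gpos"
    proof -
      have "fin (\<lambda>x. eC (inv_into V \<phi>) x - dC \<psi> (inv_into V \<phi> x))" 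
        using fin_diff fin_aut[OF _ ai] Gneg_inv[OF f] p by (auto simp: Gpos_def Gneg_def)
      then have "fin (eC (\<psi> \<circ> inv_into V \<phi>))" by (rule fin_cong) (simp add: eC_def dC_def)
      then have "\<psi> \<circ> inv_into V \<phi> \<in> Gneg" using Gam_comp p Gneg_inv[OF f] by (simp add: Gpos_def Gneg_def)
      then show ?thesis unfolding \<theta>_def using Gneg_comp f by blast
    qed
    have rel: "\<theta> (\<phi> y) = \<phi> (\<psi> y)" if "y \<in> V" for y using aut_inv_f[OF a that] by (simp add: \<theta>_def)
    have "\<tau> \<theta> = - \<tau> \<psi>" by (rule tau_conj[OF f p th rel])
    then have "ht (\<phi> (\<psi> x)) * n0 = ht (\<phi> x) * n0 - \<tau> \<psi>" 
      using ht_Gpos[OF th, of "\<phi> x"] rel[OF x] aut_V[OF a x] by simp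
    then have "(ht (\<phi> (\<psi> x)) + ht (\<psi> x)) * n0 = (ht (\<phi> x) + ht x) * n0"
      using ht_Gpos[OF p x] by (simp add: algebra_simps)
    then show ?thesis using n0(1) by simp
  qed
  have hb: "ht x + ht (\<phi> x) = ht b0 + ht (\<phi> b0)" if xO: "x \<in> orbit" for x
  proof -
    obtain \<psi> where "\<psi> \<in> Gpos" "x = \<psi> b0" using xO by (auto simp: orbit_def)
    then show ?thesis using conj[OF _ b0_V, of \<psi>] by simp
  qed
  have "ht x + ht (\<phi> x) = ht b0 + ht (\<phi> b0)" if x: "x \<in> V" for x
  proof (cases "x \<in> orbit")
    case False
    then have O: "orbit \<noteq> V" using x by blast
    have r: "swapper \<in> Gneg" "aut swapper" using swapper O Gneg_aut by auto
    obtain \<psi> where s: "\<psi> \<in> Gpos" "x = swapper (\<psi> b0)" "ht x * n0 = - \<tau> \<psi>" using outer_orbit x False by blast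
    have y: "\<psi> b0 \<in> V" "\<psi> b0 \<in> orbit" using s aut_V Gpos_aut b0_V by (auto simp: orbit_def)
    have yx: "ht (\<psi> b0) = - ht x"
    proof -
      have "(ht (\<psi> b0) + ht x) * n0 = 0" using orbit_ht[OF s(1)] s y by (simp add: ht_def algebra_simps)
      then have "ht (\<psi> b0) + ht x = 0" using n0(1) by simp
      then show ?thesis by simp
    qed
    have px: "\<phi> x \<in> orbit" using orbit_Gneg[OF f x O] False by blast
    have "\<phi> (\<psi> b0) \<notin> orbit" "\<phi> (\<psi> b0) \<in> V" using orbit_Gneg[OF f y(1) O] y aut_V[OF a] by auto
    then obtain \<chi> where t: "\<chi> \<in> Gpos" "\<phi> (\<psi> b0) = swapper (\<chi> b0)" "ht (\<phi> (\<psi> b0)) * n0 = - \<tau> \<chi>" using outer_orbit by blast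
    \<comment> \<open>The square of the swap commutes with the swap, so by \<open>tau_conj\<close>
      its value is its own negative.\<close>
    have sq: "\<tau> (swapper \<circ> swapper) = 0"
    proof -
      have "swapper \<circ> swapper \<in> Gpos" using Gneg_comp r by blast
      then have "\<tau> (swapper \<circ> swapper) = - \<tau> (swapper \<circ> swapper)" by (intro tau_conj[OF r(1)]) auto
      then show ?thesis by simp
    qed
    define \<eta> where "\<eta> = inv_into V swapper \<circ> \<phi>"
    have et: "\<eta> \<in> Gpos" using Gneg_comp Gneg_inv r f by (simp add: \<eta>_def)
    have rel: "swapper (\<eta> z) = \<phi> z" if "z \<in> V" for z
      using aut_f_inv[OF r(2)] aut_V[OF a that] by (simp add: \<eta>_def)
    have "\<tau> \<chi> = \<tau> (\<eta> \<circ> \<psi>)"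
    proof (rule tau_unique[OF t(1) Gpos_comp[OF et s(1)]])
      have "swapper (\<chi> b0) = swapper (\<eta> (\<psi> b0))" using rel[OF y(1)] t by simp
      moreover have "\<chi> b0 \<in> V" "\<eta> (\<psi> b0) \<in> V" using aut_V Gpos_aut t et y b0_V by blast+
      ultimately show "\<chi> b0 = (\<eta> \<circ> \<psi>) b0" using aut_inj[OF r(2)] by (auto dest: inj_onD)
    qed
    then have 1: "ht (\<phi> (\<psi> b0)) * n0 = - \<tau> \<eta> - \<tau> \<psi>" using t tau_comp[OF et s(1)] by simp
    define \<kappa> where "\<kappa> = swapper \<circ> (\<eta> \<circ> inv_into V swapper)"
    have ka: "\<kappa> \<in> Gpos"
    proof -
      have ai: "aut (inv_into V swapper)" using aut_inv r by blast
      have "fin (\<lambda>x. eC (inv_into V swapper) x - dC \<eta> (inv_into V swapper x))" 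
        using fin_diff fin_aut[OF _ ai] Gneg_inv[OF r(1)] et by (auto simp: Gpos_def Gneg_def)
      then have "fin (eC (\<eta> \<circ> inv_into V swapper))" by (rule fin_cong) (simp add: eC_def dC_def)
      then have "\<eta> \<circ> inv_into V swapper \<in> Gneg" using Gam_comp et Gneg_inv[OF r(1)] by (simp add: Gpos_def Gneg_def)
      then show ?thesis unfolding \<kappa>_def using Gneg_comp r by blast
    qed
    have "\<tau> \<kappa> = - \<tau> \<eta>" by (rule tau_conj[OF r(1) et ka]) (simp add: \<kappa>_def aut_inv_f[OF r(2)])
    moreover have "\<phi> x = (\<kappa> \<circ> ((swapper \<circ> swapper) \<circ> \<psi>)) b0"
      using rel[OF x] s aut_inv_f[OF r(2)] aut_V[OF r(2)] y by (simp add: \<kappa>_def)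
    moreover have g: "(swapper \<circ> swapper) \<circ> \<psi> \<in> Gpos" using Gpos_comp Gneg_comp r s by blast
    ultimately have "ht (\<phi> x) * n0 = - \<tau> \<eta> + (0 + \<tau> \<psi>)"
      using orbit_ht[OF Gpos_comp[OF ka g]] tau_comp[OF ka g] tau_comp[OF Gneg_comp[OF r(1) r(1)] s(1)] sq px
      by (simp add: ht_def)
    then have "(ht x + ht (\<phi> x)) * n0 = (ht (\<psi> b0) + ht (\<phi> (\<psi> b0))) * n0"
      using 1 s(3) yx by (simp add: algebra_simps)
    then have "ht x + ht (\<phi> x) = ht (\<psi> b0) + ht (\<phi> (\<psi> b0))" using n0(1) by simp
    then show ?thesis using hb y by simp
  qed (use hb in blast)
  then have "\<forall>x\<in>V. ht (\<phi> x) = - ht x + (ht b0 + ht (\<phi> b0))" by force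
  then show ?thesis by blast
qed

end

context two_ended
begin

section \<open>Level sets of the height and the ends\<close>

lemma shift_all: "\<exists>\<psi>\<in>Gpos. \<forall>x\<in>V. ht (\<psi> x) = ht x + i"
proof (induction i rule: int_induct[where k = 0])
  case base
  obtain g where g: "g \<in> Gpos" "\<forall>x\<in>V. ht (g x) = ht x + 1" using shift_ex by blast
  have a: "aut g" using Gpos_aut g by blast
  show ?case
    by (rule bexI[of _ "inv_into V g \<circ> g"]) (use aut_inv_f[OF a] Gpos_comp[OF Gpos_inv[OF g(1)] g(1)] in auto)
next
  case (step1 i)
  then obtain \<psi> where p: "\<psi> \<in> Gpos" "\<forall>x\<in>V. ht (\<psi> x) = ht x + i" by blast
  obtain g where g: "g \<in> Gpos" "\<forall>x\<in>V. ht (g x) = ht x + 1" using shift_ex by blast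
  show ?case using p g aut_V[OF Gpos_aut[OF p(1)]] Gpos_comp[OF g(1) p(1)]
    by (intro bexI[of _ "g \<circ> \<psi>"]) auto
next
  case (step2 i)
  then obtain \<psi> where p: "\<psi> \<in> Gpos" "\<forall>x\<in>V. ht (\<psi> x) = ht x + i" by blast
  obtain g where g: "g \<in> Gpos" "\<forall>x\<in>V. ht (g x) = ht x + 1" using shift_ex by blast
  have a: "aut g" using Gpos_aut g by blast
  have gi: "ht (inv_into V g x) = ht x - 1" if "x \<in> V" for x
    using g(2) aut_V[OF aut_inv[OF a] that] aut_f_inv[OF a that] by (metis add_diff_cancel_right')
  show ?case using p gi aut_V[OF Gpos_aut[OF p(1)]] Gpos_comp[OF Gpos_inv[OF g(1)] p(1)]
    by (intro bexI[of _ "inv_into V g \<circ> \<psi>"]) auto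
qed

text \<open>Outside a ball around \<open>b0\<close> the sign of the height tells the side by
  \<open>far\<close>, so exceptions and vertices of height zero are confined to that ball.\<close>

lemma ends_orbit: "\<exists>m. \<forall>x\<in>orbit. (ht x < - m \<longrightarrow> x \<in> C) \<and> (m < ht x \<longrightarrow> x \<notin> C)" 
  and finite_lvl0: "finite {x \<in> orbit. ht x = 0}"
proof -
  obtain r where r: "\<forall>\<phi>\<in>Gpos. r < gd b0 (\<phi> b0) \<longrightarrow> (\<phi> b0 \<notin> C \<longrightarrow> 0 < \<tau> \<phi>) \<and> (\<phi> b0 \<in> C \<longrightarrow> \<tau> \<phi> < 0)"
    using far by blast
  have far': "(x \<notin> C \<longrightarrow> 0 < ht x) \<and> (x \<in> C \<longrightarrow> ht x < 0)" if x: "x \<in> orbit" "x \<notin> bl b0 r" for x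
  proof -
    obtain \<phi> where p: "\<phi> \<in> Gpos" "x = \<phi> b0" using x by (auto simp: orbit_def)
    have "r < gd b0 x" using x orbit_V by (auto simp: bl_def)
    then have "(x \<notin> C \<longrightarrow> 0 < \<tau> \<phi>) \<and> (x \<in> C \<longrightarrow> \<tau> \<phi> < 0)" using r p by blast
    moreover have "ht x * n0 = \<tau> \<phi>" using orbit_ht p x by (simp add: ht_def)
    ultimately show ?thesis using n0(1) by (metis mult_less_0_iff zero_less_mult_iff less_asym)
  qed
  have "{x \<in> orbit. ht x = 0} \<subseteq> bl b0 r" using far' by force
  then show "finite {x \<in> orbit. ht x = 0}" using finite_bl b0_V finite_subset by blast
  let ?B = "(\<lambda>x. \<bar>ht x\<bar>) ` bl b0 r"
  have B: "finite ?B" using finite_bl b0_V by simp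
  have "(ht x < - (Max ?B + 0) \<longrightarrow> x \<in> C) \<and> (Max ?B + 0 < ht x \<longrightarrow> x \<notin> C)" if x: "x \<in> orbit" for x
  proof (cases "x \<in> bl b0 r")
    case True
    then have "\<bar>ht x\<bar> \<le> Max ?B" using B by (intro Max_ge) auto
    then show ?thesis by linarith
  next
    case False
    have "0 \<le> Max ?B" using Max_ge[OF B, of "\<bar>ht b0\<bar>"] b0_V bl_center by (force intro: order_trans[OF abs_ge_zero])
    then show ?thesis using far' x False by force
  qed
  then show "\<exists>m. \<forall>x\<in>orbit. (ht x < - m \<longrightarrow> x \<in> C) \<and> (m < ht x \<longrightarrow> x \<notin> C)" by blast
qed

text \<open>Outside the orbit both height and side are transported by the swap, the side up to
  finitely many vertices.\<close>

lemma ends: "\<exists>m. \<forall>x\<in>V. (ht x < - m \<longrightarrow> x \<in> C) \<and> (m < ht x \<longrightarrow> x \<notin> C)"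
proof (cases "orbit = V")
  case True then show ?thesis using ends_orbit by simp
next
  case False
  have r: "swapper \<in> Gneg" "aut swapper" using swapper False Gneg_aut by auto
  obtain m where m: "\<forall>x\<in>orbit. (ht x < - m \<longrightarrow> x \<in> C) \<and> (m < ht x \<longrightarrow> x \<notin> C)" using ends_orbit by blast
  obtain k where k: "\<forall>x\<in>V. ht (swapper x) = - ht x + k" using ht_Gneg r by blast
  define F where "F = {x \<in> V. eC swapper x \<noteq> 0}"
  have F: "finite F" using r by (simp add: F_def Gneg_def fin_def)
  define M where "M = Max (insert 0 ((\<lambda>x. \<bar>ht (swapper x)\<bar>) ` F))"
  have M: "0 \<le> M" "\<And>x. x \<in> F \<Longrightarrow> \<bar>ht (swapper x)\<bar> \<le> M" using F by (auto simp: M_def)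
  have "(ht x < - (M + \<bar>m\<bar> + \<bar>k\<bar>) \<longrightarrow> x \<in> C) \<and> (M + \<bar>m\<bar> + \<bar>k\<bar> < ht x \<longrightarrow> x \<notin> C)" if x: "x \<in> V" for x
  proof (cases "x \<in> orbit")
    case True
    then have "(ht x < - m \<longrightarrow> x \<in> C) \<and> (m < ht x \<longrightarrow> x \<notin> C)" using m by blast
    then show ?thesis using M(1) by linarith
  next
    case out: False
    obtain \<psi> where s: "\<psi> \<in> Gpos" "x = swapper (\<psi> b0)" using outer_orbit x out by blast
    define y where "y = \<psi> b0"
    have y: "y \<in> V" "y \<in> orbit" "x = swapper y" using s aut_V Gpos_aut b0_V by (auto simp: orbit_def y_def)
    have hx: "ht x = - ht y + k" using k y by blast
    have my: "(ht y < - m \<longrightarrow> y \<in> C) \<and> (m < ht y \<longrightarrow> y \<notin> C)" using m y by blast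
    show ?thesis
    proof (cases "y \<in> F")
      case True
      then have "\<bar>ht x\<bar> \<le> M" using M y by blast
      then show ?thesis by linarith
    next
      case False
      then have "ind C y + ind C x - 1 = 0" using y by (simp add: F_def eC_def)
      then have "x \<in> C \<longleftrightarrow> y \<notin> C" by (auto simp: ind_def split: if_splits)
      then show ?thesis using my hx M(1) by (auto simp: abs_if split: if_splits)
    qed
  qed
  then show ?thesis by blast
qed

definition s1 :: nat where "s1 = card {x \<in> orbit. ht x = 0}"

lemma image_lvl:
  assumes a: "aut \<phi>" and Q: "Q \<subseteq> V" "\<And>x. x \<in> V \<Longrightarrow> \<phi> x \<in> Q' \<longleftrightarrow> x \<in> Q" "Q' \<subseteq> V"
    and h: "\<And>x. x \<in> V \<Longrightarrow> ht (\<phi> x) = i' \<longleftrightarrow> ht x = i"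
  shows "{x \<in> Q'. ht x = i'} = \<phi> ` {x \<in> Q. ht x = i}"
proof
  show "{x \<in> Q'. ht x = i'} \<subseteq> \<phi> ` {x \<in> Q. ht x = i}"
  proof
    fix x assume x: "x \<in> {x \<in> Q'. ht x = i'}"
    then have "x \<in> \<phi> ` V" using aut_image_V[OF a] Q by auto
    then obtain y where y: "y \<in> V" "x = \<phi> y" by blast
    then show "x \<in> \<phi> ` {x \<in> Q. ht x = i}" using x Q(2)[OF y(1)] h[OF y(1)] by blast
  qed
  show "\<phi> ` {x \<in> Q. ht x = i} \<subseteq> {x \<in> Q'. ht x = i'}" using Q h by auto
qed

lemma lvl_orbit: "finite {x \<in> orbit. ht x = i}" "card {x \<in> orbit. ht x = i} = s1"
proof -
  obtain \<psi> where p: "\<psi> \<in> Gpos" "\<forall>x\<in>V. ht (\<psi> x) = ht x + i" using shift_all by blast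
  have a: "aut \<psi>" using Gpos_aut p by blast
  have e: "{x \<in> orbit. ht x = i} = \<psi> ` {x \<in> orbit. ht x = 0}"
    by (rule image_lvl[OF a orbit_V _ orbit_V]) (use orbit_Gpos p in auto)
  then show "finite {x \<in> orbit. ht x = i}" using finite_lvl0 by simp
  have "{x \<in> orbit. ht x = 0} \<subseteq> V" using orbit_V by blast
  then show "card {x \<in> orbit. ht x = i} = s1" using e aut_card[OF a] by (simp add: s1_def)
qed

lemma s1_pos: "0 < s1"
proof -
  obtain x where "x \<in> orbit" using orbit_inf by (metis finite.emptyI ex_in_conv)
  then have "{y \<in> orbit. ht y = ht x} \<noteq> {}" by blast
  then show ?thesis using lvl_orbit[of "ht x"] by (metis card_gt_0_iff)
qed

lemma lvl_outer: assumes "orbit \<noteq> V" shows "finite {x \<in> V - orbit. ht x = i}" "card {x \<in> V - orbit. ht x = i} = s1"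
proof -
  have r: "swapper \<in> Gneg" "aut swapper" using swapper assms Gneg_aut by auto
  obtain k where k: "\<forall>x\<in>V. ht (swapper x) = - ht x + k" using ht_Gneg r by blast
  have e: "{x \<in> V - orbit. ht x = i} = swapper ` {x \<in> orbit. ht x = k - i}"
    by (rule image_lvl[OF r(2) orbit_V]) (use orbit_Gneg[OF r(1) _ assms] k aut_V[OF r(2)] in auto)
  then show "finite {x \<in> V - orbit. ht x = i}" using lvl_orbit by simp
  have "{x \<in> orbit. ht x = k - i} \<subseteq> V" using orbit_V by blast
  then show "card {x \<in> V - orbit. ht x = i} = s1" using e aut_card[OF r(2)] lvl_orbit by simp
qed

lemma Gpos_trans: assumes "x \<in> V" "y \<in> V" "x \<in> orbit \<longleftrightarrow> y \<in> orbit" shows "\<exists>\<phi>\<in>Gpos. \<phi> x = y"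
proof (cases "x \<in> orbit")
  case True
  then obtain \<phi> \<psi> where p: "\<phi> \<in> Gpos" "x = \<phi> b0" "\<psi> \<in> Gpos" "y = \<psi> b0" using assms by (auto simp: orbit_def)
  then show ?thesis using Gpos_comp[OF p(3) Gpos_inv[OF p(1)]] aut_inv_f[OF Gpos_aut[OF p(1)] b0_V]
    by (intro bexI[of _ "\<psi> \<circ> inv_into V \<phi>"]) auto
next
  case False
  obtain \<phi> where p: "\<phi> \<in> Gam" "\<phi> x = y" using Gam_trans assms by blast
  have "\<phi> \<notin> Gneg" using orbit_Gneg[of \<phi> x] p assms False by blast
  then show ?thesis using Gam_cases p by blast
qed

text \<open>Double counting: an invariant digraph between two orbits with equal level sizes is biregular.\<close>

lemma expand:
  fixes p :: "'a \<Rightarrow> int"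
  assumes pG: "\<And>\<phi>. \<phi> \<in> Gpos \<Longrightarrow> \<exists>k. \<forall>x\<in>V. p (\<phi> x) = p x + k"
    and Q: "Q \<subseteq> V" "Q' \<subseteq> V" "\<And>x y. x \<in> Q \<Longrightarrow> y \<in> Q \<Longrightarrow> \<exists>\<phi>\<in>Gpos. \<phi> x = y"
      "\<And>x y. x \<in> Q' \<Longrightarrow> y \<in> Q' \<Longrightarrow> \<exists>\<phi>\<in>Gpos. \<phi> x = y"
      "\<And>x \<phi>. x \<in> V \<Longrightarrow> \<phi> \<in> Gpos \<Longrightarrow> \<phi> x \<in> Q \<longleftrightarrow> x \<in> Q" "\<And>x \<phi>. x \<in> V \<Longrightarrow> \<phi> \<in> Gpos \<Longrightarrow> \<phi> x \<in> Q' \<longleftrightarrow> x \<in> Q'"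
    and x0: "x0 \<in> Q" "y0 \<in> Q'" "(x0, y0) \<in> E" "p y0 = p x0 + t"
    and lv: "finite {x \<in> Q. p x = p x0}" "finite {y \<in> Q'. p y = p y0}" "card {x \<in> Q. p x = p x0} = card {y \<in> Q'. p y = p y0}"
    and S: "finite S" "S \<subseteq> Q"
  shows "card S \<le> card {y \<in> Q'. \<exists>x\<in>S. (x, y) \<in> E \<and> p y = p x + t}"
proof -
  define J where "J x y \<longleftrightarrow> (x, y) \<in> E \<and> x \<in> Q \<and> y \<in> Q' \<and> p y = p x + t" for x y
  have Jinv: "J (\<phi> x) (\<phi> y) \<longleftrightarrow> J x y" if "\<phi> \<in> Gpos" "x \<in> V" "y \<in> V" for \<phi> x y
  proof -
    obtain k where "\<forall>x\<in>V. p (\<phi> x) = p x + k" using pG \<open>\<phi> \<in> Gpos\<close> by blast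
    then show ?thesis using aut_E[OF Gpos_aut[OF that(1)] that(2,3)] Q(5,6) that by (auto simp: J_def)
  qed
  have J_V: "J x y \<Longrightarrow> x \<in> V \<and> y \<in> V" for x y using E_V by (auto simp: J_def)
  have fo: "finite {y. J x y}" for x
  proof (cases "x \<in> V")
    case True
    then show ?thesis using fin_nbrs[of x] by (auto simp: J_def elim!: rev_finite_subset)
  next
    case False
    then have "{y. J x y} = {}" using J_V by blast
    then show ?thesis by simp
  qed
  have fi: "finite {x. J x y}" for y
  proof (cases "y \<in> V")
    case True
    then show ?thesis using fin_nbrs[of y] E_sym by (auto simp: J_def elim!: rev_finite_subset)
  next
    case False
    then have "{x. J x y} = {}" using J_V by blast
    then show ?thesis by simp
  qed
  have outc: "card {y. J x y} = card {y. J x0 y}" if x: "x \<in> Q" for x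
  proof -
    obtain \<phi> where p: "\<phi> \<in> Gpos" "\<phi> x0 = x" using Q(3) x x0 by blast
    have "{y. J x y} = \<phi> ` {y. J x0 y}"
    proof
      show "{y. J x y} \<subseteq> \<phi> ` {y. J x0 y}"
      proof
        fix y assume y: "y \<in> {y. J x y}"
        then have "y \<in> \<phi> ` V" using J_V aut_image_V[OF Gpos_aut[OF p(1)]] by auto
        then obtain z where "z \<in> V" "y = \<phi> z" by blast
        then show "y \<in> \<phi> ` {y. J x0 y}" using y Jinv[OF p(1), of x0 z] p Q x0 by auto
      qed
      show "\<phi> ` {y. J x0 y} \<subseteq> {y. J x y}"
        using Jinv[OF p(1), of x0] p J_V Q x0 by auto
    qed
    moreover have "{y. J x0 y} \<subseteq> V" using J_V by blast
    ultimately show ?thesis using aut_card[OF Gpos_aut[OF p(1)]] by simp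
  qed
  have inc: "card {x. J x y} = card {x. J x y0}" if y: "y \<in> Q'" for y
  proof -
    obtain \<phi> where p: "\<phi> \<in> Gpos" "\<phi> y0 = y" using Q(4) y x0 by blast
    have "{x. J x y} = \<phi> ` {x. J x y0}"
    proof
      show "{x. J x y} \<subseteq> \<phi> ` {x. J x y0}"
      proof
        fix x assume x: "x \<in> {x. J x y}"
        then have "x \<in> \<phi> ` V" using J_V aut_image_V[OF Gpos_aut[OF p(1)]] by auto
        then obtain z where "z \<in> V" "x = \<phi> z" by blast
        then show "x \<in> \<phi> ` {x. J x y0}" using x Jinv[OF p(1), of z y0] p Q x0 by auto
      qed
      show "\<phi> ` {x. J x y0} \<subseteq> {x. J x y}"
        using Jinv[OF p(1), of _ y0] p J_V Q x0 by auto
    qed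
    moreover have "{x. J x y0} \<subseteq> V" using J_V by blast
    ultimately show ?thesis using aut_card[OF Gpos_aut[OF p(1)]] by simp
  qed
  define D where "D = card {y. J x0 y}"
  define D' where "D' = card {x. J x y0}"
  define L where "L = {x \<in> Q. p x = p x0}"
  define L' where "L' = {y \<in> Q'. p y = p y0}"
  have L: "finite L" "finite L'" "card L = card L'" "x0 \<in> L" using lv x0 by (auto simp: L_def L'_def)
  have "(\<Sum>x\<in>L. card {y \<in> L'. J x y}) = (\<Sum>y\<in>L'. card {x \<in> L. J x y})"
    using sum_multicount_gen[OF L(1,2), of J "\<lambda>y. card {x \<in> L. J x y}"] by simp
  moreover have "{y \<in> L'. J x y} = {y. J x y}" if "x \<in> L" for x using that x0 by (auto simp: L_def L'_def J_def)
  moreover have "{x \<in> L. J x y} = {x. J x y}" if "y \<in> L'" for y using that x0 by (auto simp: L_def L'_def J_def)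
  ultimately have "(\<Sum>x\<in>L. D) = (\<Sum>y\<in>L'. D')" using outc inc by (simp add: L_def L'_def D_def D'_def)
  then have "card L * D = card L * D'" using L by simp
  moreover have "card L \<noteq> 0" using L by auto
  ultimately have marks: "D = D'" by simp
  have "y0 \<in> {y. J x0 y}" using x0 by (simp add: J_def)
  then have D: "0 < D" unfolding D_def using fo[of x0] card_gt_0_iff by blast
  define N where "N = {y \<in> Q'. \<exists>x\<in>S. (x, y) \<in> E \<and> p y = p x + t}"
  have N: "N = (\<Union>x\<in>S. {y. J x y})" using S by (auto simp: N_def J_def)
  then have fN: "finite N" using S fo by simp
  have "card S * D = (\<Sum>x\<in>S. card {y \<in> N. J x y})"
  proof -
    have "{y \<in> N. J x y} = {y. J x y}" if "x \<in> S" for x using that N by auto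
    then show ?thesis using outc S by (simp add: D_def subset_iff)
  qed
  also have "\<dots> = (\<Sum>y\<in>N. card {x \<in> S. J x y})"
    using sum_multicount_gen[OF S(1) fN, of J "\<lambda>y. card {x \<in> S. J x y}"] by simp
  also have "\<dots> \<le> (\<Sum>y\<in>N. D')"
  proof (rule sum_mono)
    fix y assume "y \<in> N"
    then have "card {x. J x y} = D'" using inc by (simp add: N_def D'_def)
    then show "card {x \<in> S. J x y} \<le> D'" using card_mono[OF fi, of "{x \<in> S. J x y}" y] by auto
  qed
  finally have "card S * D \<le> card N * D" using marks by simp
  then show ?thesis using D by (simp add: N_def)
qed

text \<open>Upward jumps by \<open>t\<close> from the part \<open>S\<close> of \<open>C\<close>
  above a deep level reach at least \<open>card S\<close> vertices. All of these lie in
  \<open>bd C\<close> or in \<open>S\<close> without its lowest \<open>t\<close> levels, and those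
  levels contain \<open>s * t\<close> vertices.\<close>

lemma cut_bound:
  fixes p :: "'a \<Rightarrow> int" and t :: nat
  assumes fib: "\<And>i. finite {x \<in> V. p x = i} \<and> card {x \<in> V. p x = i} = s"
    and m: "\<And>x. x \<in> V \<Longrightarrow> (p x < - m \<longrightarrow> x \<in> C) \<and> (m < p x \<longrightarrow> x \<notin> C)"
    and ex: "\<And>S. finite S \<Longrightarrow> S \<subseteq> V \<Longrightarrow> card S \<le> card {y \<in> V. \<exists>x\<in>S. (x, y) \<in> E \<and> p y = p x + int t}"
  shows "s * t \<le> card (bd C)"
proof -
  have fr: "finite {x \<in> V. a \<le> p x \<and> p x \<le> b}" for a b
  proof (rule finite_subset)
    show "{x \<in> V. a \<le> p x \<and> p x \<le> b} \<subseteq> (\<Union>i\<in>{a..b}. {x \<in> V. p x = i})" by auto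
    show "finite (\<Union>i\<in>{a..b}. {x \<in> V. p x = i})" using fib by simp
  qed
  define M where "M = \<bar>m\<bar> + int t + 1"
  define S where "S = {x \<in> C. - M \<le> p x}"
  define S' where "S' = {x \<in> C. - M + int t \<le> p x}"
  define L where "L = {x \<in> V. - M \<le> p x \<and> p x \<le> - M + int t - 1}"
  define N where "N = {y \<in> V. \<exists>x\<in>S. (x, y) \<in> E \<and> p y = p x + int t}"
  have "S \<subseteq> {x \<in> V. - M \<le> p x \<and> p x \<le> \<bar>m\<bar>}" using m C_V by (fastforce simp: S_def)
  then have fS: "finite S" using fr finite_subset by blast
  have LC: "L \<subseteq> C" using m by (auto simp: L_def M_def)
  have fL: "finite L" unfolding L_def by (rule fr)
  have "L = (\<Union>j\<in>{..<t}. {x \<in> V. p x = - M + int j})"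
  proof
    show "L \<subseteq> (\<Union>j\<in>{..<t}. {x \<in> V. p x = - M + int j})"
    proof
      fix x assume "x \<in> L"
      then have "x \<in> V" "nat (p x + M) \<in> {..<t}" "p x = - M + int (nat (p x + M))" by (auto simp: L_def)
      then show "x \<in> (\<Union>j\<in>{..<t}. {x \<in> V. p x = - M + int j})" by blast
    qed
  qed (auto simp: L_def)
  then have "card L = (\<Sum>j<t. card {x \<in> V. p x = - M + int j})"
    by (simp only:) (rule card_UN_disjoint, use fib in auto)
  then have cL: "card L = s * t" using fib by simp
  have "S = S' \<union> L" "S' \<inter> L = {}" using LC C_V by (auto simp: S_def S'_def L_def)
  then have cS: "card S = card S' + s * t" using fS fL cL by (simp add: card_Un_disjoint)
  have "N \<subseteq> S' \<union> bd C"
  proof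
    fix y assume "y \<in> N"
    then obtain x where x: "x \<in> S" "(x, y) \<in> E" "p y = p x + int t" by (auto simp: N_def)
    then show "y \<in> S' \<union> bd C" using step_bd[of x C y] by (auto simp: S_def S'_def)
  qed
  then have "card N \<le> card (S' \<union> bd C)"
    using finite_bd_C fS \<open>S = S' \<union> L\<close> by (intro card_mono) auto
  then have "card N \<le> card S' + card (bd C)" using card_Un_le order_trans by blast
  moreover have "card S \<le> card N" unfolding N_def by (rule ex[OF fS]) (use C_V in \<open>auto simp: S_def\<close>)
  ultimately show ?thesis using cS by linarith
qed

text \<open>\<open>t\<close> is the longest jump of \<open>p\<close> along an edge. The point is
  that vertices of both orbits jump by \<open>t\<close> upwards and downwards; the involution
  \<open>\<sigma>\<close> on the two orbit types tells to which orbit these jumps lead.\<close>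

lemma assemble:
  fixes p :: "'a \<Rightarrow> int"
  assumes fib: "\<And>i. finite {x \<in> V. p x = i} \<and> card {x \<in> V. p x = i} = s" and s: "0 < s"
    and pP: "\<And>\<phi>. \<phi> \<in> Gpos \<Longrightarrow> \<exists>k. \<forall>x\<in>V. p (\<phi> x) = p x + k"
    and pM: "\<And>\<phi>. \<phi> \<in> Gneg \<Longrightarrow> \<exists>k. \<forall>x\<in>V. p (\<phi> x) = - p x + k"
    and m: "\<And>x. x \<in> V \<Longrightarrow> (p x < - m \<longrightarrow> x \<in> C) \<and> (m < p x \<longrightarrow> x \<notin> C)"
    and lv1: "\<And>x. x \<in> orbit \<Longrightarrow> card {y \<in> orbit. p y = p x} = s1" 
    and lv2: "\<And>x. x \<in> V - orbit \<Longrightarrow> card {y \<in> V - orbit. p y = p x} = s1"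
    and bal: "\<And>x y. (x, y) \<in> E \<Longrightarrow> x \<in> orbit \<Longrightarrow> y \<notin> orbit \<Longrightarrow> 
      (\<exists>(x', y')\<in>E. x' \<in> orbit \<and> y' \<notin> orbit \<and> p y' - p x' \<le> - (p y - p x)) \<and>
      (\<exists>(x', y')\<in>E. x' \<in> orbit \<and> y' \<notin> orbit \<and> - (p y - p x) \<le> p y' - p x')"
  shows "\<exists>t::nat. 0 < t \<and> (\<forall>(x, y)\<in>E. \<bar>p y - p x\<bar> \<le> int t) \<and>
    (\<forall>x\<in>V. (\<exists>y. (x, y) \<in> E \<and> p y = p x + int t) \<and> (\<exists>y. (x, y) \<in> E \<and> p y = p x - int t)) \<and> s * t \<le> card (bd C)"
proof -
  define Js where "Js = (\<lambda>y. \<bar>p y - p b0\<bar>) ` {y. (b0, y) \<in> E}"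
  have J: "\<bar>p y - p x\<bar> \<in> Js" if xy: "(x, y) \<in> E" for x y
  proof -
    have V: "x \<in> V" "y \<in> V" using E_V xy by auto
    obtain \<phi> where f: "\<phi> \<in> Gam" "\<phi> x = b0" using Gam_trans V b0_V by blast
    then have "(\<exists>k. \<forall>x\<in>V. p (\<phi> x) = p x + k) \<or> (\<exists>k. \<forall>x\<in>V. p (\<phi> x) = - p x + k)"
      using Gam_cases pP pM by blast
    then have "\<bar>p (\<phi> y) - p (\<phi> x)\<bar> = \<bar>p y - p x\<bar>" using V by force
    moreover have "(b0, \<phi> y) \<in> E" using aut_E[OF Gam_aut[OF f(1)] V] f xy by simp
    ultimately show ?thesis using f unfolding Js_def by (metis (mono_tags, lifting) image_eqI mem_Collect_eq)
  qed
  have fJ: "finite Js" using fin_nbrs b0_V by (simp add: Js_def)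
  have ex_edge: "\<exists>(x, y)\<in>E. p y \<noteq> p x"
  proof (rule ccontr)
    assume "\<not> (\<exists>(x, y)\<in>E. p y \<noteq> p x)"
    then have st: "p y = p x" if "(x, y) \<in> E" for x y using that by blast
    have "p x = p b0" if "x \<in> V" for x
      using conn[OF b0_V that] by (induction rule: rtrancl_induct) (auto dest: st)
    then have "{x \<in> V. p x = p b0 + 1} = {}" by auto
    then have "card {x \<in> V. p x = p b0 + 1} = 0" by (simp only: card.empty)
    then show False using fib[of "p b0 + 1"] s by simp
  qed
  then have Jne: "Js \<noteq> {}" using J by blast
  define t where "t = nat (Max Js)"
  have tM: "int t = Max Js" 
  proof -
    obtain j where "j \<in> Js" using Jne by blast
    then have "0 \<le> j" "j \<le> Max Js" using fJ by (auto simp: Js_def)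
    then show ?thesis by (simp add: t_def)
  qed
  have tle: "\<bar>p y - p x\<bar> \<le> int t" if "(x, y) \<in> E" for x y using J[OF that] fJ tM by simp
  have tpos: "0 < t" using ex_edge tle by force
  have "int t \<in> Js" using Max_in fJ Jne tM by simp
  then obtain u w where "(u, w) \<in> E" "\<bar>p w - p u\<bar> = int t" by (auto simp: Js_def)
  then obtain x0 y0 where e0: "(x0, y0) \<in> E" "p y0 = p x0 + int t"
    using E_sym by (cases "p w \<ge> p u") (metis abs_of_nonneg add.commute diff_add_cancel diff_ge_0_iff_ge, 
      metis abs_minus_commute abs_of_nonneg add.commute diff_add_cancel diff_ge_0_iff_ge linear)
  define U where "U \<alpha> \<beta> \<longleftrightarrow> (\<exists>x y. (x, y) \<in> E \<and> p y = p x + int t \<and> (x \<in> orbit \<longleftrightarrow> \<alpha>) \<and> (y \<in> orbit \<longleftrightarrow> \<beta>))" for \<alpha> \<beta>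
  have UI: "U (x \<in> orbit) (y \<in> orbit)" if "(x, y) \<in> E" "p y = p x + int t" for x y
    using that unfolding U_def by blast
  have Uflip: "U (\<not> \<beta>) (\<not> \<alpha>)" if U: "U \<alpha> \<beta>" and O: "orbit \<noteq> V" for \<alpha> \<beta>
  proof -
    obtain x y where xy: "(x, y) \<in> E" "p y = p x + int t" "x \<in> orbit \<longleftrightarrow> \<alpha>" "y \<in> orbit \<longleftrightarrow> \<beta>" using U by (auto simp: U_def)
    have V: "x \<in> V" "y \<in> V" using E_V xy by auto
    have r: "swapper \<in> Gneg" "aut swapper" using swapper O Gneg_aut by auto
    obtain k where k: "\<forall>x\<in>V. p (swapper x) = - p x + k" using pM r by blast
    have "(swapper y, swapper x) \<in> E" using aut_E[OF r(2) V(2,1)] E_sym xy by blast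
    moreover have "p (swapper x) = p (swapper y) + int t" using k V xy by simp
    moreover have "swapper y \<in> orbit \<longleftrightarrow> \<not> \<beta>" "swapper x \<in> orbit \<longleftrightarrow> \<not> \<alpha>" using orbit_Gneg[OF r(1) _ O] V xy by auto
    ultimately show ?thesis using UI[of "swapper y" "swapper x"] by simp
  qed
  \<comment> \<open>Balance answers an extreme jump between the orbits by one of opposite direction
    and at least the same length, which must be exactly \<open>t\<close>.\<close>
  have Ucross: "U True False \<longleftrightarrow> U False True"
  proof
    assume "U True False"
    then obtain x y where xy: "(x, y) \<in> E" "p y = p x + int t" "x \<in> orbit" "y \<notin> orbit" by (auto simp: U_def)
    then obtain x' y' where e: "(x', y') \<in> E" "x' \<in> orbit" "y' \<notin> orbit" "p y' - p x' \<le> - (p y - p x)" using bal by blast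
    then have "p x' = p y' + int t" using tle[OF e(1)] xy by linarith
    then show "U False True" using UI[OF E_sym[OF e(1)]] e by simp
  next
    assume "U False True"
    then obtain y x where xy: "(x, y) \<in> E" "p x = p y + int t" "x \<in> orbit" "y \<notin> orbit" using E_sym by (auto simp: U_def)
    then obtain x' y' where e: "(x', y') \<in> E" "x' \<in> orbit" "y' \<notin> orbit" "- (p y - p x) \<le> p y' - p x'" using bal by blast
    then have "p y' = p x' + int t" using tle[OF e(1)] xy by linarith
    then show "U True False" using UI[OF e(1)] e by simp
  qed
  have "\<exists>\<sigma>. (\<forall>\<alpha>. \<sigma> (\<sigma> \<alpha>) = \<alpha>) \<and> (\<forall>x\<in>V. U (x \<in> orbit) (\<sigma> (x \<in> orbit)))"
  proof (cases "orbit = V")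
    case True
    then have "U True True" using UI[OF e0] E_V[OF e0(1)] by simp
    then show ?thesis using True by (intro exI[of _ "\<lambda>\<alpha>. \<alpha>"]) simp
  next
    case False
    show ?thesis
    proof (cases "x0 \<in> orbit \<longleftrightarrow> y0 \<in> orbit")
      case True
      then have "U True True \<or> U False False" using UI[OF e0] by (cases "x0 \<in> orbit") auto
      then have "U True True \<and> U False False" using Uflip[OF _ False] by fastforce
      then have "U (x \<in> orbit) (x \<in> orbit)" for x by (cases "x \<in> orbit") auto
      then show ?thesis by (intro exI[of _ "\<lambda>\<alpha>. \<alpha>"]) auto
    next
      case F: False
      then have "U True False \<or> U False True" using UI[OF e0] by (cases "x0 \<in> orbit") auto
      then have "U True False \<and> U False True" using Ucross by blast
      then have "U (x \<in> orbit) (\<not> x \<in> orbit)" for x by (cases "x \<in> orbit") auto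
      then show ?thesis by (intro exI[of _ Not]) auto
    qed
  qed
  then obtain \<sigma> where \<sigma>: "\<And>\<alpha>. \<sigma> (\<sigma> \<alpha>) = \<alpha>" "\<And>x. x \<in> V \<Longrightarrow> U (x \<in> orbit) (\<sigma> (x \<in> orbit))" by blast
  have up: "\<exists>y. (x, y) \<in> E \<and> p y = p x + int t \<and> (y \<in> orbit \<longleftrightarrow> \<sigma> (x \<in> orbit))" if x: "x \<in> V" for x
  proof -
    obtain a b where ab: "(a, b) \<in> E" "p b = p a + int t" "a \<in> orbit \<longleftrightarrow> x \<in> orbit" "b \<in> orbit \<longleftrightarrow> \<sigma> (x \<in> orbit)"
      using \<sigma>(2)[OF x] by (auto simp: U_def)
    have V: "a \<in> V" "b \<in> V" using E_V ab by auto
    obtain \<phi> where f: "\<phi> \<in> Gpos" "\<phi> a = x" using Gpos_trans V x ab by blast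
    obtain k where "\<forall>x\<in>V. p (\<phi> x) = p x + k" using pP f by blast
    then show ?thesis using aut_E[OF Gpos_aut[OF f(1)] V] orbit_Gpos[OF f(1) V(2)] f ab V by (intro exI[of _ "\<phi> b"]) auto
  qed
  \<comment> \<open>Two upward jumps return to the type of \<open>x\<close>. An end-preserving map
    takes their last vertex to \<open>x\<close> and the middle vertex to a neighbour
    \<open>t\<close> levels below.\<close>
  have down: "\<exists>y. (x, y) \<in> E \<and> p y = p x - int t" if x: "x \<in> V" for x
  proof -
    obtain y where y: "(x, y) \<in> E" "p y = p x + int t" "y \<in> orbit \<longleftrightarrow> \<sigma> (x \<in> orbit)" using up x by blast
    then have yV: "y \<in> V" using E_V by blast
    obtain b where b: "(y, b) \<in> E" "p b = p y + int t" "b \<in> orbit \<longleftrightarrow> \<sigma> (y \<in> orbit)" using up yV by blast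
    then have "b \<in> orbit \<longleftrightarrow> x \<in> orbit" using y \<sigma>(1) by simp
    moreover have bV: "b \<in> V" using E_V b by blast
    ultimately obtain \<phi> where f: "\<phi> \<in> Gpos" "\<phi> b = x" using Gpos_trans x by blast
    obtain k where "\<forall>x\<in>V. p (\<phi> x) = p x + k" using pP f by blast
    then show ?thesis using aut_E[OF Gpos_aut[OF f(1)] bV yV] E_sym[OF b(1)] f b bV yV by (intro exI[of _ "\<phi> y"]) auto
  qed
  define ty where "ty \<alpha> = {x \<in> V. x \<in> orbit \<longleftrightarrow> \<alpha>}" for \<alpha>
  have tyT: "ty True = orbit" "ty False = V - orbit" using orbit_V by (auto simp: ty_def)
  have fin_p: "finite {x \<in> Q. p x = i}" if "Q \<subseteq> V" for Q i
    using fib[of i] that by (auto elim: rev_finite_subset)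
  have lv: "card {y \<in> ty \<alpha>. p y = p x} = s1" if "x \<in> ty \<alpha>" for x \<alpha>
    using that lv1 lv2 tyT by (cases \<alpha>) auto
  have ex1: "card S \<le> card {y \<in> ty (\<sigma> \<alpha>). \<exists>x\<in>S. (x, y) \<in> E \<and> p y = p x + int t}" 
    if S: "finite S" "S \<subseteq> ty \<alpha>" for S \<alpha>
  proof (cases "ty \<alpha> = {}")
    case False
    then obtain x where x: "x \<in> V" "x \<in> orbit \<longleftrightarrow> \<alpha>" by (auto simp: ty_def)
    obtain y where y: "(x, y) \<in> E" "p y = p x + int t" "y \<in> orbit \<longleftrightarrow> \<sigma> (x \<in> orbit)" using up x by blast
    then have yV: "y \<in> V" using E_V by blast
    show ?thesis
    proof (rule expand[OF pP, where Q = "ty \<alpha>" and ?x0.0 = x and ?y0.0 = y])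
      show "x \<in> ty \<alpha>" "y \<in> ty (\<sigma> \<alpha>)" using x y yV by (auto simp: ty_def)
      then show "card {z \<in> ty \<alpha>. p z = p x} = card {z \<in> ty (\<sigma> \<alpha>). p z = p y}" using lv by simp
      have "ty \<beta> \<subseteq> V" for \<beta> by (auto simp: ty_def)
      then show "finite {z \<in> ty \<alpha>. p z = p x}" "finite {z \<in> ty (\<sigma> \<alpha>). p z = p y}" using fin_p by blast+
    qed (use S y Gpos_trans orbit_Gpos aut_V Gpos_aut in \<open>auto simp: ty_def\<close>)
  qed (use S in simp)
  have "s * t \<le> card (bd C)"
  proof (rule cut_bound[OF fib m])
    fix S assume S: "finite S" "S \<subseteq> V"
    define N where "N S = {y \<in> V. \<exists>x\<in>S. (x, y) \<in> E \<and> p y = p x + int t}" for S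
    define N' where "N' \<alpha> = {y \<in> ty (\<sigma> \<alpha>). \<exists>x\<in>S \<inter> ty \<alpha>. (x, y) \<in> E \<and> p y = p x + int t}" for \<alpha>
    have "N S \<subseteq> (\<Union>x\<in>S. {y. (x, y) \<in> E})" by (auto simp: N_def)
    moreover have "finite (\<Union>x\<in>S. {y. (x, y) \<in> E})" using S fin_nbrs by blast
    ultimately have fN: "finite (N S)" by (rule finite_subset)
    have NN: "N' True \<union> N' False \<subseteq> N S" by (auto simp: N_def N'_def ty_def)
    have "\<sigma> True \<noteq> \<sigma> False" using \<sigma>(1) by metis
    then have disj: "N' True \<inter> N' False = {}" by (auto simp: N'_def ty_def)
    have "card S = card (S \<inter> ty True) + card (S \<inter> ty False)"
      using S tyT by (subst card_Un_disjoint[symmetric]) (auto intro: arg_cong[of _ _ card])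
    also have "\<dots> \<le> card (N' True) + card (N' False)"
      unfolding N'_def using S by (intro add_mono ex1) auto
    also have "\<dots> = card (N' True \<union> N' False)"
      using disj NN fN by (intro card_Un_disjoint[symmetric]) (auto elim: finite_subset)
    also have "\<dots> \<le> card (N S)" using NN fN by (rule card_mono[rotated])
    finally show "card S \<le> card {y \<in> V. \<exists>x\<in>S. (x, y) \<in> E \<and> p y = p x + int t}" by (simp add: N_def)
  qed
  then show ?thesis using tpos tle up down by (intro exI[of _ t]) blast
qed

lemma b0_orbit: "b0 \<in> orbit"
proof -
  obtain g where g: "g \<in> Gpos" using n0 by blast
  have "(inv_into V g \<circ> g) b0 = b0" using aut_inv_f[OF Gpos_aut[OF g] b0_V] by simp
  then show ?thesis using Gpos_comp[OF Gpos_inv[OF g] g] unfolding orbit_def by (metis (mono_tags, lifting) mem_Collect_eq)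
qed

text \<open>If no orientation preserving symmetry exchanges the two orbits, their relative position is free;
  it is chosen such that the jumps between them are balanced.\<close>

lemma two_ended_blocks:
  "\<exists>(p :: 'a \<Rightarrow> int) (s :: nat) (t :: nat). 0 < s \<and> 0 < t \<and>
    (\<forall>i. finite {x \<in> V. p x = i} \<and> card {x \<in> V. p x = i} = s) \<and>
    (\<forall>(x, y)\<in>E. \<bar>p y - p x\<bar> \<le> int t) \<and>
    (\<forall>x\<in>V. (\<exists>y. (x, y) \<in> E \<and> p y = p x + int t) \<and> (\<exists>y. (x, y) \<in> E \<and> p y = p x - int t)) \<and>
    (\<forall>\<phi>\<in>Gam. \<exists>\<epsilon>\<in>{1, -1}. \<exists>k. \<forall>x\<in>V. p (\<phi> x) = \<epsilon> * p x + k) \<and> s * t \<le> card (bd C)"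
proof -
  obtain m where m: "\<forall>x\<in>V. (ht x < - m \<longrightarrow> x \<in> C) \<and> (m < ht x \<longrightarrow> x \<notin> C)" using ends by blast
  have main: ?thesis if fib: "\<And>i. finite {x \<in> V. p x = i} \<and> card {x \<in> V. p x = i} = s" and s: "0 < s"
    and pP: "\<And>\<phi>. \<phi> \<in> Gpos \<Longrightarrow> \<exists>k. \<forall>x\<in>V. p (\<phi> x) = p x + k"
    and pM: "\<And>\<phi>. \<phi> \<in> Gneg \<Longrightarrow> \<exists>k. \<forall>x\<in>V. p (\<phi> x) = - p x + k"
    and m: "\<And>x. x \<in> V \<Longrightarrow> (p x < - m \<longrightarrow> x \<in> C) \<and> (m < p x \<longrightarrow> x \<notin> C)"
    and lv1: "\<And>x. x \<in> orbit \<Longrightarrow> card {y \<in> orbit. p y = p x} = s1" 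
    and lv2: "\<And>x. x \<in> V - orbit \<Longrightarrow> card {y \<in> V - orbit. p y = p x} = s1"
    and bal: "\<And>x y. (x, y) \<in> E \<Longrightarrow> x \<in> orbit \<Longrightarrow> y \<notin> orbit \<Longrightarrow> 
      (\<exists>(x', y')\<in>E. x' \<in> orbit \<and> y' \<notin> orbit \<and> p y' - p x' \<le> - (p y - p x)) \<and>
      (\<exists>(x', y')\<in>E. x' \<in> orbit \<and> y' \<notin> orbit \<and> - (p y - p x) \<le> p y' - p x')" 
    for p :: "'a \<Rightarrow> int" and s and m
  proof -
    have "\<exists>\<epsilon>\<in>{1, -1}. \<exists>k. \<forall>x\<in>V. p (\<phi> x) = \<epsilon> * p x + k" if "\<phi> \<in> Gam" for \<phi>
    proof (cases "\<phi> \<in> Gpos")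
      case True
      then show ?thesis using pP by (intro bexI[of _ 1]) auto
    next
      case False
      then have "\<phi> \<in> Gneg" using Gam_cases that by blast
      then show ?thesis using pM by (intro bexI[of _ "-1"]) auto
    qed
    then show ?thesis using assemble[OF fib s pP pM m lv1 lv2 bal] fib s by blast
  qed
  show ?thesis
  proof (cases "orbit = V")
    case True
    show ?thesis
    proof (rule main[of ht s1 m])
      fix \<phi> assume "\<phi> \<in> Gpos" then show "\<exists>k. \<forall>x\<in>V. ht (\<phi> x) = ht x + k" by (rule ht_Gp')
    next
      fix \<phi> assume "\<phi> \<in> Gneg" then show "\<exists>k. \<forall>x\<in>V. ht (\<phi> x) = - ht x + k" by (rule ht_Gneg)
    next
      fix x y assume "(x, y) \<in> E" "y \<notin> orbit"
      then have False using E_V True by blast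
      then show "(\<exists>(x', y')\<in>E. x' \<in> orbit \<and> y' \<notin> orbit \<and> ht y' - ht x' \<le> - (ht y - ht x)) \<and>
        (\<exists>(x', y')\<in>E. x' \<in> orbit \<and> y' \<notin> orbit \<and> - (ht y - ht x) \<le> ht y' - ht x')" ..
    qed (use m lvl_orbit s1_pos True in auto)
  next
    case False
    define JJ where "JJ = {ht y - ht x |x y. (x, y) \<in> E \<and> x \<in> orbit \<and> y \<notin> orbit}"
    have "JJ \<subseteq> (\<lambda>y. ht y - ht b0) ` {y. (b0, y) \<in> E}"
    proof
      fix j assume "j \<in> JJ"
      then obtain x y where xy: "j = ht y - ht x" "(x, y) \<in> E" "x \<in> orbit" by (auto simp: JJ_def)
      have V: "x \<in> V" "y \<in> V" using E_V xy by auto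
      obtain \<phi> where f: "\<phi> \<in> Gpos" "\<phi> x = b0" using Gpos_trans V b0_V b0_orbit xy by blast
      obtain k where "\<forall>x\<in>V. ht (\<phi> x) = ht x + k" using ht_Gp' f by blast
      then have "j = ht (\<phi> y) - ht b0" using V f xy by force
      moreover have "(b0, \<phi> y) \<in> E" using aut_E[OF Gpos_aut[OF f(1)] V] f xy by simp
      ultimately show "j \<in> (\<lambda>y. ht y - ht b0) ` {y. (b0, y) \<in> E}" by blast
    qed
    then have fJ: "finite JJ" using fin_nbrs b0_V finite_subset by blast
    have "\<exists>z. z \<in> V \<and> z \<notin> orbit" using False orbit_V by blast
    then have "bd orbit \<noteq> {}" using cn_exit[OF cn_V _ _ b0_orbit] b0_V by blast
    then have neJ: "JJ \<noteq> {}" by (auto simp: bd_def JJ_def)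
    define \<alpha> where "\<alpha> = Min JJ"
    define \<beta> where "\<beta> = Max JJ"
    have ab: "\<alpha> \<in> JJ" "\<beta> \<in> JJ" "\<And>j. j \<in> JJ \<Longrightarrow> \<alpha> \<le> j \<and> j \<le> \<beta>" using fJ neJ by (auto simp: \<alpha>_def \<beta>_def)
    \<comment> \<open>The second orbit is shifted by the mean of the extreme jumps. If
      \<open>\<alpha> + \<beta>\<close> is odd, heights are doubled first; the orbits then occupy
      the even and the odd levels, and each level has \<open>s1\<close> instead of
      \<open>2 * s1\<close> vertices.\<close>
    define u :: int where "u = (if even (\<alpha> + \<beta>) then 1 else 2)"
    define c where "c = (if even (\<alpha> + \<beta>) then (\<alpha> + \<beta>) div 2 else \<alpha> + \<beta>)"
    have uc: "2 * c = u * (\<alpha> + \<beta>)" "0 < u" by (auto simp: u_def c_def)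
    define p where "p x = u * ht x - (if x \<in> orbit then 0 else c)" for x
    define s where "s = (if even (\<alpha> + \<beta>) then 2 * s1 else s1)"
    have fib: "finite {x \<in> V. p x = i} \<and> card {x \<in> V. p x = i} = s" for i
    proof (cases "even (\<alpha> + \<beta>)")
      case True
      have "{x \<in> V. p x = i} = {x \<in> orbit. ht x = i} \<union> {x \<in> V - orbit. ht x = i + c}"
        using orbit_V True by (auto simp: p_def u_def)
      moreover have "card ({x \<in> orbit. ht x = i} \<union> {x \<in> V - orbit. ht x = i + c}) = s1 + s1"
        using lvl_orbit[of i] lvl_outer[OF False, of "i + c"] by (subst card_Un_disjoint) auto
      ultimately show ?thesis using lvl_orbit(1)[of i] lvl_outer(1)[OF False, of "i + c"] True by (simp add: s_def)
    next
      case odd: False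
      then have o: "odd c" "u = 2" by (auto simp: c_def u_def)
      show ?thesis
      proof (cases "even i")
        case True
        have "u * ht x - c \<noteq> i" for x using o True by (metis dvd_diff_right_iff dvd_triv_left even_diff)
        then have "{x \<in> V. p x = i} = {x \<in> orbit. ht x = i div 2}" using orbit_V o True by (auto simp: p_def)
        then show ?thesis using lvl_orbit odd by (simp add: s_def)
      next
        case oi: False
        have "u * ht x \<noteq> i" for x using o oi by auto
        moreover have "u * ht x - c = i \<longleftrightarrow> ht x = (i + c) div 2" for x
        proof -
          have "even (i + c)" using o oi by simp
          then have "i + c = 2 * ((i + c) div 2)" by simp
          then show ?thesis unfolding o(2) by linarith
        qed
        ultimately have "{x \<in> V. p x = i} = {x \<in> V - orbit. ht x = (i + c) div 2}" by (auto simp: p_def)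
        then show ?thesis using lvl_outer[OF False] odd by (simp add: s_def)
      qed
    qed
    show ?thesis
    proof (rule main[OF fib])
      show "0 < s" using s1_pos by (simp add: s_def)
    next
      fix \<phi> assume f: "\<phi> \<in> Gpos"
      obtain k where "\<forall>x\<in>V. ht (\<phi> x) = ht x + k" using ht_Gp' f by blast
      then show "\<exists>k. \<forall>x\<in>V. p (\<phi> x) = p x + k" using orbit_Gpos[OF f]
        by (intro exI[of _ "u * k"]) (auto simp: p_def algebra_simps)
    next
      fix \<phi> assume f: "\<phi> \<in> Gneg"
      obtain k where "\<forall>x\<in>V. ht (\<phi> x) = - ht x + k" using ht_Gneg f by blast
      then show "\<exists>k. \<forall>x\<in>V. p (\<phi> x) = - p x + k" using orbit_Gneg[OF f _ False]
        by (intro exI[of _ "u * k - c"]) (auto simp: p_def algebra_simps)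
    next
      fix x assume x: "x \<in> V"
      have mx: "(ht x < - m \<longrightarrow> x \<in> C) \<and> (m < ht x \<longrightarrow> x \<notin> C)" using m x by blast
      have "u = 1 \<or> u = 2" by (simp add: u_def)
      then show "(p x < - (2 * \<bar>m\<bar> + \<bar>c\<bar>) \<longrightarrow> x \<in> C) \<and> (2 * \<bar>m\<bar> + \<bar>c\<bar> < p x \<longrightarrow> x \<notin> C)"
        using mx by (auto simp: p_def abs_if split: if_splits)
    next
      fix x assume x: "x \<in> orbit"
      have "{y \<in> orbit. p y = p x} = {y \<in> orbit. ht y = ht x}" using x uc by (auto simp: p_def)
      then show "card {y \<in> orbit. p y = p x} = s1" using lvl_orbit by simp
    next
      fix x assume x: "x \<in> V - orbit"
      have "{y \<in> V - orbit. p y = p x} = {y \<in> V - orbit. ht y = ht x}" using x uc by (auto simp: p_def)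
      then show "card {y \<in> V - orbit. p y = p x} = s1" using lvl_outer[OF False] by simp
    next
      fix x y assume xy: "(x, y) \<in> E" "x \<in> orbit" "y \<notin> orbit"
      then have "ht y - ht x \<in> JJ" by (auto simp: JJ_def)
      then have j: "\<alpha> \<le> ht y - ht x" "ht y - ht x \<le> \<beta>" using ab by auto
      have pj: "p y' - p x' = u * (ht y' - ht x') - c" if "x' \<in> orbit" "y' \<notin> orbit" for x' y'
        using that by (simp add: p_def algebra_simps)
      obtain x1 y1 where 1: "\<alpha> = ht y1 - ht x1" "(x1, y1) \<in> E" "x1 \<in> orbit" "y1 \<notin> orbit" using ab(1) by (auto simp: JJ_def)
      obtain x2 y2 where 2: "\<beta> = ht y2 - ht x2" "(x2, y2) \<in> E" "x2 \<in> orbit" "y2 \<notin> orbit" using ab(2) by (auto simp: JJ_def)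
      have "u * \<alpha> \<le> u * (\<alpha> + \<beta> - (ht y - ht x))" "u * (\<alpha> + \<beta> - (ht y - ht x)) \<le> u * \<beta>"
        using j uc(2) by simp_all
      then have "p y1 - p x1 \<le> - (p y - p x)" "- (p y - p x) \<le> p y2 - p x2"
        using pj[OF xy(2,3)] pj[OF 1(3,4), folded 1(1)] pj[OF 2(3,4), folded 2(1)] uc(1)
        unfolding distrib_left right_diff_distrib by linarith+
      then show "(\<exists>(x', y')\<in>E. x' \<in> orbit \<and> y' \<notin> orbit \<and> p y' - p x' \<le> - (p y - p x)) \<and>
        (\<exists>(x', y')\<in>E. x' \<in> orbit \<and> y' \<notin> orbit \<and> - (p y - p x) \<le> p y' - p x')" using 1 2 by blast
    qed
  qed
qed

lemma two_ended_blocksE: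
  obtains p :: "'a \<Rightarrow> int" and s t :: nat where "0 < s" "0 < t"
    "\<And>i. finite {x \<in> V. p x = i}" "\<And>i. card {x \<in> V. p x = i} = s"
    "\<And>x y. (x, y) \<in> E \<Longrightarrow> \<bar>p y - p x\<bar> \<le> int t"
    "\<And>x. x \<in> V \<Longrightarrow> \<exists>y. (x, y) \<in> E \<and> p y = p x + int t" "\<And>x. x \<in> V \<Longrightarrow> \<exists>y. (x, y) \<in> E \<and> p y = p x - int t"
    "\<And>\<phi>. \<phi> \<in> Gam \<Longrightarrow> \<exists>\<epsilon> k. (\<epsilon> = 1 \<or> \<epsilon> = -1) \<and> (\<forall>x\<in>V. p (\<phi> x) = \<epsilon> * p x + k)" "s * t \<le> card (bd C)"
  using two_ended_blocks
proof (elim exE conjE, goal_cases)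
  case (1 p s t)
  have "\<exists>\<epsilon> k. (\<epsilon> = 1 \<or> \<epsilon> = -1) \<and> (\<forall>x\<in>V. p (\<phi> x) = \<epsilon> * p x + k)" if "\<phi> \<in> Gam" for \<phi>
    using 1(7) that by (blast dest: bspec)
  moreover have "\<bar>p y - p x\<bar> \<le> int t" if "(x, y) \<in> E" for x y using 1(5) that by auto
  ultimately show ?case using 1(2-4,6,8) by (intro "1"(1)[of s t p]) simp_all
qed

end

section \<open>The ring structure\<close>

text \<open>Blocks are indexed by the integers modulo \<open>N\<close>; the value \<open>N = 0\<close> encodes infinitely many
  blocks.\<close>

locale ring_graph = deep_graph +
  fixes block :: "int \<Rightarrow> 'a set" and N s t :: nat
  assumes s_pos: "0 < s" and t_pos: "0 < t"
    and block_fin: "finite (block i)" and block_card: "card (block i) = s"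
    and block_eq: "x \<in> block i \<Longrightarrow> x \<in> block j \<Longrightarrow> int N dvd j - i"
    and block_per: "block (i + int N) = block i"
    and block_UN: "(\<Union>i. block i) = V"
    and block_E: "x \<in> block i \<Longrightarrow> (x, y) \<in> E \<Longrightarrow> \<exists>j. y \<in> block j \<and> \<bar>j - i\<bar> \<le> int t"
    and block_up: "x \<in> block i \<Longrightarrow> \<exists>y\<in>block (i + int t). (x, y) \<in> E"
    and block_dn: "x \<in> block i \<Longrightarrow> \<exists>y\<in>block (i - int t). (x, y) \<in> E"
    and block_aut: "automorphism V E \<phi> \<Longrightarrow> \<exists>\<epsilon>\<in>{1, -1}. \<exists>c. \<forall>i. \<phi> ` block i = block (\<epsilon> * i + c)"
    and cap: "2 * (s * t) \<le> q"

context cut_graph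
begin

lemma ring_infinite:
  assumes inf: "infinite V"
  shows "\<exists>block N s t. ring_graph V E k A0 block N s t"
proof -
  obtain b0 where b0: "b0 \<in> V" using V_ne by blast
  note T = two_ended_infinite[OF inf]
  have "bd (V - Y) \<subseteq> wall" using Y_bd(1) no_winding_infinite inf by blast
  then have "finite (bd (V - Y))" using finite_wall finite_subset by blast
  then interpret T: two_ended V E "{\<phi>. aut \<phi>}" "V - Y" b0
    using aut_comp aut_inv vt T b0 by unfold_locales (simp_all add: bd_def)
  obtain p :: "'a \<Rightarrow> int" and s t :: nat where p: "0 < s" "0 < t"
    "\<And>i. finite {x \<in> V. p x = i}" "\<And>i. card {x \<in> V. p x = i} = s"
    "\<And>x y. (x, y) \<in> E \<Longrightarrow> \<bar>p y - p x\<bar> \<le> int t"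
    "\<And>x. x \<in> V \<Longrightarrow> \<exists>y. (x, y) \<in> E \<and> p y = p x + int t" "\<And>x. x \<in> V \<Longrightarrow> \<exists>y. (x, y) \<in> E \<and> p y = p x - int t"
    "\<And>\<phi>. \<phi> \<in> {\<phi>. aut \<phi>} \<Longrightarrow> \<exists>\<epsilon> k. (\<epsilon> = 1 \<or> \<epsilon> = -1) \<and> (\<forall>x\<in>V. p (\<phi> x) = \<epsilon> * p x + k)" "s * t \<le> card (bd (V - Y))"
    by (rule T.two_ended_blocksE) (rule that, assumption+)
  let ?B = "\<lambda>i. {x \<in> V. p x = i}"
  have "ring_graph V E k A0 ?B 0 s t"
  proof (unfold_locales)
    fix x y i assume "x \<in> ?B i" "(x, y) \<in> E"
    then show "\<exists>j. y \<in> ?B j \<and> \<bar>j - i\<bar> \<le> int t" using p(5) E_V by auto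
  next
    fix x i assume "x \<in> ?B i"
    then show "\<exists>y\<in>?B (i + int t). (x, y) \<in> E" "\<exists>y\<in>?B (i - int t). (x, y) \<in> E"
      using p(6)[of x] p(7)[of x] E_V by fastforce+
  next
    fix \<phi> assume a: "aut \<phi>"
    then obtain \<epsilon> k where e: "\<epsilon> = 1 \<or> \<epsilon> = -1" "\<And>x. x \<in> V \<Longrightarrow> p (\<phi> x) = \<epsilon> * p x + k" using p(8)[of \<phi>] by auto
    have "\<phi> ` ?B i = ?B (\<epsilon> * i + k)" for i
    proof
      show "\<phi> ` ?B i \<subseteq> ?B (\<epsilon> * i + k)" using e aut_V[OF a] by auto
      show "?B (\<epsilon> * i + k) \<subseteq> \<phi> ` ?B i"
      proof
        fix y assume y: "y \<in> ?B (\<epsilon> * i + k)"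
        then obtain x where x: "x \<in> V" "y = \<phi> x" using aut_image_V[OF a] by auto
        then have "p x = i" using e(2)[of x] e(1) y by auto
        then show "y \<in> \<phi> ` ?B i" using x by blast
      qed
    qed
    then show "\<exists>\<epsilon>\<in>{1, -1}. \<exists>c. \<forall>i. \<phi> ` ?B i = ?B (\<epsilon> * i + c)" using e(1) by blast
  next
    show "2 * (s * t) \<le> q" using p(9) T(1) card_wall by linarith
  qed (use p in auto)
  then show ?thesis by blast
qed

text \<open>The infinite cyclic cover that unwinds the cochain \<open>c\<close>.\<close>

definition cover_V :: "('a \<times> int) set" where "cover_V = V \<times> UNIV"

definition cover_E :: "('a \<times> int) rel" where "cover_E = {((x, i), (y, j)). (x, y) \<in> E \<and> j = i + c x y}"

definition cover_aut :: "('a \<times> int \<Rightarrow> 'a \<times> int) set" where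
  "cover_aut = {\<psi>. automorphism cover_V cover_E \<psi> \<and>
    (\<exists>\<epsilon>\<in>{1, -1}. \<exists>\<phi> g. aut \<phi> \<and> (\<forall>x\<in>V. \<forall>i. \<psi> (x, i) = (\<phi> x, \<epsilon> * i + g x)))}"

lemma cover_aut_E:
  assumes "\<psi> \<in> cover_aut"
  obtains \<epsilon> \<phi> g where "\<epsilon> \<in> {1, -1}" "aut \<phi>" "\<And>x i. x \<in> V \<Longrightarrow> \<psi> (x, i) = (\<phi> x, \<epsilon> * i + g x)" "automorphism cover_V cover_E \<psi>"
  using assms unfolding cover_aut_def by blast

lemma c_anti: "c y x = - c x y"
  unfolding c_def cochain_def by (rule cut_antisym)

lemma cover_E_sym: "(u, v) \<in> cover_E \<Longrightarrow> (v, u) \<in> cover_E"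
  unfolding cover_E_def using E_sym c_anti[of "fst v" "fst u"] by (auto simp: case_prod_beta)

lemma cover_E_rsym: "(u, v) \<in> cover_E\<^sup>* \<Longrightarrow> (v, u) \<in> cover_E\<^sup>*"
  using cover_E_sym by (metis symI sym_rtrancl symD)

lemma cover_E_lift: "(x, y) \<in> E\<^sup>* \<Longrightarrow> \<exists>j. \<forall>i. ((x, i), (y, i + j)) \<in> cover_E\<^sup>*"
proof (induction rule: rtrancl_induct)
  case base
  show ?case by (rule exI[of _ 0]) simp
next
  case (step y z)
  then obtain j where j: "\<forall>i. ((x, i), (y, i + j)) \<in> cover_E\<^sup>*" by blast
  have "((x, i), (z, i + (j + c y z))) \<in> cover_E\<^sup>*" for i
    by (rule rtrancl_into_rtrancl[OF j[rule_format, of i]]) (use step in \<open>simp add: cover_E_def\<close>)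
  then show ?case by blast
qed

lemma cover_E_lift0: "(x, y) \<in> E0\<^sup>* \<Longrightarrow> ((x, i), (y, i)) \<in> cover_E\<^sup>*"
proof (induction rule: rtrancl_induct)
  case (step y z)
  then show ?case by (auto simp: cover_E_def E0_def intro: rtrancl_into_rtrancl)
qed simp

text \<open>The sheets are joined by the closed walk of winding number one, which exists in a finite
  graph by \<open>Y_split\<close> and \<open>winding\<close>.\<close>

lemma cover_E_conn:
  assumes "finite V" "u \<in> cover_V" "v \<in> cover_V" shows "(u, v) \<in> cover_E\<^sup>*"
proof -
  obtain x e where xe: "(e, x) \<in> E0\<^sup>*" "(x, e) \<in> E" "c x e = 1" using winding Y_split assms(1) by metis
  have up: "((e, i), (e, i + 1)) \<in> cover_E\<^sup>*" for i
    by (rule rtrancl_into_rtrancl[OF cover_E_lift0[OF xe(1)]]) (use xe in \<open>simp add: cover_E_def\<close>)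
  have upn: "((e, i), (e, i + int n)) \<in> cover_E\<^sup>*" for i n
  proof (induction n)
    case (Suc n)
    then show ?case using up[of "i + int n"] by (auto simp: ac_simps intro: rtrancl_trans)
  qed simp
  have e: "((e, i), (e, j)) \<in> cover_E\<^sup>*" for i j
  proof (cases "i \<le> j")
    case True
    then show ?thesis using upn[of i "nat (j - i)"] by simp
  next
    case False
    then show ?thesis using cover_E_rsym[OF upn[of j "nat (i - j)"]] by simp
  qed
  have eV: "e \<in> V" using xe E_V by blast
  have *: "\<exists>j. (w, (e, j)) \<in> cover_E\<^sup>*" if wU: "w \<in> cover_V" for w
  proof -
    obtain x i where w: "w = (x, i)" "x \<in> V" using wU by (auto simp: cover_V_def)
    then show ?thesis using cover_E_lift[OF conn[OF w(2) eV]] by blast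
  qed
  obtain i j where "(u, (e, i)) \<in> cover_E\<^sup>*" "(v, (e, j)) \<in> cover_E\<^sup>*" using * assms by blast
  then show ?thesis using e[of i j] cover_E_rsym by (meson rtrancl_trans)
qed

lemma U_graph: assumes "finite V" shows "lf_graph cover_V cover_E"
proof
  show "cover_E \<subseteq> cover_V \<times> cover_V" using E_V by (auto simp: cover_E_def cover_V_def)
next
  fix u assume u: "u \<in> cover_V"
  have "{v. (u, v) \<in> cover_E} \<subseteq> (\<lambda>y. (y, snd u + c (fst u) y)) ` {y. (fst u, y) \<in> E}" by (auto simp: cover_E_def)
  moreover have "finite {y. (fst u, y) \<in> E}" using fin_nbrs u by (auto simp: cover_V_def)
  ultimately show "finite {v. (u, v) \<in> cover_E}" using finite_surj by blast
qed (use cover_E_sym cover_E_conn assms in auto)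

text \<open>Invariance of the class is exactly the condition under which the lift preserves edges;
  \<open>d\<close> is the freedom to add a deck transformation.\<close>

lemma cover_aut_lift:
  assumes a: "aut \<phi>" and e: "\<epsilon> \<in> {1, -1}" and g: "\<forall>(x, y)\<in>E. c (\<phi> x) (\<phi> y) = \<epsilon> * c x y + g y - g x"
  shows "(\<lambda>(x, i). (\<phi> x, \<epsilon> * i + (g x + d))) \<in> cover_aut"
proof -
  let ?f = "\<lambda>(x, i). (\<phi> x, \<epsilon> * i + (g x + d))"
  have ee: "\<epsilon> * \<epsilon> = 1" using e by auto
  have "automorphism cover_V cover_E ?f"
    unfolding automorphism_def
  proof (intro conjI ballI)
    show "bij_betw ?f cover_V cover_V"
    proof (rule bij_betwI[where g = "\<lambda>(y, j). (inv_into V \<phi> y, \<epsilon> * (j - (g (inv_into V \<phi> y) + d)))"])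
    qed (use aut_V[OF a] aut_V[OF aut_inv[OF a]] aut_inv_f[OF a] aut_f_inv[OF a] ee in 
        \<open>auto simp: cover_V_def mult.assoc[symmetric]\<close>)
    fix u v assume "u \<in> cover_V" "v \<in> cover_V"
    then obtain x i y j where uv: "u = (x, i)" "v = (y, j)" "x \<in> V" "y \<in> V" by (auto simp: cover_V_def)
    have "\<epsilon> * j + (g y + d) = \<epsilon> * i + (g x + d) + c (\<phi> x) (\<phi> y) \<longleftrightarrow> j = i + c x y" if "(x, y) \<in> E"
      using g that e by auto
    then show "(u, v) \<in> cover_E \<longleftrightarrow> (?f u, ?f v) \<in> cover_E"
      using uv aut_E[OF a uv(3,4)] by (auto simp: cover_E_def)
  qed
  moreover have "\<exists>\<epsilon>'\<in>{1, -1}. \<exists>\<phi>' g'. aut \<phi>' \<and> (\<forall>x\<in>V. \<forall>i. ?f (x, i) = (\<phi>' x, \<epsilon>' * i + g' x))"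
    by (intro bexI[of _ \<epsilon>] exI[of _ \<phi>] exI[of _ "\<lambda>x. g x + d"]) (use a e in auto)
  ultimately show ?thesis unfolding cover_aut_def by blast
qed

lemma aut_lift:
  assumes a: "aut \<phi>"
  shows "\<exists>\<epsilon>\<in>{1, -1}. \<exists>g. \<forall>d. (\<lambda>(x, i). (\<phi> x, \<epsilon> * i + (g x + d))) \<in> cover_aut"
proof -
  obtain \<epsilon> g where e: "\<epsilon> \<in> {1, -1}" "\<forall>(x, y)\<in>E. c (\<phi> x) (\<phi> y) = \<epsilon> * c x y + g y - g x"
    using cochain_class[OF a nch] unfolding c_def by blast
  then show ?thesis using cover_aut_lift[OF a e] by blast
qed

lemma cover_aut_comp: 
  assumes "lf_graph cover_V cover_E" "\<psi> \<in> cover_aut" "\<psi>' \<in> cover_aut" shows "\<psi> \<circ> \<psi>' \<in> cover_aut"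
proof -
  interpret U: lf_graph cover_V cover_E by fact
  obtain \<epsilon> \<phi> g where 1: "\<epsilon> \<in> {1, -1}" "aut \<phi>" "\<And>x i. x \<in> V \<Longrightarrow> \<psi> (x, i) = (\<phi> x, \<epsilon> * i + g x)" "U.aut \<psi>"
    using assms(2) by (rule cover_aut_E) (rule that, assumption+)
  obtain \<epsilon>' \<phi>' g' where 2: "\<epsilon>' \<in> {1, -1}" "aut \<phi>'" "\<And>x i. x \<in> V \<Longrightarrow> \<psi>' (x, i) = (\<phi>' x, \<epsilon>' * i + g' x)" "U.aut \<psi>'"
    using assms(3) by (rule cover_aut_E) (rule that, assumption+)
  have "\<exists>\<epsilon>''\<in>{1, -1}. \<exists>\<phi>'' g''. aut \<phi>'' \<and> (\<forall>x\<in>V. \<forall>i. (\<psi> \<circ> \<psi>') (x, i) = (\<phi>'' x, \<epsilon>'' * i + g'' x))"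
    by (intro bexI[of _ "\<epsilon> * \<epsilon>'"] exI[of _ "\<phi> \<circ> \<phi>'"] exI[of _ "\<lambda>x. \<epsilon> * g' x + g (\<phi>' x)"])
      (use 1 2 aut_comp aut_V in \<open>auto simp: algebra_simps\<close>)
  then show ?thesis using U.aut_comp[OF 1(4) 2(4)] by (simp add: cover_aut_def)
qed

lemma cover_aut_inv: 
  assumes "lf_graph cover_V cover_E" "\<psi> \<in> cover_aut" shows "inv_into cover_V \<psi> \<in> cover_aut"
proof -
  interpret U: lf_graph cover_V cover_E by fact
  obtain \<epsilon> \<phi> g where 1: "\<epsilon> \<in> {1, -1}" "aut \<phi>" "\<And>x i. x \<in> V \<Longrightarrow> \<psi> (x, i) = (\<phi> x, \<epsilon> * i + g x)" "U.aut \<psi>"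
    using assms(2) by (rule cover_aut_E) (rule that, assumption+)
  let ?x = "inv_into V \<phi>"
  have "inv_into cover_V \<psi> (y, j) = (?x y, \<epsilon> * j + (- \<epsilon> * g (?x y)))" if y: "y \<in> V" for y j
  proof -
    have x: "?x y \<in> V" "\<phi> (?x y) = y" using aut_V[OF aut_inv] aut_f_inv 1(2) y by auto
    then have "\<psi> (?x y, \<epsilon> * j + (- \<epsilon> * g (?x y))) = (y, j)" using 1(1,3) by (auto simp: algebra_simps)
    moreover have "(?x y, \<epsilon> * j + (- \<epsilon> * g (?x y))) \<in> cover_V" using x by (simp add: cover_V_def)
    ultimately show ?thesis using U.aut_inv_f[OF 1(4)] by metis
  qed
  then have "\<exists>\<epsilon>''\<in>{1, -1}. \<exists>\<phi>'' g''. aut \<phi>'' \<and> (\<forall>x\<in>V. \<forall>i. inv_into cover_V \<psi> (x, i) = (\<phi>'' x, \<epsilon>'' * i + g'' x))"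
    using 1(1) aut_inv[OF 1(2)] by (intro bexI[of _ \<epsilon>] exI[of _ ?x] exI[of _ "\<lambda>y. - \<epsilon> * g (?x y)"]) auto
  then show ?thesis using U.aut_inv[OF 1(4)] by (simp add: cover_aut_def)
qed

lemma cover_aut_trans: assumes "u \<in> cover_V" "v \<in> cover_V" shows "\<exists>\<psi>\<in>cover_aut. \<psi> u = v"
proof -
  obtain x i y j where uv: "u = (x, i)" "v = (y, j)" "x \<in> V" "y \<in> V" using assms by (auto simp: cover_V_def)
  obtain \<phi> where a: "aut \<phi>" "\<phi> x = y" using vt uv by blast
  obtain \<epsilon> g where e: "\<And>d. (\<lambda>(x, i). (\<phi> x, \<epsilon> * i + (g x + d))) \<in> cover_aut" using aut_lift[OF a(1)] by blast
  show ?thesis by (rule bexI[OF _ e[of "j - \<epsilon> * i - g x"]]) (simp add: uv a)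
qed

text \<open>Its boundary lies in one copy of the wall at height 1, so the cut does not grow in the
  cover.\<close>

definition cover_neg :: "('a \<times> int) set" where "cover_neg = V \<times> {..0}"

lemma cover_neg_bd: "{v \<in> cover_V - cover_neg. \<exists>u\<in>cover_neg. (u, v) \<in> cover_E} \<subseteq> (\<lambda>y. (y, 1)) ` wall"
proof
  fix v assume "v \<in> {v \<in> cover_V - cover_neg. \<exists>u\<in>cover_neg. (u, v) \<in> cover_E}"
  then obtain x i y where v: "v = (y, i + c x y)" "i \<le> 0" "(x, y) \<in> E" "0 < i + c x y"
    by (fastforce simp: cover_V_def cover_neg_def cover_E_def not_le)
  then show "v \<in> (\<lambda>y. (y, 1)) ` wall" using c_cases[OF v(3)] by auto
qed

lemma U_two_ended:
  assumes fV: "finite V" and b0: "b0 \<in> V"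
  shows "two_ended cover_V cover_E cover_aut cover_neg (b0, 0)"
proof -
  interpret U: lf_graph cover_V cover_E using U_graph fV by blast
  show ?thesis
  proof
    show "finite {v \<in> cover_V - cover_neg. \<exists>u\<in>cover_neg. (u, v) \<in> cover_E}" using cover_neg_bd finite_wall finite_surj by blast
    have "inj (\<lambda>i::int. (b0, i))" by (simp add: inj_def)
    then have inf: "infinite ((\<lambda>i::int. (b0, i)) ` S)" if "infinite S" for S
      using that finite_imageD inj_on_subset by blast
    have UC': "cover_V - cover_neg = V \<times> {0<..}" by (auto simp: cover_neg_def cover_V_def)
    show "infinite cover_neg" using inf[of "{..0}"] infinite_Iic b0 finite_subset[of "(\<lambda>i::int. (b0, i)) ` {..0}" cover_neg] 
      by (auto simp: cover_neg_def)
    show "infinite (cover_V - cover_neg)" 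
      using inf[of "{0<..}"] infinite_Ioi b0 finite_subset[of "(\<lambda>i::int. (b0, i)) ` {0<..}" "V \<times> {0<..}"]
      unfolding UC' by auto
    fix \<psi> assume "\<psi> \<in> cover_aut"
    then obtain \<epsilon> \<phi> g where 1: "\<epsilon> = 1 \<or> \<epsilon> = -1" "\<And>x i. x \<in> V \<Longrightarrow> \<psi> (x, i) = (\<phi> x, \<epsilon> * i + g x)" "aut \<phi>"
      by (rule cover_aut_E) (use that in auto)
    define M where "M = (\<Sum>x\<in>V. \<bar>g x\<bar>)"
    have M: "\<bar>g x\<bar> \<le> M" if "x \<in> V" for x unfolding M_def using that fV by (intro member_le_sum) auto
    have f: "finite (V \<times> {- M..M})" using fV by simp
    show "finite {x \<in> cover_V. (\<psi> x \<in> cover_neg) \<noteq> (x \<in> cover_neg)} \<or> finite {x \<in> cover_V. (\<psi> x \<in> cover_neg) = (x \<in> cover_neg)}"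
    proof (cases "\<epsilon> = 1")
      case True
      have "{x \<in> cover_V. (\<psi> x \<in> cover_neg) \<noteq> (x \<in> cover_neg)} \<subseteq> V \<times> {- M..M}"
      proof
        fix u assume u: "u \<in> {x \<in> cover_V. (\<psi> x \<in> cover_neg) \<noteq> (x \<in> cover_neg)}"
        then obtain x i where "u = (x, i)" "x \<in> V" by (auto simp: cover_V_def)
        then show "u \<in> V \<times> {- M..M}" using u 1 M[of x] True aut_V by (auto simp: cover_neg_def)
      qed
      then show ?thesis using f finite_subset by blast
    next
      case False
      have "{x \<in> cover_V. (\<psi> x \<in> cover_neg) = (x \<in> cover_neg)} \<subseteq> V \<times> {- M..M}"
      proof
        fix u assume u: "u \<in> {x \<in> cover_V. (\<psi> x \<in> cover_neg) = (x \<in> cover_neg)}"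
        then obtain x i where "u = (x, i)" "x \<in> V" by (auto simp: cover_V_def)
        then show "u \<in> V \<times> {- M..M}" using u 1 M[of x] False aut_V by (auto simp: cover_neg_def)
      qed
      then show ?thesis using f finite_subset by blast
    qed
  qed (use cover_aut_comp cover_aut_inv cover_aut_trans U_graph fV b0 in \<open>auto simp: cover_aut_def cover_neg_def cover_V_def\<close>)
qed

text \<open>The deck transformation shifts the height upstairs by a constant \<open>n\<close>, which
  is non-zero because levels are finite. Blocks are the projected levels and repeat with period the
  absolute value of \<open>n\<close>.\<close>

lemma ring_finite:
  assumes fV: "finite V"
  shows "\<exists>block N s t. ring_graph V E k A0 block N s t"
proof -
  obtain b0 where b0: "b0 \<in> V" using V_ne by blast
  interpret T: two_ended cover_V cover_E cover_aut cover_neg "(b0, 0)" using U_two_ended fV b0 .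
  obtain p :: "'a \<times> int \<Rightarrow> int" and s t :: nat where p: "0 < s" "0 < t"
    "\<And>i. finite {x \<in> cover_V. p x = i}" "\<And>i. card {x \<in> cover_V. p x = i} = s"
    "\<And>x y. (x, y) \<in> cover_E \<Longrightarrow> \<bar>p y - p x\<bar> \<le> int t"
    "\<And>x. x \<in> cover_V \<Longrightarrow> \<exists>y. (x, y) \<in> cover_E \<and> p y = p x + int t" "\<And>x. x \<in> cover_V \<Longrightarrow> \<exists>y. (x, y) \<in> cover_E \<and> p y = p x - int t"
    "\<And>\<phi>. \<phi> \<in> cover_aut \<Longrightarrow> \<exists>\<epsilon> k. (\<epsilon> = 1 \<or> \<epsilon> = -1) \<and> (\<forall>x\<in>cover_V. p (\<phi> x) = \<epsilon> * p x + k)" "s * t \<le> card (T.bd cover_neg)"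
    by (rule T.two_ended_blocksE) (rule that, assumption+)
  have V_cover_V: "x \<in> V \<Longrightarrow> (x, i) \<in> cover_V" for x i by (simp add: cover_V_def)
  have inj: "inj (\<lambda>i::int. (b0, i))" "inj (\<lambda>i::int. (b0, 2 * i))" by (simp_all add: inj_def)
  have not_const: "\<not> (\<forall>i. p (f i) = m)" if f: "inj f" "range f \<subseteq> cover_V" for f :: "int \<Rightarrow> 'a \<times> int" and m
  proof
    assume "\<forall>i. p (f i) = m"
    then have "range f \<subseteq> {x \<in> cover_V. p x = m}" using f by auto
    then have "finite (range f)" using p(3) finite_subset by blast
    then show False using f finite_imageD infinite_UNIV_int by blast
  qed
  have "(\<lambda>(x, i). (x, 1 * i + (0 + 1))) \<in> cover_aut"
    by (rule cover_aut_lift[where \<phi> = "\<lambda>x. x" and g = "\<lambda>_. 0"]) (auto intro: aut_id)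
  from p(8)[OF this] obtain \<epsilon> n where e0: "\<epsilon> = 1 \<or> \<epsilon> = -1"
    "\<forall>u\<in>cover_V. p ((\<lambda>(x, i). (x, 1 * i + (0 + 1))) u) = \<epsilon> * p u + n" by blast
  have e: "\<epsilon> = 1 \<or> \<epsilon> = -1" "x \<in> V \<Longrightarrow> p (x, i + 1) = \<epsilon> * p (x, i) + n" for x i
    using e0(1) e0(2)[rule_format, OF V_cover_V, of x i] by simp_all
  \<comment> \<open>The square of a height-reversing deck transformation would preserve heights, and
    infinitely many vertices above \<open>b0\<close> would share a level.\<close>
  have "\<epsilon> = 1"
  proof (rule ccontr)
    assume "\<epsilon> \<noteq> 1"
    then have e': "p (b0, i + 1) = n - p (b0, i)" for i using e b0 by auto
    have e2: "p (b0, i + 2) = p (b0, i)" for i using e'[of i] e'[of "i + 1"] by (simp add: add.assoc)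
    have "p (b0, 2 * i) = p (b0, 0)" for i
    proof (induction i rule: int_induct[where k = 0])
      case (step1 i) then show ?case using e2[of "2 * i"] by (simp add: algebra_simps)
    next
      case (step2 i) then show ?case using e2[of "2 * i - 2"] by (simp add: algebra_simps)
    qed simp
    then show False using not_const[OF inj(2)] b0 by (auto simp: cover_V_def)
  qed
  then have e1: "p (x, i + 1) = p (x, i) + n" if "x \<in> V" for x i using e that by simp
  have en: "p (x, i + j) = p (x, i) + j * n" if x: "x \<in> V" for x i j
  proof (induction j rule: int_induct[where k = 0])
    case (step1 j) then show ?case using e1[OF x, of "i + j"] by (simp add: algebra_simps)
  next
    case (step2 j) then show ?case using e1[OF x, of "i + j - 1"] by (simp add: algebra_simps)
  qed simp
  have en': "p (x, j) = p (x, i) + (j - i) * n" if "x \<in> V" for x i j using en[OF that, of i "j - i"] by simp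
  have n0: "n \<noteq> 0"
  proof
    assume "n = 0"
    then have "\<forall>i. p (b0, i) = p (b0, 0)" using en[OF b0, of 0] by simp
    then show False using not_const[OF inj(1)] b0 by (auto simp: cover_V_def)
  qed
  let ?B = "\<lambda>i. {x \<in> V. \<exists>j. p (x, j) = i}"
  have B: "?B i = fst ` {u \<in> cover_V. p u = i}" for i by (force simp: cover_V_def)
  have "ring_graph V E k A0 ?B (nat \<bar>n\<bar>) s t"
  proof (unfold_locales)
    fix i
    show "finite (?B i)" unfolding B using p(3) by simp
    have "inj_on fst {u \<in> cover_V. p u = i}"
    proof (rule inj_onI)
      fix u v assume uv: "u \<in> {u \<in> cover_V. p u = i}" "v \<in> {u \<in> cover_V. p u = i}" "fst u = fst v"
      then have "p (fst u, snd u) = p (fst u, snd v)" "fst u \<in> V" by (auto simp: cover_V_def)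
      then show "u = v" using en'[of "fst u" "snd v" "snd u"] n0 uv by (simp add: prod_eq_iff)
    qed
    then show "card (?B i) = s" unfolding B using p(4) by (simp add: card_image)
    have sh: "x \<in> ?B (i' + n) \<longleftrightarrow> x \<in> ?B i'" for x i'
      using e1[of x] by (auto) (metis add_right_cancel diff_add_cancel)
    have "?B (i + n) = ?B i" "?B (i - n) = ?B i" using sh[of _ i] sh[of _ "i - n"] by auto
    then show "?B (i + int (nat \<bar>n\<bar>)) = ?B i" by (cases "0 \<le> n") auto
  next
    fix x i j assume "x \<in> ?B i" "x \<in> ?B j"
    then obtain a b where "x \<in> V" "p (x, a) = i" "p (x, b) = j" by auto
    then have "j - i = (b - a) * n" using en'[of x b a] by simp
    then show "int (nat \<bar>n\<bar>) dvd j - i" by simp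
  next
    fix x y i assume x: "x \<in> ?B i" "(x, y) \<in> E"
    then obtain j where j: "p (x, j) = i" by auto
    have "((x, j), (y, j + c x y)) \<in> cover_E" using x by (simp add: cover_E_def)
    then show "\<exists>j. y \<in> ?B j \<and> \<bar>j - i\<bar> \<le> int t" using p(5) j E_V[OF x(2)] by fastforce
  next
    fix x i assume x: "x \<in> ?B i"
    then obtain j where j: "p (x, j) = i" "x \<in> V" by auto
    have *: "\<exists>z\<in>?B m. (x, z) \<in> E" if "((x, j), y) \<in> cover_E" "p y = m" for y m
    proof (rule bexI[of _ "fst y"])
      show "(x, fst y) \<in> E" using that by (auto simp: cover_E_def)
      then show "fst y \<in> ?B m" using E_V that by (auto intro: exI[of _ "snd y"])
    qed
    then show "\<exists>y\<in>?B (i + int t). (x, y) \<in> E" "\<exists>y\<in>?B (i - int t). (x, y) \<in> E"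
      using p(6,7)[OF V_cover_V[OF j(2), of j]] j by auto
  next
    fix \<phi> assume a: "aut \<phi>"
    obtain \<epsilon>' g where "\<And>d. (\<lambda>(x, i). (\<phi> x, \<epsilon>' * i + (g x + d))) \<in> cover_aut" using aut_lift[OF a] by blast
    then obtain \<psi> where u: "\<psi> \<in> cover_aut" "\<And>u. fst (\<psi> u) = \<phi> (fst u)" by (metis (no_types, lifting) case_prod_beta fst_conv)
    obtain \<epsilon> m where e: "\<epsilon> = 1 \<or> \<epsilon> = -1" "\<And>u. u \<in> cover_V \<Longrightarrow> p (\<psi> u) = \<epsilon> * p u + m" using p(8)[OF u(1)] by auto
    have ua: "T.aut \<psi>" using u(1) by (simp add: cover_aut_def)
    have "\<phi> ` ?B i = ?B (\<epsilon> * i + m)" for i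
    proof -
      have "\<psi> ` {u \<in> cover_V. p u = i} = {u \<in> cover_V. p u = \<epsilon> * i + m}"
      proof
        show "\<psi> ` {u \<in> cover_V. p u = i} \<subseteq> {u \<in> cover_V. p u = \<epsilon> * i + m}" using e T.aut_V[OF ua] by auto
        show "{u \<in> cover_V. p u = \<epsilon> * i + m} \<subseteq> \<psi> ` {u \<in> cover_V. p u = i}"
        proof
          fix v assume v: "v \<in> {u \<in> cover_V. p u = \<epsilon> * i + m}"
          then obtain w where w: "w \<in> cover_V" "v = \<psi> w" using T.aut_image_V[OF ua] by blast
          then have "p w = i" using e(2)[of w] e(1) v by auto
          then show "v \<in> \<psi> ` {u \<in> cover_V. p u = i}" using w by blast
        qed
      qed
      then have "fst ` \<psi> ` {u \<in> cover_V. p u = i} = ?B (\<epsilon> * i + m)" using B by simp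
      then show ?thesis unfolding B image_image using u(2) by simp
    qed
    then show "\<exists>\<epsilon>\<in>{1, -1}. \<exists>c. \<forall>i. \<phi> ` ?B i = ?B (\<epsilon> * i + c)" using e(1) by blast
  next
    have "card (T.bd cover_neg) \<le> card ((\<lambda>y. (y, 1::int)) ` wall)" 
      unfolding T.bd_def using cover_neg_bd finite_wall by (intro card_mono) auto
    also have "\<dots> \<le> card wall" using finite_wall by (rule card_image_le)
    finally show "2 * (s * t) \<le> q" using p(9) card_wall by linarith
  qed (use p in auto)
  then show ?thesis by blast
qed

end

lemma (in deep_graph) ring_ex: "\<exists>block N s t. ring_graph V E k A0 block N s t"
  using cut_graph_ex cut_graph.ring_infinite cut_graph.ring_finite by metis

section \<open>Sets in a ring\<close>

context deep_graph
begin

lemma card_V_long: assumes "finite V" shows "31 * (k + 1)\<^sup>2 < card V"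
proof -
  obtain x y where xy: "x \<in> V" "y \<in> V" "31 * (k + 1)\<^sup>2 \<le> gd x y" using long by blast
  have "{..31 * (k + 1)\<^sup>2} \<subseteq> gd x ` V"
  proof
    fix i assume "i \<in> {..31 * (k + 1)\<^sup>2}"
    then obtain z where "z \<in> V" "gd x z = i" using gd_between[OF xy(1,2), of i] xy(3) by force
    then show "i \<in> gd x ` V" by blast
  qed
  from card_mono[OF finite_imageI[OF assms] this] show ?thesis
    using card_image_le[OF assms, of "gd x"] by simp
qed

text \<open>For radii from \<open>q\<close> to below \<open>15 * (k + 1)\<^sup>2\<close> balls are
  at most half of \<open>V\<close> by \<open>half_bl\<close>, so each has at least \<open>q\<close>
  boundary vertices, and these boundaries lie on different spheres.\<close>

lemma card_V_spheres: 
  assumes "finite V" shows "q * (15 * (k + 1)\<^sup>2 - q) \<le> card V"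
proof -
  obtain v where v: "v \<in> V" using V_ne by blast
  let ?I = "{q..<15 * (k + 1)\<^sup>2}"
  have s: "bd (bl v r) \<subseteq> {y \<in> V. gd v y = r + 1}" for r
    using gd_edge_le v by (fastforce simp: bd_def bl_def)
  have f: "finite (bd (bl v r))" for r using finite_bd finite_bl v by blast
  have "q \<le> card (bd (bl v r))" if r: "r \<in> ?I" for r
  proof -
    have "2 * r + 1 \<le> 31 * (k + 1)\<^sup>2" using r by auto
    then have "half (bl v r)" using half_bl v by blast
    then show ?thesis using deep_bd[of "bl v r" v r] finite_bl v bl_V r by simp
  qed
  then have "(\<Sum>r\<in>?I. q) \<le> (\<Sum>r\<in>?I. card (bd (bl v r)))" by (rule sum_mono)
  also have "\<dots> = card (\<Union>r\<in>?I. bd (bl v r))"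
  proof (intro card_UN_disjoint[symmetric] ballI impI)
    show "bd (bl v i) \<inter> bd (bl v j) = {}" if "i \<noteq> j" for i j
    proof (rule ccontr)
      assume "\<not> ?thesis"
      then obtain x where x: "x \<in> bd (bl v i)" "x \<in> bd (bl v j)" by auto
      show False using subsetD[OF s x(1)] subsetD[OF s x(2)] that by simp
    qed
  qed (use f in simp_all)
  also have "\<dots> \<le> card V" using assms bd_V by (intro card_mono) auto
  finally show ?thesis by (simp add: mult.commute)
qed

end

context ring_graph
begin

abbreviation blocks :: "int set \<Rightarrow> 'a set" where "blocks I \<equiv> (\<Union>i\<in>I. block i)"

definition a :: nat where "a = s * t"

text \<open>An interval of length \<open>m\<close> has room for balls of radius \<open>a\<close> around the vertices of a central window
  of \<open>t\<close> blocks, and for a margin of \<open>t\<close> blocks at either end.\<close>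

definition m :: int where "m = int t * (2 * int a + 3)"

lemma a_pos: "0 < a" using s_pos t_pos by (simp add: a_def)

lemma a_q: "2 * a \<le> q" using cap by (simp add: a_def)

lemma s_le_a: "s \<le> a" using t_pos by (simp add: a_def)

lemma m_ge: "3 * int t \<le> m" "5 \<le> m"
proof -
  have "int t * 5 \<le> m" unfolding m_def using a_pos by (intro mult_left_mono) auto
  then show "3 * int t \<le> m" "5 \<le> m" using t_pos by linarith+
qed

lemma block_V: "block i \<subseteq> V" using block_UN by blast

lemma block_ne: "block i \<noteq> {}" using block_card[of i] s_pos by auto

lemma block_cong: assumes "int N dvd j - i" shows "block i = block j"
proof -
  have *: "block (i + int n * int N) = block i" for i n
  proof (induction n)
    case (Suc n)
    then show ?case using block_per[of "i + int n * int N"] by (simp add: algebra_simps)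
  qed simp
  obtain d where d: "j - i = int N * d" using assms by blast
  show ?thesis
  proof (cases "0 \<le> d")
    case True
    then have "j = i + int (nat d) * int N" using d by (simp add: algebra_simps)
    then show ?thesis using * by metis
  next
    case False
    then have "i = j + int (nat (- d)) * int N" using d by (simp add: algebra_simps)
    then show ?thesis using * by metis
  qed
qed

lemma block_eq_iff: "block i = block j \<longleftrightarrow> int N dvd j - i"
  using block_cong block_eq block_ne by (metis ex_in_conv)

lemma finite_blocks: "finite I \<Longrightarrow> finite (blocks I)" using block_fin by blast

lemma card_blocks: assumes "finite I" shows "card (blocks I) \<le> s * card I"
proof -
  have "card (blocks I) \<le> (\<Sum>i\<in>I. card (block i))" by (rule card_UN_le[OF assms])
  then show ?thesis by (simp add: block_card mult.commute)
qed

lemma gd_block: "x \<in> block i \<Longrightarrow> (x, y) \<in> E ^^ n \<Longrightarrow> \<exists>j. y \<in> block j \<and> \<bar>j - i\<bar> \<le> int n * int t"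
proof (induction n arbitrary: y)
  case (Suc n)
  then obtain z where z: "(x, z) \<in> E ^^ n" "(z, y) \<in> E" by auto
  then obtain j where j: "z \<in> block j" "\<bar>j - i\<bar> \<le> int n * int t" using Suc by blast
  obtain j' where "y \<in> block j'" "\<bar>j' - j\<bar> \<le> int t" using block_E j z by blast
  then show ?case using j by (intro exI[of _ j']) (auto simp: algebra_simps)
qed auto

lemma bl_block: assumes "x \<in> block i" "y \<in> bl x n" shows "\<exists>j. y \<in> block j \<and> \<bar>j - i\<bar> \<le> int n * int t"
proof -
  have "(x, y) \<in> E ^^ gd x y" "gd x y \<le> n" using assms block_V relpow_gd by (auto simp: bl_def)
  then obtain j where j: "y \<in> block j" "\<bar>j - i\<bar> \<le> int (gd x y) * int t" using gd_block assms by blast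
  have "int (gd x y) * int t \<le> int n * int t" using \<open>gd x y \<le> n\<close> by (intro mult_right_mono) auto
  then show ?thesis using j by (intro exI[of _ j]) auto
qed

text \<open>Indices are quantified explicitly because in a finite ring a vertex determines its block
  index only modulo \<open>N\<close>.\<close>

definition closed_on :: "int set \<Rightarrow> 'a set \<Rightarrow> bool" where
  "closed_on I X \<longleftrightarrow> (\<forall>x\<in>X. \<forall>y i j. x \<in> block i \<longrightarrow> i \<in> I \<longrightarrow> (x, y) \<in> E \<longrightarrow> y \<in> block j \<longrightarrow> j \<in> I \<longrightarrow> y \<in> X)"

lemma closed_onD: "closed_on I X \<Longrightarrow> x \<in> X \<Longrightarrow> x \<in> block i \<Longrightarrow> i \<in> I \<Longrightarrow> (x, y) \<in> E \<Longrightarrow> y \<in> block j \<Longrightarrow> j \<in> I \<Longrightarrow> y \<in> X"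
  unfolding closed_on_def by blast

lemma closed_on_free: 
  assumes "\<And>i. i \<in> I \<Longrightarrow> block i \<inter> bd A = {}" shows "closed_on I A" "closed_on I (V - A)"
  using assms E_V E_sym unfolding closed_on_def bd_def by blast+

text \<open>Each vertex has a neighbour exactly \<open>t\<close> blocks further on, so a set closed
  on an interval contains vertices along an arithmetic progression of indices.\<close>

lemma line_up:
  assumes "closed_on {b..<b'} X" "x \<in> X" "x \<in> block i" "b \<le> i"
  shows "i + int n * int t < b' \<Longrightarrow> \<exists>y\<in>X. y \<in> block (i + int n * int t)"
proof (induction n)
  case (Suc n)
  then obtain y where y: "y \<in> X" "y \<in> block (i + int n * int t)" by (auto simp: algebra_simps)
  obtain z where z: "z \<in> block (i + int n * int t + int t)" "(y, z) \<in> E" using block_up y by blast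
  have "0 \<le> int n * int t" by simp
  moreover have "int (Suc n) * int t = int n * int t + int t" by (simp add: algebra_simps)
  ultimately have "i + int n * int t \<in> {b..<b'}" "i + int n * int t + int t \<in> {b..<b'}"
    using assms(4) Suc(2) unfolding atLeastLessThan_iff by linarith+
  then have "z \<in> X" using closed_onD[OF assms(1) y _ z(2,1)] by blast
  then show ?case using z by (intro bexI[of _ z]) (auto simp: algebra_simps)
qed (use assms in auto)

lemma line_dn:
  assumes "closed_on {b..<b'} X" "x \<in> X" "x \<in> block i" "i < b'"
  shows "b \<le> i - int n * int t \<Longrightarrow> \<exists>y\<in>X. y \<in> block (i - int n * int t)"
proof (induction n)
  case (Suc n)
  then obtain y where y: "y \<in> X" "y \<in> block (i - int n * int t)" by (auto simp: algebra_simps)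
  obtain z where z: "z \<in> block (i - int n * int t - int t)" "(y, z) \<in> E" using block_dn y by blast
  have "0 \<le> int n * int t" by simp
  moreover have "int (Suc n) * int t = int n * int t + int t" by (simp add: algebra_simps)
  ultimately have "i - int n * int t \<in> {b..<b'}" "i - int n * int t - int t \<in> {b..<b'}"
    using assms(4) Suc(2) unfolding atLeastLessThan_iff by linarith+
  then have "z \<in> X" using closed_onD[OF assms(1) y _ z(2,1)] by blast
  then show ?case using z by (intro bexI[of _ z]) (auto simp: algebra_simps)
qed (use assms in auto)

text \<open>Lines advance in steps of \<open>t\<close>, so they hit every window of \<open>t\<close>
  consecutive indices.\<close>

lemma line_window:
  assumes c: "closed_on {b..<b'} X" and x: "x \<in> X" "x \<in> block i" "b \<le> i" "i < b'" and w: "b \<le> w" "w + int t \<le> b'"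
  shows "\<exists>y\<in>X. \<exists>j. y \<in> block j \<and> w \<le> j \<and> j < w + int t"
proof -
  define d where "d = (i - w) div int t"
  define j where "j = w + (i - w) mod int t"
  have j: "j = i - d * int t" "w \<le> j" "j < w + int t"
    using t_pos minus_div_mult_eq_mod[of "i - w" "int t"] by (simp_all add: j_def d_def)
  have "\<exists>y\<in>X. y \<in> block j"
  proof (cases "0 \<le> d")
    case True
    then show ?thesis using line_dn[OF c x(1,2,4), of "nat d"] j w by simp
  next
    case False
    then show ?thesis using line_up[OF c x(1,2,3), of "nat (- d)"] j w by simp
  qed
  then show ?thesis using j by blast
qed

text \<open>An edge changes the index by at most \<open>t\<close>, so from the inner interval it
  stays in the outer one, where \<open>X\<close> is closed.\<close>

lemma bd_closed:
  assumes c: "closed_on {b..<b + m} X" "X \<subseteq> V" and I': "I' = {b + int t..<b + m - int t}"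
  shows "bd (X \<inter> blocks I') \<subseteq> X \<inter> blocks ({b..<b + m} - I')"
proof
  fix y assume "y \<in> bd (X \<inter> blocks I')"
  then obtain x i where x: "x \<in> X" "x \<in> block i" "i \<in> I'" "(x, y) \<in> E" "y \<notin> X \<inter> blocks I'" by (auto simp: bd_def)
  obtain j where j: "y \<in> block j" "\<bar>j - i\<bar> \<le> int t" using block_E[OF x(2,4)] by blast
  then have "j \<in> {b..<b + m}" "i \<in> {b..<b + m}" using x(3) I' by auto
  then show "y \<in> X \<inter> blocks ({b..<b + m} - I')" using closed_onD[OF c(1) x(1,2) _ x(4) j(1)] x(5) j(1) by blast
qed

text \<open>If a long interval free of the boundary met both \<open>A\<close> and its complement, then the smaller of
  the two boundaries would contradict the minimality of \<open>q\<close>.\<close>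

lemma closed_deep:
  assumes c: "closed_on {b..<b + m} X" "X \<subseteq> V" and I': "I' = {b + int t..<b + m - int t}"
    and x: "x \<in> X \<inter> blocks {b..<b + m}"
  shows "a < card (bd (X \<inter> blocks I'))"
proof (rule ccontr)
  assume n: "\<not> a < card (bd (X \<inter> blocks I'))"
  \<comment> \<open>The central window starts after \<open>t\<close> blocks of margin and the
    \<open>t * a\<close> blocks that a ball of radius \<open>a\<close> can reach.\<close>
  let ?w = "b + int t + int t * int a" and ?Z = "X \<inter> blocks I'"
  have mm: "m = 3 * int t + 2 * (int t * int a)" by (simp add: m_def algebra_simps)
  have "0 \<le> int t * int a" by simp
  then obtain v j where v: "v \<in> X" "v \<in> block j" "?w \<le> j" "j < ?w + int t"
    using line_window[OF c(1), of x _ ?w] x mm by fastforce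
  have vV: "v \<in> V" using v block_V by blast
  have "j \<in> I'" using v mm \<open>0 \<le> int t * int a\<close> unfolding I' atLeastLessThan_iff by linarith
  then have "v \<in> ?Z" using v by blast
  moreover have "a < gd v y" if y: "y \<in> bd ?Z" for y
  proof (rule ccontr)
    assume "\<not> a < gd v y"
    then have "y \<in> bl v a" using y bd_V by (auto simp: bl_def)
    then obtain j' where j': "y \<in> block j'" "\<bar>j' - j\<bar> \<le> int a * int t" using bl_block v by blast
    then have "j' \<in> I'" using v mm by (auto simp: I' mult.commute)
    moreover have "y \<in> X" using y bd_closed[OF c I'] by blast
    ultimately show False using y j' bd_V by blast
  qed
  ultimately have bl: "bl v a \<subseteq> ?Z" using bl_out[of v ?Z a] vV by blast
  have fI: "finite I'" by (simp add: I')
  then have fin: "finite ?Z" using finite_blocks by blast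
  have "card ?Z \<le> card (blocks I')" using finite_blocks[OF fI] by (intro card_mono) auto
  also have "\<dots> \<le> s * card I'" using card_blocks fI by blast
  also have "card I' = t * (2 * a + 1)" unfolding I' using mm by (simp add: nat_eq_iff algebra_simps)
  finally have cZ: "card ?Z \<le> a * (2 * a + 1)" by (simp add: a_def algebra_simps)
  have "half ?Z" unfolding half_def
  proof
    assume "finite V"
    have "2 * a \<le> k" using a_q q_le_k by simp
    then have "2 * a * (2 * a + 1) \<le> k * (k + 1)" by (intro mult_mono) auto
    also have "\<dots> \<le> 31 * (k + 1)\<^sup>2" by (simp add: power2_eq_square)
    finally show "2 * card ?Z \<le> card V" using cZ card_V_long[OF \<open>finite V\<close>] by linarith
  qed
  moreover have "bl v (card (bd ?Z)) \<subseteq> ?Z" using bl bl_mono[of "card (bd ?Z)" a v] n by auto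
  ultimately have "?Z \<in> deep_sets" using c(2) fin vV by (auto simp: deep_sets_def)
  then show False using q_min n a_q a_pos by fastforce
qed

text \<open>The two boundaries of \<open>closed_deep\<close> are disjoint and lie in the margin.
  Each has more than \<open>a\<close> vertices, but the \<open>2 * t\<close> blocks of the margin
  have only \<open>2 * a\<close>.\<close>

lemma pure:
  assumes A: "A \<subseteq> V" and free: "\<And>i. i \<in> {b..<b + m} \<Longrightarrow> block i \<inter> bd A = {}"
  shows "blocks {b..<b + m} \<subseteq> A \<or> blocks {b..<b + m} \<inter> A = {}"
proof (rule ccontr)
  assume n: "\<not> ?thesis"
  let ?I = "{b..<b + m}" define I' where I': "I' = {b + int t..<b + m - int t}"
  obtain x where x: "x \<in> A \<inter> blocks ?I" using n by blast
  obtain y where y: "y \<in> (V - A) \<inter> blocks ?I" using n block_V by blast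
  note cl = closed_on_free[OF free]
  have 1: "a < card (bd (A \<inter> blocks I'))" using closed_deep[OF cl(1) A I' x] .
  have 2: "a < card (bd ((V - A) \<inter> blocks I'))" using closed_deep[OF cl(2) _ I' y] by blast
  have sub: "bd (A \<inter> blocks I') \<subseteq> A \<inter> blocks (?I - I')" "bd ((V - A) \<inter> blocks I') \<subseteq> (V - A) \<inter> blocks (?I - I')"
    using bd_closed[OF cl(1) A I'] bd_closed[OF cl(2) _ I'] by blast+
  have f: "finite (blocks (?I - I'))" by (rule finite_blocks) simp
  have "card (bd (A \<inter> blocks I')) + card (bd ((V - A) \<inter> blocks I')) = card (bd (A \<inter> blocks I') \<union> bd ((V - A) \<inter> blocks I'))"
    using sub f by (intro card_Un_disjoint[symmetric]) (auto intro: finite_subset)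
  also have "\<dots> \<le> card (blocks (?I - I'))" using sub f by (intro card_mono) auto
  also have "\<dots> \<le> s * card (?I - I')" by (rule card_blocks) simp
  also have "?I - I' = {b..<b + int t} \<union> {b + m - int t..<b + m}" unfolding I' using m_ge t_pos by auto
  also have "card \<dots> = t + t" using m_ge by (subst card_Un_disjoint) auto
  finally show False using 1 2 by (simp add: a_def algebra_simps)
qed

end

text \<open>The ring is cut open along an interval of blocks that \<open>A\<close> and its boundary avoid; for a finite
  graph the intervals at \<open>u\<close> and \<open>u'\<close> are the same one.\<close>

locale ring_cut = ring_graph +
  fixes A :: "'a set" and u u' :: int
  assumes A: "A \<subseteq> V" "finite A" "A \<noteq> {}" "half A" and cn_A: "cn (A \<union> bd A)"
    and turn: "N = 0 \<or> u' = u + int N"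
    and left: "i \<in> {u..<u + m} \<Longrightarrow> block i \<inter> (A \<union> bd A) = {}"
    and right: "i \<in> {u'..<u' + m} \<Longrightarrow> block i \<inter> (A \<union> bd A) = {}"
    and A_blocks: "A \<union> bd A \<subseteq> blocks {u..<u'}"
begin

lemma index_unique: 
  assumes "x \<in> block i" "x \<in> block j" "i \<in> {u..<u'}" "j \<in> {u..<u'}" shows "i = j"
proof (cases "N = 0")
  case True
  then show ?thesis using block_eq[OF assms(1,2)] by simp
next
  case False
  then have "\<bar>j - i\<bar> < int N" using turn assms by auto
  then show ?thesis using block_eq[OF assms(1,2)] zdvd_not_zless[of "\<bar>j - i\<bar>" "int N"] by auto
qed

lemma index_edge:
  assumes "x \<in> A \<union> bd A" "x \<in> block i" "i \<in> {u..<u'}" "y \<in> A \<union> bd A" "y \<in> block j" "j \<in> {u..<u'}" "(x, y) \<in> E"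
  shows "\<bar>j - i\<bar> \<le> int t"
proof -
  obtain j' where j': "y \<in> block j'" "\<bar>j' - i\<bar> \<le> int t" using block_E[OF assms(2,7)] by blast
  have "i \<notin> {u..<u + m}" "j' \<notin> {u'..<u' + m}" using left right assms j'(1) by blast+
  then have "j' \<in> {u..<u'}" using m_ge j'(2) assms(3) by auto
  then show ?thesis using index_unique[OF j'(1) assms(5) _ assms(6)] j'(2) by simp
qed

text \<open>\<open>A \<union> bd A\<close> is connected, so it contains an edge across the index
  \<open>c\<close>, and an edge changes the index by at most \<open>t\<close>.\<close>

lemma index_crossing:
  assumes "x \<in> A \<union> bd A" "x \<in> block i" "i \<in> {u..<c}" "y \<in> A \<union> bd A" "y \<in> block j" "c \<le> j" "j \<in> {u..<u'}"
  shows "\<exists>z\<in>A \<union> bd A. \<exists>j. z \<in> block j \<and> c \<le> j \<and> j < c + int t"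
proof -
  let ?X = "(A \<union> bd A) \<inter> blocks {u..<c}"
  have "x \<in> ?X" using assms by blast
  moreover have "y \<notin> ?X"
  proof
    assume "y \<in> ?X"
    then obtain j' where j': "y \<in> block j'" "j' \<in> {u..<c}" by blast
    then have "j' = j" using index_unique[OF j'(1) assms(5) _ assms(7)] assms(6,7) by auto
    then show False using j' assms by auto
  qed
  ultimately obtain z where z: "z \<in> bd ?X" "z \<in> A \<union> bd A"
    using cn_exit[OF cn_A assms(1,4), of ?X] by blast
  then obtain w where w: "w \<in> ?X" "(w, z) \<in> E" "z \<notin> ?X" by (auto simp: bd_def)
  then obtain i' where i': "w \<in> block i'" "i' \<in> {u..<c}" by blast
  obtain j' where j': "z \<in> block j'" "j' \<in> {u..<u'}" using z(2) A_blocks by blast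
  have "j' \<notin> {u..<c}" using w(3) j' z(2) by blast
  moreover have "\<bar>j' - i'\<bar> \<le> int t" using index_edge[OF _ i'(1) _ z(2) j' w(2)] w(1) i'(2) assms(6,7) by auto
  ultimately show ?thesis using z(2) j' i'(2) by (intro bexI[of _ z] exI[of _ j']) auto
qed

lemma card_index:
  assumes "finite X" "K \<subseteq> {u..<u'}" "\<And>i. i \<in> K \<Longrightarrow> block i \<inter> X \<noteq> {}"
  shows "card K \<le> card (X \<inter> blocks K)"
proof -
  let ?g = "\<lambda>x. SOME i. i \<in> K \<and> x \<in> block i"
  have "K \<subseteq> ?g ` (X \<inter> blocks K)"
  proof
    fix i assume i: "i \<in> K"
    then obtain x where x: "x \<in> block i" "x \<in> X" using assms(3) by blast
    have "?g x \<in> K \<and> x \<in> block (?g x)" by (rule someI[of "\<lambda>i. i \<in> K \<and> x \<in> block i"]) (use i x in auto)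
    then have "?g x = i" using index_unique[of x "?g x" i] x i assms(2) by blast
    then show "i \<in> ?g ` (X \<inter> blocks K)" using x i by blast
  qed
  then show ?thesis using assms(1) surj_card_le by blast
qed

section \<open>Counting between the blocks that meet the boundary\<close>

definition marks :: "int set" where "marks = {i \<in> {u..<u'}. block i \<inter> bd A \<noteq> {}}"

lemma marks: "finite marks" "marks \<noteq> {}" "marks \<subseteq> {u..<u'}" "card marks \<le> card (bd A)"
proof -
  show sub: "marks \<subseteq> {u..<u'}" by (auto simp: marks_def)
  then show f: "finite marks" by (rule finite_subset) simp
  obtain b where b: "b \<in> bd A" using bd_nonempty[OF A(1,2,4,3)] by blast
  then obtain i where "b \<in> block i" "i \<in> {u..<u'}" using A_blocks by blast
  with b show "marks \<noteq> {}" unfolding marks_def by blast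
  have fb: "finite (bd A)" using finite_bd A by blast
  have "card marks \<le> card (bd A \<inter> blocks marks)" by (rule card_index) (use fb in \<open>auto simp: marks_def\<close>)
  also have "\<dots> \<le> card (bd A)" using fb by (intro card_mono) auto
  finally show "card marks \<le> card (bd A)" .
qed

lemma marks_left: assumes "d \<in> marks" shows "u + m \<le> d"
proof (rule ccontr)
  assume "\<not> ?thesis"
  then have "d \<in> {u..<u + m}" using subsetD[OF marks(3) assms] by simp
  then have "block d \<inter> (A \<union> bd A) = {}" by (rule left)
  then have "block d \<inter> bd A = {}" by (simp add: Int_Un_distrib)
  then show False using assms by (simp add: marks_def)
qed

lemma marks_Min: "Min marks \<in> marks" "Min marks \<in> {u..<u'}" "i \<in> marks \<Longrightarrow> Min marks \<le> i"
  using Min_in[OF marks(1,2)] marks(3) Min_le[OF marks(1)] by blast+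

lemma marks_Max: "Max marks \<in> marks" "Max marks \<in> {u..<u'}" "i \<in> marks \<Longrightarrow> i \<le> Max marks"
  using Max_in[OF marks(1,2)] marks(3) Max_ge[OF marks(1)] by blast+

lemma not_marks: "i \<in> {u..<u'} \<Longrightarrow> i \<notin> marks \<Longrightarrow> block i \<inter> bd A = {}"
  by (simp add: marks_def)

text \<open>Beyond the extreme marks \<open>A\<close> is closed under edges, so a vertex of
  \<open>A\<close> there would, by \<open>line_window\<close>, force one into the free interval at
  \<open>u\<close> or \<open>u'\<close>.\<close>

lemma A_span: "A \<subseteq> blocks {Min marks..Max marks}"
proof
  fix x assume x: "x \<in> A"
  then obtain i where i: "x \<in> block i" "i \<in> {u..<u'}" using A_blocks by blast
  have l: "u + m \<le> Min marks" by (rule marks_left[OF marks_Min(1)])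
  have "Min marks \<le> i"
  proof (rule ccontr)
    assume n: "\<not> Min marks \<le> i"
    have "block i' \<inter> bd A = {}" if "i' \<in> {u..<Min marks}" for i'
      using that marks_Min(2) marks_Min(3)[of i'] by (intro not_marks) auto
    then have "closed_on {u..<Min marks} A" by (rule closed_on_free)
    then obtain y j where "y \<in> A" "y \<in> block j" "u \<le> j" "j < u + int t"
      using line_window[of u "Min marks" A x i u] x i n l m_ge by auto
    then show False using left[of j] m_ge by auto
  qed
  moreover have "i \<le> Max marks"
  proof (rule ccontr)
    assume n: "\<not> i \<le> Max marks"
    have "block i' \<inter> bd A = {}" if "i' \<in> {Max marks + 1..<u' + m}" for i'
    proof (cases "i' < u'")
      case True
      then show ?thesis using that marks_Max(2) marks_Max(3)[of i'] by (intro not_marks) auto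
    next
      case False
      then show ?thesis using right[of i'] that by auto
    qed
    then have "closed_on {Max marks + 1..<u' + m} A" by (rule closed_on_free)
    then obtain y j where "y \<in> A" "y \<in> block j" "u' \<le> j" "j < u' + int t"
      using line_window[of "Max marks + 1" "u' + m" A x i u'] x i n m_ge by auto
    then show False using right[of j] m_ge by auto
  qed
  ultimately show "x \<in> blocks {Min marks..Max marks}" using i by auto
qed

text \<open>A run shorter than \<open>t\<close> has at most \<open>a\<close> vertices, the marked
  block included. A run of length at least \<open>m\<close> lies in \<open>A\<close> by
  \<open>pure\<close>. In between, the run itself is short enough, and the vertices of
  \<open>A\<close> on one line in it make up for the excess.\<close>

lemma run_bound:
  assumes d: "d \<in> marks" and e: "d < e" "e \<le> u'" and run: "\<And>i. i \<in> {d + 1..<e} \<Longrightarrow> i \<notin> marks" and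
    e_end: "e = d + 1 \<or> e \<in> marks"
  shows "card (blocks {d..<e} - A) \<le> 2 * a * (a + 1)"
proof -
  let ?I = "{d + 1..<e}"
  define len where "len = nat (e - d - 1)"
  have len: "e = d + 1 + int len" using e by (simp add: len_def)
  have du: "d \<in> {u..<u'}" using d marks by blast
  have fB: "finite (blocks {d..<e})" by (rule finite_blocks) simp
  have cB: "card (blocks {d..<e}) \<le> s * (len + 1)" using card_blocks[of "{d..<e}"] len by (simp add: nat_add_distrib add.commute)
  have a2: "a \<le> 2 * a * (a + 1)" by simp
  show ?thesis
  proof (cases "len < t")
    case True
    then have "s * (len + 1) \<le> a" unfolding a_def by (intro mult_left_mono) auto
    moreover have "card (blocks {d..<e} - A) \<le> card (blocks {d..<e})" using fB by (intro card_mono) auto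
    ultimately show ?thesis using cB a2 by linarith
  next
    case False
    then have eD: "e \<in> marks" using e_end len t_pos by auto
    have free: "block i \<inter> bd A = {}" if "i \<in> ?I" for i using run[OF that] that e du by (intro not_marks) auto
    note cl = closed_on_free(1)[OF free]
    obtain x0 y0 where "x0 \<in> block d" "x0 \<in> bd A" "y0 \<in> block e" "y0 \<in> bd A" using d eD unfolding marks_def by blast
    \<comment> \<open>Connectedness of \<open>A \<union> bd A\<close> across the run yields a vertex
      among its first \<open>t\<close> blocks; these are free of the boundary, so it belongs to
      \<open>A\<close> and starts the line.\<close>
    obtain z j where z: "z \<in> A \<union> bd A" "z \<in> block j" "d + 1 \<le> j" "j < d + 1 + int t"
    proof -
      have "e \<in> {u..<u'}" using eD marks(3) by blast
      then show thesis using index_crossing[of x0 d "d + 1" y0 e] du e that \<open>x0 \<in> block d\<close> \<open>x0 \<in> bd A\<close> \<open>y0 \<in> block e\<close> \<open>y0 \<in> bd A\<close>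
        by auto
    qed
    then have j: "j \<in> ?I" using len False by auto
    have zA: "z \<in> A" using free[OF j] z by blast
    show ?thesis
    proof (cases "m \<le> int len")
      case True
      have "block i \<subseteq> A" if i: "i \<in> ?I" for i
      proof -
        \<comment> \<open>A window of length \<open>m\<close> that contains \<open>i\<close> and is
          pushed back where it would leave the run.\<close>
        define b where "b = (if i \<le> e - m then i else e - m)"
        have b: "d + 1 \<le> b" "b + m \<le> e" "i \<in> {b..<b + m}" using i True len m_ge by (auto simp: b_def)
        have "\<exists>y\<in>A. \<exists>j. y \<in> block j \<and> b \<le> j \<and> j < b + int t"
          by (rule line_window[OF cl zA z(2)]) (use j b m_ge in auto)
        then obtain y j' where y: "y \<in> A" "y \<in> block j'" "j' \<in> {b..<b + m}" using m_ge by force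
        have "blocks {b..<b + m} \<subseteq> A \<or> blocks {b..<b + m} \<inter> A = {}" by (rule pure[OF A(1) free]) (use b in auto)
        then show ?thesis using y b(3) by blast
      qed
      moreover have "i = d \<or> i \<in> ?I" if "i \<in> {d..<e}" for i using that by auto
      ultimately have "blocks {d..<e} - A \<subseteq> block d" by blast
      then have "card (blocks {d..<e} - A) \<le> s" using card_mono[OF block_fin] block_card by metis
      then show ?thesis using s_le_a a2 by linarith
    next
      case short: False
      \<comment> \<open>The line has \<open>w\<close> vertices in \<open>A\<close>, and the run with
        its mark has at most \<open>a * (w + 1)\<close> vertices. Since
        \<open>w \<le> 2 * a + 2\<close>, the difference \<open>(a - 1) * w + a\<close> is at most
        \<open>2 * a * (a + 1)\<close>.\<close>
      define w where "w = len div t"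
      have w: "w * t \<le> len" "len + 1 \<le> (w + 1) * t"
      proof -
        have "len = w * t + len mod t" by (simp add: w_def)
        moreover have "len mod t < t" using t_pos by simp
        ultimately show "w * t \<le> len" "len + 1 \<le> (w + 1) * t" unfolding distrib_right by linarith+
      qed
      have "m = int ((2 * a + 3) * t)" by (simp add: m_def algebra_simps)
      then have "len < (2 * a + 3) * t" using short by linarith
      then have "w < 2 * a + 3" unfolding w_def using t_pos by (simp add: div_less_iff_less_mult)
      define K where "K = (\<lambda>n. j + int n * int t) ` {..<w}"
      have K: "j + int n * int t < e" if "n < w" for n
      proof -
        have "(n + 1) * t \<le> w * t" using that by (intro mult_right_mono) auto
        then have "int n * int t + int t \<le> int len" using w(1) by (simp add: algebra_simps flip: of_nat_mult of_nat_add)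
        then show ?thesis using z(4) len by linarith
      qed
      have "d + 1 \<le> j + int n * int t" for n using z(3) by (rule order_trans) simp
      then have K_I: "K \<subseteq> ?I" using K by (auto simp: K_def)
      have "inj_on (\<lambda>n. j + int n * int t) {..<w}" using t_pos by (auto simp: inj_on_def)
      then have "w = card K" by (simp add: K_def card_image)
      also have "\<dots> \<le> card (A \<inter> blocks K)"
      proof (rule card_index)
        show "K \<subseteq> {u..<u'}" using K_I du e by auto
        fix i assume "i \<in> K"
        then obtain n where "i = j + int n * int t" "n < w" by (auto simp: K_def)
        then show "block i \<inter> A \<noteq> {}" using line_up[OF cl zA z(2,3) K[of n]] by blast
      qed (rule A)
      also have "\<dots> \<le> card (A \<inter> blocks {d..<e})" using K_I A by (intro card_mono) force+
      finally have wA: "w \<le> card (A \<inter> blocks {d..<e})" .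
      have "card (blocks {d..<e}) = card (blocks {d..<e} - A) + card (A \<inter> blocks {d..<e})"
        using fB card_Diff_subset_Int[of "blocks {d..<e}" A] card_mono[OF fB, of "blocks {d..<e} \<inter> A"]
        by (simp add: Int_commute)
      moreover have "s * (len + 1) \<le> a * (w + 1)" using mult_left_mono[OF w(2), of s] by (simp add: a_def ac_simps)
      moreover have "a * (w + 1) \<le> 2 * a * (a + 1) + w"
      proof -
        obtain a' where a': "a = Suc a'" using a_pos by (cases a) auto
        have "a' * w \<le> a' * (2 * a + 2)" using \<open>w < 2 * a + 3\<close> by (intro mult_left_mono) auto
        then show ?thesis unfolding a' by (simp add: algebra_simps)
      qed
      ultimately show ?thesis using wA cB by linarith
    qed
  qed
qed

text \<open>The span from the first to the last mark is covered by runs, one for each mark, and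
  there are at most \<open>card (bd A)\<close> marks.\<close>

lemma ring_interval:
  "\<exists>l r. l \<le> r \<and> {l..r} \<subseteq> {u..<u'} \<and> A \<subseteq> blocks {l..r} \<and> card (blocks {l..r} - A) \<le> card (bd A) * (2 * a * (a + 1))"
proof (intro exI conjI)
  let ?l = "Min marks" and ?r = "Max marks"
  show lr: "?l \<le> ?r" "{?l..?r} \<subseteq> {u..<u'}" using marks_Min(1,2) marks_Max(2) marks_Max(3)[of ?l] by auto
  show "A \<subseteq> blocks {?l..?r}" by (rule A_span)
  \<comment> \<open>The run of the last mark consists of its own block.\<close>
  define nx where "nx d = (if d = ?r then ?r + 1 else Min {e \<in> marks. d < e})" for d
  have nx: "d < nx d \<and> nx d \<le> u' \<and> (\<forall>i\<in>{d + 1..<nx d}. i \<notin> marks) \<and> (nx d = d + 1 \<or> nx d \<in> marks)" if d: "d \<in> marks" for d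
  proof (cases "d = ?r")
    case True
    then show ?thesis using marks_Max(2) by (simp add: nx_def)
  next
    case False
    let ?S = "{e \<in> marks. d < e}"
    define M where "M = Min ?S"
    have "?r \<in> ?S" using False marks_Max(1) marks_Max(3)[OF d] by simp
    then have S: "M \<in> ?S" unfolding M_def using marks(1) by (intro Min_in) auto
    have "i \<notin> marks" if "i \<in> {d + 1..<M}" for i
    proof
      assume "i \<in> marks"
      then have "M \<le> i" unfolding M_def using marks(1) that by (intro Min_le) auto
      then show False using that by simp
    qed
    moreover have "M \<in> {u..<u'}" using S marks(3) by blast
    moreover have "nx d = M" using False by (simp add: nx_def M_def)
    ultimately show ?thesis using S by simp
  qed
  have "blocks {?l..?r} - A \<subseteq> (\<Union>d\<in>marks. blocks {d..<nx d} - A)"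
  proof
    fix x assume "x \<in> blocks {?l..?r} - A"
    then obtain i where i: "x \<in> block i" "?l \<le> i" "i \<le> ?r" "x \<notin> A" by auto
    let ?S = "{e \<in> marks. e \<le> i}"
    define M where "M = Max ?S"
    have "?l \<in> ?S" using marks_Min(1) i by simp
    then have S: "M \<in> ?S" unfolding M_def using marks(1) by (intro Max_in) auto
    have "i < nx M"
    proof (rule ccontr)
      assume n: "\<not> i < nx M"
      have "M < nx M" using nx S by blast
      then have "M \<noteq> ?r" using n i(3) by (auto simp: nx_def)
      then have "nx M = Min {e \<in> marks. M < e}" by (simp add: nx_def)
      moreover have "?r \<in> {e \<in> marks. M < e}" using \<open>M \<noteq> ?r\<close> marks_Max(1) marks_Max(3)[of M] S by simp
      then have "Min {e \<in> marks. M < e} \<in> {e \<in> marks. M < e}" using marks(1) by (intro Min_in) auto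
      ultimately have "nx M \<in> ?S" using n by simp
      then have "nx M \<le> M" unfolding M_def using marks(1) by (intro Max_ge) auto
      then show False using \<open>M < nx M\<close> by simp
    qed
    moreover have "M \<in> marks" "M \<le> i" using S by auto
    ultimately show "x \<in> (\<Union>d\<in>marks. blocks {d..<nx d} - A)" using i by (intro UN_I[of M]) auto
  qed
  moreover have "finite (\<Union>d\<in>marks. blocks {d..<nx d} - A)" using marks(1) finite_blocks by (intro finite_UN_I finite_Diff) auto
  ultimately have "card (blocks {?l..?r} - A) \<le> card (\<Union>d\<in>marks. blocks {d..<nx d} - A)" by (intro card_mono)
  also have "\<dots> \<le> (\<Sum>d\<in>marks. card (blocks {d..<nx d} - A))" using marks(1) by (intro card_UN_le) auto
  also have "\<dots> \<le> (\<Sum>d\<in>marks. 2 * a * (a + 1))" using nx by (intro sum_mono run_bound) auto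
  also have "\<dots> \<le> card (bd A) * (2 * a * (a + 1))" using marks(4) by (simp add: mult_le_mono1)
  finally show "card (blocks {?l..?r} - A) \<le> card (bd A) * (2 * a * (a + 1))" .
qed

end

context ring_graph
begin

lemma N_infinite: "N = 0 \<longleftrightarrow> infinite V"
proof
  assume N: "N = 0"
  have "inj block" using block_eq_iff N by (auto simp: inj_def)
  then have "infinite (range block)" using finite_imageD infinite_UNIV_int by blast
  moreover have "range block \<subseteq> Pow V" using block_V by blast
  ultimately show "infinite V" using finite_subset by auto
next
  assume i: "infinite V"
  show "N = 0"
  proof (rule ccontr)
    assume N: "N \<noteq> 0"
    have "V \<subseteq> blocks {0..<int N}"
    proof
      fix x assume "x \<in> V"
      then obtain i where "x \<in> block i" using block_UN by blast
      moreover have "block i = block (i mod int N)" by (rule block_cong) (simp add: mod_eq_dvd_iff[symmetric])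
      ultimately show "x \<in> blocks {0..<int N}" using N by force
    qed
    then show False using i finite_blocks[of "{0..<int N}"] finite_subset by blast
  qed
qed

lemma V_turn: assumes "N \<noteq> 0" shows "V = blocks {u..<u + int N}"
proof -
  have "x \<in> blocks {u..<u + int N}" if x: "x \<in> V" for x
  proof -
    obtain i where i: "x \<in> block i" using block_UN x by blast
    let ?j = "u + (i - u) mod int N"
    have "int N dvd ?j - i" using mod_eq_dvd_iff[of "(i - u) mod int N" "int N" "i - u"] by (simp add: algebra_simps)
    then have "x \<in> block ?j" using i block_eq_iff dvd_diff_commute by blast
    then show ?thesis using assms by (intro UN_I[of ?j]) auto
  qed
  then show ?thesis using block_V by blast
qed

text \<open>Otherwise, by \<open>pure\<close>, every vertex outside \<open>A\<close> would lie fewer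
  than \<open>m\<close> blocks before a boundary vertex. This would bound \<open>V\<close> by
  \<open>2 * (k * (a * (2 * a + 3)))\<close>, less than \<open>card_V_spheres\<close>
  allows.\<close>

lemma free_interval:
  assumes A: "A \<subseteq> V" "half A" "card (bd A) \<le> k" "finite (bd A)" and fV: "finite V"
  shows "\<exists>u. \<forall>i\<in>{u..<u + m}. block i \<inter> (A \<union> bd A) = {}"
proof (rule ccontr)
  assume n: "\<not> ?thesis"
  obtain g where g: "\<And>b. b \<in> V \<Longrightarrow> b \<in> block (g b)" using block_UN by (metis UN_iff)
  have "V - A \<subseteq> (\<Union>b\<in>bd A. blocks {g b - m<..g b})"
  proof
    fix x assume x: "x \<in> V - A"
    then have gx: "x \<in> block (g x)" using g by blast
    let ?I = "{g x..<g x + m}"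
    have "\<exists>i\<in>?I. block i \<inter> bd A \<noteq> {}"
    proof (rule ccontr)
      assume f: "\<not> ?thesis"
      then have "blocks ?I \<subseteq> A \<or> blocks ?I \<inter> A = {}" using pure[OF A(1)] by blast
      moreover have "x \<in> blocks ?I" using gx m_ge by force
      ultimately have "blocks ?I \<inter> A = {}" using x by blast
      then show False using n f by blast
    qed
    then obtain i b where i: "i \<in> ?I" "b \<in> block i" "b \<in> bd A" by blast
    have "int N dvd i - g b" using block_eq[of b "g b" i] g i bd_V by blast
    then have "int N dvd g b - i" by (rule dvd_diff_commute[THEN iffD1])
    then have "int N dvd (g x + (g b - i)) - g x" by simp
    then have "x \<in> block (g x + (g b - i))" using gx block_eq_iff by blast
    then show "x \<in> (\<Union>b\<in>bd A. blocks {g b - m<..g b})" 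
      using i by (intro UN_I[of b] UN_I[of "g x + (g b - i)"]) auto
  qed
  then have "card (V - A) \<le> card (\<Union>b\<in>bd A. blocks {g b - m<..g b})"
    using A(4) finite_blocks by (intro card_mono) auto
  also have "\<dots> \<le> (\<Sum>b\<in>bd A. card (blocks {g b - m<..g b}))" using A(4) by (rule card_UN_le)
  also have "\<dots> \<le> (\<Sum>b\<in>bd A. s * nat m)" 
  proof (rule sum_mono)
    show "card (blocks {g b - m<..g b}) \<le> s * nat m" for b using card_blocks[of "{g b - m<..g b}"] by simp
  qed
  also have "\<dots> \<le> k * (s * nat m)" using A(3) by (simp add: mult_le_mono1)
  also have "s * nat m = a * (2 * a + 3)" by (simp add: m_def a_def nat_mult_distrib nat_add_distrib)
  finally have "card (V - A) \<le> k * (a * (2 * a + 3))" .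
  moreover have "card V \<le> 2 * card (V - A)" using A fV card_Diff_subset[OF finite_subset[OF A(1) fV] A(1)] by (simp add: half_def)
  ultimately have 1: "card V \<le> 2 * (k * (a * (2 * a + 3)))" by linarith
  have "2 * (k * (a * (2 * a + 3))) = (2 * a) * (k * (2 * a + 3))" by simp
  also have "\<dots> \<le> q * (k * (k + 3))" using a_q q_le_k by (intro mult_mono) auto
  also have "\<dots> < q * (15 * (k + 1)\<^sup>2 - k)" using q_pos
    by (intro mult_strict_left_mono) (simp_all add: power2_eq_square algebra_simps)
  also have "\<dots> \<le> q * (15 * (k + 1)\<^sup>2 - q)" using q_le_k by (intro mult_left_mono) auto
  finally show False using 1 card_V_spheres[OF fV] by linarith
qed

text \<open>A finite ring is opened at a free interval, with \<open>u'\<close> the same place one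
  turn later. In an infinite ring only finitely many indices are occupied, and there are free
  intervals before and after them.\<close>

lemma ring_cut_ex:
  assumes A: "A \<subseteq> V" "finite A" "A \<noteq> {}" "half A" "cn (A \<union> bd A)" "card (bd A) \<le> k"
  shows "\<exists>u u'. ring_cut V E k A0 block N s t A u u'"
proof (cases "N = 0")
  case False
  have fb: "finite (bd A)" using finite_bd A by blast
  obtain u where u: "\<And>i. i \<in> {u..<u + m} \<Longrightarrow> block i \<inter> (A \<union> bd A) = {}"
    using free_interval[OF A(1,4,6) fb] False N_infinite by blast
  have "block i \<inter> (A \<union> bd A) = {}" if "i \<in> {u + int N..<u + int N + m}" for i
    using u[of "i - int N"] that block_per[of "i - int N"] by auto
  moreover have "A \<union> bd A \<subseteq> blocks {u..<u + int N}" using V_turn[OF False, of u] A bd_V by blast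
  ultimately have "ring_cut V E k A0 block N s t A u (u + int N)" using A u by unfold_locales auto
  then show ?thesis by blast
next
  case True
  let ?H = "A \<union> bd A"
  define K where "K = {i. block i \<inter> ?H \<noteq> {}}"
  have "?H \<subseteq> V" using A bd_V by blast
  then have K_ne: "K \<noteq> {}" using A block_UN by (fastforce simp: K_def)
  have "K = (\<Union>x\<in>?H. {i. x \<in> block i})" by (auto simp: K_def)
  moreover have "finite {i. x \<in> block i}" for x
  proof (cases "{i. x \<in> block i} = {}")
    case False
    then obtain i where "x \<in> block i" by blast
    then have "j = i" if "x \<in> block j" for j using block_eq[OF _ that, of i] True by simp
    then have "{i. x \<in> block i} \<subseteq> {i}" by blast
    then show ?thesis using finite_subset by blast
  qed simp
  ultimately have fK: "finite K" using A finite_bd by auto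
  have K: "block i \<inter> ?H = {}" if "i < Min K \<or> Max K < i" for i
  proof -
    have "i \<notin> K"
    proof
      assume "i \<in> K"
      then show False using that Min_le[OF fK, of i] Max_ge[OF fK, of i] by linarith
    qed
    then show ?thesis unfolding K_def by blast
  qed
  have "?H \<subseteq> blocks {Min K - m..<Max K + 1}"
  proof
    fix x assume x: "x \<in> ?H"
    then obtain i where i: "x \<in> block i" using block_UN \<open>?H \<subseteq> V\<close> by blast
    then have "i \<in> K" using x by (auto simp: K_def)
    show "x \<in> blocks {Min K - m..<Max K + 1}" using i Min_le[OF fK \<open>i \<in> K\<close>] Max_ge[OF fK \<open>i \<in> K\<close>] m_ge
      by (intro UN_I[of i]) auto
  qed
  then have "ring_cut V E k A0 block N s t A (Min K - m) (Max K + 1)" using A True K by unfold_locales auto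
  then show ?thesis by blast
qed

end

context ring_cut
begin

section \<open>The cyclic system formed by the blocks\<close>

lemma N_large: "N = 0 \<or> 5 < N"
proof (cases "N = 0")
  case False
  \<comment> \<open>A free interval of length \<open>m \<ge> 5\<close> and a marked block fit into
    one turn, which is more than the three blocks that a cycle requires.\<close>
  have "u + m \<le> Min marks" "Min marks < u'" using marks_left[OF marks_Min(1)] marks_Min(2) by auto
  then show ?thesis using turn False m_ge by auto
qed simp

definition next_rel :: "'a set rel" where "next_rel = {(B, C). \<exists>i. B = block i \<and> C = block (i + 1) \<or> B = block (i + 1) \<and> C = block i}"

lemma next_rel_iff: "(block i, block j) \<in> next_rel \<longleftrightarrow> int N dvd j - (i + 1) \<or> int N dvd i - (j + 1)"
proof
  assume "(block i, block j) \<in> next_rel"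
  then obtain n where "block i = block n \<and> block j = block (n + 1) \<or> block i = block (n + 1) \<and> block j = block n" by (auto simp: next_rel_def)
  moreover have "block j = block (n + 1) \<Longrightarrow> block i = block n \<Longrightarrow> int N dvd j - (i + 1)"
    using dvd_diff[of "int N" "n - i" "n + 1 - j"] dvd_diff_commute[of "int N" "i + 1" j]
    unfolding block_eq_iff by (simp add: algebra_simps)
  moreover have "block i = block (n + 1) \<Longrightarrow> block j = block n \<Longrightarrow> int N dvd i - (j + 1)"
    using dvd_diff[of "int N" "n - j" "n + 1 - i"] dvd_diff_commute[of "int N" "j + 1" i]
    unfolding block_eq_iff by (simp add: algebra_simps)
  ultimately show "int N dvd j - (i + 1) \<or> int N dvd i - (j + 1)" by blast
next
  assume "int N dvd j - (i + 1) \<or> int N dvd i - (j + 1)"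
  then have "block (i + 1) = block j \<or> block (j + 1) = block i" using block_cong by blast
  then show "(block i, block j) \<in> next_rel" by (auto simp: next_rel_def)
qed

lemma next_rel_suc: "(block i, block (i + 1)) \<in> next_rel" "(block (i + 1), block i) \<in> next_rel"
  by (auto simp: next_rel_def)

lemma next_rel_cyclic_order: "cyclic_order (range block) next_rel"
  unfolding cyclic_order_def
proof
  show "simple_graph (range block) next_rel" unfolding simple_graph_def
  proof (intro conjI)
    show "next_rel \<subseteq> range block \<times> range block" "sym next_rel" by (auto simp: next_rel_def sym_def)
    show "irrefl next_rel"
    proof (rule irreflI)
      fix B show "(B, B) \<notin> next_rel"
      proof
        assume "(B, B) \<in> next_rel"
        then obtain i where "block i = block (i + 1)" by (auto simp: next_rel_def)
        then have "int N dvd 1" unfolding block_eq_iff by simp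
        then show False using N_large by auto
      qed
    qed
  qed
  show "is_cycle (range block) next_rel \<or> is_two_way_infinite_path (range block) next_rel"
  proof (cases "N = 0")
    case True
    have "inj block" using block_eq_iff True by (auto simp: inj_def)
    then have "bij_betw block UNIV (range block)" by (simp add: bij_betw_def)
    moreover have "(block i, block j) \<in> next_rel \<longleftrightarrow> j = i + 1 \<or> i = j + 1" for i j unfolding next_rel_iff using True by auto
    ultimately show ?thesis unfolding is_two_way_infinite_path_def by blast
  next
    case False
    let ?f = "\<lambda>i::nat. block (int i)"
    have eq: "int N dvd int y - int x \<longleftrightarrow> y mod N = x mod N" for x y
      by (metis mod_eq_dvd_iff of_nat_eq_iff of_nat_mod)
    have "inj_on ?f {0..<N}"
      by (rule inj_onI) (simp add: block_eq_iff eq)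
    moreover have "?f ` {0..<N} = range block"
    proof
      show "range block \<subseteq> ?f ` {0..<N}"
      proof
        fix B assume "B \<in> range block"
        then obtain i where i: "B = block i" by blast
        have "int N dvd i - i mod int N" by (simp add: minus_mod_eq_mult_div)
        then have "block (i mod int N) = block i" by (rule block_cong)
        then have "B = ?f (nat (i mod int N))" using i False by simp
        moreover have "nat (i mod int N) \<in> {0..<N}" using False by (simp add: nat_less_iff)
        ultimately show "B \<in> ?f ` {0..<N}" by blast
      qed
    qed auto
    moreover have "(?f i, ?f j) \<in> next_rel \<longleftrightarrow> j = (i + 1) mod N \<or> i = (j + 1) mod N" if "i < N" "j < N" for i j
      using eq[of j "i + 1"] eq[of i "j + 1"] that unfolding next_rel_iff by (simp add: add.commute)
    ultimately show ?thesis unfolding is_cycle_def bij_betw_def using N_large False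
      by (intro disjI1 exI[of _ N] conjI exI[of _ ?f]) auto
  qed
qed

lemma next_rel_cyclic_system: "cyclic_system V E (range block) next_rel"
  unfolding cyclic_system_def imprimitivity_system_def
proof (intro conjI allI impI next_rel_cyclic_order)
  show "partition_on V (range block)"
  proof (rule partition_onI)
    show "\<Union>(range block) = V" by (rule block_UN)
    fix B C assume "B \<in> range block" "C \<in> range block" "B \<noteq> C"
    then obtain i j where ij: "B = block i" "C = block j" "\<not> int N dvd j - i" using block_eq_iff by blast
    then show "disjnt B C" unfolding disjnt_def using block_eq[of _ i j] by blast
  qed (use block_ne in auto)
  fix \<phi> assume "aut \<phi>"
  from block_aut[OF this] obtain \<epsilon> n where "\<epsilon> \<in> {1, -1}" "\<forall>i. \<phi> ` block i = block (\<epsilon> * i + n)"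
    by (elim bexE exE)
  then have e: "\<epsilon> = 1 \<or> \<epsilon> = -1" "\<phi> ` block i = block (\<epsilon> * i + n)" for i by auto
  show "\<forall>B\<in>range block. \<phi> ` B \<in> range block" by (simp add: e(2))
  have "(\<phi> ` block i, \<phi> ` block (i + 1)) \<in> next_rel \<and> (\<phi> ` block (i + 1), \<phi> ` block i) \<in> next_rel" for i
    using next_rel_suc[of "\<epsilon> * i + n"] next_rel_suc[of "\<epsilon> * i + n - 1"] e(1) unfolding e(2) by (auto simp: algebra_simps)
  then show "\<forall>(B, C)\<in>next_rel. (\<phi> ` B, \<phi> ` C) \<in> next_rel" by (auto simp: next_rel_def)
qed

lemma next_rel_relpow: "(block i, block (i + int n)) \<in> next_rel ^^ n \<and> (block (i + int n), block i) \<in> next_rel ^^ n"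
proof (induction n)
  case (Suc n)
  have "(block (i + int n), block (i + int (Suc n))) \<in> next_rel" "(block (i + int (Suc n)), block (i + int n)) \<in> next_rel"
    using next_rel_suc[of "i + int n"] by (simp_all add: ac_simps)
  then show ?case using Suc relpow_Suc_I relpow_Suc_I2 by metis
qed simp

lemma next_rel_ring_like: "ring_like E (range block) next_rel s t"
  unfolding ring_like_def
proof (intro conjI ballI impI)
  fix B C x y assume "B \<in> range block" "C \<in> range block" "x \<in> B" "y \<in> C" "(x, y) \<in> E"
  then obtain i j where ij: "B = block i" "C = block j" "x \<in> block i" "y \<in> block j" by blast
  then obtain j' where j': "y \<in> block j'" "\<bar>j' - i\<bar> \<le> int t" using block_E \<open>(x, y) \<in> E\<close> by blast
  have "C = block j'" using block_cong block_eq ij j' by blast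
  define n where "n = nat \<bar>j' - i\<bar>"
  have "(block i, block j') \<in> next_rel ^^ n"
    using next_rel_relpow[of i n] next_rel_relpow[of j' n] by (cases "i \<le> j'") (auto simp: n_def)
  then have "gdist next_rel B C \<le> enat n" unfolding gdist_def ij(1) \<open>C = block j'\<close> by (intro INF_lower) simp
  also have "\<dots> \<le> enat t" using j' by (simp add: n_def)
  finally show "gdist next_rel B C \<le> enat t" .
qed (use block_fin block_card in auto)

lemma ring_result:
  "\<exists>\<sigma> R. cyclic_system V E \<sigma> R \<and> ring_like E \<sigma> R s t \<and>
    (\<exists>J. cyclic_interval \<sigma> R J \<and> A \<subseteq> \<Union>J \<and> card (\<Union>J - A) \<le> card (bd A) * (2 * a * (a + 1)))"
proof -
  obtain l r where lr: "l \<le> r" "{l..r} \<subseteq> {u..<u'}" "A \<subseteq> blocks {l..r}"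
    "card (blocks {l..r} - A) \<le> card (bd A) * (2 * a * (a + 1))" using ring_interval by blast
  have "inj_on block {l..r}"
  proof (rule inj_onI)
    fix i j assume ij: "i \<in> {l..r}" "j \<in> {l..r}" "block i = block j"
    obtain x where "x \<in> block i" using block_ne by blast
    then show "i = j" using index_unique[of x i j] ij lr(2) by blast
  qed
  then have "distinct (map block [l..r])" by (simp add: distinct_map)
  moreover have "successively (\<lambda>x y. (x, y) \<in> next_rel) (map block [l..r])"
    unfolding successively_conv_nth using next_rel_suc(1)[of "l + int _"] by (auto simp: ac_simps)
  ultimately have "cyclic_interval (range block) next_rel (block ` {l..r})" unfolding cyclic_interval_def
    using lr(1) by (intro conjI exI[of _ "map block [l..r]"]) auto
  then show ?thesis using lr(3,4) next_rel_cyclic_system next_rel_ring_like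
    by (intro exI[of _ "range block"] exI[of _ next_rel] exI[of _ "block ` {l..r}"] conjI) auto
qed

end

context deep_graph
begin

lemma deep_result:
  assumes A: "A \<subseteq> V" "finite A" "A \<noteq> {}" "half A" "cn (A \<union> bd A)" "card (bd A) \<le> k"
  shows "\<exists>s t::nat. 0 < s \<and> 0 < t \<and> 2 * (s * t) \<le> k \<and> (\<exists>\<sigma> R. cyclic_system V E \<sigma> R \<and> ring_like E \<sigma> R s t \<and>
    (\<exists>J. cyclic_interval \<sigma> R J \<and> A \<subseteq> \<Union>J \<and> 2 * card (\<Union>J - A) \<le> k ^ 3 + 2 * k ^ 2))"
proof -
  obtain block N s t where "ring_graph V E k A0 block N s t" using ring_ex by blast
  then interpret G: ring_graph V E k A0 block N s t .
  obtain u u' where "ring_cut V E k A0 block N s t A u u'" using G.ring_cut_ex A by blast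
  then interpret H: ring_cut V E k A0 block N s t A u u' .
  obtain \<sigma> R J where J: "cyclic_system V E \<sigma> R" "ring_like E \<sigma> R s t" "cyclic_interval \<sigma> R J" "A \<subseteq> \<Union>J"
    "card (\<Union>J - A) \<le> card (bd A) * (2 * G.a * (G.a + 1))" using H.ring_result by blast
  have a: "2 * G.a \<le> k" using G.a_q q_le_k by linarith
  \<comment> \<open>Written with \<open>2 * a\<close> twice, so that \<open>2 * a \<le> k\<close>
    yields \<open>k * (k * (k + 2))\<close>.\<close>
  have "2 * card (\<Union>J - A) \<le> k * (2 * G.a * (2 * G.a + 2))"
  proof -
    have "card (\<Union>J - A) \<le> k * (2 * G.a * (G.a + 1))" using J(5) mult_le_mono1[OF A(6)] by (rule order_trans)
    then show ?thesis by (simp add: algebra_simps)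
  qed
  also have "\<dots> \<le> k * (k * (k + 2))" using a by (intro mult_le_mono) auto
  finally have "2 * card (\<Union>J - A) \<le> k ^ 3 + 2 * k ^ 2" by (simp add: power3_eq_cube power2_eq_square algebra_simps)
  then show ?thesis using J(1-4) G.s_pos G.t_pos a unfolding G.a_def by blast
qed

end

section \<open>Atoms and the degree\<close>

context vt_graph
begin

definition outer :: "'a set \<Rightarrow> 'a set" where "outer X = V - (X \<union> bd X)"

text \<open>Only the separated set is required to be finite; its outer set may be infinite.\<close>

definition separating :: "'a set \<Rightarrow> bool" where
  "separating X \<longleftrightarrow> X \<subseteq> V \<and> finite X \<and> X \<noteq> {} \<and> outer X \<noteq> {}"

text \<open>The vertex connectivity with respect to cuts that have a finite side.\<close>

definition connectivity :: nat where "connectivity = (LEAST n. \<exists>X. separating X \<and> card (bd X) = n)"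

definition atom :: "'a set \<Rightarrow> bool" where
  "atom F \<longleftrightarrow> separating F \<and> card (bd F) = connectivity \<and> (\<forall>X. separating X \<longrightarrow> card (bd X) = connectivity \<longrightarrow> card F \<le> card X)"

lemma connectivity_min: "separating X \<Longrightarrow> connectivity \<le> card (bd X)"
  unfolding connectivity_def by (rule Least_le) blast

lemma separating_sub: "separating F \<Longrightarrow> X \<subseteq> F \<Longrightarrow> X \<noteq> {} \<Longrightarrow> separating X"
proof -
  assume a: "separating F" "X \<subseteq> F" "X \<noteq> {}"
  have "outer F \<subseteq> outer X" using a(2) unfolding outer_def bd_def by blast
  then show ?thesis using a finite_subset[of X F] unfolding separating_def by blast
qed

lemma atom_proper: 
  assumes "atom F" "X \<subset> F" "X \<noteq> {}" shows "connectivity < card (bd X)"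
proof -
  have "separating X" "finite F" using assms separating_sub[of F X] by (auto simp: atom_def separating_def)
  then have "connectivity \<le> card (bd X)" "card X < card F" using connectivity_min assms(2) psubset_card_mono by auto
  moreover have "card (bd X) = connectivity \<Longrightarrow> card F \<le> card X" using assms(1) \<open>separating X\<close> by (simp add: atom_def)
  ultimately show ?thesis by linarith
qed

lemma atom_ex: assumes "separating A" shows "\<exists>F. atom F"
proof -
  have "\<exists>X. separating X \<and> card (bd X) = connectivity" unfolding connectivity_def by (rule LeastI_ex) (use assms in blast)
  then obtain X where X: "separating X \<and> card (bd X) = connectivity" by blast
  show ?thesis
    using ex_has_least_nat[of "\<lambda>X. separating X \<and> card (bd X) = connectivity" X card] X unfolding atom_def by blast
qed

lemma separating_aut: assumes "aut \<phi>" "separating F" shows "separating (\<phi> ` F)"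
proof -
  have F: "F \<subseteq> V" "finite F" "F \<noteq> {}" "outer F \<noteq> {}" using assms by (auto simp: separating_def)
  have "F \<union> bd F \<subseteq> V" using F bd_V by blast
  then have "\<phi> ` outer F = V - \<phi> ` (F \<union> bd F)" 
    unfolding outer_def using aut_image_Diff[OF assms(1) subset_refl] aut_image_V[OF assms(1)] by simp
  also have "\<dots> = outer (\<phi> ` F)" unfolding outer_def image_Un aut_bd[OF assms(1) F(1)] ..
  finally show ?thesis using F aut_V[OF assms(1)] by (auto simp: separating_def)
qed

lemma atom_aut: assumes "aut \<phi>" "atom F" shows "atom (\<phi> ` F)"
proof -
  have "F \<subseteq> V" "bd F \<subseteq> V" using assms bd_V by (auto simp: atom_def separating_def)
  then have "card (bd (\<phi> ` F)) = card (bd F)" "card (\<phi> ` F) = card F"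
    using aut_bd[OF assms(1)] aut_card[OF assms(1)] by simp_all
  then show ?thesis using assms separating_aut by (simp add: atom_def)
qed

lemma atom_through: assumes "atom F" "v \<in> V" shows "\<exists>F'. atom F' \<and> v \<in> F'"
proof -
  obtain x where x: "x \<in> F" "x \<in> V" using assms by (auto simp: atom_def separating_def)
  then obtain \<phi> where "aut \<phi>" "\<phi> x = v" using vt assms by blast
  then show ?thesis using atom_aut[of \<phi> F] assms(1) x by blast
qed

lemma card_split: 
  assumes "finite T" "T \<subseteq> V" shows "card T = card (T \<inter> Y) + card (T \<inter> bd Y) + card (T \<inter> outer Y)"
proof -
  have "T = (T \<inter> Y) \<union> (T \<inter> bd Y) \<union> (T \<inter> outer Y)" using assms bd_V by (auto simp: outer_def)
  moreover have "card ((T \<inter> Y) \<union> (T \<inter> bd Y) \<union> (T \<inter> outer Y)) = card ((T \<inter> Y) \<union> (T \<inter> bd Y)) + card (T \<inter> outer Y)"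
    using assms by (intro card_Un_disjoint) (auto simp: outer_def)
  moreover have "card ((T \<inter> Y) \<union> (T \<inter> bd Y)) = card (T \<inter> Y) + card (T \<inter> bd Y)"
    using assms bd_V[of Y] by (intro card_Un_disjoint) auto
  ultimately show ?thesis by simp
qed

lemma card_3: 
  assumes "S \<subseteq> X \<union> Y \<union> Z" "finite X" "finite Y" "finite Z" shows "card S \<le> card X + card Y + card Z"
proof -
  have "card S \<le> card (X \<union> Y \<union> Z)" using assms by (intro card_mono) auto
  also have "\<dots> \<le> card X + card Y + card Z" using card_Un_le[of "X \<union> Y" Z] card_Un_le[of X Y] by linarith
  finally show ?thesis .
qed

lemma bd_Int: "bd (X \<inter> Y) \<subseteq> (X \<inter> bd Y) \<union> (bd X \<inter> bd Y) \<union> (bd X \<inter> Y)"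
  by (auto simp: bd_def)

lemma bd_outer: "bd (outer X) \<subseteq> bd X"
  unfolding outer_def bd_def using E_sym by blast

lemma bd_Int_outer: "bd (X \<inter> outer Y) \<subseteq> (X \<inter> bd Y) \<union> (bd X \<inter> bd Y) \<union> (bd X \<inter> outer Y)"
  using bd_Int[of X "outer Y"] bd_outer[of Y] by blast

lemma bd_Un: "bd (X \<union> Y) \<subseteq> (bd X \<inter> bd Y) \<union> (bd X \<inter> outer Y) \<union> (outer X \<inter> bd Y)"
  by (auto simp: bd_def outer_def)

lemma atomD:
  assumes "atom F" shows "separating F" "F \<subseteq> V" "finite F" "F \<noteq> {}" "outer F \<noteq> {}" "card (bd F) = connectivity" "finite (bd F)" "bd F \<subseteq> V"
    "\<And>F'. atom F' \<Longrightarrow> card F' = card F" "\<And>X. separating X \<Longrightarrow> card (bd X) \<le> connectivity \<Longrightarrow> card F \<le> card X"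
proof -
  show s: "separating F" "card (bd F) = connectivity" using assms by (simp_all add: atom_def)
  then show "F \<subseteq> V" "finite F" "F \<noteq> {}" "outer F \<noteq> {}" by (simp_all add: separating_def)
  show "finite (bd F)" "bd F \<subseteq> V" using s finite_bd bd_V by (auto simp: separating_def)
  show "card F' = card F" if "atom F'" for F' 
    using assms that by (intro le_antisym) (simp_all add: atom_def)
  show "card F \<le> card X" if X: "separating X" "card (bd X) \<le> connectivity" for X
  proof -
    have "card (bd X) = connectivity" using connectivity_min[OF X(1)] X(2) by (rule le_antisym[rotated])
    then show ?thesis using assms X(1) by (simp add: atom_def)
  qed
qed

text \<open>Two atoms that overlap would have, by counting, an intersection or an outer part that is
  separating and too small.\<close>

lemma atoms_disjoint:
  assumes "atom F" "atom F'" "F \<noteq> F'" shows "F \<inter> F' = {}"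
proof (rule ccontr)
  assume ne: "F \<inter> F' \<noteq> {}"
  note D = atomD[OF assms(1)] note D' = atomD[OF assms(2)]
  have "\<not> F \<subseteq> F'" "\<not> F' \<subseteq> F" using card_subset_eq[OF D'(3)] card_subset_eq[OF D(3)] D(9)[OF assms(2)] assms(3) by auto
  then have g: "connectivity < card (bd (F \<inter> F'))" using atom_proper[OF assms(1), of "F \<inter> F'"] ne by blast
  have "card (bd (F \<inter> F')) \<le> card (F \<inter> bd F') + card (bd F \<inter> bd F') + card (bd F \<inter> F')"
    using bd_Int by (rule card_3) (use D D' in auto)
  moreover note s = card_split[OF D(7,8), of F'] card_split[OF D'(7,8), of F]
  ultimately have 1: "card (bd F \<inter> outer F') < card (F \<inter> bd F')" "card (bd F' \<inter> outer F) < card (F' \<inter> bd F)"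
    using g D(6) D'(6) by (simp_all add: Int_commute)
  show False
  proof (cases "outer F \<inter> outer F' = {}")
    case True
    \<comment> \<open>Now the outer set of \<open>F'\<close> is finite and separating with a minimal
      boundary, so it is at least as large as an atom; the strict inequality just obtained makes it
      smaller.\<close>
    then have sub: "outer F' \<subseteq> (F \<inter> outer F') \<union> (bd F \<inter> outer F')" by (auto simp: outer_def)
    then have f: "finite (outer F')" using D by (meson finite_Int finite_Un finite_subset)
    have "F' \<subseteq> outer (outer F')" using D'(2) bd_outer[of F'] bd_V[of F'] unfolding outer_def by blast
    then have "separating (outer F')"
      using f D'(4,5) unfolding separating_def by (auto simp: outer_def)
    moreover have "card (bd (outer F')) \<le> connectivity" using card_mono[OF D'(7) bd_outer] D'(6) by simp
    ultimately have "card F \<le> card (outer F')" by (rule D(10))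
    also have "\<dots> \<le> card (F \<inter> outer F') + card (bd F \<inter> outer F')"
      using card_mono[OF _ sub] card_Un_le[of "F \<inter> outer F'" "bd F \<inter> outer F'"] D by fastforce
    also have "\<dots> < card (F \<inter> outer F') + card (F \<inter> bd F')" using 1 by simp
    also have "\<dots> \<le> card F" using card_split[OF D(3,2), of F'] by simp
    finally show False by simp
  next
    case False
    have "separating (F \<union> F')" using D D' False bd_Un[of F F'] by (auto simp: separating_def outer_def bd_def)
    then have "connectivity \<le> card (bd (F \<union> F'))" by (rule connectivity_min)
    also have "\<dots> \<le> card (bd F \<inter> bd F') + card (bd F \<inter> outer F') + card (outer F \<inter> bd F')"
      using bd_Un by (rule card_3) (use D D' in auto)
    finally show False using 1 s D(6) by (simp add: Int_commute)
  qed
qed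

text \<open>If \<open>F'\<close> also met the outer set of \<open>F\<close>, that part of it would
  have too large a boundary, and counting gives a strict inequality between the pieces of
  \<open>F\<close> and \<open>F'\<close>. Then either \<open>F\<close> lies inside
  \<open>bd F'\<close>, so that it is smaller than \<open>F'\<close>, or the part of
  \<open>F\<close> outside \<open>F'\<close> has too small a boundary.\<close>

lemma atom_in_bd:
  assumes "atom F" "atom F'" "F' \<inter> bd F \<noteq> {}" shows "F' \<subseteq> bd F"
proof (rule ccontr)
  assume n: "\<not> F' \<subseteq> bd F"
  note D = atomD[OF assms(1)] note D' = atomD[OF assms(2)]
  have "F \<noteq> F'" using assms(3) by (auto simp: bd_def)
  then have disj: "F \<inter> F' = {}" using atoms_disjoint assms by blast
  then have ne: "F' \<inter> outer F \<noteq> {}" using n D' by (auto simp: outer_def)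
  have "connectivity < card (bd (F' \<inter> outer F))"
    by (rule atom_proper[OF assms(2) _ ne]) (use assms(3) in \<open>auto simp: outer_def\<close>)
  also have "\<dots> \<le> card (F' \<inter> bd F) + card (bd F' \<inter> bd F) + card (bd F' \<inter> outer F)"
    using bd_Int_outer by (rule card_3) (use D D' in auto)
  finally have 1: "card (bd F' \<inter> F) < card (F' \<inter> bd F)" using card_split[OF D'(7,8), of F] D'(6) by simp
  show False
  proof (cases "F \<inter> outer F' = {}")
    case True
    then have "F \<subseteq> bd F' \<inter> F" using disj D by (auto simp: outer_def)
    then have "card F \<le> card (bd F' \<inter> F)" using D(3) by (intro card_mono) auto
    moreover have "card (F' \<inter> bd F) \<le> card F'" using D'(3) by (intro card_mono) auto
    ultimately show False using 1 D(9)[OF assms(2)] by simp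
  next
    case False
    have "connectivity \<le> card (bd (F \<inter> outer F'))" by (rule connectivity_min, rule separating_sub[OF D(1) _ False]) auto
    also have "\<dots> \<le> card (F \<inter> bd F') + card (bd F \<inter> bd F') + card (bd F \<inter> outer F')"
      using bd_Int_outer by (rule card_3) (use D D' in auto)
    finally show False using 1 card_split[OF D(7,8), of F'] D(6) by (simp add: Int_commute)
  qed
qed

text \<open>The boundary of an atom is a union of atoms, which are disjoint and of equal size, so it
  suffices to find two. If it were a single atom \<open>F1\<close>, then \<open>F\<close> would be
  the boundary of \<open>F1\<close>, and \<open>F \<union> F1\<close> would have an empty boundary
  although it is not all of \<open>V\<close>.\<close>

lemma atom_small: assumes "atom F" shows "2 * card F \<le> connectivity"
proof -
  note D = atomD[OF assms]
  obtain x y where xy: "x \<in> F" "x \<in> V" "y \<in> outer F" "y \<in> V" using D by (auto simp: outer_def)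
  then have "y \<notin> F \<union> bd F" by (auto simp: outer_def)
  then have "bd F \<noteq> {}" using cn_exit[OF cn_V xy(2,4,1)] by blast
  then obtain v u where v: "v \<in> bd F" "u \<in> F" "(u, v) \<in> E" by (auto simp: bd_def)
  then obtain F1 where F1: "atom F1" "v \<in> F1" using atom_through[OF assms] D(8) by blast
  note D1 = atomD[OF F1(1)]
  have s1: "F1 \<subseteq> bd F" using atom_in_bd[OF assms F1(1)] v F1 by blast
  have "F1 \<noteq> bd F"
  proof
    assume eq: "F1 = bd F"
    have "u \<notin> F1" using s1 v bd_V[of F] by blast
    then have "u \<in> bd F1" using v E_sym[OF v(3)] F1(2) D(2) unfolding bd_def by blast
    then have "F \<subseteq> bd F1" using atom_in_bd[OF F1(1) assms] v by blast
    moreover have "card F = card (bd F1)" using D1(6) D(9)[OF F1(1)] D(6) eq by simp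
    ultimately have "F = bd F1" using card_subset_eq D1(7) by blast
    then have "bd (F \<union> F1) = {}" using eq by (auto simp: bd_def)
    then show False using cn_exit[OF cn_V xy(2,4), of "F \<union> F1"] xy(1) \<open>y \<notin> F \<union> bd F\<close> eq by blast
  qed
  then obtain w where w: "w \<in> bd F" "w \<notin> F1" using s1 by blast
  then obtain F2 where F2: "atom F2" "w \<in> F2" using atom_through[OF assms] D(8) by blast
  have s2: "F2 \<subseteq> bd F" using atom_in_bd[OF assms F2(1)] w F2 by blast
  have "F1 \<inter> F2 = {}" using atoms_disjoint[OF F1(1) F2(1)] w F2 by blast
  then have "card F1 + card F2 = card (F1 \<union> F2)" using D1(3) atomD(3)[OF F2(1)] by (intro card_Un_disjoint[symmetric])
  also have "\<dots> \<le> connectivity" using card_mono[OF D(7), of "F1 \<union> F2"] s1 s2 D(6) by simp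
  finally show ?thesis using D(9)[OF F1(1)] D(9)[OF F2(1)] by simp
qed

text \<open>The closed neighbourhood of a vertex lies in the atom through it and the boundary of
  that atom, so it has at most 3/2 times the connectivity many vertices.\<close>

lemma degree_bound:
  assumes "separating A" "v \<in> V" "(v, v) \<notin> E" shows "2 * (card {y. (v, y) \<in> E} + 1) \<le> 3 * card (bd A)"
proof -
  obtain F0 where "atom F0" using atom_ex assms by blast
  then obtain F where F: "atom F" "v \<in> F" using atom_through assms(2) by blast
  note D = atomD[OF F(1)]
  have "insert v {y. (v, y) \<in> E} \<subseteq> F \<union> bd F" using F(2) step_bd by blast
  then have "card (insert v {y. (v, y) \<in> E}) \<le> card (F \<union> bd F)" using D by (intro card_mono) auto
  also have "\<dots> \<le> card F + connectivity" using card_Un_le[of F "bd F"] D(6) by simp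
  finally have "card (insert v {y. (v, y) \<in> E}) \<le> card F + connectivity" .
  moreover have "card (insert v {y. (v, y) \<in> E}) = card {y. (v, y) \<in> E} + 1"
    using fin_nbrs[OF assms(2)] assms(3) by simp
  ultimately have "card {y. (v, y) \<in> E} + 1 \<le> card F + connectivity" by metis
  moreover have "2 * (n + 1) \<le> 3 * b" if "n + 1 \<le> f + c" "2 * f \<le> c" "c \<le> b" for n f c b :: nat
    using that by presburger
  ultimately show ?thesis using atom_small[OF F(1)] connectivity_min[OF assms(1)] by blast
qed

end

section \<open>Shallow sets\<close>

context vt_graph
begin

text \<open>Copies are recorded as vertex lists and not as automorphisms: only finitely many lists
  pass through a given vertex at a given position, even if its stabilizer is infinite.\<close>

definition copies :: "(nat \<Rightarrow> 'a) \<Rightarrow> nat \<Rightarrow> 'a list set" where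
  "copies p n = {xs. \<exists>\<phi>. aut \<phi> \<and> xs = map (\<lambda>i. \<phi> (p i)) [0..<n]}"

text \<open>An automorphism taking \<open>v\<close> to \<open>w\<close> maps the copies through
  \<open>v\<close> injectively to those through \<open>w\<close>; a copy stays within a bounded
  distance of its \<open>i\<close>-th vertex.\<close>

lemma card_copies:
  assumes p: "\<And>i. i < n \<Longrightarrow> p i \<in> V" and i: "i < n" and v: "v \<in> V" "w \<in> V"
  shows "finite {xs \<in> copies p n. xs ! i = v}"
    "card {xs \<in> copies p n. xs ! i = v} = card {xs \<in> copies p n. xs ! i = w}"
    "0 < card {xs \<in> copies p n. xs ! i = v}"
proof -
  let ?F = "\<lambda>v. {xs \<in> copies p n. xs ! i = v}"
  have fin: "finite (?F v)" if v: "v \<in> V" for v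
  proof -
    define r where "r = Max ((\<lambda>j. gd (p i) (p j)) ` {..<n})"
    have r: "gd (p i) (p j) \<le> r" if "j < n" for j unfolding r_def using that by (intro Max_ge) auto
    have "?F v \<subseteq> {xs. set xs \<subseteq> bl v r \<and> length xs = n}"
    proof
      fix xs assume "xs \<in> ?F v"
      then obtain \<phi> where f: "aut \<phi>" "xs = map (\<lambda>i. \<phi> (p i)) [0..<n]" "\<phi> (p i) = v" using i by (auto simp: copies_def)
      have "\<phi> (p j) \<in> bl v r" if "j < n" for j
        using aut_V[OF f(1) p[OF that]] aut_gd[OF f(1) p[OF i] p[OF that]] r[OF that] f(3) by (simp add: bl_def)
      then show "xs \<in> {xs. set xs \<subseteq> bl v r \<and> length xs = n}" using f(2) by auto
    qed
    then show ?thesis using finite_lists_length_eq[OF finite_bl[OF v]] finite_subset by blast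
  qed
  then show "finite (?F v)" using v by blast
  have le: "card (?F v) \<le> card (?F w)" if vw: "v \<in> V" "w \<in> V" for v w
  proof -
    obtain \<psi> where a: "aut \<psi>" "\<psi> v = w" using vt vw by blast
    have len: "length xs = n \<and> set xs \<subseteq> V" if "xs \<in> copies p n" for xs
      using that p aut_V by (auto simp: copies_def)
    have "inj_on (map \<psi>) (?F v)"
    proof (rule inj_onI)
      fix xs ys assume "xs \<in> ?F v" "ys \<in> ?F v" "map \<psi> xs = map \<psi> ys"
      then show "xs = ys" using len[of xs] len[of ys] inj_on_subset[OF aut_inj[OF a(1)], of "set xs \<union> set ys"]
        by (auto simp: inj_on_map_eq_map)
    qed
    moreover have "map \<psi> ` ?F v \<subseteq> ?F w"
    proof
      fix ys assume "ys \<in> map \<psi> ` ?F v"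
      then obtain \<phi> where f: "aut \<phi>" "ys = map \<psi> (map (\<lambda>i. \<phi> (p i)) [0..<n])" "\<phi> (p i) = v"
        using i by (auto simp: copies_def)
      then show "ys \<in> ?F w" using i a aut_comp[OF a(1) f(1)] unfolding copies_def 
        by (auto intro!: exI[of _ "\<psi> \<circ> \<phi>"])
    qed
    ultimately show ?thesis using fin[OF vw(2)] card_inj_on_le by blast
  qed
  then show "card (?F v) = card (?F w)" using v by (intro le_antisym) auto
  obtain \<phi> where "aut \<phi>" "\<phi> (p i) = v" using vt p[OF i] v by blast
  then have "map (\<lambda>i. \<phi> (p i)) [0..<n] \<in> ?F v" using i by (auto simp: copies_def)
  then show "0 < card (?F v)" using fin[OF v(1)] by (auto simp: card_gt_0_iff)
qed

text \<open>Count the copies of a path of length \<open>2 * L\<close> whose \<open>i\<close>-th vertex lies in \<open>A\<close>. Each of them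
  leaves \<open>A\<close> within \<open>L\<close> steps. As the stabilizers may be infinite, the number of copies with
  prescribed \<open>i\<close>-th vertex may depend on \<open>i\<close>, so one starts at an index where it is maximal.\<close>

lemma card_by_boundary:
  assumes A: "A \<subseteq> V" "finite A" and diam: "\<And>x y. x \<in> A \<Longrightarrow> y \<in> A \<Longrightarrow> gd x y < L"
    and p: "\<And>i. i \<le> 2 * L \<Longrightarrow> p i \<in> V" "\<And>i j. i \<le> j \<Longrightarrow> j \<le> 2 * L \<Longrightarrow> gd (p i) (p j) = j - i"
  shows "card A \<le> L * card (bd A)"
proof (cases "A = {}")
  case False
  then obtain v0 where v0: "v0 \<in> A" "v0 \<in> V" using A by blast
  define n where "n = 2 * L + 1"
  let ?F = "\<lambda>i v. {xs \<in> copies p n. xs ! i = v}"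
  have pn: "p i \<in> V" if "i < n" for i using p(1)[of i] that by (simp add: n_def)
  have F: "finite (?F i v)" "card (?F i v) = card (?F i v0)" "0 < card (?F i v)" if "i < n" "v \<in> V" for i v
    using card_copies[of n p i v v0, OF pn] that v0 by auto
  define M where "M = Max ((\<lambda>i. card (?F i v0)) ` {..<n})"
  have "M \<in> (\<lambda>i. card (?F i v0)) ` {..<n}" unfolding M_def by (rule Max_in) (auto simp: n_def)
  then obtain i where i: "i < n" "card (?F i v0) = M" by auto
  have Mmax: "card (?F j v0) \<le> M" if "j < n" for j unfolding M_def using that by (intro Max_ge) auto
  have Mpos: "0 < M" using F(3)[OF i(1) v0(2)] i by simp
  \<comment> \<open>From index \<open>i\<close> the path is followed in a direction in which
    \<open>L\<close> steps remain; they lead to distance \<open>L\<close>, hence out of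
    \<open>A\<close>.\<close>
  define e where "e m = (if i \<le> L then i + m else i - m)" for m
  have e: "e 0 = i" "\<And>m. m \<le> L \<Longrightarrow> e m < n" "\<And>m. m < L \<Longrightarrow> e (Suc m) = Suc (e m) \<or> e m = Suc (e (Suc m))"
    "e L = i + L \<or> i = e L + L" using i(1) by (auto simp: e_def n_def)
  have "(\<Union>v\<in>A. ?F i v) \<subseteq> (\<Union>m\<in>{1..L}. \<Union>b\<in>bd A. ?F (e m) b)"
  proof
    fix xs assume "xs \<in> (\<Union>v\<in>A. ?F i v)"
    then obtain \<phi> where f: "aut \<phi>" "xs = map (\<lambda>i. \<phi> (p i)) [0..<n]" "xs ! i \<in> A" by (auto simp: copies_def)
    have xs: "xs ! j = \<phi> (p j)" "xs ! j \<in> V" if "j < n" for j using f that pn aut_V by auto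
    have gd_xs: "gd (xs ! j) (xs ! l) = l - j" if "j \<le> l" "l < n" for j l
      using xs[of j] xs[of l] that aut_gd[OF f(1) pn pn, of j l] p(2)[of j l] by (simp add: n_def)
    have nb: "(xs ! j, xs ! Suc j) \<in> E" "(xs ! Suc j, xs ! j) \<in> E" if "Suc j < n" for j
      using edge_iff_gd[of "xs ! j" "xs ! Suc j"] gd_xs[of j "Suc j"] xs(2) E_sym that by auto
    have "xs ! e L \<notin> A"
    proof
      assume "xs ! e L \<in> A"
      then have "gd (xs ! i) (xs ! e L) < L" "gd (xs ! e L) (xs ! i) < L" using diam f(3) by blast+
      then show False using e(4) e(2)[of L] i(1) gd_xs[of i "e L"] gd_xs[of "e L" i] by auto
    qed
    then have ex: "\<exists>m. m \<le> L \<and> xs ! e m \<notin> A" by blast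
    define m where "m = (LEAST m. m \<le> L \<and> xs ! e m \<notin> A)"
    have m: "m \<le> L \<and> xs ! e m \<notin> A" unfolding m_def using LeastI_ex[OF ex] .
    then obtain m' where m': "m = Suc m'" using f(3) e(1) by (cases m) auto
    then have "xs ! e m' \<in> A" using not_less_Least[of m' "\<lambda>m. m \<le> L \<and> xs ! e m \<notin> A"] m unfolding m_def[symmetric] by auto
    moreover have "(xs ! e m', xs ! e m) \<in> E"
      using e(3)[of m'] m m' nb[of "e m'"] nb[of "e m"] e(2)[of m] e(2)[of m'] by auto
    ultimately have "xs ! e m \<in> bd A" using m xs(2) e(2) by (auto simp: bd_def)
    moreover have "xs \<in> copies p n" using f by (auto simp: copies_def)
    moreover have "m \<in> {1..L}" using m m' by simp
    ultimately show "xs \<in> (\<Union>m\<in>{1..L}. \<Union>b\<in>bd A. ?F (e m) b)" by blast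
  qed
  moreover have fb: "finite (bd A)" using finite_bd A by blast
  have fF: "finite (?F (e m) b)" if "m \<in> {1..L}" "b \<in> bd A" for m b using F(1)[OF e(2)] that bd_V by auto
  have fU: "finite (\<Union>b\<in>bd A. ?F (e m) b)" if "m \<in> {1..L}" for m using fF that fb by blast
  then have "finite (\<Union>m\<in>{1..L}. \<Union>b\<in>bd A. ?F (e m) b)" by blast
  ultimately have "card (\<Union>v\<in>A. ?F i v) \<le> card (\<Union>m\<in>{1..L}. \<Union>b\<in>bd A. ?F (e m) b)" by (intro card_mono)
  also have "\<dots> \<le> (\<Sum>m\<in>{1..L}. card (\<Union>b\<in>bd A. ?F (e m) b))" by (rule card_UN_le) simp
  also have "\<dots> \<le> (\<Sum>m\<in>{1..L}. card (bd A) * M)"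
  proof (rule sum_mono)
    fix m assume m: "m \<in> {1..L}"
    have "card (\<Union>b\<in>bd A. ?F (e m) b) \<le> (\<Sum>b\<in>bd A. card (?F (e m) b))" using fb by (rule card_UN_le)
    also have "\<dots> \<le> (\<Sum>b\<in>bd A. M)"
    proof (rule sum_mono)
      fix b assume "b \<in> bd A"
      then have "b \<in> V" using bd_V by blast
      then show "card (?F (e m) b) \<le> M" using F(2)[of "e m" b] Mmax[of "e m"] e(2)[of m] m by simp
    qed
    finally show "card (\<Union>b\<in>bd A. ?F (e m) b) \<le> card (bd A) * M" by simp
  qed
  finally have 1: "card (\<Union>v\<in>A. ?F i v) \<le> L * (card (bd A) * M)" by simp
  have "card (\<Union>v\<in>A. ?F i v) = (\<Sum>v\<in>A. card (?F i v))"
    using A F(1)[OF i(1)] by (intro card_UN_disjoint) auto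
  also have "\<dots> = (\<Sum>v\<in>A. M)" using F(2)[OF i(1)] i(2) A by (intro sum.cong) auto
  finally have "card A * M \<le> (L * card (bd A)) * M" using 1 by (simp add: mult.assoc)
  then show ?thesis using Mpos by simp
qed simp

lemma geodesic_path:
  assumes "x \<in> V" "y \<in> V" "n \<le> gd x y"
  shows "\<exists>p. (\<forall>i\<le>n. p i \<in> V) \<and> (\<forall>i j. i \<le> j \<longrightarrow> j \<le> n \<longrightarrow> gd (p i) (p j) = j - i)"
proof -
  have "(x, y) \<in> E ^^ gd x y" using relpow_gd assms by blast
  then obtain f where f: "f 0 = x" "f (gd x y) = y" "\<And>i. i < gd x y \<Longrightarrow> (f i, f (Suc i)) \<in> E"
    unfolding relpow_fun_conv by blast
  have V: "f i \<in> V" if "i \<le> gd x y" for i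
    using that f(1) assms(1) E_V[OF f(3), of "i - 1"] by (cases i) auto
  have le: "gd (f i) (f j) \<le> j - i" if "i \<le> j" "j \<le> gd x y" for i j
    using that
  proof (induction j rule: dec_induct)
    case (step j)
    then show ?case using gd_edge_le[OF f(3), of j "f i"] V[of i] by fastforce
  qed simp
  have "gd (f i) (f j) = j - i" if "i \<le> j" "j \<le> gd x y" for i j
  proof -
    have "gd x y \<le> gd x (f i) + (gd (f i) (f j) + gd (f j) y)"
      using gd_triangle[of x "f i" y] gd_triangle[of "f i" "f j" y] V that assms(1,2) by fastforce
    then show ?thesis using le[of 0 i] le[of i j] le[of j "gd x y"] that f(1,2) by simp
  qed
  then show ?thesis using V assms(3) by (intro exI[of _ f]) auto
qed

text \<open>All of \<open>A \<union> bd A\<close> is within \<open>k\<close> of its \<open>k\<close>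
  boundary vertices, so \<open>cluster\<close> bounds its diameter by \<open>L - 1\<close> with
  \<open>L = k * (2 * k + 1)\<close>. Counting then gives at most \<open>L * k\<close> vertices, and
  the large diameter of the graph leaves a vertex outside.\<close>

lemma shallow_result:
  assumes A: "A \<subseteq> V" "finite A" "A \<noteq> {}" "cn (A \<union> bd A)" and k: "k = card (bd A)"
    and shallow: "\<And>v. v \<in> A \<Longrightarrow> \<exists>w\<in>V - A. gd v w \<le> k"
    and long: "x \<in> V" "y \<in> V" "31 * (k + 1)\<^sup>2 \<le> gd x y"
  shows "card A \<le> 2 * k ^ 3 + k\<^sup>2" "separating A"
proof -
  let ?H = "A \<union> bd A"
  have near: "\<exists>b\<in>bd A. gd h b \<le> k" if h: "h \<in> ?H" for h
  proof (cases "h \<in> A")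
    case True
    then obtain w where w: "w \<in> V" "w \<notin> A" "gd h w \<le> k" using shallow by blast
    then obtain b where "b \<in> bd A" "gd h b + gd b w = gd h w" using geo_exit[of h A w] True A by blast
    then show ?thesis using w by (intro bexI[of _ b]) auto
  next
    case False
    then show ?thesis using h by (intro bexI[of _ h]) auto
  qed
  have fb: "finite (bd A)" using finite_bd A by blast
  have diam: "gd x y + 1 \<le> k * (2 * k + 1)" if "x \<in> ?H" "y \<in> ?H" for x y
    unfolding k by (rule cluster[OF fb _ A(4)]) (use near that A bd_V k in auto)
  have "2 * (k * (2 * k + 1)) \<le> 31 * (k + 1)\<^sup>2" by (simp add: power2_eq_square algebra_simps)
  then have "2 * (k * (2 * k + 1)) \<le> gd x y" using long by linarith
  from geodesic_path[OF long(1,2) this] obtain p where p: "\<forall>i\<le>2 * (k * (2 * k + 1)). p i \<in> V"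
    "\<forall>i j. i \<le> j \<longrightarrow> j \<le> 2 * (k * (2 * k + 1)) \<longrightarrow> gd (p i) (p j) = j - i" by blast
  have "card A \<le> k * (2 * k + 1) * card (bd A)"
  proof (rule card_by_boundary[OF A(1,2)])
    show "gd x y < k * (2 * k + 1)" if "x \<in> A" "y \<in> A" for x y using diam[of x y] that by auto
  qed (use p in auto)
  then show "card A \<le> 2 * k ^ 3 + k\<^sup>2" unfolding k[symmetric] by (simp add: power3_eq_cube power2_eq_square algebra_simps)
  have "x \<in> ?H \<Longrightarrow> y \<notin> ?H" using diam[of x y] \<open>2 * (k * (2 * k + 1)) \<le> gd x y\<close> by linarith
  then show "separating A" using A long(1,2) by (auto simp: separating_def outer_def)
qed

end

theorem theorem1p9:
  fixes V :: "'a set" and E :: "'a rel" and A :: "'a set" and k :: nat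
  assumes "simple_graph V E" and "locally_finite V E"
    and "connected_graph V E"
    and "vertex_transitive V E"
    and "A \<subseteq> V" and "finite A" and "A \<noteq> {}"
    and "finite V \<longrightarrow> real (card A) \<le> 1 / 2 * real (card V)"
    and "connected_graph (A \<union> boundary V E A) (induced_edges E (A \<union> boundary V E A))"
    and "k = card (boundary V E A)"
    and "diam E V \<ge> enat (31 * (k + 1) ^ 2)"
  shows "(depth V E A \<le> enat k \<and> card A \<le> 2 * k ^ 3 + k ^ 2 \<and>
            (\<exists>d. regular V E d \<and> real d \<le> 3 / 2 * real k - 1))
       \<or> (\<exists>s t :: nat. s > 0 \<and> t > 0 \<and> real (s * t) \<le> real k / 2 \<and>
            (\<exists>\<sigma> R. cyclic_system V E \<sigma> R \<and> ring_like E \<sigma> R s t \<and>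
              (\<exists>J. cyclic_interval \<sigma> R J \<and> A \<subseteq> \<Union>J \<and>
                real (card (\<Union>J - A)) \<le> 1 / 2 * real k ^ 3 + real k ^ 2)))"
proof -
  interpret vt_graph V E
  proof
    show "E \<subseteq> V \<times> V" "\<And>x y. (x, y) \<in> E \<Longrightarrow> (y, x) \<in> E"
      using assms(1) by (auto simp: simple_graph_def sym_def)
  qed (use assms(2-4) in \<open>auto simp: locally_finite_def neighbours_def connected_graph_def vertex_transitive_def\<close>)
  note A = assms(5-7)
  have half: "half A" using assms(8) by (auto simp: half_def)
  have cn: "cn (A \<union> bd A)" using assms(9) by (simp add: cn_def connected_graph_def induced_edges_def bd_boundary)
  have k: "k = card (bd A)" using assms(10) by (simp add: bd_boundary)
  obtain x y where xy: "x \<in> V" "y \<in> V" "31 * (k + 1)\<^sup>2 \<le> gd x y"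
  proof -
    have "\<exists>x\<in>V. \<exists>y\<in>V. 31 * (k + 1)\<^sup>2 \<le> gd x y"
    proof (rule ccontr)
      assume n: "\<not> ?thesis"
      \<comment> \<open>The supremum is bounded by the predecessor, since strict bounds on the
        single distances would give only a weak bound on it.\<close>
      have "diam E V \<le> enat (31 * (k + 1)\<^sup>2 - 1)" unfolding diam_def
      proof (intro SUP_least)
        fix x y assume v: "x \<in> V" "y \<in> V"
        then have "gd x y < 31 * (k + 1)\<^sup>2" using n by (meson not_le)
        then show "gdist E x y \<le> enat (31 * (k + 1)\<^sup>2 - 1)" using gdist_gd[OF v] by simp
      qed
      then have "enat (31 * (k + 1)\<^sup>2) \<le> enat (31 * (k + 1)\<^sup>2 - 1)" using assms(11) by (rule order_trans[rotated])
      moreover have "0 < 31 * (k + 1)\<^sup>2" by simp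
      ultimately show False unfolding enat_ord_simps by linarith
    qed
    then show thesis using that by blast
  qed
  show ?thesis
  proof (cases "depth V E A \<le> enat k")
    case True
    have shallow: "\<exists>w\<in>V - A. gd v w \<le> k" if v: "v \<in> A" for v
    proof (rule ccontr)
      assume n: "\<not> ?thesis"
      have "enat (k + 1) \<le> vertex_depth V E A v" unfolding vertex_depth_def
      proof (rule INF_greatest)
        fix w assume w: "w \<in> V - A"
        then have "k + 1 \<le> gd v w" using n by (metis Suc_eq_plus1 not_less_eq_eq)
        then show "enat (k + 1) \<le> gdist E v w" using gdist_gd[of v w] w v A by auto
      qed
      also have "\<dots> \<le> depth V E A" unfolding depth_def using v by (rule SUP_upper)
      finally have "enat (k + 1) \<le> enat k" using True by (rule order_trans)
      then show False by simp
    qed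
    note S = shallow_result[OF A cn k shallow xy]
    obtain v0 where v0: "v0 \<in> V" using A by blast
    let ?d = "card {y. (v0, y) \<in> E}"
    have nbl: "insert v {y. (v, y) \<in> E} = bl v 1" if v: "v \<in> V" for v
    proof
      show "insert v {y. (v, y) \<in> E} \<subseteq> bl v 1" using gd_edge[of v] E_V v by (simp add: bl_def subset_iff)
      show "bl v 1 \<subseteq> insert v {y. (v, y) \<in> E}"
      proof
        fix y assume "y \<in> bl v 1"
        then have "y \<in> V" "gd v y = 0 \<or> gd v y = 1" by (auto simp: bl_def)
        then show "y \<in> insert v {y. (v, y) \<in> E}" using edge_iff_gd[OF v] gd_eq_0[OF v] by auto
      qed
    qed
    have irr: "(v, v) \<notin> E" for v using assms(1) by (auto simp: simple_graph_def irrefl_def)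
    have "card {y. (v, y) \<in> E} + 1 = card (bl v 1)" if v: "v \<in> V" for v
      using nbl[OF v] fin_nbrs[OF v] irr[of v] by (metis Suc_eq_plus1 card_insert_disjoint mem_Collect_eq)
    then have "card {y. (v, y) \<in> E} = ?d" if "v \<in> V" for v
      using card_bl_eq[OF that v0, of 1] that v0 by (metis add_right_cancel)
    then have "regular V E ?d" using fin_nbrs by (simp add: regular_def neighbours_def)
    moreover have "2 * (?d + 1) \<le> 3 * k" using degree_bound[OF S(2) v0 irr] k by simp
    then have "real (2 * (?d + 1)) \<le> real (3 * k)" by (rule of_nat_mono)
    then have "real ?d \<le> 3 / 2 * real k - 1" by simp
    ultimately show ?thesis using True S(1) by blast
  next
    case False
    \<comment> \<open>A vertex of depth greater than \<open>k\<close> is the centre of a ball of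
      radius \<open>k = card (bd A)\<close> inside \<open>A\<close>, which makes \<open>A\<close>
      deep.\<close>
    then obtain v where v: "v \<in> A" "enat k < vertex_depth V E A v"
      unfolding depth_def by (meson SUP_least not_le)
    have "bl v k \<subseteq> A"
    proof
      fix w assume w: "w \<in> bl v k"
      show "w \<in> A"
      proof (rule ccontr)
        assume "w \<notin> A"
        then have "vertex_depth V E A v \<le> gdist E v w" unfolding vertex_depth_def 
          using w by (intro INF_lower) (simp add: bl_def)
        also have "\<dots> \<le> enat k" using gdist_gd[of v w] w v A by (auto simp: bl_def)
        finally show False using v by simp
      qed
    qed
    then have "A \<in> deep_sets" using A half v k by (auto simp: deep_sets_def)
    then interpret deep_graph V E k A using xy k by unfold_locales auto
    obtain s t \<sigma> R J where r: "0 < s" "0 < t" "2 * (s * t) \<le> k" "cyclic_system V E \<sigma> R" "ring_like E \<sigma> R s t"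
      "cyclic_interval \<sigma> R J" "A \<subseteq> \<Union>J" "2 * card (\<Union>J - A) \<le> k ^ 3 + 2 * k ^ 2"
      using deep_result[OF A half cn] k by auto
    have "real (2 * (s * t)) \<le> real k" "real (2 * card (\<Union>J - A)) \<le> real (k ^ 3 + 2 * k ^ 2)"
      using r(3,8) by (simp_all only: of_nat_le_iff)
    then have "real (s * t) \<le> real k / 2" "real (card (\<Union>J - A)) \<le> 1 / 2 * real k ^ 3 + real k ^ 2" by simp_all
    then show ?thesis using r by blast
  qed
qed

end
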